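(* Let $p,k\ge1$ be integers and, for $u\in[0,1]$ and $1\le i\le p$, let $\zeta_{i,u}$ and $\xi_u$ be probability distributions on the nonnegative integers $\mathbb{Z}_+$. For $\mathbf{x}\in\mathbb{Z}_+^p$ let $R_u(\mathbf{x},\cdot)$ be the convolution product $\zeta_{1,u}^{*x_1}*\zeta_{2,u}^{*x_2}*\cdots*\zeta_{p,u}^{*x_p}*\xi_u$ (with $\zeta^{*0}=\delta_0$). Let $Q_u$, $Y_{n,t}$ and $X_{n,t}=(Y_{n,t-p+1},\ldots,Y_{n,t})$ be as in the context. Assume: (E31) $\sup_{u\in[0,1]}\sum_{i=1}^p\sum_{x\ge0}x\,\zeta_{i,u}(x)<1$, and there exists an integer $x_0\geq 0$ with $\inf_{u\in[0,1]}\xi_u(x_0)>0$. (E32) For each integer $x\ge0$ the maps $u\mapsto\zeta_{i,u}(x)$ ($1\le i\le p$) and $u\mapsto\xi_u(x)$ are of class $\mathcal{C}^k$ on $[0,1]$, and there is a positive integer $d_1$ such that for $s=0,1,\ldots,k$, $$\lim_{M\to\infty}\sup_{u\in[0,1]}\sum_{i=1}^p\sum_{x\ge M}x^{d_1+k-s}\left[|\zeta_{i,u}^{(s)}(x)|+|\xi_u^{(s)}(x)|\right]=0,$$ where the superscript $(s)$ denotes the $s$-th derivative in $u$. Then, with $V_0(x_1,\ldots,x_p)=\sum_{i=1}^p(1+x_i)^{d_1}$, the triangular array of Markov chains $\{X_{n,t}:1\le t\le n,n\ge1\}$ is $V_0$-locally stationary, and for each integer $j\ge1$ the map $u\mapsto\pi_{u,j}$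 is $k$-times continuously differentiable from $[0,1]$ to $\mathcal{M}_{V_0}(\mathbb{Z}_+^{pj})$.
   Context: Write $E=\mathbb{Z}_+$ (discrete). $Q_u$ is the Markov kernel on $E^p$ given by $Q_u(\mathbf{x},d\mathbf{y})=R_u(\mathbf{x},dy_p)\prod_{i=1}^{p-1}\delta_{x_{i+1}}(dy_i)$, and $\pi_u$ is its (unique) invariant probability measure. For each $n\ge1$, $(Y_{n,t})_{t\le n}$ is a process such that $\mathbb{P}(Y_{n,t}\in A\mid Y_{n,t-1},Y_{n,t-2},\ldots)=R_{t/n}((Y_{n,t-p},\ldots,Y_{n,t-1}),A)$ for $1\le t\le n$, and $(Y_{n,t})_{t\le0}$ is a stationary $p$-order Markov process with transition kernel $R_0$; thus $X_{n,t}=(Y_{n,t-p+1},\ldots,Y_{n,t})$ is a Markov chain with transition $Q_{t/n}$ at time $t$ and $X_{n,0}\sim\pi_0$. For $V:E^p\to[1,\infty)$ and $j\ge1$, $\mathcal{M}_V(E^{pj})$ is the Banach space of signed measures $\mu$ on $(E^p)^j$ with $\|\mu\|_V:=\sup\{\int g\,d\mu:\ |g(\mathbf{x}_1,\ldots,\mathbf{x}_j)|\le V(\mathbf{x}_1)+\cdots+V(\mathbf{x}_j)\}<\infty$. $\pi_{u,j}(d\mathbf{x}_1,\ldots,d\mathbf{x}_j)=\pi_u(d\mathbf{x}_1)Q_u(\mathbf{x}_1,d\mathbf{x}_2)\cdots Q_u(\mathbf{x}_{j-1},d\mathbf{x}_j)$, and $\pi^{(n)}_{t,j}$ is the law of $(X_{n,t},\ldots,X_{n,t+j-1})$.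 The array is $V$-locally stationary if for every $j\ge1$ there is $C_j>0$, not depending on $u,n,t$, such that $\|\pi^{(n)}_{t,j}-\pi_{u,j}\|_V\le C_j\left[|u-\frac tn|+\frac1n\right]$ for all $u\in[0,1]$, $n\ge1$, $1\le t\le n-j+1$. Derivatives at the endpoints of $[0,1]$ are one-sided. *)

theory Defs
  imports "HOL-Probability.Probability"
begin

definition conv_pmf :: "nat pmf \<Rightarrow> nat pmf \<Rightarrow> nat pmf" where
  "conv_pmf P Q = map_pmf (\<lambda>(a, b). a + b) (pair_pmf P Q)"

definition conv_power :: "nat pmf \<Rightarrow> nat \<Rightarrow> nat pmf" where
  "conv_power P m = (conv_pmf P ^^ m) (return_pmf 0)"

text \<open>Points of \<open>\<int>\<^sub>+\<^sup>p\<close> are lists of length \<open>p\<close>, so \<open>x\<^sub>1, \<dots>, x\<^sub>p\<close> are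
  \<open>x ! 0, \<dots>, x ! (p - 1)\<close>; accordingly the family \<open>\<zeta>\<close> is indexed by \<open>i < p\<close>.\<close>

definition branching_kernel ::
    "nat \<Rightarrow> (nat \<Rightarrow> real \<Rightarrow> nat pmf) \<Rightarrow> (real \<Rightarrow> nat pmf) \<Rightarrow> real \<Rightarrow> nat list \<Rightarrow> nat pmf" where
  "branching_kernel p \<zeta> \<xi> u x =
     foldr conv_pmf (map (\<lambda>i. conv_power (\<zeta> i u) (x ! i)) [0..<p]) (\<xi> u)"

text \<open>The kernel on \<open>p\<close>-tuples induced by a \<open>p\<close>-order kernel \<open>R\<close>: drop the oldest (first)
  coordinate and append a draw from \<open>R x\<close>.\<close>

definition companion_kernel :: "(nat list \<Rightarrow> nat pmf) \<Rightarrow> nat list \<Rightarrow> nat list pmf" where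
  "companion_kernel R x = map_pmf (\<lambda>y. tl x @ [y]) (R x)"

definition invariant_pmf :: "nat \<Rightarrow> (nat list \<Rightarrow> nat list pmf) \<Rightarrow> nat list pmf \<Rightarrow> bool" where
  "invariant_pmf p Q \<mu> \<longleftrightarrow> set_pmf \<mu> \<subseteq> {x. length x = p} \<and> bind_pmf \<mu> Q = \<mu>"

definition the_invariant_pmf :: "nat \<Rightarrow> (nat list \<Rightarrow> nat list pmf) \<Rightarrow> nat list pmf" where
  "the_invariant_pmf p Q = (THE \<mu>. invariant_pmf p Q \<mu>)"

text \<open>Law of the first \<open>m + 1\<close> states of the chain with kernel \<open>Q\<close> started at \<open>x\<close>.\<close>

primrec path_pmf :: "('s \<Rightarrow> 's pmf) \<Rightarrow> nat \<Rightarrow> 's \<Rightarrow> 's list pmf" where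
  "path_pmf Q 0 x = return_pmf [x]"
| "path_pmf Q (Suc m) x = map_pmf ((#) x) (bind_pmf (Q x) (path_pmf Q m))"

text \<open>The law \<open>\<pi>(dx\<^sub>1) Q(x\<^sub>1, dx\<^sub>2) \<dots> Q(x\<^sub>j\<^sub>-\<^sub>1, dx\<^sub>j)\<close>, for \<open>j \<ge> 1\<close>.\<close>

definition stationary_path_pmf ::
    "nat \<Rightarrow> (nat list \<Rightarrow> nat list pmf) \<Rightarrow> nat \<Rightarrow> nat list list pmf" where
  "stationary_path_pmf p Q j = bind_pmf (the_invariant_pmf p Q) (path_pmf Q (j - 1))"


text \<open>\<open>lag_vec p Y t = (Y\<^sub>t\<^sub>-\<^sub>p\<^sub>+\<^sub>1, \<dots>, Y\<^sub>t)\<close>.\<close>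

definition lag_vec :: "nat \<Rightarrow> (int \<Rightarrow> 'a \<Rightarrow> nat) \<Rightarrow> int \<Rightarrow> 'a \<Rightarrow> nat list" where
  "lag_vec p Y t \<omega> = map (\<lambda>s. Y s \<omega>) [t - int p + 1..t]"

definition past_algebra :: "'a measure \<Rightarrow> (int \<Rightarrow> 'a \<Rightarrow> nat) \<Rightarrow> int \<Rightarrow> 'a measure" where
  "past_algebra M Y t = sigma (space M) {Y s -` A \<inter> space M | s A. s < t}"

definition has_transition_at ::
    "'a measure \<Rightarrow> nat \<Rightarrow> (int \<Rightarrow> 'a \<Rightarrow> nat) \<Rightarrow> int \<Rightarrow> (nat list \<Rightarrow> nat pmf) \<Rightarrow> bool" where
  "has_transition_at M p Y t R \<longleftrightarrow>
     (\<forall>A. AE \<omega> in M. real_cond_exp M (past_algebra M Y t) (\<lambda>\<omega>. indicator A (Y t \<omega>)) \<omega>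
                       = measure_pmf.prob (R (lag_vec p Y (t - 1) \<omega>)) A)"

text \<open>For each \<open>n \<ge> 1\<close>, only the values \<open>Y n t\<close> with \<open>t \<le> n\<close> matter; the probability space
  may depend on \<open>n\<close>.\<close>

definition markov_array ::
    "nat \<Rightarrow> (real \<Rightarrow> nat list \<Rightarrow> nat pmf) \<Rightarrow> (nat \<Rightarrow> 'a measure)
      \<Rightarrow> (nat \<Rightarrow> int \<Rightarrow> 'a \<Rightarrow> nat) \<Rightarrow> bool" where
  "markov_array p R M Y \<longleftrightarrow>
     (\<forall>n\<ge>1. prob_space (M n) \<and>
        (\<forall>t\<le>int n. Y n t \<in> M n \<rightarrow>\<^sub>M count_space UNIV) \<and>
        (\<forall>t. 1 \<le> t \<and> t \<le> int n \<longrightarrow> has_transition_at (M n) p (Y n) t (R (real_of_int t / real n))) \<and>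
        (\<forall>t\<le>0. has_transition_at (M n) p (Y n) t (R 0)) \<and>
        (\<forall>m. \<forall>t\<le>0. distr (M n) (count_space UNIV) (lag_vec m (Y n) t)
                   = distr (M n) (count_space UNIV) (lag_vec m (Y n) 0)))"


text \<open>\<open>(\<int>\<^sub>+\<^sup>p)\<^sup>j\<close> is countable and discrete, so a signed measure on it is identified with its
  mass function, and \<open>\<integral> g d\<mu>\<close> is \<open>\<Sum>\<^sub>z g z \<mu>(z)\<close> (unconditional, hence absolute, summability).
  Values of mass functions outside \<open>blocks p j\<close> play no role. The norm is extended-real valued;
  for \<open>V \<ge> 1\<close> it is infinite exactly for those \<open>\<mu>\<close> outside the space.\<close>

definition blocks :: "nat \<Rightarrow> nat \<Rightarrow> nat list list set" where
  "blocks p j = {z. length z = j \<and> (\<forall>x\<in>set z. length x = p)}"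

definition V_norm ::
    "nat \<Rightarrow> nat \<Rightarrow> (nat list \<Rightarrow> real) \<Rightarrow> (nat list list \<Rightarrow> real) \<Rightarrow> ereal" where
  "V_norm p j V \<mu> =
     (SUP g\<in>{g. (\<forall>z\<in>blocks p j. \<bar>g z\<bar> \<le> (\<Sum>x\<leftarrow>z. V x)) \<and>
                (\<lambda>z. g z * \<mu> z) summable_on blocks p j}.
        ereal (\<Sum>\<^sub>\<infinity>z\<in>blocks p j. g z * \<mu> z))"

definition V_space ::
    "nat \<Rightarrow> nat \<Rightarrow> (nat list \<Rightarrow> real) \<Rightarrow> (nat list list \<Rightarrow> real) set" where
  "V_space p j V = {\<mu>. \<mu> summable_on blocks p j \<and> V_norm p j V \<mu> < \<infinity>}"

text \<open>\<open>D s\<close> is the \<open>s\<close>-th derivative of \<open>F\<close> in the norm, one-sided at the endpoints.\<close>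

definition Ck_into_V_space ::
    "nat \<Rightarrow> nat \<Rightarrow> nat \<Rightarrow> (nat list \<Rightarrow> real) \<Rightarrow> (real \<Rightarrow> nat list list \<Rightarrow> real) \<Rightarrow> bool" where
  "Ck_into_V_space k p j V F \<longleftrightarrow>
     (\<exists>D. (\<forall>u\<in>{0..1}. D 0 u = F u) \<and>
          (\<forall>s\<le>k. \<forall>u\<in>{0..1}. D s u \<in> V_space p j V) \<and>
          (\<forall>s<k. \<forall>u\<in>{0..1}.
             ((\<lambda>v. V_norm p j V (\<lambda>z. (D s v z - D s u z) / (v - u) - D (Suc s) u z)) \<longlongrightarrow> 0)
               (at u within {0..1})) \<and>
          (\<forall>u\<in>{0..1}.
             ((\<lambda>v. V_norm p j V (\<lambda>z. D k v z - D k u z)) \<longlongrightarrow> 0) (at u within {0..1})))"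

definition locally_stationary ::
    "nat \<Rightarrow> (nat list \<Rightarrow> real) \<Rightarrow> (nat \<Rightarrow> 'a measure) \<Rightarrow> (nat \<Rightarrow> int \<Rightarrow> 'a \<Rightarrow> nat list)
      \<Rightarrow> (real \<Rightarrow> nat list \<Rightarrow> nat list pmf) \<Rightarrow> bool" where
  "locally_stationary p V M X Q \<longleftrightarrow>
     (\<forall>j\<ge>1. \<exists>C>0. \<forall>u\<in>{0..1}. \<forall>n\<ge>1. \<forall>t. 1 \<le> t \<and> t \<le> int n - int j + 1 \<longrightarrow>
        V_norm p j V
          (\<lambda>z. measure (distr (M n) (count_space UNIV)
                  (\<lambda>\<omega>. map (\<lambda>s. X n s \<omega>) [t..t + int j - 1])) {z}
               - pmf (stationary_path_pmf p (Q u) j) z)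
        \<le> ereal (C * (\<bar>u - real_of_int t / real n\<bar> + 1 / real n)))"


text \<open>Derivatives on \<open>[0, 1]\<close>, one-sided at the endpoints.\<close>

definition nth_deriv01 :: "nat \<Rightarrow> (real \<Rightarrow> real) \<Rightarrow> real \<Rightarrow> real" where
  "nth_deriv01 s f = ((\<lambda>g u. vector_derivative g (at u within {0..1})) ^^ s) f"

definition Ck01 :: "nat \<Rightarrow> (real \<Rightarrow> real) \<Rightarrow> bool" where
  "Ck01 k f \<longleftrightarrow> (\<forall>s<k. nth_deriv01 s f differentiable_on {0..1}) \<and>
     continuous_on {0..1} (nth_deriv01 k f)"

end

theory Submission
  imports Defs
begin

text \<open>
  Write \<open>x \<mapsto> Q\<^sub>u(x, \<cdot>)\<close> for the kernel of the vector process. Measures are handled as mass functions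
  in the weighted spaces with weights \<open>(1 + |x|)\<^sup>m\<close>, \<open>d\<^sub>1 \<le> m \<le> d\<^sub>1 + k\<close>; each derivative of \<open>Q\<^sub>u\<close> in
  \<open>u\<close> costs one power of the weight, since differentiating the convolution power \<open>\<zeta>\<^sup>*\<^sup>n\<close> produces a
  factor \<open>n\<close>.

  The process started from \<open>x\<close> is the sum of the process started from 0 and of an independent
  subcritical branching process without immigration started from \<open>x\<close>. Hence the two processes
  coalesce when the latter dies out, and the moments of the latter decay geometrically because of a
  Lyapunov function built from the moments of all orders up to \<open>m\<close>. This gives a contraction of
  centred measures in every weight, uniformly over products of kernels with varying \<open>u\<close>; no
  minorisation is needed.

  Differentiating \<open>\<mu>\<^sub>n\<^sub>+\<^sub>1 = \<mu>\<^sub>n Q\<^sub>u\<close> repeatedly in \<open>u\<close>, the increments of the derivatives of the iterates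
  satisfy a triangular system of contractions, so all derivatives converge geometrically in norm, and
  the limit \<open>\<pi>\<^sub>u\<close> inherits the smoothness. Local stationarity follows from the contraction and the
  Lipschitz continuity of \<open>u \<mapsto> \<pi>\<^sub>u\<close>, by comparing the law at time \<open>t\<close> with \<open>\<pi>\<^sub>t\<^sub>/\<^sub>n\<close> step by step.
\<close>

section \<open>Weighted norms and kernels on countable spaces\<close>

text \<open>The derivatives of the kernel are bounded only from one weight to a smaller one, so no
  single Banach space carries the equation for the invariant law together with its derivatives, and
  a fixed point argument in one space cannot simply be differentiated. Hence all derivatives are
  transported as one object, level \<open>r\<close> living in weight \<open>L - r\<close> with
  \<open>L = d1 + k\<close>, and each construction (convolution, image, action of a kernel, limit)
  is shown to preserve such families. The last level keeps an exponent of at least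
  \<open>d1\<close>, hence at least 1; a positive exponent is essential, since extinction is
  detected by moments that vanish at the state 0. Contraction concerns measures of mass 0 only.
  These arise by themselves: differences of laws have mass 0, and so have derivatives of laws.
  Contraction also holds only up to a constant factor, while a recursion in time needs a factor
  below 1 at every step. A second norm, comparable to the first on centred measures and common to
  all \<open>u\<close>, removes the constant; this serves both the derivatives of the iterates and
  the array, whose parameter changes at each step.\<close>

definition wnorm :: "('a \<Rightarrow> real) \<Rightarrow> ('a \<Rightarrow> real) \<Rightarrow> ennreal" where
  "wnorm w f = (\<integral>\<^sup>+x. ennreal (\<bar>f x\<bar> * w x) \<partial>count_space UNIV)"

text \<open>\<open>kernel_app \<nu> K\<close> is the measure \<open>\<nu>K\<close>; its value at \<open>z\<close> is 0 if the sum diverges.\<close>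

definition kernel_app :: "('a \<Rightarrow> real) \<Rightarrow> ('a \<Rightarrow> 'b \<Rightarrow> real) \<Rightarrow> 'b \<Rightarrow> real" where
  "kernel_app \<nu> K z = (\<integral>x. \<nu> x * K x z \<partial>count_space UNIV)"

lemma nn_integral_count_space_swap:
  "(\<integral>\<^sup>+x. \<integral>\<^sup>+y. f x y \<partial>count_space UNIV \<partial>count_space UNIV) =
   (\<integral>\<^sup>+y. \<integral>\<^sup>+x. f x y \<partial>count_space UNIV \<partial>count_space UNIV)"
  using nn_integral_fst_count_space[of "\<lambda>(x, y). f x y"] nn_integral_snd_count_space[of "\<lambda>(x, y). f x y"]
  by simp

text \<open>Bridges two ways of summing: the moment hypotheses and \<open>V_norm\<close> use
  unconditional sums, the estimates use integrals over counting measure. An enumeration of the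
  countable type reduces the upper bound to partial sums of a series.\<close>

lemma nn_integral_count_space_SUP:
  fixes f :: "'a::countable \<Rightarrow> ennreal"
  shows "(\<integral>\<^sup>+x. f x \<partial>count_space UNIV) = (SUP S\<in>{S. finite S}. sum f S)"
proof (rule antisym)
  have "(\<integral>\<^sup>+x. f x \<partial>count_space UNIV) = (\<integral>\<^sup>+n. f (from_nat n) \<partial>count_space (range (to_nat :: 'a \<Rightarrow> nat)))"
    by (subst nn_integral_bij_count_space[where g = "to_nat" and A = UNIV, symmetric])
       (auto intro: inj_on_imp_bij_betw)
  also have "\<dots> = (\<integral>\<^sup>+n. f (from_nat n) * indicator (range (to_nat :: 'a \<Rightarrow> nat)) n \<partial>count_space UNIV)"
    by (rule nn_integral_count_space_indicator) auto
  also have "\<dots> = (\<Sum>n. f (from_nat n) * indicator (range (to_nat :: 'a \<Rightarrow> nat)) n)"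
    by (rule nn_integral_count_space_nat)
  also have "\<dots> = (SUP N. \<Sum>n<N. f (from_nat n) * indicator (range (to_nat :: 'a \<Rightarrow> nat)) n)"
    by (rule suminf_eq_SUP)
  also have "\<dots> \<le> (SUP S\<in>{S. finite S}. sum f S)"
  proof (rule SUP_least)
    fix N :: nat
    let ?A = "{..<N} \<inter> range (to_nat :: 'a \<Rightarrow> nat)"
    have "(\<Sum>n<N. f (from_nat n) * indicator (range (to_nat :: 'a \<Rightarrow> nat)) n) = (\<Sum>n\<in>?A. f (from_nat n))"
      by (intro sum.mono_neutral_cong_right) (auto simp: indicator_def)
    also have "\<dots> = sum f (from_nat ` ?A)"
      by (subst sum.reindex) (auto simp: inj_on_def)
    also have "\<dots> \<le> (SUP S\<in>{S. finite S}. sum f S)"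
      by (intro SUP_upper) auto
    finally show "(\<Sum>n<N. f (from_nat n) * indicator (range (to_nat :: 'a \<Rightarrow> nat)) n) \<le> \<dots>" .
  qed
  finally show "(\<integral>\<^sup>+x. f x \<partial>count_space UNIV) \<le> (SUP S\<in>{S. finite S}. sum f S)" .
next
  show "(SUP S\<in>{S. finite S}. sum f S) \<le> (\<integral>\<^sup>+x. f x \<partial>count_space UNIV)"
  proof (rule SUP_least)
    fix S :: "'a set" assume "S \<in> {S. finite S}"
    then have "sum f S = (\<integral>\<^sup>+x. f x \<partial>count_space S)"
      by (simp add: nn_integral_count_space_finite)
    also have "\<dots> = (\<integral>\<^sup>+x. f x * indicator S x \<partial>count_space UNIV)"
      by (rule nn_integral_count_space_indicator) auto
    also have "\<dots> \<le> (\<integral>\<^sup>+x. f x \<partial>count_space UNIV)"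
      by (intro nn_integral_mono) (auto simp: indicator_def)
    finally show "sum f S \<le> \<dots>" .
  qed
qed

lemma nn_integral_count_space_eq_infsum:
  fixes f :: "'a::countable \<Rightarrow> ennreal"
  shows "(\<integral>\<^sup>+x. f x \<partial>count_space UNIV) = infsum f UNIV"
  unfolding nn_integral_count_space_SUP
  by (subst nonneg_infsum_complete) auto

lemma sum_le_wnorm:
  fixes f :: "'a::countable \<Rightarrow> real"
  assumes "finite S" and "\<And>x. 0 \<le> w x"
  shows "ennreal (\<Sum>x\<in>S. \<bar>f x\<bar> * w x) \<le> wnorm w f"
proof -
  have "ennreal (\<Sum>x\<in>S. \<bar>f x\<bar> * w x) = (\<Sum>x\<in>S. ennreal (\<bar>f x\<bar> * w x))"
    using assms by (simp add: sum_ennreal)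
  also have "\<dots> \<le> wnorm w f"
    unfolding wnorm_def nn_integral_count_space_SUP using assms(1) by (intro SUP_upper) auto
  finally show ?thesis .
qed

text \<open>With \<open>sum_le_wnorm\<close>, the norm is the supremum of its finite partial sums.
  Arguments with real numbers, such as the mean value theorem or coordinatewise limits, can thus be
  run on finite sums alone.\<close>

lemma wnorm_leI:
  fixes f :: "'a::countable \<Rightarrow> real"
  assumes "\<And>x. 0 \<le> w x" and "\<And>S. finite S \<Longrightarrow> (\<Sum>x\<in>S. \<bar>f x\<bar> * w x) \<le> c"
  shows "wnorm w f \<le> ennreal c"
  unfolding wnorm_def nn_integral_count_space_SUP
proof (rule SUP_least)
  fix S :: "'a set" assume "S \<in> {S. finite S}"
  then show "(\<Sum>x\<in>S. ennreal (\<bar>f x\<bar> * w x)) \<le> ennreal c"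
    using assms by (simp add: sum_ennreal ennreal_leI)
qed

lemma wnorm_mono:
  assumes "\<And>x. \<bar>f x\<bar> * w x \<le> \<bar>g x\<bar> * v x"
  shows "wnorm w f \<le> wnorm v g"
  unfolding wnorm_def by (intro nn_integral_mono ennreal_leI assms)

lemma wnorm_mono_abs:
  assumes "\<And>x. \<bar>f x\<bar> \<le> \<bar>g x\<bar>" and "\<And>x. 0 \<le> w x"
  shows "wnorm w f \<le> wnorm w g"
  by (intro wnorm_mono mult_right_mono assms)

lemma wnorm_zero [simp]: "wnorm w (\<lambda>x. 0) = 0"
  by (simp add: wnorm_def)

lemma wnorm_add:
  assumes "\<And>x. 0 \<le> w x"
  shows "wnorm w (\<lambda>x. f x + g x) \<le> wnorm w f + wnorm w g"
proof -
  have "wnorm w (\<lambda>x. f x + g x) \<le> (\<integral>\<^sup>+x. ennreal (\<bar>f x\<bar> * w x) + ennreal (\<bar>g x\<bar> * w x) \<partial>count_space UNIV)"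
    unfolding wnorm_def
  proof (rule nn_integral_mono)
    fix x
    have "\<bar>f x + g x\<bar> * w x \<le> (\<bar>f x\<bar> + \<bar>g x\<bar>) * w x"
      using assms by (intro mult_right_mono) auto
    then show "ennreal (\<bar>f x + g x\<bar> * w x) \<le> ennreal (\<bar>f x\<bar> * w x) + ennreal (\<bar>g x\<bar> * w x)"
      using assms by (subst ennreal_plus[symmetric]) (auto simp: distrib_right simp del: ennreal_plus intro!: ennreal_leI)
  qed
  also have "\<dots> = wnorm w f + wnorm w g"
    unfolding wnorm_def by (rule nn_integral_add) auto
  finally show ?thesis .
qed

lemma wnorm_sum:
  assumes "\<And>x. 0 \<le> w x"
  shows "wnorm w (\<lambda>x. \<Sum>i\<in>I. f i x) \<le> (\<Sum>i\<in>I. wnorm w (f i))"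
proof (induction I rule: infinite_finite_induct)
  case (insert i I)
  then show ?case
    using wnorm_add[of w "f i" "\<lambda>x. \<Sum>i\<in>I. f i x"] assms
    by (auto intro: order_trans add_left_mono)
qed auto

lemma wnorm_cmult: "wnorm w (\<lambda>x. c * f x) = ennreal \<bar>c\<bar> * wnorm w f"
  unfolding wnorm_def
  by (subst nn_integral_cmult[symmetric]) (auto simp: abs_mult mult.assoc ennreal_mult' intro!: nn_integral_cong)

lemma wnorm_uminus: "wnorm w (\<lambda>x. - f x) = wnorm w f"
  by (simp add: wnorm_def)

lemma wnorm_diff_commute: "wnorm w (\<lambda>x. f x - g x) = wnorm w (\<lambda>x. g x - f x)"
  by (simp add: wnorm_def abs_minus_commute)

lemma wnorm_point:
  fixes f :: "'a::countable \<Rightarrow> real"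
  assumes "\<And>x. 1 \<le> w x"
  shows "ennreal \<bar>f x\<bar> \<le> wnorm w f"
proof -
  have w0: "0 \<le> w x" for x using assms[of x] by linarith
  have "\<bar>f x\<bar> \<le> \<bar>f x\<bar> * w x" using assms[of x] mult_left_mono[of 1 "w x" "\<bar>f x\<bar>"] by simp
  also have "\<dots> = (\<Sum>x\<in>{x}. \<bar>f x\<bar> * w x)" by simp
  finally have "ennreal \<bar>f x\<bar> \<le> ennreal (\<Sum>x\<in>{x}. \<bar>f x\<bar> * w x)" by (rule ennreal_leI)
  also have "\<dots> \<le> wnorm w f" using w0 by (intro sum_le_wnorm) auto
  finally show ?thesis .
qed

lemma wnorm_delta:
  assumes "0 \<le> w a"
  shows "wnorm w (\<lambda>z. if z = a then c else 0) = ennreal (\<bar>c\<bar> * w a)"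
proof -
  have "wnorm w (\<lambda>z. if z = a then c else 0) = (\<integral>\<^sup>+x. ennreal (\<bar>c\<bar> * w a) * indicator {a} x \<partial>count_space UNIV)"
    unfolding wnorm_def by (intro nn_integral_cong) (auto simp: indicator_def)
  then show ?thesis by simp
qed

section \<open>Action of kernels on mass functions\<close>

lemma wnorm_kernel_app:
  assumes "\<And>z. 0 \<le> w z"
  shows "wnorm w (kernel_app \<nu> K) \<le> (\<integral>\<^sup>+x. ennreal \<bar>\<nu> x\<bar> * wnorm w (K x) \<partial>count_space UNIV)"
proof -
  have "wnorm w (kernel_app \<nu> K) \<le> (\<integral>\<^sup>+z. \<integral>\<^sup>+x. ennreal \<bar>\<nu> x\<bar> * ennreal (\<bar>K x z\<bar> * w z) \<partial>count_space UNIV \<partial>count_space UNIV)"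
    unfolding wnorm_def
  proof (rule nn_integral_mono)
    fix z
    have "ennreal \<bar>kernel_app \<nu> K z\<bar> \<le> (\<integral>\<^sup>+x. ennreal \<bar>\<nu> x * K x z\<bar> \<partial>count_space UNIV)"
    proof (cases "integrable (count_space UNIV) (\<lambda>x. \<nu> x * K x z)")
      case True
      then show ?thesis unfolding kernel_app_def using integral_norm_bound_ennreal[OF True] by simp
    next
      \<comment> \<open>A divergent sum has the value 0, which meets any bound; this is why no
        integrability is assumed.\<close>
      case False
      then show ?thesis unfolding kernel_app_def by (simp add: not_integrable_integral_eq)
    qed
    then have "ennreal (\<bar>kernel_app \<nu> K z\<bar> * w z) \<le> (\<integral>\<^sup>+x. ennreal \<bar>\<nu> x * K x z\<bar> \<partial>count_space UNIV) * ennreal (w z)"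
      using assms by (simp add: ennreal_mult mult_right_mono)
    also have "\<dots> = (\<integral>\<^sup>+x. ennreal \<bar>\<nu> x\<bar> * ennreal (\<bar>K x z\<bar> * w z) \<partial>count_space UNIV)"
      by (subst nn_integral_multc[symmetric])
         (auto simp: abs_mult ennreal_mult assms mult.assoc intro!: nn_integral_cong)
    finally show "ennreal (\<bar>kernel_app \<nu> K z\<bar> * w z) \<le> \<dots>" .
  qed
  also have "\<dots> = (\<integral>\<^sup>+x. \<integral>\<^sup>+z. ennreal \<bar>\<nu> x\<bar> * ennreal (\<bar>K x z\<bar> * w z) \<partial>count_space UNIV \<partial>count_space UNIV)"
    by (rule nn_integral_count_space_swap)
  also have "\<dots> = (\<integral>\<^sup>+x. ennreal \<bar>\<nu> x\<bar> * wnorm w (K x) \<partial>count_space UNIV)"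
    unfolding wnorm_def by (intro nn_integral_cong nn_integral_cmult) auto
  finally show ?thesis .
qed

text \<open>The working form of an operator bound from weight \<open>v\<close> to weight
  \<open>w\<close>. The kernel is constrained only where \<open>\<nu>\<close> does not vanish,
  because kernels on states are meaningful only at lists of length \<open>p\<close>.\<close>

lemma wnorm_kernel_app_le:
  assumes "\<And>z. 0 \<le> w z" "\<And>x. 0 \<le> v x" "0 \<le> C"
    and K: "\<And>x. \<nu> x \<noteq> 0 \<Longrightarrow> wnorm w (K x) \<le> ennreal (C * v x)"
  shows "wnorm w (kernel_app \<nu> K) \<le> ennreal C * wnorm v \<nu>"
proof -
  have "wnorm w (kernel_app \<nu> K) \<le> (\<integral>\<^sup>+x. ennreal \<bar>\<nu> x\<bar> * wnorm w (K x) \<partial>count_space UNIV)"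
    by (rule wnorm_kernel_app) fact
  also have "\<dots> \<le> (\<integral>\<^sup>+x. ennreal C * ennreal (\<bar>\<nu> x\<bar> * v x) \<partial>count_space UNIV)"
  proof (rule nn_integral_mono)
    fix x
    show "ennreal \<bar>\<nu> x\<bar> * wnorm w (K x) \<le> ennreal C * ennreal (\<bar>\<nu> x\<bar> * v x)"
    proof (cases "\<nu> x = 0")
      case False
      have "ennreal \<bar>\<nu> x\<bar> * wnorm w (K x) \<le> ennreal \<bar>\<nu> x\<bar> * ennreal (C * v x)"
        by (intro mult_left_mono K False) auto
      also have "\<dots> = ennreal C * ennreal (\<bar>\<nu> x\<bar> * v x)"
        using assms by (simp add: ennreal_mult[symmetric] mult_ac)
      finally show ?thesis .
    qed auto
  qed
  also have "\<dots> = ennreal C * wnorm v \<nu>"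
    unfolding wnorm_def by (rule nn_integral_cmult) auto
  finally show ?thesis .
qed

lemma integrable_count_space_bound:
  assumes "\<And>x. \<bar>g x\<bar> \<le> C * (\<bar>f x\<bar> * w x)" "wnorm w f < \<infinity>" "0 \<le> C"
  shows "integrable (count_space UNIV) (g :: _ \<Rightarrow> real)"
proof (rule integrableI_bounded)
  have "(\<integral>\<^sup>+x. ennreal (norm (g x)) \<partial>count_space UNIV) \<le> (\<integral>\<^sup>+x. ennreal C * ennreal (\<bar>f x\<bar> * w x) \<partial>count_space UNIV)"
    using assms by (intro nn_integral_mono) (auto simp: ennreal_mult'[symmetric] intro!: ennreal_leI)
  also have "\<dots> = ennreal C * wnorm w f"
    unfolding wnorm_def by (rule nn_integral_cmult) auto
  also have "\<dots> < \<infinity>" using assms(2) by (simp add: ennreal_mult_less_top)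
  finally show "(\<integral>\<^sup>+x. ennreal (norm (g x)) \<partial>count_space UNIV) < \<infinity>" .
qed auto

lemma kernel_app_add:
  assumes "integrable (count_space UNIV) (\<lambda>x. \<nu> x * K x z)" "integrable (count_space UNIV) (\<lambda>x. \<mu> x * K x z)"
  shows "kernel_app (\<lambda>x. \<nu> x + \<mu> x) K z = kernel_app \<nu> K z + kernel_app \<mu> K z"
  unfolding kernel_app_def by (simp add: distrib_right assms)

lemma kernel_app_diff:
  assumes "integrable (count_space UNIV) (\<lambda>x. \<nu> x * K x z)" "integrable (count_space UNIV) (\<lambda>x. \<mu> x * K x z)"
  shows "kernel_app (\<lambda>x. \<nu> x - \<mu> x) K z = kernel_app \<nu> K z - kernel_app \<mu> K z"
  unfolding kernel_app_def by (simp add: left_diff_distrib assms)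

lemma kernel_app_cong:
  assumes "\<And>x. \<nu> x = \<mu> x" "\<And>x. \<mu> x \<noteq> 0 \<Longrightarrow> K x z = H x z"
  shows "kernel_app \<nu> K z = kernel_app \<mu> H z"
  unfolding kernel_app_def using assms by (intro Bochner_Integration.integral_cong) auto

lemma kernel_app_finite:
  assumes "finite S" "\<And>x. x \<notin> S \<Longrightarrow> \<nu> x * K x z = 0"
  shows "kernel_app \<nu> K z = (\<Sum>x\<in>S. \<nu> x * K x z)"
proof -
  have fin: "finite {x. \<nu> x * K x z \<noteq> 0}"
    using assms by (rule_tac finite_subset[of _ S]) auto
  have "kernel_app \<nu> K z = (\<Sum>x | \<nu> x * K x z \<noteq> 0. \<nu> x * K x z)"
    unfolding kernel_app_def
    by (subst lebesgue_integral_count_space_finite_support) (use fin in auto)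
  also have "\<dots> = (\<Sum>x\<in>S. \<nu> x * K x z)"
    using assms by (intro sum.mono_neutral_left) auto
  finally show ?thesis .
qed

lemma kernel_app_assoc:
  fixes \<nu> :: "'a::countable \<Rightarrow> real" and K :: "'a \<Rightarrow> 'b::countable \<Rightarrow> real"
  assumes "(\<integral>\<^sup>+x. \<integral>\<^sup>+y. ennreal \<bar>\<nu> x * K x y * H y z\<bar> \<partial>count_space UNIV \<partial>count_space UNIV) < \<infinity>"
  shows "kernel_app (kernel_app \<nu> K) H z = kernel_app \<nu> (\<lambda>x. kernel_app (K x) H) z"
proof -
  interpret A: sigma_finite_measure "count_space (UNIV :: 'a set)" by (rule sigma_finite_measure_count_space)
  interpret B: sigma_finite_measure "count_space (UNIV :: 'b set)" by (rule sigma_finite_measure_count_space)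
  interpret AB: pair_sigma_finite "count_space (UNIV :: 'a set)" "count_space (UNIV :: 'b set)" ..
  have eq: "count_space (UNIV :: 'a set) \<Otimes>\<^sub>M count_space (UNIV :: 'b set) = count_space UNIV"
    by (subst pair_measure_countable) auto
  let ?f = "\<lambda>x y. \<nu> x * K x y * H y z"
  have int: "integrable (count_space UNIV \<Otimes>\<^sub>M count_space UNIV) (\<lambda>(x, y). ?f x y)"
    unfolding eq
  proof (rule integrableI_bounded)
    have "(\<integral>\<^sup>+xy. ennreal (norm (case xy of (x, y) \<Rightarrow> ?f x y)) \<partial>count_space UNIV) =
        (\<integral>\<^sup>+x. \<integral>\<^sup>+y. ennreal \<bar>?f x y\<bar> \<partial>count_space UNIV \<partial>count_space UNIV)"
      by (subst nn_integral_fst_count_space[symmetric]) auto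
    then show "(\<integral>\<^sup>+xy. ennreal (norm (case xy of (x, y) \<Rightarrow> ?f x y)) \<partial>count_space UNIV) < \<infinity>"
      using assms by simp
  qed auto
  have "kernel_app (kernel_app \<nu> K) H z = (\<integral>y. \<integral>x. ?f x y \<partial>count_space UNIV \<partial>count_space UNIV)"
    unfolding kernel_app_def
    by (auto simp flip: integral_mult_left_zero)
  also have "\<dots> = (\<integral>x. \<integral>y. ?f x y \<partial>count_space UNIV \<partial>count_space UNIV)"
    by (rule AB.Fubini_integral) (fact int)
  also have "\<dots> = kernel_app \<nu> (\<lambda>x. kernel_app (K x) H) z"
    unfolding kernel_app_def by (auto simp flip: integral_mult_right_zero simp: mult.assoc)
  finally show ?thesis .
qed

lemma pmf_bind_kernel_app: "pmf (bind_pmf P K) z = kernel_app (pmf P) (\<lambda>x. pmf (K x)) z"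
  unfolding pmf_bind kernel_app_def
  by (subst measure_pmf_eq_density, subst integral_density) auto

lemma wnorm_pmf: "wnorm w (pmf P) = (\<integral>\<^sup>+x. ennreal (w x) \<partial>measure_pmf P)"
  unfolding wnorm_def nn_integral_measure_pmf by (intro nn_integral_cong) (auto simp: ennreal_mult')

section \<open>Smooth families in weighted spaces\<close>

text \<open>Approximants with errors \<open>1 / (n + 1)\<close> form a sequence whose derivatives
  converge uniformly, so limit and derivative may be exchanged. In this form families can be shown
  to be smooth by approximation, without building sequences each time.\<close>

lemma derivative_limit:
  fixes f g :: "real \<Rightarrow> real"
  assumes appr: "\<And>e. e > 0 \<Longrightarrow> \<exists>h h'. (\<forall>u\<in>{0..1}. (h has_real_derivative h' u) (at u within {0..1})) \<and>
      (\<forall>u\<in>{0..1}. \<bar>f u - h u\<bar> \<le> e) \<and> (\<forall>u\<in>{0..1}. \<bar>g u - h' u\<bar> \<le> e)"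
    and u: "u \<in> {0..1}"
  shows "(f has_real_derivative g u) (at u within {0..1})"
proof -
  have "\<exists>h h'. (\<forall>u\<in>{0..1}. (h has_real_derivative h' u) (at u within {0..1})) \<and>
      (\<forall>u\<in>{0..1}. \<bar>f u - h u\<bar> \<le> inverse (real (Suc n))) \<and> (\<forall>u\<in>{0..1}. \<bar>g u - h' u\<bar> \<le> inverse (real (Suc n)))" for n
    by (rule appr) auto
  then obtain h h' where der: "\<And>n u. u \<in> {0..1} \<Longrightarrow> (h n has_real_derivative h' n u) (at u within {0..1})"
    and f: "\<And>n u. u \<in> {0..1} \<Longrightarrow> \<bar>f u - h n u\<bar> \<le> inverse (real (Suc n))"
    and g: "\<And>n u. u \<in> {0..1} \<Longrightarrow> \<bar>g u - h' n u\<bar> \<le> inverse (real (Suc n))"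
    by metis
  have conv: "(\<lambda>n. h n u) \<longlonglongrightarrow> f u" if "u \<in> {0..1}" for u
  proof (rule LIM_zero_cancel, rule Lim_null_comparison)
    show "\<forall>\<^sub>F n in sequentially. norm (h n u - f u) \<le> inverse (real (Suc n))"
      using f[OF that] by (intro always_eventually) (auto simp: abs_minus_commute)
    show "(\<lambda>n. inverse (real (Suc n))) \<longlonglongrightarrow> 0" by (rule LIMSEQ_inverse_real_of_nat)
  qed
  have "\<exists>F. \<forall>x\<in>{0..1}. (\<lambda>n. h n x) \<longlonglongrightarrow> F x \<and> (F has_derivative (\<lambda>t. g x * t)) (at x within {0..1})"
  proof (rule has_derivative_sequence[where f' = "\<lambda>n x t. h' n x * t" and ?x0.0 = u and l = "f u"])
    fix e :: real assume "e > 0"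
    then obtain N where N: "inverse (real (Suc N)) < e" using reals_Archimedean by blast
    show "\<forall>\<^sub>F n in sequentially. \<forall>x\<in>{0..1}. \<forall>t. norm (h' n x * t - g x * t) \<le> e * norm t"
      unfolding eventually_sequentially
    proof (intro exI allI impI ballI)
      fix n x t assume n: "N \<le> n" and x: "x \<in> {0..1::real}"
      have "\<bar>h' n x - g x\<bar> \<le> inverse (real (Suc n))" using g[OF x, of n] by (simp add: abs_minus_commute)
      also have "\<dots> \<le> inverse (real (Suc N))" using n by (intro le_imp_inverse_le) auto
      finally have "\<bar>h' n x - g x\<bar> \<le> e" using N by linarith
      then show "norm (h' n x * t - g x * t) \<le> e * norm t"
        by (simp add: left_diff_distrib[symmetric] abs_mult mult_right_mono)
    qed
  qed (use der conv u in \<open>auto simp: has_field_derivative_def\<close>)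
  then obtain F where F: "\<And>x. x \<in> {0..1} \<Longrightarrow> (\<lambda>n. h n x) \<longlonglongrightarrow> F x"
     "\<And>x. x \<in> {0..1} \<Longrightarrow> (F has_derivative (\<lambda>t. g x * t)) (at x within {0..1})" by blast
  have eq: "F x = f x" if "x \<in> {0..1}" for x
    using F(1)[OF that] conv[OF that] by (rule LIMSEQ_unique)
  have "(F has_real_derivative g u) (at u within {0..1})"
    using F(2)[OF u] by (simp add: has_field_derivative_def)
  then show ?thesis
    by (rule has_field_derivative_transform_within[where d = 1]) (use eq u in auto)
qed

text \<open>The size function is a parameter so that the same weights serve for integers, for states
  and for paths of states.\<close>

definition wt :: "('a \<Rightarrow> nat) \<Rightarrow> nat \<Rightarrow> 'a \<Rightarrow> real" where
  "wt sz m z = (1 + real (sz z)) ^ m"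

lemma wt_ge_1 [simp]: "1 \<le> wt sz m z" and wt_nonneg [simp]: "0 \<le> wt sz m z"
  by (simp_all add: wt_def)

lemma wt_mono: "m \<le> n \<Longrightarrow> wt sz m z \<le> wt sz n z"
  unfolding wt_def by (rule power_increasing) auto

section \<open>Norm-continuous families of mass functions\<close>

text \<open>Continuity into the weighted space: on a countable set it amounts to continuity of the
  coordinates together with uniformly small tails.\<close>

definition weighted_cont :: "('a \<Rightarrow> real) \<Rightarrow> (real \<Rightarrow> 'a \<Rightarrow> real) \<Rightarrow> bool" where
  "weighted_cont w F \<longleftrightarrow> (\<forall>z. continuous_on {0..1} (\<lambda>u. F u z)) \<and>
     (\<forall>e>0. \<exists>S. finite S \<and> (\<forall>u\<in>{0..1}. wnorm w (\<lambda>z. if z \<in> S then 0 else F u z) \<le> ennreal e))"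

lemma weighted_cont_continuous: "weighted_cont w F \<Longrightarrow> continuous_on {0..1} (\<lambda>u. F u z)"
  by (simp add: weighted_cont_def)

lemma weighted_cont_tail:
  assumes "weighted_cont w F" "e > 0"
  obtains S where "finite S" "\<And>u. u \<in> {0..1} \<Longrightarrow> wnorm w (\<lambda>z. if z \<in> S then 0 else F u z) \<le> ennreal e"
  using assms unfolding weighted_cont_def by blast

lemma weighted_cont_finite_support:
  assumes "finite S" "\<And>u z. u \<in> {0..1} \<Longrightarrow> z \<notin> S \<Longrightarrow> F u z = 0" "\<And>z. continuous_on {0..1} (\<lambda>u. F u z)"
  shows "weighted_cont w F"
  unfolding weighted_cont_def
proof (intro conjI allI impI)
  fix e :: real assume "e > 0"
  have "wnorm w (\<lambda>z. if z \<in> S then 0 else F u z) = 0" if "u \<in> {0..1}" for u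
  proof -
    have "(\<lambda>z. if z \<in> S then 0 else F u z) = (\<lambda>z. 0)" using assms(2)[OF that] by auto
    then show ?thesis by simp
  qed
  then show "\<exists>S. finite S \<and> (\<forall>u\<in>{0..1}. wnorm w (\<lambda>z. if z \<in> S then 0 else F u z) \<le> ennreal e)"
    using assms(1) by (intro exI[of _ S]) auto
qed (use assms in auto)

lemma weighted_cont_add:
  assumes "weighted_cont w F" "weighted_cont w G" "\<And>z. 0 \<le> w z"
  shows "weighted_cont w (\<lambda>u z. F u z + G u z)"
  unfolding weighted_cont_def
proof (intro conjI allI impI)
  fix e :: real assume e: "e > 0"
  obtain S where S: "finite S" "\<And>u. u \<in> {0..1} \<Longrightarrow> wnorm w (\<lambda>z. if z \<in> S then 0 else F u z) \<le> ennreal (e/2)"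
    using weighted_cont_tail[OF assms(1), of "e/2"] e by auto
  obtain S' where S': "finite S'" "\<And>u. u \<in> {0..1} \<Longrightarrow> wnorm w (\<lambda>z. if z \<in> S' then 0 else G u z) \<le> ennreal (e/2)"
    using weighted_cont_tail[OF assms(2), of "e/2"] e by auto
  show "\<exists>S. finite S \<and> (\<forall>u\<in>{0..1}. wnorm w (\<lambda>z. if z \<in> S then 0 else F u z + G u z) \<le> ennreal e)"
  proof (intro exI[of _ "S \<union> S'"] conjI ballI)
    fix u :: real assume u: "u \<in> {0..1}"
    have "wnorm w (\<lambda>z. if z \<in> S \<union> S' then 0 else F u z + G u z) \<le>
        wnorm w (\<lambda>z. (if z \<in> S \<union> S' then 0 else F u z) + (if z \<in> S \<union> S' then 0 else G u z))"
      by (intro wnorm_mono_abs assms) auto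
    also have "\<dots> \<le> wnorm w (\<lambda>z. if z \<in> S \<union> S' then 0 else F u z) + wnorm w (\<lambda>z. if z \<in> S \<union> S' then 0 else G u z)"
      by (intro wnorm_add assms)
    also have "\<dots> \<le> wnorm w (\<lambda>z. if z \<in> S then 0 else F u z) + wnorm w (\<lambda>z. if z \<in> S' then 0 else G u z)"
      by (intro add_mono wnorm_mono_abs assms) auto
    also have "\<dots> \<le> ennreal (e/2) + ennreal (e/2)"
      by (intro add_mono S S' u)
    also have "\<dots> = ennreal e" using e by (simp flip: ennreal_plus)
    finally show "wnorm w (\<lambda>z. if z \<in> S \<union> S' then 0 else F u z + G u z) \<le> ennreal e" .
  qed (use S S' in auto)
qed (use assms in \<open>auto intro!: continuous_intros simp: weighted_cont_def\<close>)

lemma weighted_cont_zero [simp]: "weighted_cont w (\<lambda>u z. 0)"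
  by (rule weighted_cont_finite_support[where S = "{}"]) auto

lemma weighted_cont_sum:
  assumes "\<And>i. i \<in> I \<Longrightarrow> weighted_cont w (F i)" "\<And>z. 0 \<le> w z"
  shows "weighted_cont w (\<lambda>u z. \<Sum>i\<in>I. F i u z)"
  using assms(1)
  by (induction I rule: infinite_finite_induct) (auto intro!: weighted_cont_add assms(2))

lemma weighted_cont_scale:
  assumes "weighted_cont w F" "continuous_on {0..1} s" "\<And>z. 0 \<le> w z"
  shows "weighted_cont w (\<lambda>u z. s u * F u z)"
  unfolding weighted_cont_def
proof (intro conjI allI impI)
  have "compact (s ` {0..1})" using assms(2) by (intro compact_continuous_image) auto
  then obtain B where "B > 0" and B: "\<And>u. u \<in> {0..1} \<Longrightarrow> \<bar>s u\<bar> \<le> B"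
    using compact_imp_bounded bounded_pos by (metis imageI real_norm_def)
  fix e :: real assume e: "e > 0"
  obtain S where S: "finite S" "\<And>u. u \<in> {0..1} \<Longrightarrow> wnorm w (\<lambda>z. if z \<in> S then 0 else F u z) \<le> ennreal (e/B)"
    using weighted_cont_tail[OF assms(1), of "e/B"] e \<open>B > 0\<close> by auto
  show "\<exists>S. finite S \<and> (\<forall>u\<in>{0..1}. wnorm w (\<lambda>z. if z \<in> S then 0 else s u * F u z) \<le> ennreal e)"
  proof (intro exI[of _ S] conjI ballI)
    fix u :: real assume u: "u \<in> {0..1}"
    have "wnorm w (\<lambda>z. if z \<in> S then 0 else s u * F u z) = wnorm w (\<lambda>z. s u * (if z \<in> S then 0 else F u z))"
      by (rule arg_cong[where f = "wnorm w"]) auto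
    also have "\<dots> = ennreal \<bar>s u\<bar> * wnorm w (\<lambda>z. if z \<in> S then 0 else F u z)" by (rule wnorm_cmult)
    also have "\<dots> \<le> ennreal B * ennreal (e / B)"
      by (intro mult_mono ennreal_leI B S u) auto
    also have "\<dots> = ennreal e" using \<open>B > 0\<close> e by (simp flip: ennreal_mult)
    finally show "wnorm w (\<lambda>z. if z \<in> S then 0 else s u * F u z) \<le> ennreal e" .
  qed (use S in auto)
qed (use assms in \<open>auto intro!: continuous_intros simp: weighted_cont_def\<close>)

lemma weighted_cont_mono:
  assumes "weighted_cont w F" "\<And>z. v z \<le> w z"
  shows "weighted_cont v F"
proof -
  have "wnorm v f \<le> wnorm w f" for f
    by (intro wnorm_mono mult_left_mono assms) auto
  then show ?thesis using assms(1) unfolding weighted_cont_def by (meson order_trans)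
qed

text \<open>Closedness under uniform limits in norm. Coordinates are uniform limits of continuous
  functions, as the weights are at least 1, and the finite set that captures an approximant up to
  \<open>e/2\<close> captures the limit up to \<open>e\<close>.\<close>

lemma weighted_cont_approx:
  fixes F :: "real \<Rightarrow> 'a::countable \<Rightarrow> real"
  assumes appr: "\<And>e. e > 0 \<Longrightarrow> \<exists>G. weighted_cont w G \<and> (\<forall>u\<in>{0..1}. wnorm w (\<lambda>z. F u z - G u z) \<le> ennreal e)"
    and w: "\<And>z. 1 \<le> w z"
  shows "weighted_cont w F"
proof -
  have w0: "0 \<le> w z" for z using w[of z] by linarith
  show ?thesis
    unfolding weighted_cont_def
  proof (intro conjI allI impI)
    fix z
    show "continuous_on {0..1} (\<lambda>u. F u z)"
    proof (rule continuous_on_iff[THEN iffD2], intro ballI allI impI)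
      fix u e :: real assume u: "u \<in> {0..1}" and e: "e > 0"
      obtain G where G: "weighted_cont w G" "\<And>u. u \<in> {0..1} \<Longrightarrow> wnorm w (\<lambda>z. F u z - G u z) \<le> ennreal (e/4)"
        using appr[of "e/4"] e by auto
      have close: "\<bar>F v z - G v z\<bar> \<le> e/4" if "v \<in> {0..1}" for v
      proof -
        have "ennreal \<bar>F v z - G v z\<bar> \<le> ennreal (e/4)"
          using wnorm_point[of w "\<lambda>z. F v z - G v z" z] w G(2)[OF that] by (auto intro: order_trans)
        then show ?thesis using e by (simp add: ennreal_le_iff)
      qed
      obtain d where d: "d > 0" "\<And>v. v \<in> {0..1} \<Longrightarrow> dist v u < d \<Longrightarrow> dist (G v z) (G u z) < e/4"
        using weighted_cont_continuous[OF G(1), of z] u e unfolding continuous_on_iff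
        by (metis divide_pos_pos zero_less_numeral)
      show "\<exists>d>0. \<forall>v\<in>{0..1}. dist v u < d \<longrightarrow> dist (F v z) (F u z) < e"
      proof (intro exI[of _ d] conjI ballI impI)
        fix v assume v: "v \<in> {0..1::real}" "dist v u < d"
        show "dist (F v z) (F u z) < e"
          using close[OF u] close[OF v(1)] d(2)[OF v] e unfolding dist_real_def by linarith
      qed (use d in auto)
    qed
  next
    fix e :: real assume e: "e > 0"
    obtain G where G: "weighted_cont w G" "\<And>u. u \<in> {0..1} \<Longrightarrow> wnorm w (\<lambda>z. F u z - G u z) \<le> ennreal (e/2)"
      using appr[of "e/2"] e by auto
    obtain S where S: "finite S" "\<And>u. u \<in> {0..1} \<Longrightarrow> wnorm w (\<lambda>z. if z \<in> S then 0 else G u z) \<le> ennreal (e/2)"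
      using weighted_cont_tail[OF G(1), of "e/2"] e by auto
    show "\<exists>S. finite S \<and> (\<forall>u\<in>{0..1}. wnorm w (\<lambda>z. if z \<in> S then 0 else F u z) \<le> ennreal e)"
    proof (intro exI[of _ S] conjI ballI)
      fix u :: real assume u: "u \<in> {0..1}"
      have "wnorm w (\<lambda>z. if z \<in> S then 0 else F u z) \<le>
          wnorm w (\<lambda>z. (if z \<in> S then 0 else F u z - G u z) + (if z \<in> S then 0 else G u z))"
        by (intro wnorm_mono_abs w0) auto
      also have "\<dots> \<le> wnorm w (\<lambda>z. if z \<in> S then 0 else F u z - G u z) + wnorm w (\<lambda>z. if z \<in> S then 0 else G u z)"
        by (intro wnorm_add w0)
      also have "\<dots> \<le> wnorm w (\<lambda>z. F u z - G u z) + wnorm w (\<lambda>z. if z \<in> S then 0 else G u z)"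
        by (intro add_mono wnorm_mono_abs w0) auto
      also have "\<dots> \<le> ennreal (e/2) + ennreal (e/2)"
        by (intro add_mono S G u)
      also have "\<dots> = ennreal e" using e by (simp flip: ennreal_plus)
      finally show "wnorm w (\<lambda>z. if z \<in> S then 0 else F u z) \<le> ennreal e" .
    qed (use S in auto)
  qed
qed

text \<open>Off a finite set the norm is at most 1 for all \<open>u\<close>; the finitely many
  remaining coordinates are continuous on a compact interval.\<close>

lemma weighted_cont_bounded:
  assumes "weighted_cont w F" "\<And>z. 0 \<le> w z"
  obtains C where "0 \<le> C" "\<And>u. u \<in> {0..1} \<Longrightarrow> wnorm w (F u) \<le> ennreal C"
proof -
  obtain S where S: "finite S" "\<And>u. u \<in> {0..1} \<Longrightarrow> wnorm w (\<lambda>z. if z \<in> S then 0 else F u z) \<le> ennreal 1"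
    using weighted_cont_tail[OF assms(1), of 1] by auto
  have "\<exists>B. \<forall>u\<in>{0..1}. \<bar>F u z\<bar> \<le> B" for z
  proof -
    have "compact ((\<lambda>u. F u z) ` {0..1})" using weighted_cont_continuous[OF assms(1)] by (intro compact_continuous_image) auto
    then show ?thesis using compact_imp_bounded bounded_iff by (metis imageI real_norm_def)
  qed
  then obtain B where B: "\<And>z u. u \<in> {0..1} \<Longrightarrow> \<bar>F u z\<bar> \<le> B z" by metis
  let ?C = "1 + (\<Sum>z\<in>S. \<bar>B z\<bar> * w z)"
  have "wnorm w (F u) \<le> ennreal ?C" if u: "u \<in> {0..1}" for u
  proof -
    have "wnorm w (F u) \<le> wnorm w (\<lambda>z. (if z \<in> S then 0 else F u z) + (\<Sum>a\<in>S. if z = a then F u a else 0))"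
      using S(1) assms(2) by (intro wnorm_mono_abs) (auto simp: sum.delta)
    also have "\<dots> \<le> wnorm w (\<lambda>z. if z \<in> S then 0 else F u z) + wnorm w (\<lambda>z. \<Sum>a\<in>S. if z = a then F u a else 0)"
      by (intro wnorm_add assms)
    also have "\<dots> \<le> ennreal 1 + (\<Sum>a\<in>S. wnorm w (\<lambda>z. if z = a then F u a else 0))"
      by (intro add_mono S u wnorm_sum assms)
    also have "\<dots> \<le> ennreal 1 + (\<Sum>a\<in>S. ennreal (\<bar>B a\<bar> * w a))"
      using B[OF u] by (intro add_mono sum_mono order_refl)
        (auto simp: wnorm_delta assms intro!: ennreal_leI mult_right_mono order_trans[OF B[OF u] abs_ge_self])
    also have "\<dots> = ennreal ?C"
      using assms(2) by (subst sum_ennreal) (auto simp: sum_nonneg)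
    finally show ?thesis .
  qed
  moreover have "0 \<le> ?C" using assms(2) by (simp add: sum_nonneg add_nonneg_nonneg)
  ultimately show ?thesis using that by blast
qed

section \<open>Families together with their normalised derivatives\<close>

text \<open>\<open>T r\<close> is the \<open>r\<close>-th derivative of \<open>T 0\<close> divided by \<open>r!\<close>, so that Leibniz's rule has no binomial
  coefficients. Every derivative loses one power of the weight.\<close>

definition tower :: "nat \<Rightarrow> nat \<Rightarrow> ('a \<Rightarrow> nat) \<Rightarrow> (nat \<Rightarrow> real \<Rightarrow> 'a \<Rightarrow> real) \<Rightarrow> bool" where
  "tower k L sz T \<longleftrightarrow>
     (\<forall>r<k. \<forall>u\<in>{0..1}. \<forall>z. ((\<lambda>v. T r v z) has_real_derivative real (Suc r) * T (Suc r) u z) (at u within {0..1})) \<and>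
     (\<forall>r\<le>k. weighted_cont (wt sz (L - r)) (T r))"

lemma tower_weighted_cont: "tower k L sz T \<Longrightarrow> r \<le> k \<Longrightarrow> weighted_cont (wt sz (L - r)) (T r)"
  by (simp add: tower_def)

lemma tower_deriv: "tower k L sz T \<Longrightarrow> r < k \<Longrightarrow> u \<in> {0..1} \<Longrightarrow>
    ((\<lambda>v. T r v z) has_real_derivative real (Suc r) * T (Suc r) u z) (at u within {0..1})"
  by (simp add: tower_def)

lemma tower_bounded:
  assumes "tower k L sz T"
  obtains C where "0 \<le> C" "\<And>r u. r \<le> k \<Longrightarrow> u \<in> {0..1} \<Longrightarrow> wnorm (wt sz (L - r)) (T r u) \<le> ennreal C"
proof -
  have "\<exists>C\<ge>0. \<forall>u\<in>{0..1}. wnorm (wt sz (L - r)) (T r u) \<le> ennreal C" if "r \<le> k" for r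
    using weighted_cont_bounded[OF tower_weighted_cont[OF assms that]] by (metis wt_nonneg)
  then obtain C where C: "\<And>r u. r \<le> k \<Longrightarrow> u \<in> {0..1} \<Longrightarrow> wnorm (wt sz (L - r)) (T r u) \<le> ennreal (C r)" "\<And>r. r \<le> k \<Longrightarrow> C r \<ge> 0"
    by metis
  show ?thesis
  proof (rule that)
    show "0 \<le> (\<Sum>r\<le>k. C r)" using C(2) by (intro sum_nonneg) auto
    fix r u assume r: "r \<le> k" and u: "u \<in> {0..1::real}"
    have "C r \<le> (\<Sum>r\<le>k. C r)" using C(2) r by (intro member_le_sum) auto
    then show "wnorm (wt sz (L - r)) (T r u) \<le> ennreal (\<Sum>r\<le>k. C r)"
      using C(1)[OF r u] by (meson ennreal_leI order_trans)
  qed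
qed

text \<open>The closure principle behind both main constructions: the action of a kernel is
  approximated by finite sums, and the invariant law by the iterates. Approximating all levels at
  once suffices, because \<open>derivative_limit\<close> then links consecutive levels.\<close>

lemma tower_approx:
  fixes T :: "nat \<Rightarrow> real \<Rightarrow> 'a::countable \<Rightarrow> real"
  assumes appr: "\<And>e. e > 0 \<Longrightarrow> \<exists>T'. tower k L sz T' \<and>
     (\<forall>r\<le>k. \<forall>u\<in>{0..1}. wnorm (wt sz (L - r)) (\<lambda>z. T r u z - T' r u z) \<le> ennreal e)"
  shows "tower k L sz T"
  unfolding tower_def
proof (intro conjI allI impI ballI)
  fix r assume r: "r \<le> k"
  show "weighted_cont (wt sz (L - r)) (T r)"
  proof (rule weighted_cont_approx)
    fix e :: real assume "e > 0"
    from appr[OF this] r show "\<exists>G. weighted_cont (wt sz (L - r)) G \<and> (\<forall>u\<in>{0..1}. wnorm (wt sz (L - r)) (\<lambda>z. T r u z - G u z) \<le> ennreal e)"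
      by (auto simp: tower_def)
  qed auto
next
  fix r :: nat and u :: real and z assume r: "r < k" and u: "u \<in> {0..1}"
  show "((\<lambda>v. T r v z) has_real_derivative real (Suc r) * T (Suc r) u z) (at u within {0..1})"
  proof (rule derivative_limit[OF _ u, where g = "\<lambda>u. real (Suc r) * T (Suc r) u z"])
    fix e :: real assume e: "e > 0"
    \<comment> \<open>Level \<open>r + 1\<close> is multiplied by \<open>r + 1\<close> when it
      serves as the derivative of level \<open>r\<close>, so its tolerance must be divided
      accordingly; the uniform choice \<open>e / (k + 1)\<close> is good for all levels.\<close>
    obtain T' where T': "tower k L sz T'"
       "\<And>r u. r \<le> k \<Longrightarrow> u \<in> {0..1} \<Longrightarrow> wnorm (wt sz (L - r)) (\<lambda>z. T r u z - T' r u z) \<le> ennreal (e / real (Suc r))"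
    proof -
      obtain T' where T': "tower k L sz T'"
        "\<And>r u. r \<le> k \<Longrightarrow> u \<in> {0..1} \<Longrightarrow> wnorm (wt sz (L - r)) (\<lambda>z. T r u z - T' r u z) \<le> ennreal (e / real (Suc k))"
        using appr[of "e / real (Suc k)"] e by auto
      have "ennreal (e / real (Suc k)) \<le> ennreal (e / real (Suc r))" if "r \<le> k" for r
        using that e by (intro ennreal_leI divide_left_mono) auto
      then show ?thesis using that T' by (meson order_trans)
    qed
    have close: "\<bar>T r u z - T' r u z\<bar> \<le> e / real (Suc r)" if "u \<in> {0..1}" "r \<le> k" for u r
    proof -
      have "ennreal \<bar>T r u z - T' r u z\<bar> \<le> ennreal (e / real (Suc r))"
        using wnorm_point[of "wt sz (L - r)" "\<lambda>z. T r u z - T' r u z" z] T'(2)[OF that(2,1)]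
        by (auto intro: order_trans)
      then show ?thesis using e by (simp add: ennreal_le_iff)
    qed
    show "\<exists>h h'. (\<forall>u\<in>{0..1}. (h has_real_derivative h' u) (at u within {0..1})) \<and>
      (\<forall>u\<in>{0..1}. \<bar>T r u z - h u\<bar> \<le> e) \<and> (\<forall>u\<in>{0..1}. \<bar>real (Suc r) * T (Suc r) u z - h' u\<bar> \<le> e)"
    proof (rule exI[of _ "\<lambda>u. T' r u z"], rule exI[of _ "\<lambda>u. real (Suc r) * T' (Suc r) u z"], intro conjI ballI)
      fix v :: real assume v: "v \<in> {0..1}"
      show "((\<lambda>u. T' r u z) has_real_derivative real (Suc r) * T' (Suc r) v z) (at v within {0..1})"
        by (rule tower_deriv[OF T'(1) r v])
      have "e / real (Suc r) \<le> e" using e by (simp add: field_simps)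
      then show "\<bar>T r v z - T' r v z\<bar> \<le> e" using close[OF v, of r] r by linarith
      have "\<bar>real (Suc r) * T (Suc r) v z - real (Suc r) * T' (Suc r) v z\<bar> = real (Suc r) * \<bar>T (Suc r) v z - T' (Suc r) v z\<bar>"
        by (simp add: right_diff_distrib[symmetric] abs_mult)
      also have "\<dots> \<le> real (Suc r) * (e / real (Suc (Suc r)))"
        using close[OF v, of "Suc r"] r by (intro mult_left_mono) auto
      also have "\<dots> \<le> e" using e by (simp add: field_simps)
      finally show "\<bar>real (Suc r) * T (Suc r) v z - real (Suc r) * T' (Suc r) v z\<bar> \<le> e" .
    qed
  qed
qed

lemma tower_zero [simp]: "tower k L sz (\<lambda>r u z. 0)"
  by (simp add: tower_def)

lemma tower_add:
  assumes "tower k L sz T" "tower k L sz U"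
  shows "tower k L sz (\<lambda>r u z. T r u z + U r u z)"
  unfolding tower_def
proof (intro conjI allI impI ballI)
  fix r :: nat and u :: real and z assume r: "r < k" and u: "u \<in> {0..1}"
  show "((\<lambda>v. T r v z + U r v z) has_real_derivative real (Suc r) * (T (Suc r) u z + U (Suc r) u z)) (at u within {0..1})"
    unfolding distrib_left by (intro DERIV_add tower_deriv[OF assms(1)] tower_deriv[OF assms(2)] r u)
qed (auto intro!: weighted_cont_add tower_weighted_cont[OF assms(1)] tower_weighted_cont[OF assms(2)])

lemma tower_sum:
  assumes "\<And>i. i \<in> I \<Longrightarrow> tower k L sz (T i)"
  shows "tower k L sz (\<lambda>r u z. \<Sum>i\<in>I. T i r u z)"
  using assms by (induction I rule: infinite_finite_induct) (auto intro!: tower_add)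

text \<open>Leibniz's rule for a scalar factor depending on \<open>u\<close>. It is applied to a
  measure restricted to finitely many points: the scalars are then the masses of these
  points.\<close>

lemma tower_scale:
  assumes T: "tower k L sz T"
    and s: "\<And>r u. r < k \<Longrightarrow> u \<in> {0..1} \<Longrightarrow> (s r has_real_derivative real (Suc r) * s (Suc r) u) (at u within {0..1})"
    and c: "\<And>r. r \<le> k \<Longrightarrow> continuous_on {0..1} (s r)"
  shows "tower k L sz (\<lambda>r u z. \<Sum>i\<le>r. s i u * T (r - i) u z)"
  unfolding tower_def
proof (intro conjI allI impI ballI)
  fix r assume "r \<le> k"
  then show "weighted_cont (wt sz (L - r)) (\<lambda>u z. \<Sum>i\<le>r. s i u * T (r - i) u z)"
    by (intro weighted_cont_sum weighted_cont_scale c) (auto intro!: weighted_cont_mono[OF tower_weighted_cont[OF T]] wt_mono)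
next
  fix r :: nat and u :: real and z assume r: "r < k" and u: "u \<in> {0..1}"
  \<comment> \<open>Leibniz's identity is read off from formal power series: coefficient
    \<open>r\<close> of the derivative of \<open>f * g\<close> is \<open>r + 1\<close> times the
    convolution of order \<open>r + 1\<close>, and the product rule for series splits it into the
    two sums wanted.\<close>
  define f where "f = Abs_fps (\<lambda>i. s i u)"
  define g where "g = Abs_fps (\<lambda>i. T i u z)"
  have "real (Suc r) * (\<Sum>i\<le>Suc r. s i u * T (Suc r - i) u z) = fps_nth (fps_deriv (f * g)) r"
    by (simp add: f_def g_def fps_mult_nth atLeast0AtMost del: sum.atMost_Suc fps_deriv_mult)
  also have "\<dots> = fps_nth (f * fps_deriv g + fps_deriv f * g) r"
    by (simp only: fps_deriv_mult)
  also have "\<dots> = (\<Sum>i\<le>r. s i u * (real (Suc (r - i)) * T (Suc (r - i)) u z) + (real (Suc i) * s (Suc i) u) * T (r - i) u z)"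
    unfolding fps_add_nth fps_mult_nth sum.distrib[symmetric] f_def g_def atLeast0AtMost
    by (intro sum.cong) auto
  finally have eq: "real (Suc r) * (\<Sum>i\<le>Suc r. s i u * T (Suc r - i) u z) = \<dots>" .
  show "((\<lambda>v. \<Sum>i\<le>r. s i v * T (r - i) v z) has_real_derivative real (Suc r) * (\<Sum>i\<le>Suc r. s i u * T (Suc r - i) u z)) (at u within {0..1})"
    unfolding eq
  proof (rule DERIV_sum)
    fix i assume i: "i \<in> {..r}"
    have "((\<lambda>v. s i v * T (r - i) v z) has_real_derivative
        (real (Suc i) * s (Suc i) u) * T (r - i) u z + (real (Suc (r - i)) * T (Suc (r - i)) u z) * s i u) (at u within {0..1})"
      using i r by (intro DERIV_mult' tower_deriv[OF T] s u DERIV_mult) auto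
    then show "((\<lambda>v. s i v * T (r - i) v z) has_real_derivative
        s i u * (real (Suc (r - i)) * T (Suc (r - i)) u z) + real (Suc i) * s (Suc i) u * T (r - i) u z) (at u within {0..1})"
      by (simp add: algebra_simps)
  qed
qed

lemma kernel_app_split:
  assumes "integrable (count_space UNIV) (\<lambda>x. \<nu> x * K x z)" and S: "finite S"
  shows "kernel_app \<nu> K z = (\<Sum>x\<in>S. \<nu> x * K x z) + kernel_app (\<lambda>x. if x \<in> S then 0 else \<nu> x) K z"
proof -
  have fin: "integrable (count_space UNIV) (\<lambda>x. (if x \<in> S then \<nu> x else 0) * K x z)"
  proof (rule integrableI_bounded)
    have "(\<integral>\<^sup>+x. ennreal (norm ((if x \<in> S then \<nu> x else 0) * K x z)) \<partial>count_space UNIV) =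
        (\<Sum>x\<in>S. ennreal (norm ((if x \<in> S then \<nu> x else 0) * K x z)))"
      by (rule nn_integral_count_space'[OF S]) auto
    also have "\<dots> < \<infinity>" using S by (simp add: sum_ennreal)
    finally show "(\<integral>\<^sup>+x. ennreal (norm ((if x \<in> S then \<nu> x else 0) * K x z)) \<partial>count_space UNIV) < \<infinity>" .
  qed auto
  have "kernel_app (\<lambda>x. if x \<in> S then 0 else \<nu> x) K z = kernel_app (\<lambda>x. \<nu> x - (if x \<in> S then \<nu> x else 0)) K z"
    by (intro kernel_app_cong) auto
  also have "\<dots> = kernel_app \<nu> K z - kernel_app (\<lambda>x. if x \<in> S then \<nu> x else 0) K z"
    by (rule kernel_app_diff) (use assms fin in auto)
  also have "kernel_app (\<lambda>x. if x \<in> S then \<nu> x else 0) K z = (\<Sum>x\<in>S. \<nu> x * K x z)"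
    using S by (subst kernel_app_finite[where S = S]) auto
  finally show ?thesis by simp
qed

text \<open>Leibniz's rule for the law obtained by applying a kernel to a measure when both depend
  on \<open>u\<close>: \<open>i\<close> derivatives fall on the measure and \<open>r - i\<close> on
  the kernel.\<close>

definition tower_bind :: "(nat \<Rightarrow> real \<Rightarrow> 'a \<Rightarrow> real) \<Rightarrow> ('a \<Rightarrow> nat \<Rightarrow> real \<Rightarrow> 'b \<Rightarrow> real) \<Rightarrow> nat \<Rightarrow> real \<Rightarrow> 'b \<Rightarrow> real" where
  "tower_bind T G r u z = (\<Sum>i\<le>r. kernel_app (T i u) (\<lambda>x. G x (r - i) u) z)"

lemma integrable_kernel_app:
  fixes K :: "'a \<Rightarrow> 'b::countable \<Rightarrow> real"
  assumes "wnorm v \<nu> < \<infinity>" "\<And>z. 1 \<le> w z" "\<And>x. 0 \<le> v x" "0 \<le> C" "\<And>x. \<nu> x \<noteq> 0 \<Longrightarrow> wnorm w (K x) \<le> ennreal (C * v x)"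
  shows "integrable (count_space UNIV) (\<lambda>x. \<nu> x * K x z)"
proof (rule integrable_count_space_bound[where C = C and f = \<nu> and w = v])
  fix x
  show "\<bar>\<nu> x * K x z\<bar> \<le> C * (\<bar>\<nu> x\<bar> * v x)"
  proof (cases "\<nu> x = 0")
    case False
    have "ennreal \<bar>K x z\<bar> \<le> wnorm w (K x)" by (rule wnorm_point) fact
    also have "\<dots> \<le> ennreal (C * v x)" using assms False by auto
    finally have "\<bar>K x z\<bar> \<le> C * v x" using assms by (simp add: ennreal_le_iff)
    then have "\<bar>\<nu> x\<bar> * \<bar>K x z\<bar> \<le> \<bar>\<nu> x\<bar> * (C * v x)" by (rule mult_left_mono) auto
    then show ?thesis by (simp add: abs_mult mult_ac)
  qed auto
qed (use assms in auto)

lemma wnorm_tower_bind_le: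
  fixes G :: "'a \<Rightarrow> nat \<Rightarrow> real \<Rightarrow> 'b \<Rightarrow> real"
  assumes "0 \<le> C" "0 \<le> B"
    and T: "\<And>i. i \<le> r \<Longrightarrow> wnorm (wt sz (m + r - i)) (T i u) \<le> ennreal B"
    and G: "\<And>i x. i \<le> r \<Longrightarrow> wnorm (wt sz' m) (G x (r - i) u) \<le> ennreal (C * wt sz (m + r - i) x)"
  shows "wnorm (wt sz' m) (tower_bind T G r u) \<le> ennreal (real (Suc r) * C * B)"
proof -
  have "wnorm (wt sz' m) (tower_bind T G r u) \<le> (\<Sum>i\<le>r. wnorm (wt sz' m) (kernel_app (T i u) (\<lambda>x. G x (r - i) u)))"
    unfolding tower_bind_def by (rule wnorm_sum) auto
  also have "\<dots> \<le> (\<Sum>i\<le>r. ennreal C * wnorm (wt sz (m + r - i)) (T i u))"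
    by (intro sum_mono wnorm_kernel_app_le assms) auto
  also have "\<dots> \<le> (\<Sum>i\<le>r. ennreal C * ennreal B)"
    by (intro sum_mono mult_left_mono T) auto
  also have "\<dots> = ennreal (real (Suc r) * C * B)"
    using assms by (simp add: ennreal_mult ennreal_of_nat_eq_real_of_nat mult.assoc)
  finally show ?thesis .
qed

text \<open>Restricted to finitely many starting points \<open>x\<close>, the construction is a
  finite sum of scaled towers. The error comes from the tails of the measure, which are uniformly
  small in weight \<open>L - i\<close>, and a kernel differentiated \<open>r - i\<close> times maps
  this weight boundedly to weight \<open>L - r\<close>.\<close>

lemma tower_kernel:
  fixes T :: "nat \<Rightarrow> real \<Rightarrow> 'a::countable \<Rightarrow> real" and G :: "'a \<Rightarrow> nat \<Rightarrow> real \<Rightarrow> 'b::countable \<Rightarrow> real"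
  assumes kL: "k \<le> L" and T: "tower k L sz T" and G: "\<And>x. tower k L sz' (G x)" and C: "0 \<le> C"
    and bd: "\<And>x r m u. r \<le> k \<Longrightarrow> m + r \<le> L \<Longrightarrow> u \<in> {0..1} \<Longrightarrow>
      wnorm (wt sz' m) (G x r u) \<le> ennreal (C * wt sz (m + r) x)"
  shows "tower k L sz' (tower_bind T G)"
proof (rule tower_approx)
  fix e :: real assume e: "e > 0"
  \<comment> \<open>Shared among at most \<open>k + 1\<close> terms, each enlarged by the kernel
    bound; \<open>C + 1\<close> replaces \<open>C\<close> to allow for \<open>C = 0\<close>.\<close>
  define e' where "e' = e / (real (Suc k) * (C + 1))"
  have e': "e' > 0" using e C by (simp add: e'_def)
  have "\<exists>S. finite S \<and> (\<forall>u\<in>{0..1}. wnorm (wt sz (L - i)) (\<lambda>x. if x \<in> S then 0 else T i u x) \<le> ennreal e')" if "i \<le> k" for i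
    using tower_weighted_cont[OF T that] e' unfolding weighted_cont_def by blast
  then obtain S where S: "\<And>i. i \<le> k \<Longrightarrow> finite (S i)"
    "\<And>i u. i \<le> k \<Longrightarrow> u \<in> {0..1} \<Longrightarrow> wnorm (wt sz (L - i)) (\<lambda>x. if x \<in> S i then 0 else T i u x) \<le> ennreal e'"
    by metis
  define A where "A = (\<Union>i\<le>k. S i)"
  have A: "finite A" using S(1) by (auto simp: A_def)
  define T' where "T' r u z = (\<Sum>x\<in>A. \<Sum>i\<le>r. T i u x * G x (r - i) u z)" for r u z
  have "tower k L sz' T'"
    unfolding T'_def
    by (intro tower_sum tower_scale G tower_deriv[OF T] weighted_cont_continuous[OF tower_weighted_cont[OF T]])
  moreover have "wnorm (wt sz' (L - r)) (\<lambda>z. tower_bind T G r u z - T' r u z) \<le> ennreal e"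
    if r: "r \<le> k" and u: "u \<in> {0..1}" for r u
  proof -
    obtain B where B: "\<And>r u. r \<le> k \<Longrightarrow> u \<in> {0..1} \<Longrightarrow> wnorm (wt sz (L - r)) (T r u) \<le> ennreal B"
      by (rule tower_bounded[OF T]) blast
    have bd': "wnorm (wt sz' (L - r)) (G x (r - i) u) \<le> ennreal (C * wt sz (L - i) x)" if "i \<le> r" for i x
    proof -
      have "L - r + (r - i) = L - i" using that r kL by auto
      then show ?thesis using bd[of "r - i" "L - r" u x] that r kL u by auto
    qed
    have eq: "tower_bind T G r u z - T' r u z =
        (\<Sum>i\<le>r. kernel_app (\<lambda>x. if x \<in> A then 0 else T i u x) (\<lambda>x. G x (r - i) u) z)" for z
    proof -
      have "T' r u z = (\<Sum>i\<le>r. \<Sum>x\<in>A. T i u x * G x (r - i) u z)"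
        unfolding T'_def by (rule sum.swap)
      moreover have "kernel_app (T i u) (\<lambda>x. G x (r - i) u) z = (\<Sum>x\<in>A. T i u x * G x (r - i) u z) +
          kernel_app (\<lambda>x. if x \<in> A then 0 else T i u x) (\<lambda>x. G x (r - i) u) z" if "i \<le> r" for i
      proof (rule kernel_app_split[OF _ A])
        show "integrable (count_space UNIV) (\<lambda>x. T i u x * G x (r - i) u z)"
          using that r u B[of i u] bd'[OF that]
          by (intro integrable_kernel_app[where v = "wt sz (L - i)" and C = C and w = "wt sz' (L - r)"] C)
             (auto intro: le_less_trans)
      qed
      ultimately show ?thesis
        unfolding tower_bind_def by (simp add: sum.distrib)
    qed
    have "wnorm (wt sz' (L - r)) (\<lambda>z. tower_bind T G r u z - T' r u z) \<le>
        (\<Sum>i\<le>r. wnorm (wt sz' (L - r)) (kernel_app (\<lambda>x. if x \<in> A then 0 else T i u x) (\<lambda>x. G x (r - i) u)))"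
      unfolding eq by (rule wnorm_sum) auto
    also have "\<dots> \<le> (\<Sum>i\<le>r. ennreal C * wnorm (wt sz (L - i)) (\<lambda>x. if x \<in> A then 0 else T i u x))"
      by (intro sum_mono wnorm_kernel_app_le C bd') auto
    also have "\<dots> \<le> (\<Sum>i\<le>r. ennreal C * ennreal e')"
    proof (intro sum_mono mult_left_mono)
      fix i assume i: "i \<in> {..r}"
      have "wnorm (wt sz (L - i)) (\<lambda>x. if x \<in> A then 0 else T i u x) \<le> wnorm (wt sz (L - i)) (\<lambda>x. if x \<in> S i then 0 else T i u x)"
        using i r by (intro wnorm_mono_abs) (auto simp: A_def)
      also have "\<dots> \<le> ennreal e'" using S(2) i r u by auto
      finally show "wnorm (wt sz (L - i)) (\<lambda>x. if x \<in> A then 0 else T i u x) \<le> ennreal e'" .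
    qed auto
    also have "\<dots> = ennreal (real (Suc r) * (C * e'))"
      using C e' by (simp add: ennreal_mult ennreal_of_nat_eq_real_of_nat mult.assoc)
    also have "\<dots> \<le> ennreal e"
    proof (rule ennreal_leI)
      have "real (Suc r) * (C * e') \<le> real (Suc k) * ((C + 1) * e')"
        using r C e' by (intro mult_mono) auto
      also have "\<dots> = e" using C by (simp add: e'_def)
      finally show "real (Suc r) * (C * e') \<le> e" .
    qed
    finally show ?thesis .
  qed
  ultimately show "\<exists>T'. tower k L sz' T' \<and>
     (\<forall>r\<le>k. \<forall>u\<in>{0..1}. wnorm (wt sz' (L - r)) (\<lambda>z. tower_bind T G r u z - T' r u z) \<le> ennreal e)"
    by (intro exI[of _ T'] conjI allI impI ballI)
qed

definition tower_return :: "'a \<Rightarrow> nat \<Rightarrow> real \<Rightarrow> 'a \<Rightarrow> real" where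
  "tower_return a r u z = (if r = 0 \<and> z = a then 1 else 0)"

lemma tower_tower_return: "tower k L sz (tower_return a)"
  unfolding tower_def
proof (intro conjI allI impI ballI)
  fix r :: nat and u :: real and z
  show "((\<lambda>v. tower_return a r v z) has_real_derivative real (Suc r) * tower_return a (Suc r) u z) (at u within {0..1})"
    by (simp add: tower_return_def)
  show "weighted_cont (wt sz (L - r)) (tower_return a r)"
    by (rule weighted_cont_finite_support[where S = "{a}"]) (auto simp: tower_return_def)
qed

definition tower_map :: "('a \<Rightarrow> 'b) \<Rightarrow> (nat \<Rightarrow> real \<Rightarrow> 'a \<Rightarrow> real) \<Rightarrow> nat \<Rightarrow> real \<Rightarrow> 'b \<Rightarrow> real" where
  "tower_map h T r u z = kernel_app (T r u) (\<lambda>x z. if z = h x then 1 else 0) z"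

text \<open>An image measure is the action of a deterministic kernel that does not depend on
  \<open>u\<close>, so it is a case of \<open>tower_kernel\<close>. The constant comes from
  \<open>1 + c + s <= (1 + c) * (1 + s)\<close>, raised to a power of at most
  \<open>L\<close>.\<close>

lemma tower_tower_map:
  fixes T :: "nat \<Rightarrow> real \<Rightarrow> 'a::countable \<Rightarrow> real" and h :: "'a \<Rightarrow> 'b::countable"
  assumes kL: "k \<le> L" and T: "tower k L sz T" and h: "\<And>x. sz' (h x) \<le> c + sz x"
  shows "tower k L sz' (tower_map h T)"
proof -
  have "tower k L sz' (tower_bind T (\<lambda>x. tower_return (h x)))"
  proof (rule tower_kernel[OF kL T tower_tower_return, where C = "(1 + real c) ^ L"])
    fix x r m and u :: real assume "r \<le> k" "m + r \<le> L"
    show "wnorm (wt sz' m) (tower_return (h x) r u) \<le> ennreal ((1 + real c) ^ L * wt sz (m + r) x)"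
    proof (cases "r = 0")
      case True
      have "(1 + real (sz' (h x))) ^ m \<le> ((1 + real c) * (1 + real (sz x))) ^ m"
      proof (rule power_mono)
        have "real (sz' (h x)) \<le> real c + real (sz x)" using h[of x] by linarith
        moreover have "0 \<le> real c * real (sz x)" by simp
        ultimately show "1 + real (sz' (h x)) \<le> (1 + real c) * (1 + real (sz x))"
          unfolding distrib_left distrib_right by linarith
      qed auto
      also have "\<dots> \<le> (1 + real c) ^ L * wt sz m x"
        unfolding power_mult_distrib wt_def using \<open>m + r \<le> L\<close>
        by (intro mult_right_mono power_increasing) auto
      finally have "wt sz' m (h x) \<le> (1 + real c) ^ L * wt sz m x" by (simp add: wt_def)
      moreover have "tower_return (h x) r u = (\<lambda>z. if z = h x then 1 else 0)" using True by (auto simp: tower_return_def)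
      ultimately show ?thesis using True by (simp add: wnorm_delta ennreal_leI)
    next
      case False
      then have "tower_return (h x) r u = (\<lambda>z. 0)" by (auto simp: tower_return_def)
      then show ?thesis by simp
    qed
  qed auto
  moreover have "tower_bind T (\<lambda>x. tower_return (h x)) = tower_map h T"
  proof (intro ext)
    fix r u z
    \<comment> \<open>The kernel has no derivatives of positive order, so only the summand
      \<open>i = r\<close> remains.\<close>
    have "tower_bind T (\<lambda>x. tower_return (h x)) r u z = (\<Sum>i\<le>r. if i = r then tower_map h T r u z else 0)"
      unfolding tower_bind_def tower_map_def by (intro sum.cong) (auto simp: tower_return_def kernel_app_def)
    then show "tower_bind T (\<lambda>x. tower_return (h x)) r u z = tower_map h T r u z" by (simp add: sum.delta)
  qed
  ultimately show ?thesis by simp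
qed

lemma tower_map_inj: "inj h \<Longrightarrow> tower_map h T r u (h x) = T r u x"
  unfolding tower_map_def by (subst kernel_app_finite[where S = "{x}"]) (auto simp: inj_def)

lemma tower_map_notin: "z \<notin> range h \<Longrightarrow> tower_map h T r u z = 0"
  unfolding tower_map_def by (subst kernel_app_finite[where S = "{}"]) auto

lemma wnorm_tower_map:
  assumes "\<And>z. 0 \<le> w z"
  shows "wnorm w (tower_map h T r u) \<le> wnorm (\<lambda>x. w (h x)) (T r u)"
proof -
  have "wnorm w (tower_map h T r u) \<le> (\<integral>\<^sup>+x. ennreal \<bar>T r u x\<bar> * wnorm w (\<lambda>z. if z = h x then 1 else 0) \<partial>count_space UNIV)"
    unfolding tower_map_def by (rule wnorm_kernel_app) fact
  also have "\<dots> = wnorm (\<lambda>x. w (h x)) (T r u)"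
    unfolding wnorm_def[of "\<lambda>x. w (h x)"] using assms
    by (intro nn_integral_cong) (auto simp: wnorm_delta ennreal_mult)
  finally show ?thesis .
qed

section \<open>Total mass, increments and derivatives in norm\<close>

lemma deriv_unique01:
  assumes "(f has_real_derivative a) (at u within {0..1})" "(f has_real_derivative b) (at u within {0..1})" "u \<in> {0..1}"
  shows "a = b"
proof -
  have 1: "(f has_vector_derivative a) (at u within {0..1})" "(f has_vector_derivative b) (at u within {0..1})"
    by (rule has_real_derivative_iff_has_vector_derivative[THEN iffD1, OF assms(1)],
        rule has_real_derivative_iff_has_vector_derivative[THEN iffD1, OF assms(2)])
  have "at u within {0..1} \<noteq> bot"
    using assms(3) by (auto simp: trivial_limit_within intro!: islimpt_Icc)
  then show ?thesis using 1 by (rule vector_derivative_unique_within)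
qed

text \<open>The image under the map to a one-point space is again a tower, and its levels are the
  total masses of the levels of \<open>T\<close>. The mass of level 0 is constant, so all further
  ones vanish. This is what makes the derivatives of laws centred, hence subject to
  contraction.\<close>

lemma tower_mass:
  fixes T :: "nat \<Rightarrow> real \<Rightarrow> 'a::countable \<Rightarrow> real"
  assumes kL: "k \<le> L" and T: "tower k L sz T" and one: "\<And>u. u \<in> {0..1} \<Longrightarrow> (\<integral>x. T 0 u x \<partial>count_space UNIV) = 1"
    and r: "0 < r" "r \<le> k" and u: "u \<in> {0..1}"
  shows "(\<integral>x. T r u x \<partial>count_space UNIV) = 0"
proof -
  let ?m = "\<lambda>r u. (\<integral>x. T r u x \<partial>count_space UNIV)"
  have P: "tower k L (\<lambda>_. 0) (tower_map (\<lambda>_. ()) T)"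
    by (rule tower_tower_map[OF kL T, where c = 0]) auto
  have eq: "tower_map (\<lambda>_. ()) T r u () = ?m r u" for r u
    by (simp add: tower_map_def kernel_app_def)
  have der: "(?m r has_real_derivative real (Suc r) * ?m (Suc r) u) (at u within {0..1})" if "r < k" "u \<in> {0..1}" for r u
    using tower_deriv[OF P that, of "()"] by (simp only: eq)
  have "\<forall>u\<in>{0..1}. ?m (Suc r) u = 0" if "Suc r \<le> k" for r
    using that
  proof (induction r)
    case 0
    show ?case
    proof
      fix u :: real assume u: "u \<in> {0..1}"
      have "(?m 0 has_real_derivative 0) (at u within {0..1})"
        by (rule has_field_derivative_transform_within[where d = 1 and f = "\<lambda>_. 1"]) (use u one in auto)
      from deriv_unique01[OF der[OF _ u] this u] 0 show "?m (Suc 0) u = 0" by auto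
    qed
  next
    case (Suc r)
    show ?case
    proof
      fix u :: real assume u: "u \<in> {0..1}"
      have "(?m (Suc r) has_real_derivative 0) (at u within {0..1})"
        by (rule has_field_derivative_transform_within[where d = 1 and f = "\<lambda>_. 0"]) (use u Suc in auto)
      from deriv_unique01[OF der[OF _ u] this u] Suc.prems show "?m (Suc (Suc r)) u = 0" by auto
    qed
  qed
  then show ?thesis using r u by (cases r) auto
qed

text \<open>The mean value inequality in the weighted norm, obtained from the scalar one by duality.
  The bound on the derivative is required only between \<open>a\<close> and \<open>b\<close>, so
  that the lemma also applies on short intervals.\<close>

lemma wnorm_diff_le_deriv:
  fixes F :: "real \<Rightarrow> 'a::countable \<Rightarrow> real"
  assumes F: "\<And>u z. u \<in> {0..1} \<Longrightarrow> ((\<lambda>v. F v z) has_real_derivative F' u z) (at u within {0..1})"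
    and B: "\<And>u. u \<in> closed_segment a b \<Longrightarrow> wnorm w (F' u) \<le> ennreal B"
    and ab: "a \<in> {0..1}" "b \<in> {0..1}" and "0 \<le> B" and w: "\<And>z. 0 \<le> w z"
  shows "wnorm w (\<lambda>z. F b z - F a z) \<le> ennreal (B * \<bar>b - a\<bar>)"
proof (rule wnorm_leI[OF w])
  fix S :: "'a set" assume S: "finite S"
  \<comment> \<open>The test function that norms the increment from \<open>a\<close> to
    \<open>b\<close>: it turns the norm on the finite set \<open>S\<close> into one scalar function
    of \<open>u\<close>.\<close>
  define c where "c z = sgn (F b z - F a z) * w z" for z
  have sub: "closed_segment a b \<subseteq> {0..1}"
    using ab by (auto simp: closed_segment_eq_real_ivl split: if_splits)
  have "norm ((\<Sum>z\<in>S. c z * F b z) - (\<Sum>z\<in>S. c z * F a z)) \<le> B * norm (b - a)"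
  proof (rule field_differentiable_bound[where S = "closed_segment a b" and f = "\<lambda>v. \<Sum>z\<in>S. c z * F v z"
        and f' = "\<lambda>v. \<Sum>z\<in>S. c z * F' v z"])
    fix v assume v: "v \<in> closed_segment a b"
    have "((\<lambda>v. \<Sum>z\<in>S. c z * F v z) has_real_derivative (\<Sum>z\<in>S. c z * F' v z)) (at v within {0..1})"
      using v sub by (intro DERIV_sum DERIV_cmult F) auto
    then show "((\<lambda>v. \<Sum>z\<in>S. c z * F v z) has_real_derivative (\<Sum>z\<in>S. c z * F' v z)) (at v within closed_segment a b)"
      using sub by (rule DERIV_subset)
    have "ennreal (\<Sum>z\<in>S. \<bar>F' v z\<bar> * w z) \<le> ennreal B"
      using sum_le_wnorm[OF S w, of "F' v"] B[OF v] by (rule order_trans)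
    then have "(\<Sum>z\<in>S. \<bar>F' v z\<bar> * w z) \<le> B" using \<open>0 \<le> B\<close> by (simp add: ennreal_le_iff)
    moreover have "norm (\<Sum>z\<in>S. c z * F' v z) \<le> (\<Sum>z\<in>S. \<bar>F' v z\<bar> * w z)"
    proof (rule order_trans[OF norm_sum], rule sum_mono)
      fix z
      have "\<bar>sgn (F b z - F a z)\<bar> \<le> 1" by (auto simp: sgn_if)
      then have "\<bar>sgn (F b z - F a z)\<bar> * (\<bar>F' v z\<bar> * w z) \<le> 1 * (\<bar>F' v z\<bar> * w z)"
        using w by (intro mult_right_mono) auto
      then show "norm (c z * F' v z) \<le> \<bar>F' v z\<bar> * w z"
        using w[of z] by (simp add: c_def abs_mult mult_ac)
    qed
    ultimately show "norm (\<Sum>z\<in>S. c z * F' v z) \<le> B" by linarith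
  qed auto
  moreover have "(\<Sum>z\<in>S. c z * F b z) - (\<Sum>z\<in>S. c z * F a z) = (\<Sum>z\<in>S. \<bar>F b z - F a z\<bar> * w z)"
    unfolding sum_subtractf[symmetric] right_diff_distrib[symmetric] c_def
    by (intro sum.cong refl) (simp add: sgn_if abs_if)
  ultimately show "(\<Sum>z\<in>S. \<bar>F b z - F a z\<bar> * w z) \<le> B * \<bar>b - a\<bar>" by simp
qed

text \<open>The two tails outside \<open>S\<close> cost \<open>e/4\<close> each, and on the finite
  set \<open>S\<close> continuity of the coordinates is continuity in norm.\<close>

lemma weighted_cont_wnorm_continuous:
  fixes F :: "real \<Rightarrow> 'a::countable \<Rightarrow> real"
  assumes F: "weighted_cont w F" and w: "\<And>z. 0 \<le> w z" and u: "u \<in> {0..1}" and e: "e > 0"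
  obtains d where "d > 0" "\<And>v. v \<in> {0..1} \<Longrightarrow> \<bar>v - u\<bar> < d \<Longrightarrow> wnorm w (\<lambda>z. F v z - F u z) \<le> ennreal e"
proof -
  obtain S where S: "finite S" "\<And>u. u \<in> {0..1} \<Longrightarrow> wnorm w (\<lambda>z. if z \<in> S then 0 else F u z) \<le> ennreal (e/4)"
    using weighted_cont_tail[OF F, of "e/4"] e by auto
  have "continuous_on {0..1} (\<lambda>v. \<Sum>z\<in>S. \<bar>F v z - F u z\<bar> * w z)"
    by (intro continuous_intros weighted_cont_continuous[OF F])
  from this[unfolded continuous_on_iff, rule_format, OF u, of "e/4"] e
  obtain d where d: "d > 0" "\<And>v. v \<in> {0..1} \<Longrightarrow> dist v u < d \<Longrightarrow>
      dist (\<Sum>z\<in>S. \<bar>F v z - F u z\<bar> * w z) (\<Sum>z\<in>S. \<bar>F u z - F u z\<bar> * w z) < e/4"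
    by auto
  have "wnorm w (\<lambda>z. F v z - F u z) \<le> ennreal e" if v: "v \<in> {0..1}" "\<bar>v - u\<bar> < d" for v
  proof -
    have "\<bar>\<Sum>z\<in>S. \<bar>F v z - F u z\<bar> * w z\<bar> < e / 4"
      using d(2)[of v] v by (simp add: dist_real_def)
    then have small: "(\<Sum>z\<in>S. \<bar>F v z - F u z\<bar> * w z) \<le> e/4" by linarith
    have "wnorm w (\<lambda>z. F v z - F u z) \<le>
        wnorm w (\<lambda>z. (\<Sum>a\<in>S. if z = a then F v a - F u a else 0) + ((if z \<in> S then 0 else F v z) + - (if z \<in> S then 0 else F u z)))"
      using S(1) w by (intro wnorm_mono_abs) (auto simp: sum.delta)
    also have "\<dots> \<le> wnorm w (\<lambda>z. \<Sum>a\<in>S. if z = a then F v a - F u a else 0) +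
       (wnorm w (\<lambda>z. if z \<in> S then 0 else F v z) + wnorm w (\<lambda>z. - (if z \<in> S then 0 else F u z)))"
      by (intro order_trans[OF wnorm_add] add_left_mono wnorm_add w)
    also have "\<dots> \<le> (\<Sum>a\<in>S. wnorm w (\<lambda>z. if z = a then F v a - F u a else 0)) + (ennreal (e/4) + ennreal (e/4))"
      unfolding wnorm_uminus by (intro add_mono wnorm_sum w S u v)
    also have "(\<Sum>a\<in>S. wnorm w (\<lambda>z. if z = a then F v a - F u a else 0)) = ennreal (\<Sum>a\<in>S. \<bar>F v a - F u a\<bar> * w a)"
      using w by (simp add: wnorm_delta)
    also have "\<dots> + (ennreal (e/4) + ennreal (e/4)) \<le> ennreal (e/4) + (ennreal (e/4) + ennreal (e/4))"
      by (intro add_mono ennreal_leI small order_refl)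
    also have "\<dots> = ennreal (e/4 + (e/4 + e/4))" using e by (simp only: ennreal_plus)
    also have "\<dots> \<le> ennreal e" using e by (intro ennreal_leI) auto
    finally show ?thesis .
  qed
  with d(1) show ?thesis using that by blast
qed

text \<open>Differentiability of the coordinates becomes differentiability in norm. After
  subtraction of the linear part, the derivative is small in norm near \<open>u\<close> by norm
  continuity of level \<open>r + 1\<close>, and the mean value inequality applies on the segment
  from \<open>u\<close> to \<open>v\<close>.\<close>

lemma tower_wnorm_deriv:
  fixes T :: "nat \<Rightarrow> real \<Rightarrow> 'a::countable \<Rightarrow> real"
  assumes T: "tower k L sz T" and r: "r < k" and u: "u \<in> {0..1}" and e: "e > 0"
  obtains d where "d > 0" "\<And>v. v \<in> {0..1} \<Longrightarrow> v \<noteq> u \<Longrightarrow> \<bar>v - u\<bar> < d \<Longrightarrow>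
     wnorm (wt sz (L - Suc r)) (\<lambda>z. (T r v z - T r u z) / (v - u) - real (Suc r) * T (Suc r) u z) \<le> ennreal e"
proof -
  let ?w = "wt sz (L - Suc r)"
  have e': "e / real (Suc r) > 0" using e by simp
  obtain d where d: "d > 0" "\<And>v. v \<in> {0..1} \<Longrightarrow> \<bar>v - u\<bar> < d \<Longrightarrow> wnorm ?w (\<lambda>z. T (Suc r) v z - T (Suc r) u z) \<le> ennreal (e / real (Suc r))"
    by (rule weighted_cont_wnorm_continuous[OF tower_weighted_cont[OF T] wt_nonneg u e', of "Suc r"]) (use r in auto)
  have "wnorm ?w (\<lambda>z. (T r v z - T r u z) / (v - u) - real (Suc r) * T (Suc r) u z) \<le> ennreal e"
    if v: "v \<in> {0..1}" "v \<noteq> u" "\<bar>v - u\<bar> < d" for v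
  proof -
    define F where "F t z = T r t z - t * (real (Suc r) * T (Suc r) u z)" for t z
    define F' where "F' t z = real (Suc r) * (T (Suc r) t z - T (Suc r) u z)" for t z
    have "wnorm ?w (\<lambda>z. F v z - F u z) \<le> ennreal (e * \<bar>v - u\<bar>)"
    proof (rule wnorm_diff_le_deriv[where F' = F'])
      fix t z assume t: "t \<in> {0..1::real}"
      have "((\<lambda>t. T r t z - t * (real (Suc r) * T (Suc r) u z)) has_real_derivative
          real (Suc r) * T (Suc r) t z - 1 * (real (Suc r) * T (Suc r) u z)) (at t within {0..1})"
        by (intro DERIV_diff tower_deriv[OF T r t] DERIV_cmult_right DERIV_ident)
      then show "((\<lambda>v. F v z) has_real_derivative F' t z) (at t within {0..1})"
        unfolding F_def F'_def by (simp add: right_diff_distrib)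
    next
      fix t assume t: "t \<in> closed_segment u v"
      then have "t \<in> {0..1}" "\<bar>t - u\<bar> < d"
        using u v by (auto simp: closed_segment_eq_real_ivl split: if_splits)
      then have "wnorm ?w (\<lambda>z. T (Suc r) t z - T (Suc r) u z) \<le> ennreal (e / real (Suc r))" by (rule d)
      then have "ennreal (real (Suc r)) * wnorm ?w (\<lambda>z. T (Suc r) t z - T (Suc r) u z) \<le> ennreal (real (Suc r)) * ennreal (e / real (Suc r))"
        by (intro mult_left_mono) auto
      also have "\<dots> = ennreal e" using e by (subst ennreal_mult[symmetric]) auto
      finally show "wnorm ?w (F' t) \<le> ennreal e"
        unfolding F'_def wnorm_cmult by (simp only: abs_of_nat)
    qed (use u v e in auto)
    then have "ennreal (1 / \<bar>v - u\<bar>) * wnorm ?w (\<lambda>z. F v z - F u z) \<le> ennreal (1 / \<bar>v - u\<bar>) * ennreal (e * \<bar>v - u\<bar>)"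
      by (intro mult_left_mono) auto
    also have "\<dots> = ennreal e" using v e by (simp flip: ennreal_mult)
    also have "ennreal (1 / \<bar>v - u\<bar>) * wnorm ?w (\<lambda>z. F v z - F u z) = wnorm ?w (\<lambda>z. 1 / (v - u) * (F v z - F u z))"
      by (subst wnorm_cmult) simp
    also have "(\<lambda>z. 1 / (v - u) * (F v z - F u z)) = (\<lambda>z. (T r v z - T r u z) / (v - u) - real (Suc r) * T (Suc r) u z)"
      using v(2) unfolding F_def by (intro ext) (simp add: field_simps)
    finally show ?thesis .
  qed
  with d(1) show ?thesis using that by blast
qed

text \<open>Completeness in the form needed, with a rate: the limit is taken in each coordinate, and
  the bounds on finite partial sums, being uniform in the number of further steps, pass to
  it.\<close>

lemma wnorm_geometric_limit:
  fixes f :: "nat \<Rightarrow> 'a::countable \<Rightarrow> real"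
  assumes f: "\<And>n. wnorm w (\<lambda>z. f (Suc n) z - f n z) \<le> ennreal (C * q ^ n)"
    and q: "0 \<le> q" "q < 1" and C: "0 \<le> C" and w: "\<And>z. 1 \<le> w z"
  shows "(\<lambda>n. f n z) \<longlonglongrightarrow> lim (\<lambda>n. f n z)"
    and "wnorm w (\<lambda>z. lim (\<lambda>n. f n z) - f n z) \<le> ennreal (C * q ^ n / (1 - q))"
proof -
  have w0: "0 \<le> w z" for z using w[of z] by linarith
  have pt: "\<bar>f (Suc n) z - f n z\<bar> \<le> C * q ^ n" for n z
  proof -
    have "ennreal \<bar>f (Suc n) z - f n z\<bar> \<le> ennreal (C * q ^ n)"
      using wnorm_point[of w "\<lambda>z. f (Suc n) z - f n z" z] w f[of n] by (auto intro: order_trans)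
    then show ?thesis using C q by (simp add: ennreal_le_iff)
  qed
  have conv: "(\<lambda>n. f n z) \<longlonglongrightarrow> lim (\<lambda>n. f n z)" for z
  proof -
    have "summable (\<lambda>n. f (Suc n) z - f n z)"
      by (rule summable_comparison_test'[where g = "\<lambda>n. C * q ^ n"])
         (use pt q in \<open>auto intro!: summable_mult summable_geometric\<close>)
    then have "convergent (\<lambda>n. f n z - f 0 z)"
      by (simp only: summable_iff_convergent sum_lessThan_telescope[of "\<lambda>n. f n z"])
    then have "convergent (\<lambda>n. f n z - f 0 z + f 0 z)" by (intro convergent_add convergent_const)
    then have "convergent (\<lambda>n. f n z)" by simp
    then show ?thesis by (simp add: convergent_LIMSEQ_iff)
  qed
  then show "(\<lambda>n. f n z) \<longlonglongrightarrow> lim (\<lambda>n. f n z)" .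
  show "wnorm w (\<lambda>z. lim (\<lambda>n. f n z) - f n z) \<le> ennreal (C * q ^ n / (1 - q))"
  proof (rule wnorm_leI[OF w0])
    fix S :: "'a set" assume S: "finite S"
    have part: "(\<Sum>z\<in>S. \<bar>f (n + N) z - f n z\<bar> * w z) \<le> C * q ^ n / (1 - q)" for N
    proof -
      have "wnorm w (\<lambda>z. f (n + N) z - f n z) \<le> ennreal (\<Sum>l<N. C * q ^ (n + l))" 
      proof (induction N)
        case (Suc N)
        have "wnorm w (\<lambda>z. f (n + Suc N) z - f n z) = wnorm w (\<lambda>z. (f (n + N) z - f n z) + (f (Suc (n + N)) z - f (n + N) z))"
          by (rule arg_cong[where f = "wnorm w"]) auto
        also have "\<dots> \<le> wnorm w (\<lambda>z. f (n + N) z - f n z) + wnorm w (\<lambda>z. f (Suc (n + N)) z - f (n + N) z)"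
          by (rule wnorm_add) (rule w0)
        also have "\<dots> \<le> ennreal (\<Sum>l<N. C * q ^ (n + l)) + ennreal (C * q ^ (n + N))"
          by (intro add_mono Suc f)
        also have "\<dots> = ennreal (\<Sum>l<Suc N. C * q ^ (n + l))"
          using C q by (subst ennreal_plus[symmetric]) (auto intro!: sum_nonneg)
        finally show ?case .
      qed auto
      then have "ennreal (\<Sum>z\<in>S. \<bar>f (n + N) z - f n z\<bar> * w z) \<le> ennreal (\<Sum>l<N. C * q ^ (n + l))"
        using sum_le_wnorm[OF S w0, of "\<lambda>z. f (n + N) z - f n z"] by (rule order_trans[rotated])
      then have "(\<Sum>z\<in>S. \<bar>f (n + N) z - f n z\<bar> * w z) \<le> (\<Sum>l<N. C * q ^ (n + l))"
        using C q by (subst (asm) ennreal_le_iff) (auto intro!: sum_nonneg)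
      also have "\<dots> = C * q ^ n * (\<Sum>l<N. q ^ l)"
        by (simp add: sum_distrib_left power_add mult.assoc)
      also have "\<dots> \<le> C * q ^ n * (1 / (1 - q))"
      proof (intro mult_left_mono)
        have "(\<Sum>l<N. q ^ l) = (1 - q ^ N) / (1 - q)" using q by (subst sum_gp_strict) auto
        also have "\<dots> \<le> 1 / (1 - q)" using q by (intro divide_right_mono) auto
        finally show "(\<Sum>l<N. q ^ l) \<le> 1 / (1 - q)" .
      qed (use C q in auto)
      finally show ?thesis by simp
    qed
    have "(\<lambda>N. \<Sum>z\<in>S. \<bar>f (n + N) z - f n z\<bar> * w z) \<longlonglongrightarrow> (\<Sum>z\<in>S. \<bar>lim (\<lambda>n. f n z) - f n z\<bar> * w z)"
      using conv by (intro tendsto_intros) (subst add.commute, rule LIMSEQ_ignore_initial_segment)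
    then show "(\<Sum>z\<in>S. \<bar>lim (\<lambda>n. f n z) - f n z\<bar> * w z) \<le> C * q ^ n / (1 - q)"
      by (rule LIMSEQ_le_const2) (use part in auto)
  qed
qed

section \<open>Taylor jets and convolution\<close>

text \<open>The coefficient of index \<open>r\<close> of a jet is a \<open>r\<close>-th derivative divided by \<open>r!\<close>, itself stored as the
  generating function of a sequence; convolution and Leibniz's rule are then the product of
  \<open>real fps fps\<close>.\<close>

definition jet_tower :: "(real \<Rightarrow> real fps fps) \<Rightarrow> nat \<Rightarrow> real \<Rightarrow> nat \<Rightarrow> real" where
  "jet_tower J r u y = fps_nth (fps_nth (J u) r) y"

lemma fps_mult_nth_nth:
  fixes f g :: "real fps fps"
  shows "fps_nth (fps_nth (f * g) r) y =
    (\<Sum>i\<le>r. \<Sum>a\<le>y. fps_nth (fps_nth f i) a * fps_nth (fps_nth g (r - i)) (y - a))"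
  by (simp add: fps_mult_nth fps_sum_nth atLeast0AtMost)

lemma tower_map_plus: "tower_map ((+) a) T r u y = (if a \<le> y then T r u (y - a) else 0)" for a y :: nat
proof (cases "a \<le> y")
  case True
  then have "tower_map ((+) a) T r u (a + (y - a)) = T r u (y - a)" by (intro tower_map_inj) auto
  then show ?thesis using True by simp
next
  case False
  then have "y \<notin> range ((+) a)" by auto
  then show ?thesis using False by (simp add: tower_map_notin)
qed

lemma kernel_app_tower_map_plus:
  "kernel_app \<nu> (\<lambda>a. tower_map ((+) a) T r u) y = (\<Sum>a\<le>y. \<nu> a * T r u (y - a))" for y :: nat
proof -
  have "kernel_app \<nu> (\<lambda>a. tower_map ((+) a) T r u) y = (\<Sum>a\<le>y. \<nu> a * tower_map ((+) a) T r u y)"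
    by (rule kernel_app_finite) (auto simp: tower_map_plus)
  then show ?thesis by (simp add: tower_map_plus)
qed

text \<open>Convolution is the action of the kernel that sends \<open>a\<close> to the second law
  translated by \<open>a\<close>. The weight is submultiplicative,
  \<open>1 + a + b <= (1 + a) * (1 + b)\<close>, so the translates satisfy the bound that
  \<open>tower_kernel\<close> asks for.\<close>

lemma tower_jet_mult:
  assumes kL: "k \<le> L" and J: "tower k L (\<lambda>y. y) (jet_tower J)" and H: "tower k L (\<lambda>y. y) (jet_tower H)"
  shows "tower k L (\<lambda>y. y) (jet_tower (\<lambda>u. J u * H u))"
proof -
  obtain C where C: "0 \<le> C" "\<And>r u. r \<le> k \<Longrightarrow> u \<in> {0..1} \<Longrightarrow> wnorm (wt (\<lambda>y. y) (L - r)) (jet_tower H r u) \<le> ennreal C"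
    using tower_bounded[OF H] by blast
  have "tower k L (\<lambda>y. y) (tower_bind (jet_tower J) (\<lambda>a. tower_map ((+) a) (jet_tower H)))"
  proof (rule tower_kernel[OF kL J _ C(1)])
    show "tower k L (\<lambda>y. y) (tower_map ((+) a) (jet_tower H))" for a
      by (rule tower_tower_map[OF kL H, of _ _ a]) auto
  next
    fix a r m :: nat and u :: real assume *: "r \<le> k" "m + r \<le> L" "u \<in> {0..1}"
    have "wnorm (wt (\<lambda>y. y) m) (tower_map ((+) a) (jet_tower H) r u) \<le> wnorm (\<lambda>b. wt (\<lambda>y. y) m (a + b)) (jet_tower H r u)"
      by (rule wnorm_tower_map) auto
    also have "\<dots> \<le> wnorm (wt (\<lambda>y. y) (L - r)) (\<lambda>b. wt (\<lambda>y. y) (m + r) a * jet_tower H r u b)"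
    proof (rule wnorm_mono)
      fix b
      have "wt (\<lambda>y. y) m (a + b) \<le> ((1 + real a) * (1 + real b)) ^ m"
        unfolding wt_def by (intro power_mono) (auto simp: algebra_simps)
      also have "\<dots> = wt (\<lambda>y. y) m a * wt (\<lambda>y. y) m b" by (simp add: wt_def power_mult_distrib)
      also have "\<dots> \<le> wt (\<lambda>y. y) (m + r) a * wt (\<lambda>y. y) (L - r) b"
        using * by (intro mult_mono wt_mono) auto
      finally have "\<bar>jet_tower H r u b\<bar> * wt (\<lambda>y. y) m (a + b) \<le> \<bar>jet_tower H r u b\<bar> * (wt (\<lambda>y. y) (m + r) a * wt (\<lambda>y. y) (L - r) b)"
        by (rule mult_left_mono) auto
      then show "\<bar>jet_tower H r u b\<bar> * wt (\<lambda>y. y) m (a + b) \<le> \<bar>wt (\<lambda>y. y) (m + r) a * jet_tower H r u b\<bar> * wt (\<lambda>y. y) (L - r) b"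
        by (simp add: abs_mult mult_ac)
    qed
    also have "\<dots> \<le> ennreal (wt (\<lambda>y. y) (m + r) a) * ennreal C"
      unfolding wnorm_cmult using C(2)[OF *(1,3)] by (intro mult_mono) auto
    also have "\<dots> = ennreal (C * wt (\<lambda>y. y) (m + r) a)" using C(1) by (simp add: ennreal_mult mult.commute)
    finally show "wnorm (wt (\<lambda>y. y) m) (tower_map ((+) a) (jet_tower H) r u) \<le> ennreal (C * wt (\<lambda>y. y) (m + r) a)" .
  qed
  moreover have "tower_bind (jet_tower J) (\<lambda>a. tower_map ((+) a) (jet_tower H)) = jet_tower (\<lambda>u. J u * H u)"
    by (intro ext) (simp only: tower_bind_def kernel_app_tower_map_plus jet_tower_def fps_mult_nth_nth)
  ultimately show ?thesis by simp
qed

lemma tower_jet_one: "tower k L (\<lambda>y. y) (jet_tower (\<lambda>u. 1))"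
proof -
  have "jet_tower (\<lambda>u. 1) = tower_return 0" by (intro ext) (auto simp: jet_tower_def tower_return_def)
  then show ?thesis by (simp add: tower_tower_return)
qed

lemma tower_jet_power:
  assumes "k \<le> L" "tower k L (\<lambda>y. y) (jet_tower J)"
  shows "tower k L (\<lambda>y. y) (jet_tower (\<lambda>u. J u ^ n))"
proof (induction n)
  case (Suc n)
  then show ?case unfolding power_Suc by (intro tower_jet_mult assms)
qed (simp add: tower_jet_one)

lemma tower_jet_prod:
  fixes n :: nat
  assumes "k \<le> L" "\<And>i. i < n \<Longrightarrow> tower k L (\<lambda>y. y) (jet_tower (J i))"
  shows "tower k L (\<lambda>y. y) (jet_tower (\<lambda>u. \<Prod>i<n. J i u))"
  using assms(2)
proof (induction n)
  case (Suc n)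
  then have "tower k L (\<lambda>y. y) (jet_tower (\<lambda>u. (\<Prod>i<n. J i u) * J n u))"
    by (intro tower_jet_mult assms(1)) auto
  then show ?case by simp
qed (simp add: tower_jet_one)

section \<open>Moment bounds for products of many jets\<close>

definition vw :: "real \<Rightarrow> nat \<Rightarrow> nat \<Rightarrow> real" where
  "vw c m y = (c + real y) ^ m"

lemma vw_nonneg [simp]: "0 \<le> c \<Longrightarrow> 0 \<le> vw c m y"
  by (simp add: vw_def)

lemma wt_id: "wt (\<lambda>y. y) m = vw 1 m"
  by (simp add: wt_def vw_def fun_eq_iff)

lemma wnorm_vw0_le: "wnorm (vw 0 l) f \<le> wnorm (vw 1 l) f"
  by (intro wnorm_mono mult_left_mono) (auto simp: vw_def intro: power_mono)

text \<open>Binomial expansion of \<open>(a + (c + b)) ^ m\<close>. The offset \<open>c\<close> goes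
  entirely to the second factor, so the first one enters through pure moments and the term
  \<open>l = 0\<close> carries just its total mass.\<close>

lemma wnorm_fps_mult:
  fixes f g :: "real fps"
  assumes c: "0 \<le> c"
  shows "wnorm (vw c m) (fps_nth (f * g)) \<le>
    (\<Sum>l\<le>m. ennreal (real (m choose l)) * wnorm (vw 0 l) (fps_nth f) * wnorm (vw c (m - l)) (fps_nth g))"
proof -
  let ?T = "\<lambda>(r::nat) (u::real). fps_nth g"
  have "fps_nth (f * g) = kernel_app (fps_nth f) (\<lambda>a. tower_map ((+) a) ?T 0 0)"
    by (intro ext) (simp add: kernel_app_tower_map_plus fps_mult_nth atLeast0AtMost)
  then have "wnorm (vw c m) (fps_nth (f * g)) \<le>
      (\<integral>\<^sup>+a. ennreal \<bar>fps_nth f a\<bar> * wnorm (vw c m) (tower_map ((+) a) ?T 0 0) \<partial>count_space UNIV)"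
    using wnorm_kernel_app[of "vw c m" "fps_nth f"] c by simp
  also have "\<dots> \<le> (\<integral>\<^sup>+a. (\<Sum>l\<le>m. ennreal (real (m choose l)) * wnorm (vw c (m - l)) (fps_nth g) * ennreal (\<bar>fps_nth f a\<bar> * vw 0 l a)) \<partial>count_space UNIV)"
  proof (rule nn_integral_mono)
    fix a
    have "wnorm (vw c m) (tower_map ((+) a) ?T 0 0) \<le> wnorm (\<lambda>b. vw c m (a + b)) (fps_nth g)"
      using c by (intro wnorm_tower_map) auto
    also have "\<dots> = (\<integral>\<^sup>+b. (\<Sum>l\<le>m. ennreal (real (m choose l) * vw 0 l a) * ennreal (\<bar>fps_nth g b\<bar> * vw c (m - l) b)) \<partial>count_space UNIV)"
      unfolding wnorm_def
    proof (rule nn_integral_cong)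
      fix b
      have "vw c m (a + b) = (real a + (c + real b)) ^ m" by (simp add: vw_def add_ac)
      also have "\<dots> = (\<Sum>l\<le>m. real (m choose l) * vw 0 l a * vw c (m - l) b)"
        by (subst binomial_ring) (simp add: vw_def)
      finally have "\<bar>fps_nth g b\<bar> * vw c m (a + b) = (\<Sum>l\<le>m. real (m choose l) * vw 0 l a * (\<bar>fps_nth g b\<bar> * vw c (m - l) b))"
        by (simp add: sum_distrib_left mult_ac)
      then show "ennreal (\<bar>fps_nth g b\<bar> * vw c m (a + b)) = (\<Sum>l\<le>m. ennreal (real (m choose l) * vw 0 l a) * ennreal (\<bar>fps_nth g b\<bar> * vw c (m - l) b))"
        using c by (simp add: ennreal_mult[symmetric])
    qed
    also have "\<dots> = (\<Sum>l\<le>m. ennreal (real (m choose l) * vw 0 l a) * wnorm (vw c (m - l)) (fps_nth g))"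
      unfolding wnorm_def by (subst nn_integral_sum) (auto simp: nn_integral_cmult)
    finally have "ennreal \<bar>fps_nth f a\<bar> * wnorm (vw c m) (tower_map ((+) a) ?T 0 0) \<le>
        ennreal \<bar>fps_nth f a\<bar> * \<dots>" by (rule mult_left_mono) auto
    also have "\<dots> = (\<Sum>l\<le>m. ennreal (real (m choose l)) * wnorm (vw c (m - l)) (fps_nth g) * ennreal (\<bar>fps_nth f a\<bar> * vw 0 l a))"
      by (simp add: sum_distrib_left ennreal_mult mult_ac)
    finally show "ennreal \<bar>fps_nth f a\<bar> * wnorm (vw c m) (tower_map ((+) a) ?T 0 0) \<le> \<dots>" .
  qed
  also have "\<dots> = (\<Sum>l\<le>m. ennreal (real (m choose l)) * wnorm (vw c (m - l)) (fps_nth g) * wnorm (vw 0 l) (fps_nth f))"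
    unfolding wnorm_def[of "vw 0 _"] by (subst nn_integral_sum) (auto simp: nn_integral_cmult)
  finally show ?thesis by (simp add: mult_ac)
qed

text \<open>The induction step for sums of powers: when one factor is added to a product of
  \<open>x\<close> factors, an error of order \<open>x ^ s\<close> is absorbed by the growth of
  \<open>x ^ (s + 1)\<close>.\<close>

lemma power_Suc_add_le:
  fixes x :: real assumes "0 \<le> x"
  shows "x ^ Suc s + x ^ s \<le> (1 + x) ^ Suc s"
proof -
  have "x ^ Suc s + x ^ s = (1 + x) * x ^ s" by (simp add: algebra_simps)
  also have "\<dots> \<le> (1 + x) * (1 + x) ^ s" using assms by (intro mult_left_mono power_mono) auto
  finally show ?thesis by simp
qed

lemma wnorm_jet_mult_nth:
  fixes z P :: "real fps fps"
  shows "wnorm (vw 1 m) (fps_nth (fps_nth (z * P) r)) \<le> (\<Sum>i\<le>r. \<Sum>l\<le>m. ennreal (real (m choose l)) *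
      wnorm (vw 0 l) (fps_nth (fps_nth z i)) * wnorm (vw 1 (m - l)) (fps_nth (fps_nth P (r - i))))"
proof -
  have "fps_nth (fps_nth (z * P) r) = (\<lambda>y. \<Sum>i\<le>r. fps_nth (fps_nth z i * fps_nth P (r - i)) y)"
    by (simp add: fps_mult_nth[of z P] fps_sum_nth atLeast0AtMost fun_eq_iff)
  then have "wnorm (vw 1 m) (fps_nth (fps_nth (z * P) r)) \<le> (\<Sum>i\<le>r. wnorm (vw 1 m) (fps_nth (fps_nth z i * fps_nth P (r - i))))"
    using wnorm_sum[of "vw 1 m" "\<lambda>i. fps_nth (fps_nth z i * fps_nth P (r - i))" "{..r}"] by simp
  also have "\<dots> \<le> (\<Sum>i\<le>r. \<Sum>l\<le>m. ennreal (real (m choose l)) *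
      wnorm (vw 0 l) (fps_nth (fps_nth z i)) * wnorm (vw 1 (m - l)) (fps_nth (fps_nth P (r - i))))"
    by (intro sum_mono wnorm_fps_mult) auto
  finally show ?thesis .
qed

text \<open>Adding one factor at a time: since the factors have total mass at most 1, the top-order bound
  is carried over with constant 1 and only terms of lower order are added, which sum to the
  polynomial rate.\<close>

lemma jets_bound:
  fixes \<Z> :: "real fps fps set" and X :: "real fps fps"
  assumes B: "0 \<le> B"
    and Z0: "\<And>z. z \<in> \<Z> \<Longrightarrow> wnorm (vw 0 0) (fps_nth (fps_nth z 0)) \<le> 1"
    and Z: "\<And>z r m. z \<in> \<Z> \<Longrightarrow> r \<le> k \<Longrightarrow> m + r \<le> L \<Longrightarrow> wnorm (vw 1 m) (fps_nth (fps_nth z r)) \<le> ennreal B"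
    and X: "\<And>r m X. X \<in> \<X> \<Longrightarrow> r \<le> k \<Longrightarrow> m + r \<le> L \<Longrightarrow> wnorm (vw 1 m) (fps_nth (fps_nth X r)) \<le> ennreal B"
  obtains C where "0 \<le> C" "\<And>zs X m r. set zs \<subseteq> \<Z> \<Longrightarrow> X \<in> \<X> \<Longrightarrow> r \<le> k \<Longrightarrow> m + r \<le> L \<Longrightarrow>
     wnorm (vw 1 m) (fps_nth (fps_nth (prod_list zs * X) r)) \<le> ennreal (C * (1 + real (length zs)) ^ (m + r))"
proof -
  have "s \<le> L \<Longrightarrow> \<exists>C\<ge>0. \<forall>zs X m r. set zs \<subseteq> \<Z> \<longrightarrow> X \<in> \<X> \<longrightarrow> r \<le> k \<longrightarrow> m + r \<le> s \<longrightarrow>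
     wnorm (vw 1 m) (fps_nth (fps_nth (prod_list zs * X) r)) \<le> ennreal (C * (1 + real (length zs)) ^ (m + r))" for s
  proof (induction s)
    case 0
    have "wnorm (vw 1 0) (fps_nth (fps_nth (prod_list zs * X) 0)) \<le> ennreal B" if "set zs \<subseteq> \<Z>" "X \<in> \<X>" for zs X
      using that
    proof (induction zs)
      case Nil
      then show ?case using X[of X 0 0] by simp
    next
      case (Cons z zs)
      have "wnorm (vw 1 0) (fps_nth (fps_nth (z * (prod_list zs * X)) 0)) \<le>
          wnorm (vw 0 0) (fps_nth (fps_nth z 0)) * wnorm (vw 1 0) (fps_nth (fps_nth (prod_list zs * X) 0))"
        using wnorm_jet_mult_nth[of 0 z "prod_list zs * X" 0] by simp
      also have "\<dots> \<le> 1 * ennreal B"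
        using Cons by (intro mult_mono Z0) auto
      finally show ?case by (simp add: mult.assoc)
    qed
    then show ?case using B by (intro exI[of _ B]) auto
  next
    case (Suc s)
    then obtain C where C: "0 \<le> C" and IH: "\<And>zs X m r. set zs \<subseteq> \<Z> \<Longrightarrow> X \<in> \<X> \<Longrightarrow> r \<le> k \<Longrightarrow> m + r \<le> s \<Longrightarrow>
     wnorm (vw 1 m) (fps_nth (fps_nth (prod_list zs * X) r)) \<le> ennreal (C * (1 + real (length zs)) ^ (m + r))"
      by auto
    \<comment> \<open>With \<open>N = 1 + length zs\<close>, a term other than
      \<open>i = l = 0\<close> is at most \<open>D * N ^ s\<close>: the binomial coefficient is at
      most \<open>2 ^ L\<close>, the new factor at most \<open>B\<close>, and the remaining product
      has order at most \<open>s\<close>. \<open>K\<close> counts at most \<open>(L + 1) ^ 2\<close>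
      such terms. In \<open>C'\<close>, \<open>B\<close> covers the empty product and
      \<open>C\<close> the orders up to \<open>s\<close>.\<close>
    define D where "D = 2 ^ L * B * C"
    define K where "K = real (Suc L) * real (Suc L) * D"
    define C' where "C' = B + C + K"
    have D: "0 \<le> D" using B C by (simp add: D_def)
    have K: "0 \<le> K" using D by (simp add: K_def)
    have C': "0 \<le> C'" "B \<le> C'" "C \<le> C'" "K \<le> C'" using B C K by (auto simp: C'_def)
    have top: "wnorm (vw 1 m) (fps_nth (fps_nth (prod_list zs * X) r)) \<le> ennreal (C' * (1 + real (length zs)) ^ Suc s)"
      if "set zs \<subseteq> \<Z>" "X \<in> \<X>" "r \<le> k" "m + r = Suc s" for zs X m r
      using that(1)
    proof (induction zs)
      case Nil
      have "wnorm (vw 1 m) (fps_nth (fps_nth X r)) \<le> ennreal B" using that Suc.prems by (intro X) auto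
      also have "\<dots> \<le> ennreal C'" using C' by (intro ennreal_leI) auto
      finally show ?case by simp
    next
      case (Cons z zs)
      let ?N = "1 + real (length zs)"
      let ?P = "prod_list zs * X"
      have rm: "r \<le> L" "m \<le> L" using that(4) Suc.prems by auto
      have "wnorm (vw 1 m) (fps_nth (fps_nth (z * ?P) r)) \<le> (\<Sum>i\<le>r. \<Sum>l\<le>m. ennreal (real (m choose l)) *
          wnorm (vw 0 l) (fps_nth (fps_nth z i)) * wnorm (vw 1 (m - l)) (fps_nth (fps_nth ?P (r - i))))"
        by (rule wnorm_jet_mult_nth)
      also have "\<dots> \<le> (\<Sum>i\<le>r. \<Sum>l\<le>m. ennreal ((if i = 0 then if l = 0 then C' * ?N ^ Suc s else 0 else 0) + D * ?N ^ s))"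
      proof (intro sum_mono)
        fix i l assume il: "i \<in> {..r}" "l \<in> {..m}"
        show "ennreal (real (m choose l)) * wnorm (vw 0 l) (fps_nth (fps_nth z i)) * wnorm (vw 1 (m - l)) (fps_nth (fps_nth ?P (r - i)))
           \<le> ennreal ((if i = 0 then if l = 0 then C' * ?N ^ Suc s else 0 else 0) + D * ?N ^ s)"
        proof (cases "i = 0 \<and> l = 0")
          case True
          have "ennreal (real (m choose l)) * wnorm (vw 0 l) (fps_nth (fps_nth z i)) * wnorm (vw 1 (m - l)) (fps_nth (fps_nth ?P (r - i)))
             \<le> 1 * ennreal (C' * ?N ^ Suc s)"
            using True Cons Z0[of z] by (intro mult_mono) auto
          also have "\<dots> \<le> ennreal (C' * ?N ^ Suc s + D * ?N ^ s)"
            using D by (simp add: ennreal_leI)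
          finally show ?thesis using True by simp
        next
          case False
          have "real (m choose l) \<le> 2 ^ L"
          proof -
            have "m choose l \<le> 2 ^ m" by (rule binomial_le_pow2)
            also have "\<dots> \<le> 2 ^ L" using rm by (intro power_increasing) auto
            finally show ?thesis by (metis of_nat_le_iff of_nat_numeral of_nat_power)
          qed
          moreover have "wnorm (vw 0 l) (fps_nth (fps_nth z i)) \<le> ennreal B"
            using il Cons.prems that Suc.prems by (intro order_trans[OF wnorm_vw0_le Z]) auto
          moreover have "wnorm (vw 1 (m - l)) (fps_nth (fps_nth ?P (r - i))) \<le> ennreal (C * ?N ^ s)"
          proof -
            have "wnorm (vw 1 (m - l)) (fps_nth (fps_nth ?P (r - i))) \<le> ennreal (C * ?N ^ (m - l + (r - i)))"
              using False il that Cons.prems by (intro IH) auto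
            also have "\<dots> \<le> ennreal (C * ?N ^ s)"
              using False il that C by (intro ennreal_leI mult_left_mono power_increasing) auto
            finally show ?thesis .
          qed
          ultimately have "ennreal (real (m choose l)) * wnorm (vw 0 l) (fps_nth (fps_nth z i)) * wnorm (vw 1 (m - l)) (fps_nth (fps_nth ?P (r - i)))
             \<le> ennreal (2 ^ L) * ennreal B * ennreal (C * ?N ^ s)"
            by (intro mult_mono ennreal_leI) auto
          also have "\<dots> = ennreal (D * ?N ^ s)" using B C by (simp add: D_def ennreal_mult[symmetric] mult.assoc)
          finally show ?thesis using False by auto
        qed
      qed
      also have "\<dots> = ennreal (\<Sum>i\<le>r. \<Sum>l\<le>m. (if i = 0 then if l = 0 then C' * ?N ^ Suc s else 0 else 0) + D * ?N ^ s)"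
        using C' D by (subst sum_ennreal, simp add: sum_nonneg)+ (auto intro!: sum_nonneg sum_ennreal)
      also have "(\<Sum>i\<le>r. \<Sum>l\<le>m. (if i = 0 then if l = 0 then C' * ?N ^ Suc s else 0 else 0) + D * ?N ^ s) =
          C' * ?N ^ Suc s + real (Suc r) * real (Suc m) * D * ?N ^ s"
      proof -
        have "(\<Sum>l\<le>m. (if i = 0 then if l = 0 then C' * ?N ^ Suc s else 0 else 0) + D * ?N ^ s) =
            (if i = 0 then C' * ?N ^ Suc s else 0) + real (Suc m) * (D * ?N ^ s)" for i :: nat
          unfolding sum.distrib by (cases "i = 0") (auto simp: sum.delta)
        then have "(\<Sum>i\<le>r. \<Sum>l\<le>m. (if i = 0 then if l = 0 then C' * ?N ^ Suc s else 0 else 0) + D * ?N ^ s) =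
            (\<Sum>i\<le>r. (if i = 0 then C' * ?N ^ Suc s else 0) + real (Suc m) * (D * ?N ^ s))"
          by (simp only:)
        also have "\<dots> = C' * ?N ^ Suc s + real (Suc r) * real (Suc m) * D * ?N ^ s"
          unfolding sum.distrib by (simp add: sum.delta)
        finally show ?thesis .
      qed
      \<comment> \<open>The new terms are dominated by \<open>C' * ?N ^ s\<close>, which
        \<open>power_Suc_add_le\<close> absorbs into the passage from \<open>?N\<close> to
        \<open>1 + ?N\<close>.\<close>
      also have "\<dots> \<le> C' * ?N ^ Suc s + C' * ?N ^ s"
      proof (intro add_left_mono mult_right_mono)
        have "real (Suc r) * real (Suc m) * D \<le> K"
          unfolding K_def using rm D by (intro mult_mono) auto
        then show "real (Suc r) * real (Suc m) * D \<le> C'" using C' by linarith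
      qed auto
      also have "\<dots> = C' * (?N ^ Suc s + ?N ^ s)" by (simp only: distrib_left)
      also have "\<dots> \<le> C' * (1 + ?N) ^ Suc s"
        using C' by (intro mult_left_mono power_Suc_add_le) auto
      finally show ?case by (simp add: mult.assoc ennreal_leI add_ac)
    qed
    show ?case
    proof (intro exI[of _ C'] conjI allI impI C')
      fix zs X m r assume *: "set zs \<subseteq> \<Z>" "X \<in> \<X>" "r \<le> k" "m + r \<le> Suc s"
      show "wnorm (vw 1 m) (fps_nth (fps_nth (prod_list zs * X) r)) \<le> ennreal (C' * (1 + real (length zs)) ^ (m + r))"
      proof (cases "m + r = Suc s")
        case True
        then show ?thesis using top[OF *(1-3)] by simp
      next
        case False
        then have "wnorm (vw 1 m) (fps_nth (fps_nth (prod_list zs * X) r)) \<le> ennreal (C * (1 + real (length zs)) ^ (m + r))"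
          using * by (intro IH) auto
        also have "\<dots> \<le> ennreal (C' * (1 + real (length zs)) ^ (m + r))"
          using C' by (intro ennreal_leI mult_right_mono) auto
        finally show ?thesis .
      qed
    qed
  qed
  from this[of L] show ?thesis using that by auto
qed

section \<open>Moments of convolution products\<close>

lemma prod_list_fps_const: "prod_list (map fps_const zs) * fps_const X = fps_const (prod_list zs * X)"
  for X :: "real fps"
  by (induction zs) (auto simp: mult.assoc)

lemma power_add_mult_le:
  fixes x a :: real
  assumes "0 \<le> x" "0 \<le> a"
  shows "x ^ Suc d + real (Suc d) * a * x ^ d \<le> (x + a) ^ Suc d"
proof (induction d)
  case (Suc d)
  have "x ^ Suc (Suc d) + real (Suc (Suc d)) * a * x ^ Suc d \<le>
      (x ^ Suc d + real (Suc d) * a * x ^ d) * (x + a)"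
    using assms by (simp add: algebra_simps)
  also have "\<dots> \<le> (x + a) ^ Suc d * (x + a)"
    using assms by (intro mult_right_mono Suc) auto
  finally show ?case by (simp add: mult.commute)
qed (use assms in auto)

text \<open>The leading constant 1 in front of the power of the mean is what makes the moments contract in
  the subcritical case.\<close>

lemma sharp_moment:
  fixes \<Z> \<X> :: "real fps set" and a :: "real fps \<Rightarrow> real"
  assumes B: "0 \<le> B" and b: "0 \<le> b"
    and Z0: "\<And>z. z \<in> \<Z> \<Longrightarrow> wnorm (vw 0 0) (fps_nth z) \<le> 1"
    and Z1: "\<And>z. z \<in> \<Z> \<Longrightarrow> wnorm (vw 0 1) (fps_nth z) \<le> ennreal (a z)"
    and a: "\<And>z. z \<in> \<Z> \<Longrightarrow> 0 \<le> a z" "\<And>z. z \<in> \<Z> \<Longrightarrow> a z \<le> 1"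
    and Z: "\<And>z m. z \<in> \<Z> \<Longrightarrow> m \<le> L \<Longrightarrow> wnorm (vw 1 m) (fps_nth z) \<le> ennreal B"
    and X0: "\<And>X. X \<in> \<X> \<Longrightarrow> wnorm (vw 0 0) (fps_nth X) \<le> 1"
    and X1: "\<And>X. X \<in> \<X> \<Longrightarrow> wnorm (vw 0 1) (fps_nth X) \<le> ennreal b"
    and X: "\<And>X m. X \<in> \<X> \<Longrightarrow> m \<le> L \<Longrightarrow> wnorm (vw 1 m) (fps_nth X) \<le> ennreal B"
    and d: "1 \<le> d" "d \<le> L"
  shows "\<exists>K\<ge>0. \<forall>zs X. set zs \<subseteq> \<Z> \<longrightarrow> X \<in> \<X> \<longrightarrow> wnorm (vw 0 d) (fps_nth (prod_list zs * X)) \<le>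
     ennreal (sum_list (map a zs) ^ d + (if d = 1 then b else K * (1 + real (length zs)) ^ (d - 1)))"
  using d
proof (induction d rule: nat_induct_at_least)
  have mom0: "wnorm (vw 0 0) (fps_nth (prod_list zs * X)) \<le> 1" if "set zs \<subseteq> \<Z>" "X \<in> \<X>" for zs X
    using that(1)
  proof (induction zs)
    case Nil
    then show ?case using X0 that by simp
  next
    case (Cons z zs)
    have "wnorm (vw 0 0) (fps_nth (z * (prod_list zs * X))) \<le> wnorm (vw 0 0) (fps_nth z) * wnorm (vw 0 0) (fps_nth (prod_list zs * X))"
      using wnorm_fps_mult[of 0 0 z "prod_list zs * X"] by simp
    also have "\<dots> \<le> 1 * 1" using Cons Z0[of z] by (intro mult_mono) auto
    finally show ?case by (simp add: mult.assoc)
  qed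
  have asum: "0 \<le> sum_list (map a zs)" if "set zs \<subseteq> \<Z>" for zs
    using that by (intro sum_list_nonneg) (auto simp: a)
  {
    \<comment> \<open>The first moment is additive, so its remainder is exactly the mean bound
      \<open>b\<close> of the last factor. Keeping \<open>b\<close> rather than a general constant
      makes the remainder vanish when there is no immigration.\<close>
    case base
    have "wnorm (vw 0 1) (fps_nth (prod_list zs * X)) \<le> ennreal (sum_list (map a zs) + b)" if "set zs \<subseteq> \<Z>" "X \<in> \<X>" for zs X
      using that(1)
    proof (induction zs)
      case Nil
      then show ?case using X1 that by simp
    next
      case (Cons z zs)
      have "wnorm (vw 0 1) (fps_nth (z * (prod_list zs * X))) \<le>
          wnorm (vw 0 0) (fps_nth z) * wnorm (vw 0 1) (fps_nth (prod_list zs * X)) +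
          wnorm (vw 0 1) (fps_nth z) * wnorm (vw 0 0) (fps_nth (prod_list zs * X))"
        using wnorm_fps_mult[of 0 1 z "prod_list zs * X"] by simp
      also have "\<dots> \<le> 1 * ennreal (sum_list (map a zs) + b) + ennreal (a z) * 1"
        using Cons that by (intro add_mono mult_mono Z0 Z1 mom0) auto
      also have "\<dots> = ennreal (sum_list (map a (z # zs)) + b)"
        using asum[of zs] Cons.prems b a(1)[of z] by (simp flip: ennreal_plus add: add_ac)
      finally show ?case by (simp only: prod_list.Cons mult.assoc)
    qed
    then show ?case by (intro exI[of _ 0]) auto
  next
    case (Suc d)
    obtain K where K: "0 \<le> K" and IH: "\<And>zs X. set zs \<subseteq> \<Z> \<Longrightarrow> X \<in> \<X> \<Longrightarrow> wnorm (vw 0 d) (fps_nth (prod_list zs * X)) \<le>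
       ennreal (sum_list (map a zs) ^ d + K * (1 + real (length zs)) ^ (d - 1))"
    proof -
      obtain K where "0 \<le> K" and K: "\<And>zs X. set zs \<subseteq> \<Z> \<Longrightarrow> X \<in> \<X> \<Longrightarrow> wnorm (vw 0 d) (fps_nth (prod_list zs * X)) \<le>
         ennreal (sum_list (map a zs) ^ d + (if d = 1 then b else K * (1 + real (length zs)) ^ (d - 1)))"
        using Suc by auto
      show ?thesis
      proof (rule that[of "K + b"])
        fix zs X assume *: "set zs \<subseteq> \<Z>" "X \<in> \<X>"
        have "(if d = 1 then b else K * (1 + real (length zs)) ^ (d - 1)) \<le> (K + b) * (1 + real (length zs)) ^ (d - 1)"
          using \<open>0 \<le> K\<close> b by (auto intro: mult_right_mono)
        then show "wnorm (vw 0 d) (fps_nth (prod_list zs * X)) \<le> ennreal (sum_list (map a zs) ^ d + (K + b) * (1 + real (length zs)) ^ (d - 1))"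
          by (intro order_trans[OF K[OF *]] ennreal_leI add_left_mono)
      qed (use b \<open>0 \<le> K\<close> in auto)
    qed
    \<comment> \<open>Orders below \<open>d\<close> need no sharp constant. They come from
      \<open>jets_bound\<close> with \<open>k = 0\<close>, each law being viewed as a jet with only
      its zeroth coefficient.\<close>
    obtain C where C: "0 \<le> C" and crude: "\<And>zs X l. set zs \<subseteq> \<Z> \<Longrightarrow> X \<in> \<X> \<Longrightarrow> l \<le> L \<Longrightarrow>
       wnorm (vw 1 l) (fps_nth (prod_list zs * X)) \<le> ennreal (C * (1 + real (length zs)) ^ l)"
    proof -
      obtain C where C: "0 \<le> C" and crude: "\<And>zs X m r. set zs \<subseteq> fps_const ` \<Z> \<Longrightarrow> X \<in> fps_const ` \<X> \<Longrightarrow> r \<le> 0 \<Longrightarrow> m + r \<le> L \<Longrightarrow>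
         wnorm (vw 1 m) (fps_nth (fps_nth (prod_list zs * X) r)) \<le> ennreal (C * (1 + real (length zs)) ^ (m + r))"
        by (rule jets_bound[OF B, of "fps_const ` \<Z>" 0 L "fps_const ` \<X>"]) (use Z0 Z X in auto)
      show ?thesis
      proof (rule that[OF C])
        fix zs X l assume *: "set zs \<subseteq> \<Z>" "X \<in> \<X>" "l \<le> L"
        show "wnorm (vw 1 l) (fps_nth (prod_list zs * X)) \<le> ennreal (C * (1 + real (length zs)) ^ l)"
          using crude[of "map fps_const zs" "fps_const X" 0 l] * by (auto simp: prod_list_fps_const)
      qed
    qed
    \<comment> \<open>\<open>D\<close> bounds every term \<open>l >= 2\<close>, where at most
      \<open>d - 1\<close> powers are left for the product. In \<open>K'\<close>, \<open>B\<close>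
      covers the empty product, \<open>(d + 1) * K\<close> the remainder of the moment of order
      \<open>d\<close> in the term \<open>l = 1\<close>, and \<open>(d + 2) * D\<close> one share
      for each \<open>l\<close>.\<close>
    define D where "D = 2 ^ L * B * C"
    define K' where "K' = B + real (Suc d) * K + real (Suc (Suc d)) * D"
    have D: "0 \<le> D" using B C by (simp add: D_def)
    have K': "0 \<le> K'" "B \<le> K'" using B K D by (auto simp: K'_def)
    have "wnorm (vw 0 (Suc d)) (fps_nth (prod_list zs * X)) \<le> ennreal (sum_list (map a zs) ^ Suc d + K' * (1 + real (length zs)) ^ d)"
      if "set zs \<subseteq> \<Z>" "X \<in> \<X>" for zs X
      using that(1)
    proof (induction zs)
      case Nil
      have "wnorm (vw 0 (Suc d)) (fps_nth X) \<le> ennreal B"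
        using that Suc.prems by (intro order_trans[OF wnorm_vw0_le X]) auto
      also have "\<dots> \<le> ennreal K'" by (intro ennreal_leI K')
      finally show ?case by simp
    next
      case (Cons z zs)
      let ?P = "prod_list zs * X" and ?A = "sum_list (map a zs)" and ?N = "1 + real (length zs)"
      have z: "z \<in> \<Z>" and A0: "0 \<le> ?A" using Cons.prems asum[of zs] by auto
      \<comment> \<open>\<open>l = 0\<close> reproduces the induction hypothesis for the shorter
        product; the main part of \<open>l = 1\<close> is the second term of the expansion of
        \<open>(?A + a z) ^ Suc d\<close>, so the power of the mean is updated without loss.\<close>
      define t where "t l = (if l = 0 then ?A ^ Suc d + K' * ?N ^ d else 0) +
          (if l = 1 then real (Suc d) * a z * ?A ^ d + real (Suc d) * K * ?N ^ (d - 1) else 0) + D * ?N ^ (d - 1)" for l :: nat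
      have "wnorm (vw 0 (Suc d)) (fps_nth (z * ?P)) \<le> (\<Sum>l\<le>Suc d. ennreal (real (Suc d choose l)) *
          wnorm (vw 0 l) (fps_nth z) * wnorm (vw 0 (Suc d - l)) (fps_nth ?P))"
        by (rule wnorm_fps_mult) auto
      also have "\<dots> \<le> (\<Sum>l\<le>Suc d. ennreal (t l))"
      proof (rule sum_mono)
        fix l assume l: "l \<in> {..Suc d}"
        consider "l = 0" | "l = 1" | "2 \<le> l" by linarith
        then show "ennreal (real (Suc d choose l)) * wnorm (vw 0 l) (fps_nth z) * wnorm (vw 0 (Suc d - l)) (fps_nth ?P) \<le> ennreal (t l)"
        proof cases
          case 1
          have "ennreal (real (Suc d choose l)) * wnorm (vw 0 l) (fps_nth z) * wnorm (vw 0 (Suc d - l)) (fps_nth ?P)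
             \<le> 1 * ennreal (?A ^ Suc d + K' * ?N ^ d)"
            using 1 Cons Z0[OF z] by (intro mult_mono) auto
          also have "\<dots> \<le> ennreal (t l)"
            using 1 D by (auto simp: t_def intro!: ennreal_leI)
          finally show ?thesis .
        next
          case 2
          have "ennreal (real (Suc d choose l)) * wnorm (vw 0 l) (fps_nth z) * wnorm (vw 0 (Suc d - l)) (fps_nth ?P)
             \<le> ennreal (real (Suc d)) * ennreal (a z) * ennreal (?A ^ d + K * ?N ^ (d - 1))"
            using 2 Cons.prems Z1[OF z] IH[of zs X] that by (intro mult_mono) auto
          also have "\<dots> = ennreal (real (Suc d) * a z * (?A ^ d + K * ?N ^ (d - 1)))"
          proof -
            have "0 \<le> real (Suc d) * a z" "0 \<le> ?A ^ d + K * ?N ^ (d - 1)"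
              using a(1)[OF z] A0 K by auto
            then show ?thesis using a(1)[OF z] by (simp only: ennreal_mult of_nat_0_le_iff)
          qed
          also have "\<dots> \<le> ennreal (t l)"
          proof (rule ennreal_leI)
            have "real (Suc d) * a z * (K * ?N ^ (d - 1)) \<le> real (Suc d) * 1 * (K * ?N ^ (d - 1))"
              using a(2)[OF z] K by (intro mult_right_mono mult_left_mono) auto
            moreover have "0 \<le> D * ?N ^ (d - 1)" using D by simp
            moreover have "t l = real (Suc d) * a z * ?A ^ d + real (Suc d) * K * ?N ^ (d - 1) + D * ?N ^ (d - 1)"
              using 2 by (simp add: t_def)
            moreover have "real (Suc d) * 1 * (K * ?N ^ (d - 1)) = real (Suc d) * K * ?N ^ (d - 1)"
              by (simp only: mult_1_right mult.assoc)
            moreover have "real (Suc d) * a z * (?A ^ d + K * ?N ^ (d - 1)) =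
                real (Suc d) * a z * ?A ^ d + real (Suc d) * a z * (K * ?N ^ (d - 1))"
              by (rule distrib_left)
            ultimately show "real (Suc d) * a z * (?A ^ d + K * ?N ^ (d - 1)) \<le> t l"
              by linarith
          qed
          finally show ?thesis .
        next
          case 3
          have "real (Suc d choose l) \<le> 2 ^ L"
          proof -
            have "Suc d choose l \<le> 2 ^ Suc d" by (rule binomial_le_pow2)
            also have "\<dots> \<le> 2 ^ L" using Suc.prems by (intro power_increasing) auto
            finally show ?thesis by (metis of_nat_le_iff of_nat_numeral of_nat_power)
          qed
          moreover have "wnorm (vw 0 l) (fps_nth z) \<le> ennreal B"
            using l Suc.prems z by (intro order_trans[OF wnorm_vw0_le Z]) auto
          moreover have "wnorm (vw 0 (Suc d - l)) (fps_nth ?P) \<le> ennreal (C * ?N ^ (d - 1))"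
          proof -
            have "wnorm (vw 0 (Suc d - l)) (fps_nth ?P) \<le> ennreal (C * ?N ^ (Suc d - l))"
              using Cons.prems Suc.prems that by (intro order_trans[OF wnorm_vw0_le crude]) auto
            also have "\<dots> \<le> ennreal (C * ?N ^ (d - 1))"
              using C 3 by (intro ennreal_leI mult_left_mono power_increasing) auto
            finally show ?thesis .
          qed
          ultimately have "ennreal (real (Suc d choose l)) * wnorm (vw 0 l) (fps_nth z) * wnorm (vw 0 (Suc d - l)) (fps_nth ?P)
              \<le> ennreal (2 ^ L) * ennreal B * ennreal (C * ?N ^ (d - 1))"
            by (intro mult_mono ennreal_leI) auto
          also have "\<dots> = ennreal (D * ?N ^ (d - 1))" using B C by (simp add: D_def ennreal_mult[symmetric] mult.assoc)
          also have "\<dots> = ennreal (t l)" using 3 by (simp add: t_def)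
          finally show ?thesis .
        qed
      qed
      also have "\<dots> = ennreal (\<Sum>l\<le>Suc d. t l)"
        by (rule sum_ennreal) (use A0 K K' D a(1)[OF z] in \<open>auto simp: t_def\<close>)
      also have "(\<Sum>l\<le>Suc d. t l) = ?A ^ Suc d + K' * ?N ^ d + (real (Suc d) * a z * ?A ^ d + real (Suc d) * K * ?N ^ (d - 1))
          + real (Suc (Suc d)) * (D * ?N ^ (d - 1))"
        unfolding t_def sum.distrib by (simp add: sum.delta del: sum.atMost_Suc)
      also have "\<dots> \<le> (?A + a z) ^ Suc d + K' * (1 + ?N) ^ d"
      proof -
        have "?A ^ Suc d + real (Suc d) * a z * ?A ^ d \<le> (?A + a z) ^ Suc d"
          using A0 a(1)[OF z] by (rule power_add_mult_le)
        moreover have "K' * ?N ^ d + real (Suc d) * K * ?N ^ (d - 1) + real (Suc (Suc d)) * (D * ?N ^ (d - 1)) \<le> K' * (1 + ?N) ^ d"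
        proof -
          have "real (Suc d) * K * ?N ^ (d - 1) + real (Suc (Suc d)) * (D * ?N ^ (d - 1)) = (real (Suc d) * K + real (Suc (Suc d)) * D) * ?N ^ (d - 1)"
            by (simp add: algebra_simps)
          also have "\<dots> \<le> K' * ?N ^ (d - 1)"
            using B by (intro mult_right_mono) (auto simp: K'_def)
          finally have "K' * ?N ^ d + real (Suc d) * K * ?N ^ (d - 1) + real (Suc (Suc d)) * (D * ?N ^ (d - 1)) \<le> K' * (?N ^ d + ?N ^ (d - 1))"
            by (simp add: distrib_left)
          also have "\<dots> \<le> K' * (1 + ?N) ^ d"
            using power_Suc_add_le[of ?N "d - 1"] Suc.hyps K' by (intro mult_left_mono) auto
          finally show ?thesis .
        qed
        ultimately show ?thesis by linarith
      qed
      finally show ?case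
        by (simp add: mult.assoc ennreal_leI add_ac)
    qed
    then show ?case using K' Suc.hyps by (intro exI[of _ K']) auto
  }
qed

text \<open>The probability generating function as a formal power series. Convolution becomes
  multiplication and the law is determined by the series, so identities between convolutions reduce
  to algebra.\<close>

definition Fp :: "nat pmf \<Rightarrow> real fps" where
  "Fp P = Abs_fps (pmf P)"

lemma fps_nth_Fp [simp]: "fps_nth (Fp P) = pmf P"
  by (simp add: Fp_def fun_eq_iff)

lemma Fp_inject: "Fp P = Fp Q \<longleftrightarrow> P = Q"
  by (metis fps_nth_Fp pmf_eqI)

lemma Fp_conv: "Fp (conv_pmf P Q) = Fp P * Fp Q"
proof (rule fps_ext)
  fix y
  have eq: "conv_pmf P Q = bind_pmf P (\<lambda>a. map_pmf ((+) a) Q)"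
    unfolding conv_pmf_def pair_pmf_def map_bind_pmf map_pmf_def by (simp add: bind_assoc_pmf bind_return_pmf)
  have "pmf (map_pmf ((+) a) Q) y = tower_map ((+) a) (\<lambda>_ _. pmf Q) 0 0 y" for a
  proof (cases "a \<le> y")
    case True
    then have "pmf (map_pmf ((+) a) Q) (a + (y - a)) = pmf Q (y - a)"
      by (intro pmf_map_inj') auto
    then show ?thesis using True by (simp add: tower_map_plus)
  next
    case False
    then have "y \<notin> (+) a ` set_pmf Q" by auto
    then show ?thesis using False by (simp add: tower_map_plus pmf_map_outside)
  qed
  then have "kernel_app (pmf P) (\<lambda>a. pmf (map_pmf ((+) a) Q)) y = kernel_app (pmf P) (\<lambda>a. tower_map ((+) a) (\<lambda>_ _. pmf Q) 0 0) y"
    by (intro kernel_app_cong) auto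
  then show "fps_nth (Fp (conv_pmf P Q)) y = fps_nth (Fp P * Fp Q) y"
    by (simp add: eq pmf_bind_kernel_app kernel_app_tower_map_plus fps_mult_nth atLeast0AtMost)
qed

lemma Fp_return: "Fp (return_pmf 0) = 1"
  by (rule fps_ext) (auto simp: pmf_return)

lemma Fp_conv_power: "Fp (conv_power P n) = Fp P ^ n"
  unfolding conv_power_def by (induction n) (auto simp: Fp_conv Fp_return)

lemma Fp_branching_kernel:
  "Fp (branching_kernel p \<zeta> \<xi> u x) = (\<Prod>i<p. Fp (\<zeta> i u) ^ (x ! i)) * Fp (\<xi> u)"
proof -
  have "Fp (foldr conv_pmf (map (\<lambda>i. conv_power (\<zeta> i u) (x ! i)) is) P) =
      (\<Prod>i\<leftarrow>is. Fp (\<zeta> i u) ^ (x ! i)) * Fp P" for "is" P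
    by (induction "is") (auto simp: Fp_conv Fp_conv_power mult.assoc)
  then have "Fp (branching_kernel p \<zeta> \<xi> u x) = (\<Prod>i\<leftarrow>[0..<p]. Fp (\<zeta> i u) ^ (x ! i)) * Fp (\<xi> u)"
    by (simp add: branching_kernel_def)
  also have "(\<Prod>i\<leftarrow>[0..<p]. Fp (\<zeta> i u) ^ (x ! i)) = (\<Prod>i<p. Fp (\<zeta> i u) ^ (x ! i))"
    by (simp add: prod.distinct_set_conv_list[symmetric] atLeast0LessThan)
  finally show ?thesis .
qed

text \<open>The branching property: two populations reproduce independently, and the immigrants are
  counted with only one of them. The coupling rests on this identity.\<close>

lemma conv_branching_kernel:
  assumes "length z = p" "length x = p"
  shows "conv_pmf (branching_kernel p \<zeta> (\<lambda>_. return_pmf 0) u z) (branching_kernel p \<zeta> \<xi> u x) =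
    branching_kernel p \<zeta> \<xi> u (map2 (+) z x)"
proof -
  have "(\<Prod>i<p. Fp (\<zeta> i u) ^ (z ! i)) * (\<Prod>i<p. Fp (\<zeta> i u) ^ (x ! i)) = (\<Prod>i<p. Fp (\<zeta> i u) ^ (map2 (+) z x ! i))"
    unfolding prod.distrib[symmetric] using assms by (intro prod.cong) (auto simp: power_add)
  then show ?thesis
    unfolding Fp_inject[symmetric] Fp_conv Fp_branching_kernel Fp_return by (simp flip: mult.assoc)
qed

section \<open>The branching kernel\<close>

text \<open>One list entry per living individual, namely its offspring law. It rewrites the kernel
  as a product over a list, the form in which the moment bounds are proved by induction.\<close>

definition individuals :: "nat \<Rightarrow> (nat \<Rightarrow> 'b) \<Rightarrow> nat list \<Rightarrow> 'b list" where
  "individuals p f x = concat (map (\<lambda>i. replicate (x ! i) (f i)) [0..<p])"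

lemma individuals_Suc: "individuals (Suc p) f x = individuals p f x @ replicate (x ! p) (f p)"
  by (simp add: individuals_def)

lemma prod_list_individuals: "prod_list (individuals p f x) = (\<Prod>i<p. f i ^ (x ! i))"
  for f :: "nat \<Rightarrow> 'b::comm_monoid_mult"
  by (induction p) (auto simp: individuals_Suc individuals_def[of 0] prod_list_replicate)

lemma length_individuals: "length (individuals p f x) = (\<Sum>i<p. x ! i)"
  by (induction p) (auto simp: individuals_Suc individuals_def[of 0])

lemma sum_list_individuals: "sum_list (map g (individuals p f x)) = (\<Sum>i<p. real (x ! i) * g (f i))"
  by (induction p) (auto simp: individuals_Suc individuals_def[of 0] sum_list_replicate)

lemma set_individuals: "set (individuals p f x) \<subseteq> f ` {..<p}"
  by (auto simp: individuals_def)

lemma sum_list_nth: "length x = p \<Longrightarrow> sum_list x = (\<Sum>i<p. x ! i)" for x :: "nat list"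
  by (simp add: sum_list_sum_nth atLeast0LessThan)

lemma fps_nth_0_prod: "fps_nth (\<Prod>i<n. f i) 0 = (\<Prod>i<n. fps_nth (f i) 0)" for n :: nat and f :: "nat \<Rightarrow> 'b::comm_ring_1 fps"
  by (induction n) auto

lemma fps_nth_0_pow: "fps_nth (f ^ n) 0 = fps_nth f 0 ^ n" for f :: "'b::comm_ring_1 fps"
  by (induction n) auto

text \<open>The sum is at most \<open>p\<close> times its largest term, and the power of that term
  is one of the summands on the right.\<close>

lemma sum_power_le_power_sum:
  fixes x :: "nat \<Rightarrow> real"
  assumes "\<And>i. i < p \<Longrightarrow> 0 \<le> x i" and "1 \<le> p"
  shows "(\<Sum>i<p. x i) ^ m \<le> real p ^ m * (\<Sum>i<p. x i ^ m)"
proof -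
  have fin: "finite (x ` {..<p})" "x ` {..<p} \<noteq> {}" using assms(2) by (auto simp: lessThan_empty_iff)
  obtain i where i: "i < p" "x i = Max (x ` {..<p})"
    using Max_in[OF fin] by auto
  have "(\<Sum>j<p. x j) \<le> (\<Sum>j<p. x i)"
    using i(2) fin by (intro sum_mono) auto
  then have "(\<Sum>i<p. x i) \<le> real p * x i" by simp
  then have "(\<Sum>i<p. x i) ^ m \<le> (real p * x i) ^ m"
    using assms by (intro power_mono sum_nonneg) auto
  also have "\<dots> = real p ^ m * x i ^ m" by (rule power_mult_distrib)
  also have "\<dots> \<le> real p ^ m * (\<Sum>i<p. x i ^ m)"
    using i assms by (intro mult_left_mono member_le_sum) auto
  finally show ?thesis .
qed

lemma weighted_power_le:
  fixes x c :: "nat \<Rightarrow> real"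
  assumes "\<And>i. i < p \<Longrightarrow> 0 \<le> x i" "\<And>i. i < p \<Longrightarrow> 0 \<le> c i" "(\<Sum>i<p. c i) \<le> 1" "1 \<le> m"
  shows "(\<Sum>i<p. c i * x i) ^ m \<le> (\<Sum>i<p. c i * x i ^ m)"
proof -
  \<comment> \<open>Jensen's inequality, the missing mass of the weights being put on the point 0\<close>
  define c' where "c' i = (if i < p then c i else 1 - (\<Sum>i<p. c i))" for i
  define x' where "x' i = (if i < p then x i else 0)" for i
  have conv: "convex_on {0..} (\<lambda>t::real. t ^ m)"
    by (cases "even m") (auto intro: convex_power_odd convex_on_subset[OF convex_power_even])
  have "(\<Sum>i\<in>{..p}. c' i *\<^sub>R x' i) ^ m \<le> (\<Sum>i\<in>{..p}. c' i * (x' i) ^ m)"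
  proof (rule convex_on_sum[where f = "\<lambda>t. t ^ m" and C = "{0..}"])
    show "(\<Sum>i\<in>{..p}. c' i) = 1"
      by (simp add: lessThan_Suc_atMost[symmetric] c'_def)
  qed (use assms conv in \<open>auto simp: c'_def x'_def\<close>)
  then show ?thesis
    using assms(4) by (simp add: lessThan_Suc_atMost[symmetric] c'_def x'_def zero_power)
qed

text \<open>The parameter may differ at every step. The contraction is thus available along the
  array, where it is \<open>t / n\<close> at time \<open>t\<close>, as well as for a fixed
  \<open>u\<close>.\<close>

fun iter :: "('u \<Rightarrow> 's \<Rightarrow> 's pmf) \<Rightarrow> 'u list \<Rightarrow> 's \<Rightarrow> 's pmf" where
  "iter Q [] x = return_pmf x"
| "iter Q (u # us) x = bind_pmf (Q u x) (iter Q us)"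

text \<open>The analytic content of the hypotheses: \<open>Zj\<close> and \<open>Xj\<close> are the
  Taylor jets in \<open>u\<close> of the generating functions, and \<open>mean\<close> is a real
  upper bound for the offspring means with subcritical total \<open>a\<close>. The condition
  \<open>k < L\<close> keeps all weights \<open>L - r\<close>, \<open>r <= k\<close>, at exponent 1
  or more, as the contraction requires.\<close>

locale ginar =
  fixes p k L :: nat
    and \<zeta> :: "nat \<Rightarrow> real \<Rightarrow> nat pmf" and \<xi> :: "real \<Rightarrow> nat pmf"
    and Zj :: "nat \<Rightarrow> real \<Rightarrow> real fps fps" and Xj :: "real \<Rightarrow> real fps fps"
    and mean :: "nat \<Rightarrow> real \<Rightarrow> real" and a :: real
  assumes p: "1 \<le> p" and kL: "k < L"
    and Z_tower: "\<And>i. i < p \<Longrightarrow> tower k L (\<lambda>y. y) (jet_tower (Zj i))"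
    and X_tower: "tower k L (\<lambda>y. y) (jet_tower Xj)"
    and Z_0: "\<And>i u. fps_nth (Zj i u) 0 = Fp (\<zeta> i u)"
    and X_0: "\<And>u. fps_nth (Xj u) 0 = Fp (\<xi> u)"
    and mean_nonneg: "\<And>i u. 0 \<le> mean i u"
    and mean: "\<And>i u. i < p \<Longrightarrow> u \<in> {0..1} \<Longrightarrow> wnorm (vw 0 1) (pmf (\<zeta> i u)) \<le> ennreal (mean i u)"
    and mean_sum: "\<And>u. u \<in> {0..1} \<Longrightarrow> (\<Sum>i<p. mean i u) \<le> a"
    and a: "0 \<le> a" "a < 1"
begin

definition Rj :: "nat list \<Rightarrow> real \<Rightarrow> real fps fps" where
  "Rj x u = (\<Prod>i<p. Zj i u ^ (x ! i)) * Xj u"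

lemma Rj_0: "fps_nth (Rj x u) 0 = Fp (branching_kernel p \<zeta> \<xi> u x)"
  by (simp add: Rj_def Fp_branching_kernel fps_nth_0_prod fps_nth_0_pow Z_0 X_0)

lemma Rj_tower: "tower k L (\<lambda>y. y) (jet_tower (Rj x))"
proof -
  have "tower k L (\<lambda>y. y) (jet_tower (\<lambda>u. (\<Prod>i<p. Zj i u ^ (x ! i)) * Xj u))"
    using kL by (intro tower_jet_mult tower_jet_prod tower_jet_power Z_tower X_tower) auto
  then show ?thesis by (simp add: Rj_def[abs_def])
qed

lemma jet_moments:
  obtains B where "1 \<le> B"
    "\<And>i r m u. i < p \<Longrightarrow> r \<le> k \<Longrightarrow> m + r \<le> L \<Longrightarrow> u \<in> {0..1} \<Longrightarrow> wnorm (vw 1 m) (fps_nth (fps_nth (Zj i u) r)) \<le> ennreal B"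
    "\<And>r m u. r \<le> k \<Longrightarrow> m + r \<le> L \<Longrightarrow> u \<in> {0..1} \<Longrightarrow> wnorm (vw 1 m) (fps_nth (fps_nth (Xj u) r)) \<le> ennreal B"
proof -
  have jet_tower: "jet_tower J r u = fps_nth (fps_nth (J u) r)" for J r u by (simp add: jet_tower_def fun_eq_iff)
  have lower: "wnorm (vw 1 m) f \<le> wnorm (vw 1 n) f" if "m \<le> n" for m n and f :: "nat \<Rightarrow> real"
    using that by (intro wnorm_mono mult_left_mono) (auto simp: vw_def intro: power_increasing)
  have "\<exists>B\<ge>0. \<forall>r\<le>k. \<forall>u\<in>{0..1}. wnorm (vw 1 (L - r)) (fps_nth (fps_nth (Zj i u) r)) \<le> ennreal B" if "i < p" for i
    using tower_bounded[OF Z_tower[OF that]] unfolding wt_id jet_tower by metis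
  then obtain BZ where BZ: "\<And>i. i < p \<Longrightarrow> 0 \<le> BZ i"
    "\<And>i r u. i < p \<Longrightarrow> r \<le> k \<Longrightarrow> u \<in> {0..1} \<Longrightarrow> wnorm (vw 1 (L - r)) (fps_nth (fps_nth (Zj i u) r)) \<le> ennreal (BZ i)"
    by metis
  obtain BX where BX: "0 \<le> BX"
    "\<And>r u. r \<le> k \<Longrightarrow> u \<in> {0..1} \<Longrightarrow> wnorm (vw 1 (L - r)) (fps_nth (fps_nth (Xj u) r)) \<le> ennreal BX"
    using tower_bounded[OF X_tower] unfolding wt_id jet_tower by metis
  \<comment> \<open>The summand 1 lets \<open>B\<close> also bound the moments of the point mass at
    0, which replaces the immigration law in the process without immigration.\<close>
  define B where "B = 1 + BX + (\<Sum>i<p. BZ i)"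
  have s0: "0 \<le> (\<Sum>i<p. BZ i)" using BZ(1) by (intro sum_nonneg) auto
  show ?thesis
  proof (rule that[of B])
    show "1 \<le> B" using s0 BX by (simp add: B_def)
    fix r m u assume *: "r \<le> k" "m + r \<le> L" "u \<in> {0..1::real}"
    have "wnorm (vw 1 m) (fps_nth (fps_nth (Xj u) r)) \<le> wnorm (vw 1 (L - r)) (fps_nth (fps_nth (Xj u) r))"
      using * by (intro lower) auto
    also have "\<dots> \<le> ennreal BX" using * by (intro BX) auto
    also have "\<dots> \<le> ennreal B" using s0 by (intro ennreal_leI) (auto simp: B_def)
    finally show "wnorm (vw 1 m) (fps_nth (fps_nth (Xj u) r)) \<le> ennreal B" .
    fix i assume i: "i < p"
    have "wnorm (vw 1 m) (fps_nth (fps_nth (Zj i u) r)) \<le> wnorm (vw 1 (L - r)) (fps_nth (fps_nth (Zj i u) r))"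
      using * by (intro lower) auto
    also have "\<dots> \<le> ennreal (BZ i)" using * i by (intro BZ) auto
    also have "\<dots> \<le> ennreal B"
      using BZ(1) BX i member_le_sum[of i "{..<p}" BZ] by (intro ennreal_leI) (auto simp: B_def)
    finally show "wnorm (vw 1 m) (fps_nth (fps_nth (Zj i u) r)) \<le> ennreal B" .
  qed
qed

lemma wnorm_pmf_0: "wnorm (vw c 0) (pmf P) = 1"
  by (simp add: wnorm_pmf vw_def)

lemma Rj_bound:
  obtains C where "0 \<le> C" "\<And>x u r m. length x = p \<Longrightarrow> u \<in> {0..1} \<Longrightarrow> r \<le> k \<Longrightarrow> m + r \<le> L \<Longrightarrow>
    wnorm (wt (\<lambda>y. y) m) (jet_tower (Rj x) r u) \<le> ennreal (C * wt sum_list (m + r) x)"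
proof -
  obtain B where B: "1 \<le> B"
    "\<And>i r m u. i < p \<Longrightarrow> r \<le> k \<Longrightarrow> m + r \<le> L \<Longrightarrow> u \<in> {0..1} \<Longrightarrow> wnorm (vw 1 m) (fps_nth (fps_nth (Zj i u) r)) \<le> ennreal B"
    "\<And>r m u. r \<le> k \<Longrightarrow> m + r \<le> L \<Longrightarrow> u \<in> {0..1} \<Longrightarrow> wnorm (vw 1 m) (fps_nth (fps_nth (Xj u) r)) \<le> ennreal B"
    using jet_moments by blast
  define \<Z> where "\<Z> = {Zj i u | i u. i < p \<and> u \<in> {0..1}}"
  define \<X> where "\<X> = Xj ` {0..1}"
  obtain C where C: "0 \<le> C" "\<And>zs X m r. set zs \<subseteq> \<Z> \<Longrightarrow> X \<in> \<X> \<Longrightarrow> r \<le> k \<Longrightarrow> m + r \<le> L \<Longrightarrow>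
     wnorm (vw 1 m) (fps_nth (fps_nth (prod_list zs * X) r)) \<le> ennreal (C * (1 + real (length zs)) ^ (m + r))"
    by (rule jets_bound[of B \<Z> k L \<X>]) (use B in \<open>auto simp: \<Z>_def \<X>_def Z_0 wnorm_pmf_0\<close>)
  show ?thesis
  proof (rule that[OF C(1)])
    fix x :: "nat list" and u r m assume *: "length x = p" "u \<in> {0..1::real}" "r \<le> k" "m + r \<le> L"
    let ?zs = "individuals p (\<lambda>i. Zj i u) x"
    have "set ?zs \<subseteq> \<Z>" using set_individuals[of p "\<lambda>i. Zj i u" x] *(2) unfolding \<Z>_def by blast
    from C(2)[OF this _ *(3,4), of "Xj u"] *(1,2)
    have "wnorm (vw 1 m) (fps_nth (fps_nth (Rj x u) r)) \<le> ennreal (C * (1 + real (sum_list x)) ^ (m + r))"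
      by (simp add: \<X>_def prod_list_individuals length_individuals sum_list_nth Rj_def)
    moreover have "jet_tower (Rj x) r u = fps_nth (fps_nth (Rj x u) r)" by (simp add: jet_tower_def fun_eq_iff)
    ultimately show "wnorm (wt (\<lambda>y. y) m) (jet_tower (Rj x) r u) \<le> ennreal (C * wt sum_list (m + r) x)"
      by (simp add: wt_id) (simp add: wt_def)
  qed
qed

text \<open>The kernels with and without immigration are treated together: \<open>c\<close> is 1 in the first case
  and 0 in the second.\<close>

definition immigration :: "(real \<Rightarrow> nat pmf) \<Rightarrow> real \<Rightarrow> bool" where
  "immigration \<xi>' c \<longleftrightarrow> \<xi>' = \<xi> \<and> c = 1 \<or> \<xi>' = (\<lambda>_. return_pmf 0) \<and> c = 0"

text \<open>The leading term has constant 1, hence contracts for subcritical means; the rest has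
  lower order. Without immigration the whole bound is 0 at the state 0, which is what allows decay
  to extinction.\<close>

lemma kernel_moment:
  assumes imm: "immigration \<xi>' c" and m: "1 \<le> m" "m \<le> L"
  shows "\<exists>K\<ge>0. \<forall>u\<in>{0..1}. \<forall>x. length x = p \<longrightarrow> wnorm (vw 0 m) (pmf (branching_kernel p \<zeta> \<xi>' u x)) \<le>
     ennreal ((\<Sum>i<p. mean i u * real (x ! i)) ^ m + K * ((if m = 1 then 0 else real (sum_list x) ^ (m - 1)) + c))"
proof -
  obtain B where B: "1 \<le> B"
    "\<And>i r m u. i < p \<Longrightarrow> r \<le> k \<Longrightarrow> m + r \<le> L \<Longrightarrow> u \<in> {0..1} \<Longrightarrow> wnorm (vw 1 m) (fps_nth (fps_nth (Zj i u) r)) \<le> ennreal B"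
    "\<And>r m u. r \<le> k \<Longrightarrow> m + r \<le> L \<Longrightarrow> u \<in> {0..1} \<Longrightarrow> wnorm (vw 1 m) (fps_nth (fps_nth (Xj u) r)) \<le> ennreal B"
    using jet_moments by blast
  have c: "c = 0 \<or> c = 1" using imm by (auto simp: immigration_def)
  define \<Z> where "\<Z> = {Fp (\<zeta> i u) | i u. i < p \<and> u \<in> {0..1}}"
  define \<X> where "\<X> = (\<lambda>u. Fp (\<xi>' u)) ` {0..1}"
  \<comment> \<open>\<open>sharp_moment\<close> wants a mean that is a function of the law alone,
    whereas \<open>mean\<close> depends on \<open>i\<close> and \<open>u\<close>; so the mean is
    recovered from the series and compared with \<open>mean\<close> afterwards.\<close>
  define av where "av z = enn2real (wnorm (vw 0 1) (fps_nth z))" for z :: "real fps"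
  have ZB: "wnorm (vw 1 m) (pmf (\<zeta> i u)) \<le> ennreal B" if "i < p" "u \<in> {0..1}" "m \<le> L" for i u m
    using B(2)[of i 0 m u] that by (simp add: Z_0)
  have XB: "wnorm (vw 1 m) (pmf (\<xi>' u)) \<le> ennreal B" if "u \<in> {0..1}" "m \<le> L" for u m
    using imm B(3)[of 0 m u] B(1) that unfolding immigration_def
    by (auto simp: X_0 wnorm_pmf vw_def)
  have XB1: "wnorm (vw 0 1) (pmf (\<xi>' u)) \<le> ennreal (B * c)" if "u \<in> {0..1}" for u
    using imm XB[OF that, of 1] m wnorm_vw0_le[of 1 "pmf (\<xi>' u)"] unfolding immigration_def
    by (auto simp: wnorm_pmf vw_def intro: order_trans)
  have av: "wnorm (vw 0 1) (pmf (\<zeta> i u)) = ennreal (av (Fp (\<zeta> i u)))" "av (Fp (\<zeta> i u)) \<le> mean i u" "mean i u \<le> 1"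
    if "i < p" "u \<in> {0..1}" for i u
  proof -
    have "wnorm (vw 0 1) (pmf (\<zeta> i u)) < \<infinity>" using mean[OF that] by (auto intro: le_less_trans)
    then show *: "wnorm (vw 0 1) (pmf (\<zeta> i u)) = ennreal (av (Fp (\<zeta> i u)))" by (simp add: av_def)
    show "av (Fp (\<zeta> i u)) \<le> mean i u"
      using mean[OF that] mean_nonneg[of i u] unfolding * by (simp add: ennreal_le_iff)
    have "mean i u \<le> (\<Sum>i<p. mean i u)" using that mean_nonneg by (intro member_le_sum) auto
    then show "mean i u \<le> 1" using mean_sum[OF that(2)] a by linarith
  qed
  obtain K where K: "0 \<le> K" "\<And>zs X. set zs \<subseteq> \<Z> \<Longrightarrow> X \<in> \<X> \<Longrightarrow> wnorm (vw 0 m) (fps_nth (prod_list zs * X)) \<le>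
     ennreal (sum_list (map av zs) ^ m + (if m = 1 then B * c else K * (1 + real (length zs)) ^ (m - 1)))"
  proof -
    have "\<exists>K\<ge>0. \<forall>zs X. set zs \<subseteq> \<Z> \<longrightarrow> X \<in> \<X> \<longrightarrow> wnorm (vw 0 m) (fps_nth (prod_list zs * X)) \<le>
     ennreal (sum_list (map av zs) ^ m + (if m = 1 then B * c else K * (1 + real (length zs)) ^ (m - 1)))"
    proof (rule sharp_moment[OF _ _ _ _ _ _ _ _ _ _ m, where B = B])
      show "av z \<le> 1" if "z \<in> \<Z>" for z using that av(2,3) by (fastforce simp: \<Z>_def)
    qed (use B(1) c ZB XB XB1 av(1) in \<open>auto simp: \<Z>_def \<X>_def wnorm_pmf_0 av_def\<close>)
    then show ?thesis using that by blast
  qed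
  \<comment> \<open>\<open>B\<close> serves the case \<open>m = 1\<close>; the power of 2 comes from
    \<open>1 + ?N <= 2 * ?N\<close> for nonzero integers \<open>?N\<close>.\<close>
  define K' where "K' = B + K * 2 ^ (m - 1)"
  have K': "0 \<le> K'" "B \<le> K'" "K * 2 ^ (m - 1) \<le> K'" using K(1) B(1) by (auto simp: K'_def)
  show ?thesis
  proof (intro exI[of _ K'] conjI ballI allI impI K')
    fix u :: real and x :: "nat list" assume u: "u \<in> {0..1}" and x: "length x = p"
    let ?N = "real (sum_list x)"
    let ?zs = "individuals p (\<lambda>i. Fp (\<zeta> i u)) x"
    have A: "sum_list (map av ?zs) \<le> (\<Sum>i<p. mean i u * real (x ! i))"
      unfolding sum_list_individuals using av(2)[OF _ u]
      by (intro sum_mono) (auto simp: mult.commute[of "mean _ _"] intro: mult_left_mono)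
    have A0: "0 \<le> sum_list (map av ?zs)" by (intro sum_list_nonneg) (auto simp: av_def)
    have "set ?zs \<subseteq> \<Z>" using set_individuals[of p "\<lambda>i. Fp (\<zeta> i u)" x] u unfolding \<Z>_def by blast
    moreover have "Fp (\<xi>' u) \<in> \<X>" using u by (auto simp: \<X>_def)
    moreover have len: "real (length ?zs) = ?N" by (simp add: length_individuals sum_list_nth x)
    ultimately have "wnorm (vw 0 m) (fps_nth (prod_list ?zs * Fp (\<xi>' u))) \<le>
        ennreal (sum_list (map av ?zs) ^ m + (if m = 1 then B * c else K * (1 + ?N) ^ (m - 1)))"
      using K(2)[of ?zs "Fp (\<xi>' u)"] by (simp only: len)
    also have "prod_list ?zs * Fp (\<xi>' u) = Fp (branching_kernel p \<zeta> \<xi>' u x)"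
      by (simp add: prod_list_individuals Fp_branching_kernel)
    finally have 1: "wnorm (vw 0 m) (pmf (branching_kernel p \<zeta> \<xi>' u x)) \<le>
        ennreal (sum_list (map av ?zs) ^ m + (if m = 1 then B * c else K * (1 + ?N) ^ (m - 1)))"
      by simp
    show "wnorm (vw 0 m) (pmf (branching_kernel p \<zeta> \<xi>' u x)) \<le>
     ennreal ((\<Sum>i<p. mean i u * real (x ! i)) ^ m + K' * ((if m = 1 then 0 else ?N ^ (m - 1)) + c))"
    \<comment> \<open>The extinct state without immigration is separated: it stays at 0, while
      \<open>(1 + ?N) ^ (m - 1)\<close> would contribute 1 there.\<close>
    proof (cases "\<xi>' = (\<lambda>_. return_pmf 0) \<and> sum_list x = 0")
      case True
      then have "x ! i = 0" if "i < p" for i using that x by (auto simp: sum_list_eq_0_iff)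
      then have "Fp (branching_kernel p \<zeta> \<xi>' u x) = Fp (return_pmf 0)"
        using True by (simp add: Fp_branching_kernel Fp_return)
      then have "branching_kernel p \<zeta> \<xi>' u x = return_pmf 0" by (simp only: Fp_inject)
      then have "wnorm (vw 0 m) (pmf (branching_kernel p \<zeta> \<xi>' u x)) = 0"
        using m by (simp add: wnorm_pmf vw_def power_0_left)
      then show ?thesis by simp
    next
      case False
      have "(if m = 1 then B * c else K * (1 + ?N) ^ (m - 1)) \<le> K' * ((if m = 1 then 0 else ?N ^ (m - 1)) + c)"
      proof (cases "m = 1")
        case True
        then show ?thesis using K' c by (auto intro: mult_right_mono)
      next
        case m2: False
        have "(1 + ?N) ^ (m - 1) \<le> 2 ^ (m - 1) * (?N ^ (m - 1) + c)"
        proof (cases "sum_list x = 0")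
          case True
          then have "c = 1" using False imm by (auto simp: immigration_def)
          moreover have "?N = 0" by (simp only: True of_nat_0)
          moreover have "(1::real) * 1 \<le> 2 ^ (m - 1) * (0 ^ (m - 1) + 1)" by (intro mult_mono) auto
          ultimately show ?thesis by (simp only: add_0_right power_one mult_1_right)
        next
          case N: False
          have "1 \<le> ?N" using N by linarith
          then have "(1 + ?N) ^ (m - 1) \<le> (2 * ?N) ^ (m - 1)" by (intro power_mono) auto
          also have "(2 * ?N) ^ (m - 1) \<le> 2 ^ (m - 1) * (?N ^ (m - 1) + c)"
            using c by (auto simp: power_mult_distrib)
          finally show ?thesis .
        qed
        then have "K * (1 + ?N) ^ (m - 1) \<le> K * (2 ^ (m - 1) * (?N ^ (m - 1) + c))"
          using K(1) by (rule mult_left_mono)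
        also have "\<dots> \<le> K' * (?N ^ (m - 1) + c)"
          unfolding mult.assoc[symmetric] using K' c by (intro mult_right_mono) auto
        finally show ?thesis using m2 by simp
      qed
      moreover have "sum_list (map av ?zs) ^ m \<le> (\<Sum>i<p. mean i u * real (x ! i)) ^ m"
        using A A0 by (rule power_mono)
      ultimately show ?thesis by (intro order_trans[OF 1] ennreal_leI add_mono)
    qed
  qed
qed

text \<open>By Bernoulli's inequality \<open>\<theta> ^ p\<close> is at least
  \<open>1 - (1 - a) / 2\<close>, the midpoint between \<open>a\<close> and 1, so
  \<open>a <= \<theta> ^ p\<close> although \<open>\<theta>\<close> is below 1.\<close>

definition \<theta> :: real where "\<theta> = 1 - (1 - a) / (2 * real p)"

lemma theta: "0 < \<theta>" "\<theta> < 1" "a \<le> \<theta> ^ p"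
proof -
  have "(1 - a) / (2 * real p) \<le> 1 / 2" using p a by (simp add: field_simps)
  then show "0 < \<theta>" unfolding \<theta>_def by linarith
  show "\<theta> < 1" using p a by (simp add: \<theta>_def)
  have "1 + real p * (- ((1 - a) / (2 * real p))) \<le> (1 + - ((1 - a) / (2 * real p))) ^ p"
    using \<open>(1 - a) / (2 * real p) \<le> 1 / 2\<close> by (intro Bernoulli_inequality) linarith
  moreover have "real p * ((1 - a) / (2 * real p)) = (1 - a) / 2" using p by simp
  ultimately show "a \<le> \<theta> ^ p" using a by (simp add: \<theta>_def)
qed

text \<open>The factor \<open>\<theta>\<^sup>i\<close> makes the shift of coordinates a contraction; since \<open>a \<le> \<theta>\<^sup>p\<close>, so is the draw of the
  newest coordinate, whatever the individual means are.\<close>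

definition bnd :: "nat \<Rightarrow> real \<Rightarrow> nat list pmf \<Rightarrow> bool" where
  "bnd j M \<mu> \<longleftrightarrow> (\<forall>i<p. (\<integral>\<^sup>+x. ennreal (real (x ! i) ^ j) \<partial>measure_pmf \<mu>) \<le> ennreal (M * \<theta> ^ i))"

abbreviation Qk :: "(real \<Rightarrow> nat pmf) \<Rightarrow> real \<Rightarrow> nat list \<Rightarrow> nat list pmf" where
  "Qk \<xi>' u \<equiv> companion_kernel (branching_kernel p \<zeta> \<xi>' u)"

text \<open>A shifted coordinate gains a factor \<open>\<theta>\<close> from its change of index.
  For the drawn one, convexity turns the power of the weighted sum into a weighted sum of powers, of
  total weight at most \<open>a <= \<theta> ^ p\<close>. Moments of order \<open>j - 1\<close> enter
  additively, which forces all orders to be treated jointly.\<close>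

lemma bnd_step:
  assumes imm: "immigration \<xi>' c" and j: "1 \<le> j" "j \<le> L"
  shows "\<exists>K\<ge>0. \<forall>u\<in>{0..1}. \<forall>\<mu> M M'. set_pmf \<mu> \<subseteq> {x. length x = p} \<longrightarrow> 0 \<le> M \<longrightarrow> 0 \<le> M' \<longrightarrow> bnd j M \<mu> \<longrightarrow>
      (j \<noteq> 1 \<longrightarrow> bnd (j - 1) M' \<mu>) \<longrightarrow>
      bnd j (\<theta> * M + K * ((if j = 1 then 0 else M') + c)) (bind_pmf \<mu> (Qk \<xi>' u))"
proof -
  obtain K where K: "0 \<le> K" "\<And>u x. u \<in> {0..1} \<Longrightarrow> length x = p \<Longrightarrow> wnorm (vw 0 j) (pmf (branching_kernel p \<zeta> \<xi>' u x)) \<le>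
     ennreal ((\<Sum>i<p. mean i u * real (x ! i)) ^ j + K * ((if j = 1 then 0 else real (sum_list x) ^ (j - 1)) + c))"
    using kernel_moment[OF imm j] by blast
  have c: "c = 0 \<or> c = 1" using imm by (auto simp: immigration_def)
  \<comment> \<open>\<open>p ^ (j - 1)\<close> comes from the power of the coordinate sum, one more
    \<open>p\<close> from adding up the coordinates, and the division by
    \<open>\<theta> ^ (p - 1)\<close> offsets the factor \<open>\<theta> ^ i\<close> at the last
    index.\<close>
  define K' where "K' = K * real p ^ j / \<theta> ^ (p - 1)"
  have K': "0 \<le> K'" using K(1) theta by (simp add: K'_def)
  show ?thesis
  proof (intro exI[of _ K'] conjI ballI allI impI K')
    fix u \<mu> M M' assume u: "u \<in> {0..1::real}" and \<mu>: "set_pmf \<mu> \<subseteq> {x. length x = p}" and M: "0 \<le> M" "0 \<le> M'"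
      and b: "bnd j M \<mu>" and b': "j \<noteq> 1 \<longrightarrow> bnd (j - 1) M' \<mu>"
    let ?E = "K' * ((if j = 1 then 0 else M') + c)"
    have E: "0 \<le> ?E" using K' M c by auto
    show "bnd j (\<theta> * M + ?E) (bind_pmf \<mu> (Qk \<xi>' u))"
      unfolding bnd_def
    proof (intro allI impI)
      fix i assume i: "i < p"
      have eq: "(\<integral>\<^sup>+x. ennreal (real (x ! i) ^ j) \<partial>measure_pmf (bind_pmf \<mu> (Qk \<xi>' u))) =
          (\<integral>\<^sup>+x. \<integral>\<^sup>+y. ennreal (real ((tl x @ [y]) ! i) ^ j) \<partial>measure_pmf (branching_kernel p \<zeta> \<xi>' u x) \<partial>measure_pmf \<mu>)"
        by (simp add: nn_integral_bind_pmf companion_kernel_def nn_integral_map_pmf)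
      show "(\<integral>\<^sup>+x. ennreal (real (x ! i) ^ j) \<partial>measure_pmf (bind_pmf \<mu> (Qk \<xi>' u))) \<le> ennreal ((\<theta> * M + ?E) * \<theta> ^ i)"
      proof (cases "i < p - 1")
        case True
        have "(\<integral>\<^sup>+x. ennreal (real (x ! i) ^ j) \<partial>measure_pmf (bind_pmf \<mu> (Qk \<xi>' u))) =
            (\<integral>\<^sup>+x. ennreal (real (x ! Suc i) ^ j) \<partial>measure_pmf \<mu>)"
          unfolding eq
        proof (intro nn_integral_cong_AE, subst AE_measure_pmf_iff, intro ballI)
          fix x assume "x \<in> set_pmf \<mu>"
          then have "length x = p" using \<mu> by auto
          then show "(\<integral>\<^sup>+y. ennreal (real ((tl x @ [y]) ! i) ^ j) \<partial>measure_pmf (branching_kernel p \<zeta> \<xi>' u x)) = ennreal (real (x ! Suc i) ^ j)"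
            using True by (simp add: nth_append nth_tl)
        qed
        also have "\<dots> \<le> ennreal (M * \<theta> ^ Suc i)" using b[unfolded bnd_def, rule_format, of "Suc i"] True by auto
        also have "\<dots> \<le> ennreal ((\<theta> * M + ?E) * \<theta> ^ i)"
        proof (rule ennreal_leI)
          have "0 \<le> ?E * \<theta> ^ i" using E theta by simp
          then show "M * \<theta> ^ Suc i \<le> (\<theta> * M + ?E) * \<theta> ^ i"
            unfolding distrib_right by (simp add: mult_ac)
        qed
        finally show ?thesis .
      next
        case False
        then have ip: "i = p - 1" using i by auto
        let ?low = "if j = 1 then 0 else M'"
        have "(\<integral>\<^sup>+x. ennreal (real (x ! i) ^ j) \<partial>measure_pmf (bind_pmf \<mu> (Qk \<xi>' u))) \<le>
            (\<integral>\<^sup>+x. (\<Sum>i<p. ennreal (mean i u) * ennreal (real (x ! i) ^ j)) + 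
               (ennreal (if j = 1 then 0 else K * real p ^ (j - 1)) * (\<Sum>i<p. ennreal (real (x ! i) ^ (j - 1))) + ennreal (K * c)) \<partial>measure_pmf \<mu>)"
          unfolding eq
        proof (intro nn_integral_mono_AE, subst AE_measure_pmf_iff, intro ballI)
          fix x assume "x \<in> set_pmf \<mu>"
          then have x: "length x = p" using \<mu> by auto
          have "(\<integral>\<^sup>+y. ennreal (real ((tl x @ [y]) ! i) ^ j) \<partial>measure_pmf (branching_kernel p \<zeta> \<xi>' u x)) =
              wnorm (vw 0 j) (pmf (branching_kernel p \<zeta> \<xi>' u x))"
            using x ip by (simp add: wnorm_pmf vw_def nth_append)
          also have "\<dots> \<le> ennreal ((\<Sum>i<p. mean i u * real (x ! i)) ^ j + K * ((if j = 1 then 0 else real (sum_list x) ^ (j - 1)) + c))"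
            by (rule K(2)[OF u x])
          also have "\<dots> \<le> ennreal ((\<Sum>i<p. mean i u * real (x ! i) ^ j) + ((if j = 1 then 0 else K * real p ^ (j - 1)) * (\<Sum>i<p. real (x ! i) ^ (j - 1)) + K * c))"
          proof (intro ennreal_leI add_mono)
            show "(\<Sum>i<p. mean i u * real (x ! i)) ^ j \<le> (\<Sum>i<p. mean i u * real (x ! i) ^ j)"
              using mean_nonneg mean_sum[OF u] a j by (intro weighted_power_le) auto
            have "real (sum_list x) ^ (j - 1) \<le> real p ^ (j - 1) * (\<Sum>i<p. real (x ! i) ^ (j - 1))"
              using sum_power_le_power_sum[of p "\<lambda>i. real (x ! i)" "j - 1"] p x by (simp add: sum_list_nth)
            then have "K * real (sum_list x) ^ (j - 1) \<le> K * (real p ^ (j - 1) * (\<Sum>i<p. real (x ! i) ^ (j - 1)))"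
              using K(1) by (rule mult_left_mono)
            then show "K * ((if j = 1 then 0 else real (sum_list x) ^ (j - 1)) + c) \<le>
                (if j = 1 then 0 else K * real p ^ (j - 1)) * (\<Sum>i<p. real (x ! i) ^ (j - 1)) + K * c"
              by (auto simp: distrib_left mult.assoc)
          qed
          also have "\<dots> = (\<Sum>i<p. ennreal (mean i u) * ennreal (real (x ! i) ^ j)) + 
               (ennreal (if j = 1 then 0 else K * real p ^ (j - 1)) * (\<Sum>i<p. ennreal (real (x ! i) ^ (j - 1))) + ennreal (K * c))"
            using K(1) c mean_nonneg
            by (subst ennreal_plus, simp add: sum_nonneg, force simp: sum_nonneg, subst ennreal_plus, force simp: sum_nonneg, force)
               (simp add: ennreal_mult sum_nonneg flip: sum_ennreal)
          finally show "(\<integral>\<^sup>+y. ennreal (real ((tl x @ [y]) ! i) ^ j) \<partial>measure_pmf (branching_kernel p \<zeta> \<xi>' u x)) \<le> \<dots>" .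
        qed
        also have "\<dots> = (\<Sum>i<p. ennreal (mean i u) * (\<integral>\<^sup>+x. ennreal (real (x ! i) ^ j) \<partial>measure_pmf \<mu>)) + 
               (ennreal (if j = 1 then 0 else K * real p ^ (j - 1)) * (\<Sum>i<p. \<integral>\<^sup>+x. ennreal (real (x ! i) ^ (j - 1)) \<partial>measure_pmf \<mu>) + ennreal (K * c))"
          by (simp add: nn_integral_add nn_integral_sum nn_integral_cmult del: sum_ennreal)
        also have "\<dots> \<le> (\<Sum>i<p. ennreal (mean i u) * ennreal M) +
               (ennreal (if j = 1 then 0 else K * real p ^ (j - 1)) * (\<Sum>i<p. ennreal ?low) + ennreal (K * c))"
        proof (intro add_mono order_refl)
          have th1: "\<theta> ^ i \<le> 1" for i using theta by (intro power_le_one) auto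
          show "(\<Sum>i<p. ennreal (mean i u) * (\<integral>\<^sup>+x. ennreal (real (x ! i) ^ j) \<partial>measure_pmf \<mu>)) \<le> (\<Sum>i<p. ennreal (mean i u) * ennreal M)"
          proof (intro sum_mono mult_left_mono)
          fix i assume i: "i \<in> {..<p}"
          have "M * \<theta> ^ i \<le> M * 1" using M by (intro mult_left_mono th1) auto
          then show "(\<integral>\<^sup>+x. ennreal (real (x ! i) ^ j) \<partial>measure_pmf \<mu>) \<le> ennreal M"
            using b i by (auto simp: bnd_def intro: order_trans ennreal_leI)
          qed auto
          show "ennreal (if j = 1 then 0 else K * real p ^ (j - 1)) * (\<Sum>i<p. \<integral>\<^sup>+x. ennreal (real (x ! i) ^ (j - 1)) \<partial>measure_pmf \<mu>)
            \<le> ennreal (if j = 1 then 0 else K * real p ^ (j - 1)) * (\<Sum>i<p. ennreal ?low)"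
          proof (cases "j = 1")
            case False
            have "(\<integral>\<^sup>+x. ennreal (real (x ! i) ^ (j - 1)) \<partial>measure_pmf \<mu>) \<le> ennreal M'" if "i < p" for i
            proof -
              have "M' * \<theta> ^ i \<le> M' * 1" using M by (intro mult_left_mono th1) auto
              then show ?thesis using b' False that by (auto simp: bnd_def intro: order_trans ennreal_leI)
            qed
            then show ?thesis using False by (intro mult_left_mono sum_mono) auto
          qed auto
        qed
        also have "\<dots> = ennreal ((\<Sum>i<p. mean i u) * M + ((if j = 1 then 0 else K * real p ^ (j - 1)) * (real p * ?low) + K * c))"
        proof -
          have "(\<Sum>i<p. ennreal (mean i u) * ennreal M) = ennreal ((\<Sum>i<p. mean i u) * M)"
            unfolding sum_distrib_right using M mean_nonneg by (simp add: ennreal_mult flip: sum_ennreal)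
          moreover have "(\<Sum>i<p. ennreal ?low) = ennreal (real p * ?low)"
            using M by (simp add: ennreal_mult ennreal_of_nat_eq_real_of_nat)
          moreover have "0 \<le> (\<Sum>i<p. mean i u) * M" using M mean_nonneg by (simp add: sum_nonneg)
          ultimately show ?thesis using M c K(1) by (auto simp: ennreal_mult)
        qed
        also have "\<dots> \<le> ennreal ((\<theta> * M + ?E) * \<theta> ^ i)"
        proof (rule ennreal_leI)
          have pos: "\<theta> ^ (p - 1) \<noteq> 0" using theta by simp
          have "(\<Sum>i<p. mean i u) * M \<le> \<theta> ^ p * M"
            using mean_sum[OF u] theta M by (intro mult_right_mono) auto
          also have "\<theta> ^ p * M = \<theta> * M * \<theta> ^ i" unfolding ip using p by (cases p) auto
          finally have "(\<Sum>i<p. mean i u) * M \<le> \<theta> * M * \<theta> ^ i" .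
          moreover have "(if j = 1 then 0 else K * real p ^ (j - 1)) * (real p * ?low) + K * c \<le> ?E * \<theta> ^ i"
          proof -
            have "?E * \<theta> ^ i = K * real p ^ j * (?low + c)" using pos by (simp add: K'_def ip)
            also have "\<dots> = K * real p ^ j * ?low + K * real p ^ j * c" by (rule distrib_left)
            finally have "?E * \<theta> ^ i = K * real p ^ j * ?low + K * real p ^ j * c" .
            moreover have "K * c \<le> K * real p ^ j * c"
              using K(1) p c by (auto intro!: mult_left_mono[of 1 "real p ^ j" K, simplified])
            moreover have "(if j = 1 then 0 else K * real p ^ (j - 1)) * (real p * ?low) = K * real p ^ j * ?low"
              using j by (cases j) auto
            ultimately show ?thesis by linarith
          qed
          ultimately show "(\<Sum>i<p. mean i u) * M + ((if j = 1 then 0 else K * real p ^ (j - 1)) * (real p * ?low) + K * c) \<le> (\<theta> * M + ?E) * \<theta> ^ i"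
            unfolding distrib_right by linarith
        qed
        finally show ?thesis .
      qed
    qed
  qed
qed

end

section \<open>Geometric contraction\<close>

text \<open>The coupling inequality in weighted form: outcomes with \<open>f = g\<close> cancel, and
  each other outcome contributes at most two point masses.\<close>

lemma wnorm_coupling:
  fixes f g :: "'a \<Rightarrow> 'b::countable"
  assumes w: "\<And>z. 0 \<le> w z"
  shows "wnorm w (\<lambda>v. pmf (map_pmf f J) v - pmf (map_pmf g J) v) \<le>
    (\<integral>\<^sup>+\<omega>. (if f \<omega> = g \<omega> then 0 else ennreal (w (f \<omega>) + w (g \<omega>))) \<partial>measure_pmf J)"
proof -
  let ?I = "\<lambda>h \<omega> v. if v = h \<omega> then 1 else (0::real)"
  have pmf: "pmf (map_pmf h J) v = kernel_app (pmf J) (?I h) v" for h :: "'a \<Rightarrow> 'b" and v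
    unfolding map_pmf_def pmf_bind_kernel_app by (intro kernel_app_cong) (auto simp: pmf_return)
  have int: "integrable (count_space UNIV) (\<lambda>\<omega>. pmf J \<omega> * ?I h \<omega> v)" for h :: "'a \<Rightarrow> 'b" and v
    by (rule Bochner_Integration.integrable_bound[OF integrable_pmf]) auto
  have "pmf (map_pmf f J) v - pmf (map_pmf g J) v = kernel_app (pmf J) (\<lambda>\<omega> v. ?I f \<omega> v - ?I g \<omega> v) v" for v
    unfolding pmf unfolding kernel_app_def right_diff_distrib
    by (rule Bochner_Integration.integral_diff[symmetric]) (rule int)+
  then have "wnorm w (\<lambda>v. pmf (map_pmf f J) v - pmf (map_pmf g J) v) = wnorm w (kernel_app (pmf J) (\<lambda>\<omega> v. ?I f \<omega> v - ?I g \<omega> v))"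
    by (simp add: fun_eq_iff)
  also have "\<dots> \<le> (\<integral>\<^sup>+\<omega>. ennreal \<bar>pmf J \<omega>\<bar> * wnorm w (\<lambda>v. ?I f \<omega> v - ?I g \<omega> v) \<partial>count_space UNIV)"
    by (rule wnorm_kernel_app) (rule w)
  also have "\<dots> \<le> (\<integral>\<^sup>+\<omega>. ennreal (pmf J \<omega>) * (if f \<omega> = g \<omega> then 0 else ennreal (w (f \<omega>) + w (g \<omega>))) \<partial>count_space UNIV)"
  proof (rule nn_integral_mono)
    fix \<omega>
    have "wnorm w (\<lambda>v. ?I f \<omega> v - ?I g \<omega> v) \<le> (if f \<omega> = g \<omega> then 0 else ennreal (w (f \<omega>) + w (g \<omega>)))"
    proof (cases "f \<omega> = g \<omega>")
      case False
      have "wnorm w (\<lambda>v. ?I f \<omega> v - ?I g \<omega> v) \<le> wnorm w (\<lambda>v. (if v = f \<omega> then 1 else 0) + (if v = g \<omega> then -1 else 0))"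
        by (intro wnorm_mono_abs w) auto
      also have "\<dots> \<le> wnorm w (\<lambda>v. if v = f \<omega> then 1 else 0) + wnorm w (\<lambda>v. if v = g \<omega> then -1 else 0)"
        by (intro wnorm_add w)
      also have "\<dots> = ennreal (w (f \<omega>) + w (g \<omega>))"
        using w by (simp add: wnorm_delta ennreal_plus[symmetric] del: ennreal_plus)
      finally show ?thesis using False by simp
    qed simp
    then show "ennreal \<bar>pmf J \<omega>\<bar> * wnorm w (\<lambda>v. ?I f \<omega> v - ?I g \<omega> v) \<le> ennreal (pmf J \<omega>) * (if f \<omega> = g \<omega> then 0 else ennreal (w (f \<omega>) + w (g \<omega>)))"
      by (simp add: mult_left_mono)
  qed
  finally show ?thesis by (simp only: nn_integral_measure_pmf)
qed

lemma pair_pmf_bind: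
  "pair_pmf (bind_pmf A f) (bind_pmf B g) = bind_pmf A (\<lambda>a. bind_pmf B (\<lambda>b. pair_pmf (f a) (g b)))"
  unfolding pair_pmf_def bind_assoc_pmf
  by (intro bind_pmf_cong refl) (subst bind_commute_pmf, simp)

lemma nn_integral_pair_pmf_mult:
  "(\<integral>\<^sup>+\<omega>. F (fst \<omega>) * G (snd \<omega>) \<partial>measure_pmf (pair_pmf A B)) =
    (\<integral>\<^sup>+x. F x \<partial>measure_pmf A) * (\<integral>\<^sup>+y. G y \<partial>measure_pmf B)"
  by (simp add: nn_integral_pair_pmf' nn_integral_cmult nn_integral_multc)

text \<open>Total mass is the action of the constant kernel into a one-point space, so this is
  associativity of the action.\<close>

lemma integral_kernel_app:
  fixes \<nu> :: "'a::countable \<Rightarrow> real" and K :: "'a \<Rightarrow> 'b::countable \<Rightarrow> real"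
  assumes "(\<integral>\<^sup>+x. ennreal \<bar>\<nu> x\<bar> * wnorm (\<lambda>_. 1) (K x) \<partial>count_space UNIV) < \<infinity>"
  shows "(\<integral>z. kernel_app \<nu> K z \<partial>count_space UNIV) = (\<integral>x. \<nu> x * (\<integral>z. K x z \<partial>count_space UNIV) \<partial>count_space UNIV)"
proof -
  have "kernel_app (kernel_app \<nu> K) (\<lambda>_ _. 1) () = kernel_app \<nu> (\<lambda>x. kernel_app (K x) (\<lambda>_ _. 1)) ()"
  proof (rule kernel_app_assoc)
    have "(\<integral>\<^sup>+x. \<integral>\<^sup>+y. ennreal \<bar>\<nu> x * K x y * 1\<bar> \<partial>count_space UNIV \<partial>count_space UNIV) =
        (\<integral>\<^sup>+x. ennreal \<bar>\<nu> x\<bar> * wnorm (\<lambda>_. 1) (K x) \<partial>count_space UNIV)"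
      unfolding wnorm_def by (simp add: abs_mult ennreal_mult nn_integral_cmult)
    then show "(\<integral>\<^sup>+x. \<integral>\<^sup>+y. ennreal \<bar>\<nu> x * K x y * 1\<bar> \<partial>count_space UNIV \<partial>count_space UNIV) < \<infinity>"
      using assms by simp
  qed
  then show ?thesis by (simp add: kernel_app_def)
qed

lemma integrable_wnorm:
  assumes "wnorm w \<nu> < \<infinity>" "\<And>x. 1 \<le> w x"
  shows "integrable (count_space UNIV) \<nu>"
proof (rule integrable_count_space_bound[where C = 1 and f = \<nu> and w = w])
  fix x
  show "\<bar>\<nu> x\<bar> \<le> 1 * (\<bar>\<nu> x\<bar> * w x)"
    using assms(2)[of x] mult_left_mono[of 1 "w x" "\<bar>\<nu> x\<bar>"] by simp
qed (use assms in auto)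

lemma integrable_mult_pmf:
  assumes "integrable (count_space UNIV) \<nu>"
  shows "integrable (count_space UNIV) (\<lambda>x. \<nu> x * pmf (K x) z)"
proof (rule Bochner_Integration.integrable_bound[OF assms])
  show "AE x in count_space UNIV. norm (\<nu> x * pmf (K x) z) \<le> norm (\<nu> x)"
    by (auto simp: abs_mult pmf_le_1 intro!: AE_I2 mult_left_le)
qed auto

lemma kernel_app_pmf_assoc:
  fixes \<nu> :: "'a::countable \<Rightarrow> real" and A :: "'a \<Rightarrow> 'b::countable pmf" and B :: "'b \<Rightarrow> 'c pmf"
  assumes "integrable (count_space UNIV) \<nu>"
  shows "kernel_app (kernel_app \<nu> (\<lambda>x. pmf (A x))) (\<lambda>y. pmf (B y)) z = kernel_app \<nu> (\<lambda>x. pmf (bind_pmf (A x) B)) z"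
  unfolding pmf_bind_kernel_app
proof (rule kernel_app_assoc)
  have "(\<integral>\<^sup>+x. \<integral>\<^sup>+y. ennreal \<bar>\<nu> x * pmf (A x) y * pmf (B y) z\<bar> \<partial>count_space UNIV \<partial>count_space UNIV) \<le>
     (\<integral>\<^sup>+x. \<integral>\<^sup>+y. ennreal \<bar>\<nu> x\<bar> * ennreal (pmf (A x) y) \<partial>count_space UNIV \<partial>count_space UNIV)"
    by (intro nn_integral_mono) (auto simp: abs_mult ennreal_mult[symmetric] pmf_le_1 intro!: ennreal_leI mult_left_le)
  also have "\<dots> = (\<integral>\<^sup>+x. ennreal \<bar>\<nu> x\<bar> \<partial>count_space UNIV)"
    by (simp add: nn_integral_cmult nn_integral_pmf)
  also have "\<dots> < \<infinity>" using assms by (simp add: integrable_iff_bounded)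
  finally show "(\<integral>\<^sup>+x. \<integral>\<^sup>+y. ennreal \<bar>\<nu> x * pmf (A x) y * pmf (B y) z\<bar> \<partial>count_space UNIV \<partial>count_space UNIV) < \<infinity>" .
qed

lemma integral_kernel_app_pmf:
  fixes \<nu> :: "'a::countable \<Rightarrow> real" and A :: "'a \<Rightarrow> 'b::countable pmf"
  assumes "integrable (count_space UNIV) \<nu>"
  shows "(\<integral>z. kernel_app \<nu> (\<lambda>x. pmf (A x)) z \<partial>count_space UNIV) = (\<integral>x. \<nu> x \<partial>count_space UNIV)"
proof -
  have "wnorm (\<lambda>_. 1) (pmf P) = 1" for P :: "'b pmf" by (simp add: wnorm_pmf)
  moreover have "(\<integral>z. pmf P z \<partial>count_space UNIV) = 1" for P :: "'b pmf" by (simp add: integral_pmf)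
  moreover have "(\<integral>\<^sup>+x. ennreal \<bar>\<nu> x\<bar> \<partial>count_space UNIV) < \<infinity>" using assms by (simp add: integrable_iff_bounded)
  ultimately show ?thesis by (subst integral_kernel_app) auto
qed

context ginar begin

abbreviation zero :: "nat list" where "zero \<equiv> replicate p 0"

text \<open>The joint Lyapunov function: \<open>D\<close> bounds the moments of order
  \<open>j\<close> scaled by \<open>\<epsilon> ^ j\<close>. Order \<open>j - 1\<close> enters order
  \<open>j\<close> as \<open>D / \<epsilon> ^ (j - 1)\<close>, that is \<open>\<epsilon>\<close>
  times the bound for order \<open>j\<close>, so a small \<open>\<epsilon>\<close> makes the
  coupling of the orders harmless.\<close>

definition good :: "real \<Rightarrow> nat \<Rightarrow> real \<Rightarrow> nat list pmf \<Rightarrow> bool" where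
  "good \<epsilon> m D \<mu> \<longleftrightarrow> (\<forall>j\<in>{1..m}. bnd j (D / \<epsilon> ^ j) \<mu>)"

lemma bnd_mono: "bnd j M \<mu> \<Longrightarrow> M \<le> M' \<Longrightarrow> bnd j M' \<mu>"
  unfolding bnd_def using theta by (meson ennreal_leI mult_right_mono order_trans zero_le_power less_imp_le)

lemma good_step:
  assumes imm: "immigration \<xi>' c" and m: "m \<le> L"
  shows "\<exists>\<epsilon> K \<rho>. 0 < \<epsilon> \<and> \<epsilon> \<le> 1 \<and> 0 \<le> K \<and> 0 \<le> \<rho> \<and> \<rho> < 1 \<and>
    (\<forall>u\<in>{0..1}. \<forall>\<mu> D. set_pmf \<mu> \<subseteq> {x. length x = p} \<longrightarrow> 0 \<le> D \<longrightarrow> good \<epsilon> m D \<mu> \<longrightarrow>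
      good \<epsilon> m (\<rho> * D + K * c) (bind_pmf \<mu> (Qk \<xi>' u)))"
proof -
  have c: "c = 0 \<or> c = 1" using imm by (auto simp: immigration_def)
  have "\<forall>j\<in>{1..m}. \<exists>K\<ge>0. \<forall>u\<in>{0..1}. \<forall>\<mu> M M'. set_pmf \<mu> \<subseteq> {x. length x = p} \<longrightarrow> 0 \<le> M \<longrightarrow> 0 \<le> M' \<longrightarrow> bnd j M \<mu> \<longrightarrow>
      (j \<noteq> 1 \<longrightarrow> bnd (j - 1) M' \<mu>) \<longrightarrow> bnd j (\<theta> * M + K * ((if j = 1 then 0 else M') + c)) (bind_pmf \<mu> (Qk \<xi>' u))"
    using bnd_step[OF imm] m by auto
  then obtain K where K: "\<And>j. j \<in> {1..m} \<Longrightarrow> 0 \<le> K j"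
     "\<And>j u \<mu> M M'. j \<in> {1..m} \<Longrightarrow> u \<in> {0..1} \<Longrightarrow> set_pmf \<mu> \<subseteq> {x. length x = p} \<Longrightarrow> 0 \<le> M \<Longrightarrow> 0 \<le> M' \<Longrightarrow> bnd j M \<mu> \<Longrightarrow>
      (j \<noteq> 1 \<Longrightarrow> bnd (j - 1) M' \<mu>) \<Longrightarrow> bnd j (\<theta> * M + K j * ((if j = 1 then 0 else M') + c)) (bind_pmf \<mu> (Qk \<xi>' u))"
    by (subst (asm) bchoice_iff) blast
  define K' where "K' = (\<Sum>j\<in>{1..m}. K j)"
  have K': "0 \<le> K'" "\<And>j. j \<in> {1..m} \<Longrightarrow> K j \<le> K'"
    using K(1) unfolding K'_def by (auto intro!: sum_nonneg member_le_sum)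
  \<comment> \<open>Half of the gap \<open>1 - \<theta>\<close> is spent on the lower orders:
    \<open>K' * \<epsilon>\<close> is at most \<open>(1 - \<theta>) / 2\<close>. The summand 1
    covers \<open>K' = 0\<close> and keeps \<open>\<epsilon>\<close> below 1.\<close>
  define \<epsilon> where "\<epsilon> = (1 - \<theta>) / 2 / (K' + 1)"
  have \<epsilon>: "0 < \<epsilon>" "\<epsilon> \<le> 1" "\<theta> + K' * \<epsilon> < 1"
  proof -
    show "0 < \<epsilon>" using theta K' by (simp add: \<epsilon>_def)
    show "\<epsilon> \<le> 1" using theta K' by (simp add: \<epsilon>_def field_simps)
    have "K' * \<epsilon> \<le> (K' + 1) * \<epsilon>" using \<open>0 < \<epsilon>\<close> by (intro mult_right_mono) auto
    also have "\<dots> = (1 - \<theta>) / 2"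
    proof -
      have "x * (y / 2 / x) = y / 2" if "x \<noteq> 0" for x y :: real using that by simp
      from this[of "K' + 1"] show ?thesis using K'(1) by (simp only: \<epsilon>_def)
    qed
    also have "(1 - \<theta>) / 2 < 1 - \<theta>" using theta(2) by simp
    finally show "\<theta> + K' * \<epsilon> < 1" by (simp add: less_diff_eq add.commute)
  qed
  show ?thesis
  proof (rule exI[of _ \<epsilon>], rule exI[of _ K'], rule exI[of _ "\<theta> + K' * \<epsilon>"], intro conjI ballI allI impI)
    fix u \<mu> D assume u: "u \<in> {0..1::real}" and \<mu>: "set_pmf \<mu> \<subseteq> {x. length x = p}" and D: "0 \<le> D" and g: "good \<epsilon> m D \<mu>"
    show "good \<epsilon> m ((\<theta> + K' * \<epsilon>) * D + K' * c) (bind_pmf \<mu> (Qk \<xi>' u))"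
      unfolding good_def
    proof
      fix j assume j: "j \<in> {1..m}"
      have "bnd j (\<theta> * (D / \<epsilon> ^ j) + K j * ((if j = 1 then 0 else D / \<epsilon> ^ (j - 1)) + c)) (bind_pmf \<mu> (Qk \<xi>' u))"
      proof (intro K u \<mu> j)
        show "bnd j (D / \<epsilon> ^ j) \<mu>" using g j by (simp add: good_def)
        assume "j \<noteq> 1"
        then have "j - 1 \<in> {1..m}" using j by auto
        then show "bnd (j - 1) (D / \<epsilon> ^ (j - 1)) \<mu>" using g unfolding good_def by blast
      qed (use D \<epsilon> in auto)
      moreover have "\<theta> * (D / \<epsilon> ^ j) + K j * ((if j = 1 then 0 else D / \<epsilon> ^ (j - 1)) + c) \<le> ((\<theta> + K' * \<epsilon>) * D + K' * c) / \<epsilon> ^ j"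
      proof -
        have "(if j = 1 then 0 else D / \<epsilon> ^ (j - 1)) \<le> \<epsilon> * D / \<epsilon> ^ j"
          using j \<epsilon> D by (cases j) auto
        moreover have "c \<le> c / \<epsilon> ^ j"
        proof -
          have "\<epsilon> ^ j \<le> 1" using \<epsilon> by (intro power_le_one) auto
          then show ?thesis using c \<epsilon> by (auto simp: field_simps)
        qed
        ultimately have "(if j = 1 then 0 else D / \<epsilon> ^ (j - 1)) + c \<le> (\<epsilon> * D + c) / \<epsilon> ^ j"
          unfolding add_divide_distrib by (rule add_mono)
        moreover have "0 \<le> (if j = 1 then 0 else D / \<epsilon> ^ (j - 1)) + c" using D c \<epsilon> by auto
        ultimately have "K j * ((if j = 1 then 0 else D / \<epsilon> ^ (j - 1)) + c) \<le> K' * ((\<epsilon> * D + c) / \<epsilon> ^ j)"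
          using K'(2)[OF j] K' by (intro mult_mono) auto
        then have "\<theta> * (D / \<epsilon> ^ j) + K j * ((if j = 1 then 0 else D / \<epsilon> ^ (j - 1)) + c) \<le> \<theta> * (D / \<epsilon> ^ j) + K' * ((\<epsilon> * D + c) / \<epsilon> ^ j)"
          by (rule add_left_mono)
        also have "\<dots> = (\<theta> * D + K' * (\<epsilon> * D + c)) / \<epsilon> ^ j"
          by (simp add: add_divide_distrib distrib_left)
        also have "\<theta> * D + K' * (\<epsilon> * D + c) = (\<theta> + K' * \<epsilon>) * D + K' * c"
          by (simp add: algebra_simps)
        finally show ?thesis .
      qed
      ultimately show "bnd j (((\<theta> + K' * \<epsilon>) * D + K' * c) / \<epsilon> ^ j) (bind_pmf \<mu> (Qk \<xi>' u))"
        by (rule bnd_mono)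
    qed
  qed (use \<epsilon> K' theta in auto)
qed

lemma set_Qk: "length x = p \<Longrightarrow> set_pmf (Qk \<xi>' u x) \<subseteq> {x. length x = p}"
  using p by (auto simp: companion_kernel_def)

lemma set_iter: "length x = p \<Longrightarrow> set_pmf (iter (Qk \<xi>') us x) \<subseteq> {x. length x = p}"
proof (induction us arbitrary: x)
  case (Cons u us)
  then show ?case using set_Qk[of x \<xi>' u] by (auto simp: set_bind_pmf)
qed auto

lemma set_bind_Qk: "set_pmf \<mu> \<subseteq> {x. length x = p} \<Longrightarrow> set_pmf (bind_pmf \<mu> (Qk \<xi>' u)) \<subseteq> {x. length x = p}"
  using set_Qk[of _ \<xi>' u] by (auto simp: set_bind_pmf)

text \<open>Sizes are integers, so \<open>(x ! i) ^ j <= (sum_list x) ^ m\<close> for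
  \<open>1 <= j <= m\<close> without an additive constant. Hence the bound is 0 at the zero state
  and otherwise proportional to the moment wanted; dividing by \<open>\<theta> ^ p\<close> pays for
  the factors \<open>\<theta> ^ i\<close>.\<close>

lemma good_return:
  assumes "length x = p" "0 < \<epsilon>" "\<epsilon> \<le> 1"
  shows "good \<epsilon> m (real (sum_list x) ^ m / \<theta> ^ p) (return_pmf x)"
  unfolding good_def bnd_def
proof (intro ballI allI impI)
  fix j i assume j: "j \<in> {1..m}" and i: "i < p"
  let ?s = "real (sum_list x)"
  have xi: "x ! i \<le> sum_list x" using i assms by (intro elem_le_sum_list) auto
  have "real (x ! i) ^ j \<le> ?s ^ m"
  proof (cases "sum_list x = 0")
    case True
    then show ?thesis using xi j by (simp only: le_zero_eq) (auto simp: power_0_left)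
  next
    case False
    have "real (x ! i) ^ j \<le> ?s ^ j" using xi by (intro power_mono) auto
    also have "\<dots> \<le> ?s ^ m"
    proof (rule power_increasing)
      show "1 \<le> ?s" using False by linarith
    qed (use j in auto)
    finally show ?thesis .
  qed
  also have "?s ^ m \<le> ?s ^ m / \<theta> ^ p / \<epsilon> ^ j * \<theta> ^ i"
  proof -
    have "\<theta> ^ p \<le> \<theta> ^ i" using theta i by (intro power_decreasing) auto
    moreover have "\<epsilon> ^ j \<le> 1" using assms by (intro power_le_one) auto
    ultimately have "\<theta> ^ p * \<epsilon> ^ j \<le> \<theta> ^ i * 1" using assms theta by (intro mult_mono) auto
    then have "1 \<le> \<theta> ^ i / (\<theta> ^ p * \<epsilon> ^ j)" using theta assms by (simp add: field_simps)
    then have "?s ^ m * 1 \<le> ?s ^ m * (\<theta> ^ i / (\<theta> ^ p * \<epsilon> ^ j))" by (rule mult_left_mono) auto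
    then show ?thesis by (simp add: mult_ac)
  qed
  finally show "(\<integral>\<^sup>+x. ennreal (real (x ! i) ^ j) \<partial>measure_pmf (return_pmf x)) \<le> ennreal (?s ^ m / \<theta> ^ p / \<epsilon> ^ j * \<theta> ^ i)"
    by (simp add: ennreal_leI)
qed

lemma sum_list_moment:
  assumes "set_pmf \<mu> \<subseteq> {x. length x = p}" "good \<epsilon> m D \<mu>" "0 \<le> D" "0 < \<epsilon>" "1 \<le> m"
  shows "(\<integral>\<^sup>+x. ennreal (real (sum_list x) ^ m) \<partial>measure_pmf \<mu>) \<le> ennreal (real p ^ Suc m / \<epsilon> ^ m * D)"
proof -
  have "(\<integral>\<^sup>+x. ennreal (real (sum_list x) ^ m) \<partial>measure_pmf \<mu>) \<le>
     (\<integral>\<^sup>+x. ennreal (real p ^ m) * (\<Sum>i<p. ennreal (real (x ! i) ^ m)) \<partial>measure_pmf \<mu>)"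
  proof (intro nn_integral_mono_AE, subst AE_measure_pmf_iff, intro ballI)
    fix x assume "x \<in> set_pmf \<mu>"
    then have x: "length x = p" using assms by auto
    have "real (sum_list x) ^ m \<le> real p ^ m * (\<Sum>i<p. real (x ! i) ^ m)"
      using sum_power_le_power_sum[of p "\<lambda>i. real (x ! i)" m] p x by (simp add: sum_list_nth)
    then show "ennreal (real (sum_list x) ^ m) \<le> ennreal (real p ^ m) * (\<Sum>i<p. ennreal (real (x ! i) ^ m))"
      by (simp add: ennreal_mult[symmetric] sum_nonneg ennreal_leI)
  qed
  also have "\<dots> = ennreal (real p ^ m) * (\<Sum>i<p. \<integral>\<^sup>+x. ennreal (real (x ! i) ^ m) \<partial>measure_pmf \<mu>)"
    by (simp add: nn_integral_cmult nn_integral_sum del: sum_ennreal)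
  also have "\<dots> \<le> ennreal (real p ^ m) * (\<Sum>i<p. ennreal (D / \<epsilon> ^ m))"
  proof (intro mult_left_mono sum_mono)
    fix i assume i: "i \<in> {..<p}"
    have "(\<integral>\<^sup>+x. ennreal (real (x ! i) ^ m) \<partial>measure_pmf \<mu>) \<le> ennreal (D / \<epsilon> ^ m * \<theta> ^ i)"
      using assms i by (auto simp: good_def bnd_def)
    also have "\<dots> \<le> ennreal (D / \<epsilon> ^ m)"
      using theta assms by (intro ennreal_leI mult_left_le power_le_one) auto
    finally show "(\<integral>\<^sup>+x. ennreal (real (x ! i) ^ m) \<partial>measure_pmf \<mu>) \<le> ennreal (D / \<epsilon> ^ m)" .
  qed auto
  also have "\<dots> = ennreal (real p ^ Suc m / \<epsilon> ^ m * D)"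
    using assms by (simp add: ennreal_of_nat_eq_real_of_nat ennreal_mult[symmetric] mult_ac)
  finally show ?thesis .
qed

text \<open>A nonzero integer size \<open>s\<close> satisfies \<open>1 + s <= 2 * s\<close>, so on
  survival the weight is at most \<open>2 ^ m\<close> times the pure moment. The decay of that
  moment controls the survival probability and the size on survival at once.\<close>

lemma offspring_decay:
  assumes m: "1 \<le> m" "m \<le> L"
  shows "\<exists>C\<ge>0. \<exists>\<rho>. 0 \<le> \<rho> \<and> \<rho> < 1 \<and> (\<forall>us x. set us \<subseteq> {0..1} \<longrightarrow> length x = p \<longrightarrow>
     (\<integral>\<^sup>+z. ennreal (if sum_list z = 0 then 0 else wt sum_list m z) \<partial>measure_pmf (iter (Qk (\<lambda>_. return_pmf 0)) us x))
       \<le> ennreal (C * \<rho> ^ length us * wt sum_list m x))"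
proof -
  let ?Q = "Qk (\<lambda>_. return_pmf 0)"
  have imm: "immigration (\<lambda>_. return_pmf 0) 0" by (simp add: immigration_def)
  obtain \<epsilon> K \<rho> where \<epsilon>: "0 < \<epsilon>" "\<epsilon> \<le> 1" and \<rho>: "0 \<le> \<rho>" "\<rho> < 1"
    and step: "\<And>u \<mu> D. u \<in> {0..1} \<Longrightarrow> set_pmf \<mu> \<subseteq> {x. length x = p} \<Longrightarrow> 0 \<le> D \<Longrightarrow> good \<epsilon> m D \<mu> \<Longrightarrow>
      good \<epsilon> m (\<rho> * D) (bind_pmf \<mu> (?Q u))"
    using good_step[OF imm m(2)] by auto
  have iter: "good \<epsilon> m (\<rho> ^ length us * D) (bind_pmf \<mu> (iter ?Q us))"
    if "set us \<subseteq> {0..1}" "set_pmf \<mu> \<subseteq> {x. length x = p}" "0 \<le> D" "good \<epsilon> m D \<mu>" for us \<mu> D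
    using that
  proof (induction us arbitrary: \<mu> D)
    case Nil
    then show ?case by (simp add: bind_return_pmf')
  next
    case (Cons u us)
    have "good \<epsilon> m (\<rho> ^ length us * (\<rho> * D)) (bind_pmf (bind_pmf \<mu> (?Q u)) (iter ?Q us))"
      using Cons.prems \<rho> by (intro Cons.IH step set_bind_Qk) auto
    moreover have "iter ?Q (u # us) = (\<lambda>x. bind_pmf (?Q u x) (iter ?Q us))" by (simp add: fun_eq_iff)
    ultimately show ?case by (simp only: bind_assoc_pmf length_Cons power_Suc mult_ac)
  qed
  define C where "C = 2 ^ m * (real p ^ Suc m / \<epsilon> ^ m) / \<theta> ^ p"
  have "(\<integral>\<^sup>+z. ennreal (if sum_list z = 0 then 0 else wt sum_list m z) \<partial>measure_pmf (iter ?Q us x))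
       \<le> ennreal (C * \<rho> ^ length us * wt sum_list m x)" if us: "set us \<subseteq> {0..1}" and x: "length x = p" for us x
  proof -
    let ?D = "\<rho> ^ length us * (real (sum_list x) ^ m / \<theta> ^ p)"
    have g: "good \<epsilon> m ?D (iter ?Q us x)"
      using iter[OF us, of "return_pmf x" "real (sum_list x) ^ m / \<theta> ^ p"] good_return[OF x \<epsilon>, of m] x theta
      by (simp add: bind_return_pmf)
    have "(\<integral>\<^sup>+z. ennreal (if sum_list z = 0 then 0 else wt sum_list m z) \<partial>measure_pmf (iter ?Q us x)) \<le>
       (\<integral>\<^sup>+z. ennreal (2 ^ m) * ennreal (real (sum_list z) ^ m) \<partial>measure_pmf (iter ?Q us x))"
    proof (rule nn_integral_mono)
      fix z
      have "(if sum_list z = 0 then 0 else wt sum_list m z) \<le> 2 ^ m * real (sum_list z) ^ m"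
      proof (cases "sum_list z = 0")
        case False
        have "1 \<le> real (sum_list z)" using False by linarith
        then have "(1 + real (sum_list z)) ^ m \<le> (2 * real (sum_list z)) ^ m" by (intro power_mono) auto
        then show ?thesis using False by (simp add: wt_def power_mult_distrib)
      qed auto
      then show "ennreal (if sum_list z = 0 then 0 else wt sum_list m z) \<le> ennreal (2 ^ m) * ennreal (real (sum_list z) ^ m)"
        by (simp add: ennreal_mult[symmetric] ennreal_leI)
    qed
    also have "\<dots> = ennreal (2 ^ m) * (\<integral>\<^sup>+z. ennreal (real (sum_list z) ^ m) \<partial>measure_pmf (iter ?Q us x))"
      by (rule nn_integral_cmult) auto
    also have "\<dots> \<le> ennreal (2 ^ m) * ennreal (real p ^ Suc m / \<epsilon> ^ m * ?D)"
      using \<rho> theta \<epsilon> m by (intro mult_left_mono sum_list_moment[OF set_iter[OF x] g]) auto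
    also have "\<dots> = ennreal (C * \<rho> ^ length us * real (sum_list x) ^ m)"
      using \<epsilon> theta \<rho> by (simp add: ennreal_mult[symmetric] C_def mult_ac)
    also have "\<dots> \<le> ennreal (C * \<rho> ^ length us * wt sum_list m x)"
      using \<epsilon> theta \<rho> by (intro ennreal_leI mult_left_mono) (auto simp: wt_def C_def intro: power_mono)
    finally show ?thesis .
  qed
  moreover have "0 \<le> C" using \<epsilon> theta by (simp add: C_def)
  ultimately show ?thesis using \<rho> by blast
qed

lemma zero_moment:
  assumes m: "1 \<le> m" "m \<le> L"
  shows "\<exists>C\<ge>0. \<forall>us. set us \<subseteq> {0..1} \<longrightarrow> (\<integral>\<^sup>+z. ennreal (wt sum_list m z) \<partial>measure_pmf (iter (Qk \<xi>) us zero)) \<le> ennreal C"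
proof -
  have imm: "immigration \<xi> 1" by (simp add: immigration_def)
  obtain \<epsilon> K \<rho> where \<epsilon>: "0 < \<epsilon>" "\<epsilon> \<le> 1" and K: "0 \<le> K" and \<rho>: "0 \<le> \<rho>" "\<rho> < 1"
    and step: "\<And>u \<mu> D. u \<in> {0..1} \<Longrightarrow> set_pmf \<mu> \<subseteq> {x. length x = p} \<Longrightarrow> 0 \<le> D \<Longrightarrow> good \<epsilon> m D \<mu> \<Longrightarrow>
      good \<epsilon> m (\<rho> * D + K) (bind_pmf \<mu> (Qk \<xi> u))"
    using good_step[OF imm m(2)] by auto
  \<comment> \<open>The fixed point of \<open>D \<mapsto> \<rho> * D + K\<close>. The zero state has
    bound 0, hence starts below it, and no later step exceeds it.\<close>
  define D where "D = K / (1 - \<rho>)"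
  have D: "0 \<le> D" "\<rho> * D + K = D" using K \<rho> by (auto simp: D_def field_simps)
  have iter: "good \<epsilon> m D (bind_pmf \<mu> (iter (Qk \<xi>) us))"
    if "set us \<subseteq> {0..1}" "set_pmf \<mu> \<subseteq> {x. length x = p}" "good \<epsilon> m D \<mu>" for us \<mu>
    using that
  proof (induction us arbitrary: \<mu>)
    case Nil
    then show ?case by (simp add: bind_return_pmf')
  next
    case (Cons u us)
    have "good \<epsilon> m D (bind_pmf (bind_pmf \<mu> (Qk \<xi> u)) (iter (Qk \<xi>) us))"
      using Cons.prems D step[of u \<mu> D] by (intro Cons.IH set_bind_Qk) auto
    moreover have "iter (Qk \<xi>) (u # us) = (\<lambda>x. bind_pmf (Qk \<xi> u x) (iter (Qk \<xi>) us))" by (simp add: fun_eq_iff)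
    ultimately show ?case by (simp only: bind_assoc_pmf)
  qed
  define C where "C = 2 ^ m * (1 + real p ^ Suc m / \<epsilon> ^ m * D)"
  have "(\<integral>\<^sup>+z. ennreal (wt sum_list m z) \<partial>measure_pmf (iter (Qk \<xi>) us zero)) \<le> ennreal C" if us: "set us \<subseteq> {0..1}" for us
  proof -
    have "good \<epsilon> m 0 (return_pmf zero)"
      using good_return[of zero \<epsilon> m] \<epsilon> m by (simp add: sum_list_replicate power_0_left)
    then have "good \<epsilon> m D (return_pmf zero)"
      unfolding good_def using D \<epsilon> by (auto intro: bnd_mono)
    then have g: "good \<epsilon> m D (iter (Qk \<xi>) us zero)"
      using iter[OF us, of "return_pmf zero"] by (simp add: bind_return_pmf)
    have "(\<integral>\<^sup>+z. ennreal (wt sum_list m z) \<partial>measure_pmf (iter (Qk \<xi>) us zero)) \<le>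
       (\<integral>\<^sup>+z. ennreal (2 ^ m) * (1 + ennreal (real (sum_list z) ^ m)) \<partial>measure_pmf (iter (Qk \<xi>) us zero))"
    proof (rule nn_integral_mono)
      fix z
      let ?s = "real (sum_list z)"
      have "(1 + ?s) ^ m \<le> (2 * max 1 ?s) ^ m" by (intro power_mono) auto
      also have "\<dots> \<le> 2 ^ m * (1 + ?s ^ m)"
        unfolding power_mult_distrib by (intro mult_left_mono) (auto simp: max_def)
      finally show "ennreal (wt sum_list m z) \<le> ennreal (2 ^ m) * (1 + ennreal (?s ^ m))"
        by (simp add: wt_def ennreal_mult[symmetric] ennreal_leI ennreal_1[symmetric] ennreal_plus[symmetric] del: ennreal_1 ennreal_plus)
    qed
    also have "\<dots> = ennreal (2 ^ m) * (1 + (\<integral>\<^sup>+z. ennreal (real (sum_list z) ^ m) \<partial>measure_pmf (iter (Qk \<xi>) us zero)))"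
      by (subst nn_integral_cmult) (auto simp: nn_integral_add)
    also have "\<dots> \<le> ennreal (2 ^ m) * (1 + ennreal (real p ^ Suc m / \<epsilon> ^ m * D))"
      using D \<epsilon> m by (intro mult_left_mono add_left_mono sum_list_moment[OF set_iter g]) auto
    also have "\<dots> = ennreal C"
      using D \<epsilon> by (simp add: C_def ennreal_mult[symmetric] ennreal_1[symmetric] ennreal_plus[symmetric] del: ennreal_1 ennreal_plus)
    finally show ?thesis .
  qed
  moreover have "0 \<le> C" using D \<epsilon> by (simp add: C_def)
  ultimately show ?thesis by blast
qed

lemma Qk_add:
  assumes "length z = p" "length x = p"
  shows "Qk \<xi> u (map2 (+) z x) = map_pmf (\<lambda>(z, x). map2 (+) z x) (pair_pmf (Qk (\<lambda>_. return_pmf 0) u z) (Qk \<xi> u x))"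
proof -
  have tl: "tl (map2 (+) z x) = map2 (+) (tl z) (tl x)"
    by (cases z; cases x) auto
  show ?thesis
    unfolding companion_kernel_def conv_branching_kernel[OF assms, symmetric] conv_pmf_def pair_map_pmf1 pair_map_pmf2 tl
    using assms by (simp add: pmf.map_comp o_def split_beta zip_append)
qed

text \<open>The branching property along a whole product of kernels: the two components are started
  separately and remain independent, since \<open>pair_pmf\<close> commutes with a step of
  each.\<close>

lemma iter_add:
  assumes "length z = p" "length x = p"
  shows "iter (Qk \<xi>) us (map2 (+) z x) =
    map_pmf (\<lambda>(z, x). map2 (+) z x) (pair_pmf (iter (Qk (\<lambda>_. return_pmf 0)) us z) (iter (Qk \<xi>) us x))"
  using assms
proof (induction us arbitrary: z x)
  case Nil
  then show ?case by (simp add: pair_return_pmf1)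
next
  case (Cons u us)
  let ?Z = "Qk (\<lambda>_. return_pmf 0)"
  have "iter (Qk \<xi>) (u # us) (map2 (+) z x) =
      bind_pmf (?Z u z) (\<lambda>z'. bind_pmf (Qk \<xi> u x) (\<lambda>x'. iter (Qk \<xi>) us (map2 (+) z' x')))"
    by (simp add: Qk_add[OF Cons.prems] bind_map_pmf pair_pmf_def bind_assoc_pmf bind_return_pmf)
  also have "\<dots> = bind_pmf (?Z u z) (\<lambda>z'. bind_pmf (Qk \<xi> u x) (\<lambda>x'.
      map_pmf (\<lambda>(z, x). map2 (+) z x) (pair_pmf (iter ?Z us z') (iter (Qk \<xi>) us x'))))"
    using set_Qk Cons.prems by (intro bind_pmf_cong refl Cons.IH) blast+
  also have "\<dots> = map_pmf (\<lambda>(z, x). map2 (+) z x) (pair_pmf (iter ?Z (u # us) z) (iter (Qk \<xi>) (u # us) x))"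
    by (simp add: pair_pmf_bind map_bind_pmf)
  finally show ?case .
qed

lemma sum_list_map2_add: "length z = length x \<Longrightarrow> sum_list (map2 (+) z x) = sum_list z + sum_list (x :: nat list)"
  by (induction z x rule: list_induct2) auto

lemma map2_add_zero: "length z = length x \<Longrightarrow> sum_list z = 0 \<Longrightarrow> map2 (+) z x = (x :: nat list)"
  by (induction z x rule: list_induct2) auto

lemma map2_add_replicate: "length x = n \<Longrightarrow> map2 (+) x (replicate n 0) = (x :: nat list)"
  by (induction x arbitrary: n) auto

text \<open>In the coupling the states are \<open>z + y\<close> and \<open>y\<close>, which differ
  only if \<open>z\<close> is nonzero. The weight is submultiplicative in \<open>z\<close> and
  \<open>y\<close>, so by independence the coupling bound splits into \<open>offspring_decay\<close>
  for \<open>z\<close> and \<open>zero_moment\<close> for \<open>y\<close>.\<close>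

lemma point_contraction:
  assumes m: "1 \<le> m" "m \<le> L"
  shows "\<exists>C\<ge>0. \<exists>\<rho>. 0 \<le> \<rho> \<and> \<rho> < 1 \<and> (\<forall>us x. set us \<subseteq> {0..1} \<longrightarrow> length x = p \<longrightarrow>
     wnorm (wt sum_list m) (\<lambda>v. pmf (iter (Qk \<xi>) us x) v - pmf (iter (Qk \<xi>) us zero) v) \<le> ennreal (C * \<rho> ^ length us * wt sum_list m x))"
proof -
  let ?Z = "Qk (\<lambda>_. return_pmf 0)"
  obtain C1 \<rho> where C1: "0 \<le> C1" and \<rho>: "0 \<le> \<rho>" "\<rho> < 1" and Z: "\<And>us x. set us \<subseteq> {0..1} \<Longrightarrow> length x = p \<Longrightarrow>
     (\<integral>\<^sup>+z. ennreal (if sum_list z = 0 then 0 else wt sum_list m z) \<partial>measure_pmf (iter ?Z us x))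
       \<le> ennreal (C1 * \<rho> ^ length us * wt sum_list m x)"
    using offspring_decay[OF m] by blast
  obtain C2 where C2: "0 \<le> C2" and X: "\<And>us. set us \<subseteq> {0..1} \<Longrightarrow> (\<integral>\<^sup>+z. ennreal (wt sum_list m z) \<partial>measure_pmf (iter (Qk \<xi>) us zero)) \<le> ennreal C2"
    using zero_moment[OF m] by blast
  have "wnorm (wt sum_list m) (\<lambda>v. pmf (iter (Qk \<xi>) us x) v - pmf (iter (Qk \<xi>) us zero) v) \<le> ennreal (2 * C1 * C2 * \<rho> ^ length us * wt sum_list m x)"
    if us: "set us \<subseteq> {0..1}" and x: "length x = p" for us x
  proof -
    let ?J = "pair_pmf (iter ?Z us x) (iter (Qk \<xi>) us zero)"
    let ?f = "\<lambda>(z, y). map2 (+) z (y :: nat list)"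
    have 1: "iter (Qk \<xi>) us x = map_pmf ?f ?J"
      using iter_add[OF x, of zero us] x by (simp add: map2_add_replicate)
    have 2: "iter (Qk \<xi>) us zero = map_pmf snd ?J" by (simp add: map_snd_pair_pmf)
    have "wnorm (wt sum_list m) (\<lambda>v. pmf (map_pmf ?f ?J) v - pmf (map_pmf snd ?J) v) \<le>
      (\<integral>\<^sup>+\<omega>. (if ?f \<omega> = snd \<omega> then 0 else ennreal (wt sum_list m (?f \<omega>) + wt sum_list m (snd \<omega>))) \<partial>measure_pmf ?J)"
      by (rule wnorm_coupling) auto
    also have "\<dots> \<le> (\<integral>\<^sup>+\<omega>. 2 * (ennreal (if sum_list (fst \<omega>) = 0 then 0 else wt sum_list m (fst \<omega>)) * ennreal (wt sum_list m (snd \<omega>))) \<partial>measure_pmf ?J)"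
    proof (intro nn_integral_mono_AE, subst AE_measure_pmf_iff, intro ballI)
      fix \<omega> assume "\<omega> \<in> set_pmf ?J"
      moreover obtain z y where \<omega>: "\<omega> = (z, y)" by (cases \<omega>)
      ultimately have l: "length z = p" "length y = p"
        using set_iter[OF x, of "\<lambda>_. return_pmf 0" us] set_iter[of zero \<xi> us] by auto
      show "(if ?f \<omega> = snd \<omega> then 0 else ennreal (wt sum_list m (?f \<omega>) + wt sum_list m (snd \<omega>))) \<le>
         2 * (ennreal (if sum_list (fst \<omega>) = 0 then 0 else wt sum_list m (fst \<omega>)) * ennreal (wt sum_list m (snd \<omega>)))"
      proof (cases "sum_list z = 0")
        case True
        then have "map2 (+) z y = y" using l by (intro map2_add_zero) auto
        then show ?thesis by (simp add: \<omega>)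
      next
        case False
        have "wt sum_list m (map2 (+) z y) \<le> ((1 + real (sum_list z)) * (1 + real (sum_list y))) ^ m"
          using l unfolding wt_def by (intro power_mono) (auto simp: sum_list_map2_add distrib_left distrib_right)
        then have "wt sum_list m (map2 (+) z y) \<le> wt sum_list m z * wt sum_list m y"
          by (simp add: wt_def power_mult_distrib)
        moreover have "1 * wt sum_list m y \<le> wt sum_list m z * wt sum_list m y"
          by (intro mult_right_mono) auto
        ultimately have "wt sum_list m (map2 (+) z y) + wt sum_list m y \<le> 2 * (wt sum_list m z * wt sum_list m y)" by linarith
        then have "ennreal (wt sum_list m (map2 (+) z y) + wt sum_list m y) \<le> ennreal (2 * (wt sum_list m z * wt sum_list m y))"
          by (rule ennreal_leI)
        also have "\<dots> = 2 * (ennreal (wt sum_list m z) * ennreal (wt sum_list m y))"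
          by (simp add: ennreal_mult)
        finally show ?thesis using False by (auto simp: \<omega>)
      qed
    qed
    also have "\<dots> = 2 * ((\<integral>\<^sup>+z. ennreal (if sum_list z = 0 then 0 else wt sum_list m z) \<partial>measure_pmf (iter ?Z us x)) *
        (\<integral>\<^sup>+y. ennreal (wt sum_list m y) \<partial>measure_pmf (iter (Qk \<xi>) us zero)))"
      unfolding nn_integral_pair_pmf_mult[where F = "\<lambda>z. ennreal (if sum_list z = 0 then 0 else wt sum_list m z)" and G = "\<lambda>y. ennreal (wt sum_list m y)", symmetric]
      by (rule nn_integral_cmult) simp
    also have "\<dots> \<le> 2 * (ennreal (C1 * \<rho> ^ length us * wt sum_list m x) * ennreal C2)"
      by (intro mult_left_mono mult_mono Z X us x) auto
    also have "\<dots> = ennreal (2 * (C1 * \<rho> ^ length us * wt sum_list m x * C2))"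
      using C1 C2 \<rho> by (simp add: ennreal_mult)
    finally show ?thesis unfolding 1[symmetric] 2[symmetric] by (simp add: mult_ac)
  qed
  then show ?thesis using C1 C2 \<rho> by (intro exI[of _ "2 * C1 * C2"] conjI exI[of _ \<rho>]) auto
qed

end

section \<open>Derivatives of the invariant law\<close>

lemma wt_add_le:
  "(1 + real s + real y) ^ m \<le> 2 ^ m * ((1 + real s) ^ m + (1 + real y) ^ m)"
proof -
  have "(1 + real s + real y) ^ m \<le> (2 * max (1 + real s) (1 + real y)) ^ m"
    unfolding max_def by (intro power_mono) auto
  also have "\<dots> \<le> 2 ^ m * ((1 + real s) ^ m + (1 + real y) ^ m)"
    unfolding power_mult_distrib by (intro mult_left_mono) (auto simp: max_def)
  finally show ?thesis .
qed

text \<open>Here the size added by the map depends on the starting state and must not enter with too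
  high a power. Splitting \<open>(1 + s + y) ^ m\<close> into \<open>(1 + s) ^ m\<close> and
  \<open>(1 + y) ^ m\<close> pairs the first with the mass and the second with the moment of order
  \<open>m\<close>; both give total exponent \<open>m + r\<close>, where submultiplicativity would
  give \<open>2 * m + r\<close>.\<close>

lemma wnorm_tower_map_bound:
  assumes h: "\<And>y. sz' (h y) \<le> s + sz y" and C: "0 \<le> C"
    and m: "wnorm (wt sz m) (T r u) \<le> ennreal (C * (1 + real s) ^ (m + r))"
    and z: "wnorm (wt sz 0) (T r u) \<le> ennreal (C * (1 + real s) ^ r)"
  shows "wnorm (wt sz' m) (tower_map h T r u) \<le> ennreal (2 ^ m * 2 * C * (1 + real s) ^ (m + r))"
proof -
  have "wnorm (wt sz' m) (tower_map h T r u) \<le> wnorm (\<lambda>y. wt sz' m (h y)) (T r u)"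
    by (rule wnorm_tower_map) auto
  also have "\<dots> \<le> (\<integral>\<^sup>+y. ennreal (2 ^ m * (1 + real s) ^ m) * ennreal (\<bar>T r u y\<bar> * wt sz 0 y) +
      ennreal (2 ^ m) * ennreal (\<bar>T r u y\<bar> * wt sz m y) \<partial>count_space UNIV)"
    unfolding wnorm_def
  proof (rule nn_integral_mono)
    fix y
    have "wt sz' m (h y) \<le> (1 + real s + real (sz y)) ^ m"
      unfolding wt_def using h[of y] by (intro power_mono) linarith+
    also have "\<dots> \<le> 2 ^ m * ((1 + real s) ^ m + (1 + real (sz y)) ^ m)" by (rule wt_add_le)
    finally have "\<bar>T r u y\<bar> * wt sz' m (h y) \<le> \<bar>T r u y\<bar> * (2 ^ m * ((1 + real s) ^ m + (1 + real (sz y)) ^ m))"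
      by (rule mult_left_mono) auto
    also have "\<dots> = 2 ^ m * (1 + real s) ^ m * (\<bar>T r u y\<bar> * wt sz 0 y) + 2 ^ m * (\<bar>T r u y\<bar> * wt sz m y)"
      by (simp add: wt_def algebra_simps)
    finally have "ennreal (\<bar>T r u y\<bar> * wt sz' m (h y)) \<le> ennreal (2 ^ m * (1 + real s) ^ m * (\<bar>T r u y\<bar> * wt sz 0 y) + 2 ^ m * (\<bar>T r u y\<bar> * wt sz m y))"
      by (rule ennreal_leI)
    also have "\<dots> = ennreal (2 ^ m * (1 + real s) ^ m) * ennreal (\<bar>T r u y\<bar> * wt sz 0 y) + ennreal (2 ^ m) * ennreal (\<bar>T r u y\<bar> * wt sz m y)"
      by (subst ennreal_plus) (simp_all add: ennreal_mult[symmetric])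
    finally show "ennreal (\<bar>T r u y\<bar> * wt sz' m (h y)) \<le> \<dots>" .
  qed
  also have "\<dots> = ennreal (2 ^ m * (1 + real s) ^ m) * wnorm (wt sz 0) (T r u) + ennreal (2 ^ m) * wnorm (wt sz m) (T r u)"
    unfolding wnorm_def by (subst nn_integral_add) (auto simp: nn_integral_cmult)
  also have "\<dots> \<le> ennreal (2 ^ m * (1 + real s) ^ m) * ennreal (C * (1 + real s) ^ r) + ennreal (2 ^ m) * ennreal (C * (1 + real s) ^ (m + r))"
    by (intro add_mono mult_left_mono m z) auto
  also have "\<dots> = ennreal (2 ^ m * 2 * C * (1 + real s) ^ (m + r))"
    using C by (simp add: ennreal_mult[symmetric] ennreal_plus[symmetric] power_add mult_ac del: ennreal_plus)
  finally show ?thesis .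
qed

text \<open>A measure of mass 0 does not see a reference law that is the same for all starting
  points, so the kernel may be replaced by its difference from that law.\<close>

lemma kernel_app_diff_mass:
  assumes "integrable (count_space UNIV) \<nu>" "(\<integral>x. \<nu> x \<partial>count_space UNIV) = 0"
  shows "kernel_app \<nu> (\<lambda>x. pmf (K x)) z = kernel_app \<nu> (\<lambda>x z. pmf (K x) z - pmf P z) z"
proof -
  have "kernel_app \<nu> (\<lambda>x z. pmf (K x) z - pmf P z) z = (\<integral>x. \<nu> x * pmf (K x) z - \<nu> x * pmf P z \<partial>count_space UNIV)"
    by (simp add: kernel_app_def right_diff_distrib)
  also have "\<dots> = kernel_app \<nu> (\<lambda>x. pmf (K x)) z - (\<integral>x. \<nu> x * pmf P z \<partial>count_space UNIV)"
    unfolding kernel_app_def by (intro Bochner_Integration.integral_diff integrable_mult_pmf assms(1))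
  also have "(\<integral>x. \<nu> x * pmf P z \<partial>count_space UNIV) = 0" using assms by simp
  finally show ?thesis by simp
qed

text \<open>\<open>K * \<tau> ^ n\<close> is preserved by the recursion as soon as
  \<open>c <= K * (\<tau> - \<rho>)\<close>, which explains the constant. The strict inequality
  between \<open>\<rho>\<close> and \<open>\<tau>\<close> avoids the factor \<open>n\<close> that
  would appear for equal rates.\<close>

lemma geometric_recursion:
  fixes A :: "nat \<Rightarrow> ennreal"
  assumes A: "\<And>n. A (Suc n) \<le> ennreal \<rho> * A n + ennreal (c * \<sigma> ^ n)" "A 0 \<le> ennreal c0"
    and "0 \<le> \<rho>" "0 \<le> \<sigma>" "0 \<le> c" "0 \<le> c0" and \<tau>: "\<rho> < \<tau>" "\<sigma> \<le> \<tau>"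
  shows "A n \<le> ennreal ((c0 + c / (\<tau> - \<rho>)) * \<tau> ^ n)"
proof (induction n)
  case 0
  have "A 0 \<le> ennreal c0" by fact
  also have "\<dots> \<le> ennreal ((c0 + c / (\<tau> - \<rho>)) * \<tau> ^ 0)" using assms by (intro ennreal_leI) auto
  finally show ?case .
next
  case (Suc n)
  define K where "K = c0 + c / (\<tau> - \<rho>)"
  have "0 \<le> c0 * (\<tau> - \<rho>)" using assms by (intro mult_nonneg_nonneg) auto
  moreover have "K * (\<tau> - \<rho>) = c0 * (\<tau> - \<rho>) + c" using \<tau> by (simp add: K_def distrib_right)
  ultimately have K: "0 \<le> K" "c \<le> K * (\<tau> - \<rho>)"
    using assms by (auto simp: K_def)
  have "A (Suc n) \<le> ennreal \<rho> * ennreal (K * \<tau> ^ n) + ennreal (c * \<sigma> ^ n)"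
    using Suc by (intro order_trans[OF A(1)] add_mono mult_left_mono) (auto simp: K_def)
  also have "\<dots> = ennreal (\<rho> * (K * \<tau> ^ n) + c * \<sigma> ^ n)"
    using assms K by (simp add: ennreal_mult ennreal_plus)
  also have "\<dots> \<le> ennreal (K * \<tau> ^ Suc n)"
  proof (rule ennreal_leI)
    have "c * \<sigma> ^ n \<le> K * (\<tau> - \<rho>) * \<tau> ^ n"
      using assms K by (intro mult_mono power_mono) auto
    then show "\<rho> * (K * \<tau> ^ n) + c * \<sigma> ^ n \<le> K * \<tau> ^ Suc n" by (simp add: algebra_simps)
  qed
  finally show ?case by (simp add: K_def)
qed

lemma iter_Nil: "iter Q [] = return_pmf"
  by (simp add: fun_eq_iff)

context ginar begin

abbreviation wlist :: "nat \<Rightarrow> nat list \<Rightarrow> real" where "wlist \<equiv> wt sum_list"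

abbreviation Qp :: "real \<Rightarrow> nat list \<Rightarrow> nat list \<Rightarrow> real" where
  "Qp u x \<equiv> pmf (Qk \<xi> u x)"

definition centred :: "nat \<Rightarrow> (nat list \<Rightarrow> real) \<Rightarrow> bool" where
  "centred m \<nu> \<longleftrightarrow> (\<forall>x. length x \<noteq> p \<longrightarrow> \<nu> x = 0) \<and> wnorm (wlist m) \<nu> < \<infinity> \<and> (\<integral>x. \<nu> x \<partial>count_space UNIV) = 0"

lemma centred_integrable: "centred m \<nu> \<Longrightarrow> integrable (count_space UNIV) \<nu>"
  unfolding centred_def by (auto intro: integrable_wnorm)

lemma centred_add:
  assumes "centred m \<nu>" "centred m \<mu>" shows "centred m (\<lambda>x. \<nu> x + \<mu> x)"
proof -
  have "wnorm (wlist m) (\<lambda>x. \<nu> x + \<mu> x) \<le> wnorm (wlist m) \<nu> + wnorm (wlist m) \<mu>" by (rule wnorm_add) auto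
  also have "\<dots> < \<infinity>" using assms by (auto simp: centred_def)
  finally show ?thesis
    using assms centred_integrable[OF assms(1)] centred_integrable[OF assms(2)] by (auto simp: centred_def)
qed

lemma centred_uminus: "centred m \<nu> \<Longrightarrow> centred m (\<lambda>x. - \<nu> x)"
  by (auto simp: centred_def wnorm_uminus)

lemma centred_diff: "centred m \<nu> \<Longrightarrow> centred m \<mu> \<Longrightarrow> centred m (\<lambda>x. \<nu> x - \<mu> x)"
  using centred_add[of m \<nu> "\<lambda>x. - \<mu> x"] centred_uminus[of m \<mu>] by simp

lemma contraction:
  assumes m: "1 \<le> m" "m \<le> L"
  obtains C \<rho> where "0 \<le> C" "0 < \<rho>" "\<rho> < 1"
    "\<And>us \<nu>. set us \<subseteq> {0..1} \<Longrightarrow> centred m \<nu> \<Longrightarrow>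
       wnorm (wlist m) (kernel_app \<nu> (\<lambda>x. pmf (iter (Qk \<xi>) us x))) \<le> ennreal (C * \<rho> ^ length us) * wnorm (wlist m) \<nu>"
proof -
  obtain C \<rho>0 where C: "0 \<le> C" and \<rho>0: "0 \<le> \<rho>0" "\<rho>0 < 1" and pt: "\<And>us x. set us \<subseteq> {0..1} \<Longrightarrow> length x = p \<Longrightarrow>
     wnorm (wlist m) (\<lambda>v. pmf (iter (Qk \<xi>) us x) v - pmf (iter (Qk \<xi>) us zero) v) \<le> ennreal (C * \<rho>0 ^ length us * wlist m x)"
    using point_contraction[OF m] by blast
  \<comment> \<open>The rate is raised to at least \<open>1/2\<close> to be positive, because the
    adapted norm divides by its powers.\<close>
  define \<rho> where "\<rho> = max \<rho>0 (1/2)"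
  show ?thesis
  proof (rule that[OF C])
    show "0 < \<rho>" "\<rho> < 1" using \<rho>0 by (auto simp: \<rho>_def)
    fix us \<nu> assume us: "set us \<subseteq> {0..1::real}" and centred: "centred m \<nu>"
    have \<rho>le: "\<rho>0 ^ n \<le> \<rho> ^ n" for n using \<rho>0 by (intro power_mono) (auto simp: \<rho>_def)
    have "kernel_app \<nu> (\<lambda>x. pmf (iter (Qk \<xi>) us x)) = kernel_app \<nu> (\<lambda>x z. pmf (iter (Qk \<xi>) us x) z - pmf (iter (Qk \<xi>) us zero) z)"
      using centred by (intro ext kernel_app_diff_mass centred_integrable[OF centred]) (auto simp: centred_def)
    moreover have "wnorm (wlist m) (kernel_app \<nu> (\<lambda>x z. pmf (iter (Qk \<xi>) us x) z - pmf (iter (Qk \<xi>) us zero) z)) \<le> ennreal (C * \<rho> ^ length us) * wnorm (wlist m) \<nu>"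
    proof (rule wnorm_kernel_app_le)
      show "0 \<le> C * \<rho> ^ length us" using C by (simp add: \<rho>_def)
      fix x assume "\<nu> x \<noteq> 0"
      then have x: "length x = p" using centred by (auto simp: centred_def)
      have "C * \<rho>0 ^ length us * wlist m x \<le> C * \<rho> ^ length us * wlist m x"
        using C \<rho>le by (intro mult_right_mono mult_left_mono) auto
      then show "wnorm (wlist m) (\<lambda>z. pmf (iter (Qk \<xi>) us x) z - pmf (iter (Qk \<xi>) us zero) z) \<le> ennreal (C * \<rho> ^ length us * wlist m x)"
        using pt[OF us x] by (meson ennreal_leI order_trans)
    qed auto
    ultimately show "wnorm (wlist m) (kernel_app \<nu> (\<lambda>x. pmf (iter (Qk \<xi>) us x))) \<le> ennreal (C * \<rho> ^ length us) * wnorm (wlist m) \<nu>"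
      by simp
  qed
qed

lemma centred_kernel_app:
  assumes m: "1 \<le> m" "m \<le> L" and centred: "centred m \<nu>" and u: "u \<in> {0..1}"
  shows "centred m (kernel_app \<nu> (Qp u))"
  unfolding centred_def
proof (intro conjI allI impI)
  fix z :: "nat list" assume z: "length z \<noteq> p"
  have "pmf (Qk \<xi> u x) z = 0" if "length x = p" for x
    using set_Qk[OF that, of \<xi> u] z by (auto simp: set_pmf_iff)
  then show "kernel_app \<nu> (Qp u) z = 0"
    using centred by (subst kernel_app_finite[where S = "{}"]) (auto simp: centred_def)
next
  obtain C \<rho> where "0 \<le> C" "0 < \<rho>" "\<rho> < 1" and C:
    "\<And>us \<nu>. set us \<subseteq> {0..1} \<Longrightarrow> centred m \<nu> \<Longrightarrow>
       wnorm (wlist m) (kernel_app \<nu> (\<lambda>x. pmf (iter (Qk \<xi>) us x))) \<le> ennreal (C * \<rho> ^ length us) * wnorm (wlist m) \<nu>"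
    using contraction[OF m] by blast
  from C[of "[u]" \<nu>] u centred have "wnorm (wlist m) (kernel_app \<nu> (Qp u)) \<le> ennreal (C * \<rho>) * wnorm (wlist m) \<nu>"
    by (simp add: iter_Nil bind_return_pmf')
  also have "\<dots> < \<infinity>" using centred by (simp add: centred_def ennreal_mult_less_top)
  finally show "wnorm (wlist m) (kernel_app \<nu> (Qp u)) < \<infinity>" .
next
  show "(\<integral>x. kernel_app \<nu> (Qp u) x \<partial>count_space UNIV) = 0"
    using centred by (subst integral_kernel_app_pmf[OF centred_integrable[OF centred]]) (simp add: centred_def)
qed

text \<open>The norm is the supremum of \<open>\<rho>\<^sup>-\<^sup>n \<parallel>\<nu> Q\<^sub>u\<^sub>1 \<dots> Q\<^sub>u\<^sub>n\<parallel>\<close> over all finite products of kernels.\<close>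

lemma contracting_norm:
  assumes m: "1 \<le> m" "m \<le> L"
  obtains N :: "(nat list \<Rightarrow> real) \<Rightarrow> ennreal" and C \<rho> :: real where "0 \<le> C" "0 < \<rho>" "\<rho> < 1"
    "\<And>\<nu>. centred m \<nu> \<Longrightarrow> wnorm (wlist m) \<nu> \<le> N \<nu>"
    "\<And>\<nu>. centred m \<nu> \<Longrightarrow> N \<nu> \<le> ennreal C * wnorm (wlist m) \<nu>"
    "\<And>u \<nu>. u \<in> {0..1} \<Longrightarrow> centred m \<nu> \<Longrightarrow> N (kernel_app \<nu> (Qp u)) \<le> ennreal \<rho> * N \<nu>"
    "\<And>\<mu> \<nu>. centred m \<mu> \<Longrightarrow> centred m \<nu> \<Longrightarrow> N (\<lambda>x. \<mu> x + \<nu> x) \<le> N \<mu> + N \<nu>"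
proof -
  obtain C \<rho> where C0: "0 \<le> C" and \<rho>: "0 < \<rho>" "\<rho> < 1" and C:
    "\<And>us \<nu>. set us \<subseteq> {0..1} \<Longrightarrow> centred m \<nu> \<Longrightarrow>
       wnorm (wlist m) (kernel_app \<nu> (\<lambda>x. pmf (iter (Qk \<xi>) us x))) \<le> ennreal (C * \<rho> ^ length us) * wnorm (wlist m) \<nu>"
    using contraction[OF m] by blast
  let ?t = "\<lambda>\<nu> us. ennreal (1 / \<rho> ^ length us) * wnorm (wlist m) (kernel_app \<nu> (\<lambda>x. pmf (iter (Qk \<xi>) us x)))"
  define N where "N \<nu> = (SUP us\<in>{us. set us \<subseteq> {0..1}}. ?t \<nu> us)" for \<nu>
  show ?thesis
  proof (rule that[OF C0 \<rho>])
    fix \<nu> assume centred: "centred m \<nu>"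
    have "kernel_app \<nu> (\<lambda>x. pmf (return_pmf x)) = \<nu>"
      by (rule ext, subst kernel_app_finite[where S = "{_}"]) (auto simp: pmf_return indicator_def)
    then have "wnorm (wlist m) \<nu> = ?t \<nu> []" by simp
    also have "\<dots> \<le> N \<nu>" unfolding N_def by (rule SUP_upper) auto
    finally show "wnorm (wlist m) \<nu> \<le> N \<nu>" .
    show "N \<nu> \<le> ennreal C * wnorm (wlist m) \<nu>"
      unfolding N_def
    proof (rule SUP_least)
      fix us assume "us \<in> {us. set us \<subseteq> {0..1::real}}"
      then have "?t \<nu> us \<le> ennreal (1 / \<rho> ^ length us) * (ennreal (C * \<rho> ^ length us) * wnorm (wlist m) \<nu>)"
        using centred by (intro mult_left_mono C) auto
      also have "\<dots> = ennreal C * wnorm (wlist m) \<nu>"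
        using \<rho> C0 by (simp add: mult.assoc[symmetric] ennreal_mult[symmetric])
      finally show "?t \<nu> us \<le> ennreal C * wnorm (wlist m) \<nu>" .
    qed
    fix u :: real assume u: "u \<in> {0..1}"
    show "N (kernel_app \<nu> (Qp u)) \<le> ennreal \<rho> * N \<nu>"
      unfolding N_def[of "kernel_app \<nu> (Qp u)"]
    proof (rule SUP_least)
      fix us assume us: "us \<in> {us. set us \<subseteq> {0..1::real}}"
      have "kernel_app (kernel_app \<nu> (Qp u)) (\<lambda>x. pmf (iter (Qk \<xi>) us x)) = kernel_app \<nu> (\<lambda>x. pmf (iter (Qk \<xi>) (u # us) x))"
        unfolding iter.simps by (intro ext kernel_app_pmf_assoc centred_integrable[OF centred])
      \<comment> \<open>A product applied after \<open>Q_u\<close> is one of the products in the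
        supremum for \<open>\<nu>\<close>, with one factor more; this factor is worth exactly
        \<open>\<rho>\<close>.\<close>
      moreover have "ennreal (1 / \<rho> ^ length us) = ennreal \<rho> * ennreal (1 / \<rho> ^ length (u # us))"
        using \<rho> by (simp add: ennreal_mult[symmetric])
      ultimately have "?t (kernel_app \<nu> (Qp u)) us = ennreal \<rho> * ?t \<nu> (u # us)"
        by (simp only: mult.assoc)
      also have "\<dots> \<le> ennreal \<rho> * N \<nu>"
        unfolding N_def using us u by (intro mult_left_mono SUP_upper) auto
      finally show "?t (kernel_app \<nu> (Qp u)) us \<le> ennreal \<rho> * N \<nu>" .
    qed
  next
    fix \<mu> \<nu> assume ok': "centred m \<mu>" and centred: "centred m \<nu>"
    show "N (\<lambda>x. \<mu> x + \<nu> x) \<le> N \<mu> + N \<nu>"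
      unfolding N_def[of "\<lambda>x. \<mu> x + \<nu> x"]
    proof (rule SUP_least)
      fix us assume us: "us \<in> {us. set us \<subseteq> {0..1::real}}"
      let ?K = "\<lambda>x. pmf (iter (Qk \<xi>) us x)"
      have "kernel_app (\<lambda>x. \<mu> x + \<nu> x) ?K = (\<lambda>z. kernel_app \<mu> ?K z + kernel_app \<nu> ?K z)"
        by (intro ext kernel_app_add integrable_mult_pmf centred_integrable[OF centred] centred_integrable[OF ok'])
      then have "?t (\<lambda>x. \<mu> x + \<nu> x) us \<le> ennreal (1 / \<rho> ^ length us) * (wnorm (wlist m) (kernel_app \<mu> ?K) + wnorm (wlist m) (kernel_app \<nu> ?K))"
        by (intro mult_left_mono) (auto intro: wnorm_add)
      also have "\<dots> = ?t \<mu> us + ?t \<nu> us" by (rule distrib_left)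
      also have "\<dots> \<le> N \<mu> + N \<nu>"
        unfolding N_def using us by (intro add_mono SUP_upper) auto
      finally show "?t (\<lambda>x. \<mu> x + \<nu> x) us \<le> N \<mu> + N \<nu>" .
    qed
  qed
qed

text \<open>Set to 0 off the state space so that smoothness and bounds hold for every list, as
  \<open>tower_kernel\<close> asks for all starting points.\<close>

definition Qt :: "nat list \<Rightarrow> nat \<Rightarrow> real \<Rightarrow> nat list \<Rightarrow> real" where
  "Qt x = (if length x = p then tower_map (\<lambda>y. tl x @ [y]) (jet_tower (Rj x)) else (\<lambda>_ _ _. 0))"

lemma sum_list_tl_append: "sum_list (tl x @ [y]) \<le> sum_list x + (y :: nat)"
  by (cases x) auto

lemma Qt_tower: "tower k L sum_list (Qt x)"
proof (cases "length x = p")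
  case True
  have "tower k L sum_list (tower_map (\<lambda>y. tl x @ [y]) (jet_tower (Rj x)))"
    using kL by (intro tower_tower_map[OF _ Rj_tower, where c = "sum_list x"] sum_list_tl_append) auto
  then show ?thesis using True by (simp add: Qt_def)
qed (simp add: Qt_def)

lemma Qt_0: "length x = p \<Longrightarrow> Qt x 0 u = Qp u x"
proof
  fix z assume x: "length x = p"
  have jet_tower: "jet_tower (Rj x) 0 u = pmf (branching_kernel p \<zeta> \<xi> u x)"
    by (simp add: jet_tower_def Rj_0 fun_eq_iff)
  show "Qt x 0 u z = Qp u x z"
    using x unfolding Qt_def companion_kernel_def map_pmf_def pmf_bind_kernel_app
    by (simp add: tower_map_def jet_tower) (auto intro!: kernel_app_cong simp: pmf_return)
qed

lemma Qt_supp: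
  assumes "length z \<noteq> p" shows "Qt x r u z = 0"
proof (cases "length x = p")
  case True
  have "z \<notin> range (\<lambda>y. tl x @ [y])" using assms True p by auto
  then show ?thesis by (simp add: Qt_def tower_map_notin)
qed (simp add: Qt_def)

lemma Qt_bound:
  obtains C where "0 \<le> C" "\<And>x r m u. r \<le> k \<Longrightarrow> m + r \<le> L \<Longrightarrow> u \<in> {0..1} \<Longrightarrow>
     wnorm (wlist m) (Qt x r u) \<le> ennreal (C * wlist (m + r) x)"
proof -
  obtain C where C: "0 \<le> C" "\<And>x u r m. length x = p \<Longrightarrow> u \<in> {0..1} \<Longrightarrow> r \<le> k \<Longrightarrow> m + r \<le> L \<Longrightarrow>
    wnorm (wt (\<lambda>y. y) m) (jet_tower (Rj x) r u) \<le> ennreal (C * wlist (m + r) x)"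
    using Rj_bound by blast
  show ?thesis
  proof (rule that[of "2 ^ L * 2 * C"])
    show "0 \<le> 2 ^ L * 2 * C" using C by simp
    fix x r m and u :: real assume *: "r \<le> k" "m + r \<le> L" "u \<in> {0..1}"
    show "wnorm (wlist m) (Qt x r u) \<le> ennreal (2 ^ L * 2 * C * wlist (m + r) x)"
    proof (cases "length x = p")
      case True
      have "wnorm (wlist m) (tower_map (\<lambda>y. tl x @ [y]) (jet_tower (Rj x)) r u) \<le> ennreal (2 ^ m * 2 * C * (1 + real (sum_list x)) ^ (m + r))"
        using C(2)[OF True *(3,1,2)] C(2)[OF True *(3,1), of 0] * 
        by (intro wnorm_tower_map_bound[where sz = "\<lambda>y. y"] sum_list_tl_append C) (auto simp: wt_def)
      also have "\<dots> \<le> ennreal (2 ^ L * 2 * C * wlist (m + r) x)"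
        unfolding wt_def using * C by (intro ennreal_leI mult_right_mono power_increasing) auto
      finally show ?thesis using True by (simp add: Qt_def)
    qed (simp add: Qt_def)
  qed
qed

section \<open>The iterates of the zero state with their derivatives, and their limit\<close>

primrec Mt :: "nat \<Rightarrow> nat \<Rightarrow> real \<Rightarrow> nat list \<Rightarrow> real" where
  "Mt 0 = tower_return zero"
| "Mt (Suc n) = tower_bind (Mt n) Qt"

primrec \<mu>it :: "nat \<Rightarrow> real \<Rightarrow> nat list pmf" where
  "\<mu>it 0 u = return_pmf zero"
| "\<mu>it (Suc n) u = bind_pmf (\<mu>it n u) (Qk \<xi> u)"

lemma Mt_tower: "tower k L sum_list (Mt n)"
proof (induction n)
  case (Suc n)
  obtain C where "0 \<le> C" "\<And>x r m u. r \<le> k \<Longrightarrow> m + r \<le> L \<Longrightarrow> u \<in> {0..1} \<Longrightarrow>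
     wnorm (wlist m) (Qt x r u) \<le> ennreal (C * wlist (m + r) x)" using Qt_bound by blast
  then show ?case using kL by (simp del: One_nat_def) (intro tower_kernel[OF _ Suc Qt_tower]; auto)
qed (simp add: tower_tower_return)

lemma Mt_supp: "length z \<noteq> p \<Longrightarrow> Mt n r u z = 0"
proof (induction n)
  case (Suc n)
  then show ?case
    by (simp add: tower_bind_def) (intro sum.neutral ballI, subst kernel_app_finite[where S = "{}"], auto simp: Qt_supp)
qed (auto simp: tower_return_def)

lemma kernel_app_Qt_0:
  assumes "\<And>x. length x \<noteq> p \<Longrightarrow> \<nu> x = 0"
  shows "kernel_app \<nu> (\<lambda>x. Qt x 0 u) z = kernel_app \<nu> (Qp u) z"
  using assms by (intro kernel_app_cong refl) (metis Qt_0)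

lemma Mt_0: "Mt n 0 u = pmf (\<mu>it n u)"
proof (induction n)
  case 0
  show ?case by (auto simp: tower_return_def pmf_return fun_eq_iff)
next
  case (Suc n)
  have "Mt (Suc n) 0 u z = pmf (\<mu>it (Suc n) u) z" for z
    using Mt_supp[of _ n 0 u] by (simp add: tower_bind_def kernel_app_Qt_0 pmf_bind_kernel_app Suc)
  then show ?case by (simp add: fun_eq_iff)
qed

lemma Mt_mass: "0 < r \<Longrightarrow> r \<le> k \<Longrightarrow> u \<in> {0..1} \<Longrightarrow> (\<integral>z. Mt n r u z \<partial>count_space UNIV) = 0"
  using kL by (intro tower_mass[OF _ Mt_tower]) (auto simp: Mt_0 integral_pmf)

lemma Mt_wnorm: "r \<le> k \<Longrightarrow> u \<in> {0..1} \<Longrightarrow> wnorm (wlist (L - r)) (Mt n r u) < \<infinity>"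
  using tower_bounded[OF Mt_tower] by (metis ennreal_less_top infinity_ennreal_def le_less_trans)

definition \<Delta> :: "nat \<Rightarrow> nat \<Rightarrow> real \<Rightarrow> nat list \<Rightarrow> real" where
  "\<Delta> n r u z = Mt (Suc n) r u z - Mt n r u z"

lemma \<Delta>_centred:
  assumes "r \<le> k" "u \<in> {0..1}" shows "centred (L - r) (\<Delta> n r u)"
  unfolding centred_def
proof (intro conjI allI impI)
  have int: "integrable (count_space UNIV) (Mt n r u)" for n
    using Mt_wnorm[OF assms] by (rule integrable_wnorm) auto
  have "wnorm (wlist (L - r)) (\<Delta> n r u) = wnorm (wlist (L - r)) (\<lambda>z. Mt (Suc n) r u z + - Mt n r u z)"
    by (simp add: \<Delta>_def[abs_def])
  also have "\<dots> \<le> wnorm (wlist (L - r)) (Mt (Suc n) r u) + wnorm (wlist (L - r)) (\<lambda>z. - Mt n r u z)"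
    by (rule wnorm_add) auto
  also have "\<dots> < \<infinity>" unfolding wnorm_uminus using Mt_wnorm[OF assms, of n] Mt_wnorm[OF assms, of "Suc n"] by simp
  finally show "wnorm (wlist (L - r)) (\<Delta> n r u) < \<infinity>" .
  have "(\<integral>z. \<Delta> n r u z \<partial>count_space UNIV) = (\<integral>z. Mt (Suc n) r u z \<partial>count_space UNIV) - (\<integral>z. Mt n r u z \<partial>count_space UNIV)"
    unfolding \<Delta>_def by (rule Bochner_Integration.integral_diff[OF int int])
  also have "\<dots> = 0"
  proof (cases "r = 0")
    case True
    then show ?thesis unfolding True Mt_0 by (simp add: integral_pmf)
  next
    case False
    then show ?thesis using Mt_mass assms by (metis diff_self neq0_conv)
  qed
  finally show "(\<integral>z. \<Delta> n r u z \<partial>count_space UNIV) = 0" .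
qed (auto simp: \<Delta>_def Mt_supp simp del: Mt.simps)

text \<open>The recursion for the iterates is linear in the measure. The undifferentiated kernel
  acts on the increment of the same order; lower orders appear only as a source term.\<close>

lemma \<Delta>_Suc:
  assumes r: "r \<le> k" and u: "u \<in> {0..1}"
  shows "\<Delta> (Suc n) r u z = kernel_app (\<Delta> n r u) (Qp u) z + (\<Sum>i<r. kernel_app (\<Delta> n i u) (\<lambda>x. Qt x (r - i) u) z)"
proof -
  obtain C where C: "0 \<le> C" "\<And>x r m u. r \<le> k \<Longrightarrow> m + r \<le> L \<Longrightarrow> u \<in> {0..1} \<Longrightarrow>
     wnorm (wlist m) (Qt x r u) \<le> ennreal (C * wlist (m + r) x)" using Qt_bound by blast
  have int: "integrable (count_space UNIV) (\<lambda>x. Mt n i u x * Qt x (r - i) u z)" if "i \<le> r" for i n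
  proof (rule integrable_kernel_app[where v = "wlist (L - i)" and w = "wlist (L - r)" and C = C])
    show "wnorm (wlist (L - i)) (Mt n i u) < \<infinity>" using Mt_wnorm that r u by auto
    have "L - r + (r - i) = L - i" using that r kL by auto
    then show "wnorm (wlist (L - r)) (Qt x (r - i) u) \<le> ennreal (C * wlist (L - i) x)" for x
      using C(2)[of "r - i" "L - r" u x] that r u by auto
  qed (use C in auto)
  have "\<Delta> (Suc n) r u z = (\<Sum>i\<le>r. kernel_app (Mt (Suc n) i u) (\<lambda>x. Qt x (r - i) u) z) - (\<Sum>i\<le>r. kernel_app (Mt n i u) (\<lambda>x. Qt x (r - i) u) z)"
    unfolding \<Delta>_def by (subst (1 2) Mt.simps(2)) (simp only: tower_bind_def)
  also have "\<dots> = (\<Sum>i\<le>r. kernel_app (\<Delta> n i u) (\<lambda>x. Qt x (r - i) u) z)"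
    unfolding sum_subtractf[symmetric] \<Delta>_def
    by (intro sum.cong refl kernel_app_diff[symmetric] int) auto
  also have "\<dots> = (\<Sum>i<r. kernel_app (\<Delta> n i u) (\<lambda>x. Qt x (r - i) u) z) + kernel_app (\<Delta> n r u) (\<lambda>x. Qt x 0 u) z"
    by (simp add: lessThan_Suc_atMost[symmetric])
  also have "kernel_app (\<Delta> n r u) (\<lambda>x. Qt x 0 u) z = kernel_app (\<Delta> n r u) (Qp u) z"
    by (rule kernel_app_Qt_0) (auto simp: \<Delta>_def Mt_supp simp del: Mt.simps)
  finally show ?thesis by simp
qed

text \<open>Strong induction on the order: the source decays geometrically in weight
  \<open>L - r\<close>, because a kernel derivative of order \<open>r - i\<close> maps weight
  \<open>L - i\<close> to it, and the remaining recursion contracts in the norm adapted to weight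
  \<open>L - r\<close>.\<close>

lemma \<Delta>_decay:
  assumes "r \<le> k"
  shows "\<exists>C\<ge>0. \<exists>\<tau>. 0 \<le> \<tau> \<and> \<tau> < 1 \<and> (\<forall>n. \<forall>u\<in>{0..1}. wnorm (wlist (L - r)) (\<Delta> n r u) \<le> ennreal (C * \<tau> ^ n))"
  using assms
proof (induction r rule: less_induct)
  case (less r)
  have Lr: "1 \<le> L - r" "L - r \<le> L" using less.prems kL by auto
  obtain CQ where CQ: "0 \<le> CQ" "\<And>x r m u. r \<le> k \<Longrightarrow> m + r \<le> L \<Longrightarrow> u \<in> {0..1} \<Longrightarrow>
     wnorm (wlist m) (Qt x r u) \<le> ennreal (CQ * wlist (m + r) x)" using Qt_bound by blast
  have "\<exists>C \<tau>. i < r \<longrightarrow> 0 \<le> C \<and> 0 \<le> \<tau> \<and> \<tau> < 1 \<and> (\<forall>n. \<forall>u\<in>{0..1}. wnorm (wlist (L - i)) (\<Delta> n i u) \<le> ennreal (C * \<tau> ^ n))" for i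
    using less.IH[of i] less.prems by (cases "i < r") auto
  then obtain Ci \<tau>i where Ci: "\<And>i. i < r \<Longrightarrow> 0 \<le> Ci i" "\<And>i. i < r \<Longrightarrow> 0 \<le> \<tau>i i" "\<And>i. i < r \<Longrightarrow> \<tau>i i < 1"
    "\<And>i n u. i < r \<Longrightarrow> u \<in> {0..1} \<Longrightarrow> wnorm (wlist (L - i)) (\<Delta> n i u) \<le> ennreal (Ci i * \<tau>i i ^ n)"
    by metis
  define \<sigma> where "\<sigma> = Max (insert 0 (\<tau>i ` {..<r}))"
  have \<sigma>: "0 \<le> \<sigma>" "\<sigma> < 1" "\<And>i. i < r \<Longrightarrow> \<tau>i i \<le> \<sigma>"
    unfolding \<sigma>_def using Ci by (auto intro: Max_ge)
  define c where "c = CQ * (\<Sum>i<r. Ci i)"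
  have c: "0 \<le> c" using CQ Ci by (auto simp: c_def intro!: mult_nonneg_nonneg sum_nonneg)
  define g where "g n u z = (\<Sum>i<r. kernel_app (\<Delta> n i u) (\<lambda>x. Qt x (r - i) u) z)" for n u z
  have g: "wnorm (wlist (L - r)) (g n u) \<le> ennreal (c * \<sigma> ^ n)" if u: "u \<in> {0..1}" for n u
  proof -
    have "wnorm (wlist (L - r)) (g n u) \<le> (\<Sum>i<r. wnorm (wlist (L - r)) (kernel_app (\<Delta> n i u) (\<lambda>x. Qt x (r - i) u)))"
      unfolding g_def by (rule wnorm_sum) auto
    also have "\<dots> \<le> (\<Sum>i<r. ennreal CQ * ennreal (Ci i * \<sigma> ^ n))"
    proof (rule sum_mono)
      fix i assume i: "i \<in> {..<r}"
      have "L - r + (r - i) = L - i" using i less.prems kL by auto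
      then have "wnorm (wlist (L - r)) (kernel_app (\<Delta> n i u) (\<lambda>x. Qt x (r - i) u)) \<le> ennreal CQ * wnorm (wlist (L - i)) (\<Delta> n i u)"
        using CQ(2)[of "r - i" "L - r" u] i less.prems u by (intro wnorm_kernel_app_le CQ(1)) auto
      also have "\<dots> \<le> ennreal CQ * ennreal (Ci i * \<tau>i i ^ n)"
        using Ci(4) i u by (intro mult_left_mono) auto
      also have "\<dots> \<le> ennreal CQ * ennreal (Ci i * \<sigma> ^ n)"
        using Ci \<sigma> i by (intro mult_left_mono ennreal_leI power_mono) auto
      finally show "wnorm (wlist (L - r)) (kernel_app (\<Delta> n i u) (\<lambda>x. Qt x (r - i) u)) \<le> ennreal CQ * ennreal (Ci i * \<sigma> ^ n)" .
    qed
    also have "\<dots> = (\<Sum>i<r. ennreal (CQ * (Ci i * \<sigma> ^ n)))"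
      using CQ Ci \<sigma> by (intro sum.cong refl ennreal_mult[symmetric]) auto
    also have "\<dots> = ennreal (c * \<sigma> ^ n)"
      using CQ Ci \<sigma> by (subst sum_ennreal) (auto simp: c_def sum_distrib_left sum_distrib_right mult.assoc)
    finally show ?thesis .
  qed
  have step: "\<Delta> (Suc n) r u = (\<lambda>z. kernel_app (\<Delta> n r u) (Qp u) z + g n u z)" if "u \<in> {0..1}" for n u
    using \<Delta>_Suc[OF less.prems that] by (simp add: g_def fun_eq_iff)
  \<comment> \<open>The source is centred because it is the difference of two centred measures, by
    the recursion itself; its single summands are not examined.\<close>
  have okg: "centred (L - r) (g n u)" if u: "u \<in> {0..1}" for n u
  proof -
    have "centred (L - r) (\<lambda>z. \<Delta> (Suc n) r u z - kernel_app (\<Delta> n r u) (Qp u) z)"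
      using Lr less.prems u by (intro centred_diff \<Delta>_centred centred_kernel_app) auto
    then show ?thesis by (simp add: step[OF u])
  qed
  obtain N C \<rho> where C: "0 \<le> C" and \<rho>: "0 < \<rho>" "\<rho> < 1"
    and N: "\<And>\<nu>. centred (L - r) \<nu> \<Longrightarrow> wnorm (wlist (L - r)) \<nu> \<le> N \<nu>"
    "\<And>\<nu>. centred (L - r) \<nu> \<Longrightarrow> N \<nu> \<le> ennreal C * wnorm (wlist (L - r)) \<nu>"
    "\<And>u \<nu>. u \<in> {0..1} \<Longrightarrow> centred (L - r) \<nu> \<Longrightarrow> N (kernel_app \<nu> (Qp u)) \<le> ennreal \<rho> * N \<nu>"
    "\<And>\<mu> \<nu>. centred (L - r) \<mu> \<Longrightarrow> centred (L - r) \<nu> \<Longrightarrow> N (\<lambda>x. \<mu> x + \<nu> x) \<le> N \<mu> + N \<nu>"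
    by (rule contracting_norm[OF Lr]) blast
  obtain B0 where B0: "0 \<le> B0" "\<And>r u. r \<le> k \<Longrightarrow> u \<in> {0..1} \<Longrightarrow> wnorm (wlist (L - r)) (Mt 0 r u) \<le> ennreal B0"
    using tower_bounded[OF Mt_tower] by blast
  obtain B1 where B1: "0 \<le> B1" "\<And>r u. r \<le> k \<Longrightarrow> u \<in> {0..1} \<Longrightarrow> wnorm (wlist (L - r)) (Mt 1 r u) \<le> ennreal B1"
    using tower_bounded[OF Mt_tower] by blast
  \<comment> \<open>A rate strictly above both the contraction rate and the rate of the source, yet
    below 1.\<close>
  define \<tau> where "\<tau> = (1 + max \<rho> \<sigma>) / 2"
  have \<tau>: "\<rho> < \<tau>" "\<sigma> \<le> \<tau>" "\<tau> < 1" "0 \<le> \<tau>" using \<rho> \<sigma> by (auto simp: \<tau>_def max_def)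
  define K where "K = C * (B1 + B0) + C * c / (\<tau> - \<rho>)"
  have K: "0 \<le> K" using C c B0 B1 \<tau> by (auto simp: K_def)
  have "wnorm (wlist (L - r)) (\<Delta> n r u) \<le> ennreal (K * \<tau> ^ n)" if u: "u \<in> {0..1}" for n u
  proof -
    have centred: "centred (L - r) (\<Delta> n r u)" for n using less.prems u by (rule \<Delta>_centred)
    have "N (\<Delta> n r u) \<le> ennreal (K * \<tau> ^ n)"
      unfolding K_def
    proof (rule geometric_recursion)
      fix n
      have "N (\<Delta> (Suc n) r u) \<le> N (kernel_app (\<Delta> n r u) (Qp u)) + N (g n u)"
        unfolding step[OF u] using Lr u centred okg by (intro N(4) centred_kernel_app) auto
      also have "\<dots> \<le> ennreal \<rho> * N (\<Delta> n r u) + ennreal C * wnorm (wlist (L - r)) (g n u)"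
        using u centred okg by (intro add_mono N) auto
      also have "\<dots> \<le> ennreal \<rho> * N (\<Delta> n r u) + ennreal C * ennreal (c * \<sigma> ^ n)"
        using g[OF u] by (intro add_left_mono mult_left_mono) auto
      also have "ennreal C * ennreal (c * \<sigma> ^ n) = ennreal (C * c * \<sigma> ^ n)"
        using C c \<sigma> by (simp add: ennreal_mult mult.assoc)
      finally show "N (\<Delta> (Suc n) r u) \<le> ennreal \<rho> * N (\<Delta> n r u) + ennreal (C * c * \<sigma> ^ n)" .
    next
      have "N (\<Delta> 0 r u) \<le> ennreal C * wnorm (wlist (L - r)) (\<Delta> 0 r u)" using centred by (rule N)
      also have "wnorm (wlist (L - r)) (\<Delta> 0 r u) \<le> wnorm (wlist (L - r)) (\<lambda>z. Mt 1 r u z + - Mt 0 r u z)"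
        by (intro wnorm_mono_abs) (auto simp: \<Delta>_def)
      also have "\<dots> \<le> wnorm (wlist (L - r)) (Mt 1 r u) + wnorm (wlist (L - r)) (\<lambda>z. - Mt 0 r u z)"
        by (rule wnorm_add) auto
      also have "\<dots> \<le> ennreal B1 + ennreal B0"
        unfolding wnorm_uminus using less.prems u by (intro add_mono B0 B1)
      also have "ennreal C * (ennreal B1 + ennreal B0) = ennreal (C * (B1 + B0))"
        using C B0 B1 by (simp add: ennreal_mult)
      finally show "N (\<Delta> 0 r u) \<le> ennreal (C * (B1 + B0))" by (simp add: mult_left_mono)
    qed (use C c B0 B1 \<rho> \<sigma> \<tau> in auto)
    then show ?thesis using N(1)[OF centred, of n] by (rule order_trans[rotated])
  qed
  then show ?case using K \<tau> by blast
qed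

definition \<Pi>t :: "nat \<Rightarrow> real \<Rightarrow> nat list \<Rightarrow> real" where
  "\<Pi>t r u z = lim (\<lambda>n. Mt n r u z)"

lemma \<Pi>t_limit:
  obtains C \<tau> where "0 \<le> C" "0 \<le> \<tau>" "\<tau> < 1"
    "\<And>n r u. r \<le> k \<Longrightarrow> u \<in> {0..1} \<Longrightarrow> wnorm (wlist (L - r)) (\<lambda>z. \<Pi>t r u z - Mt n r u z) \<le> ennreal (C * \<tau> ^ n)"
    "\<And>r u z. r \<le> k \<Longrightarrow> u \<in> {0..1} \<Longrightarrow> (\<lambda>n. Mt n r u z) \<longlonglongrightarrow> \<Pi>t r u z"
proof -
  have "\<exists>C \<tau>. r \<le> k \<longrightarrow> 0 \<le> C \<and> 0 \<le> \<tau> \<and> \<tau> < 1 \<and> (\<forall>n. \<forall>u\<in>{0..1}. wnorm (wlist (L - r)) (\<Delta> n r u) \<le> ennreal (C * \<tau> ^ n))" for r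
    using \<Delta>_decay[of r] by (cases "r \<le> k") auto
  then obtain Ci \<tau>i where Ci: "\<And>i. i \<le> k \<Longrightarrow> 0 \<le> Ci i" "\<And>i. i \<le> k \<Longrightarrow> 0 \<le> \<tau>i i" "\<And>i. i \<le> k \<Longrightarrow> \<tau>i i < 1"
    "\<And>i n u. i \<le> k \<Longrightarrow> u \<in> {0..1} \<Longrightarrow> wnorm (wlist (L - i)) (\<Delta> n i u) \<le> ennreal (Ci i * \<tau>i i ^ n)"
    by metis
  define \<tau> where "\<tau> = Max (\<tau>i ` {..k})"
  have \<tau>: "\<tau> < 1" "\<And>i. i \<le> k \<Longrightarrow> \<tau>i i \<le> \<tau>"
    unfolding \<tau>_def using Ci by (auto intro: Max_ge)
  have \<tau>0: "0 \<le> \<tau>" using Ci(2)[of 0] \<tau>(2)[of 0] by simp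
  define C where "C = (\<Sum>i\<le>k. Ci i) / (1 - \<tau>)"
  have lim: "wnorm (wlist (L - r)) (\<lambda>z. \<Pi>t r u z - Mt n r u z) \<le> ennreal (C * \<tau> ^ n)"
    "(\<lambda>n. Mt n r u z) \<longlonglongrightarrow> \<Pi>t r u z" if "r \<le> k" "u \<in> {0..1}" for r u n z
  proof -
    have d: "wnorm (wlist (L - r)) (\<lambda>z. Mt (Suc n) r u z - Mt n r u z) \<le> ennreal ((\<Sum>i\<le>k. Ci i) * \<tau> ^ n)" for n
    proof -
      have "wnorm (wlist (L - r)) (\<lambda>z. Mt (Suc n) r u z - Mt n r u z) \<le> ennreal (Ci r * \<tau>i r ^ n)"
        using Ci(4)[OF that, of n] unfolding \<Delta>_def .
      also have "\<dots> \<le> ennreal ((\<Sum>i\<le>k. Ci i) * \<tau> ^ n)"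
        using Ci \<tau> \<tau>0 that by (intro ennreal_leI mult_mono power_mono member_le_sum sum_nonneg) auto
      finally show ?thesis .
    qed
    have S: "0 \<le> (\<Sum>i\<le>k. Ci i)" using Ci by (intro sum_nonneg) auto
    show "wnorm (wlist (L - r)) (\<lambda>z. \<Pi>t r u z - Mt n r u z) \<le> ennreal (C * \<tau> ^ n)"
      using wnorm_geometric_limit(2)[OF d \<tau>0 \<tau>(1) S, of n] by (simp add: \<Pi>t_def C_def)
    show "(\<lambda>n. Mt n r u z) \<longlonglongrightarrow> \<Pi>t r u z"
      using wnorm_geometric_limit(1)[OF d \<tau>0 \<tau>(1) S] by (simp add: \<Pi>t_def)
  qed
  show ?thesis
  proof (rule that[OF _ \<tau>0 \<tau>(1) lim])
    show "0 \<le> C" using Ci \<tau> by (auto simp: C_def intro!: divide_nonneg_nonneg sum_nonneg)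
  qed
qed

text \<open>All levels converge geometrically, uniformly in \<open>u\<close>, so some iterate
  approximates every level of the limit within \<open>e\<close>; iterates are towers.\<close>

lemma \<Pi>t_tower: "tower k L sum_list \<Pi>t"
proof -
  obtain C \<tau> where C: "0 \<le> C" and \<tau>: "0 \<le> \<tau>" "\<tau> < 1" and lim:
    "\<And>n r u. r \<le> k \<Longrightarrow> u \<in> {0..1} \<Longrightarrow> wnorm (wlist (L - r)) (\<lambda>z. \<Pi>t r u z - Mt n r u z) \<le> ennreal (C * \<tau> ^ n)"
    using \<Pi>t_limit by metis
  show ?thesis
  proof (rule tower_approx)
    fix e :: real assume e: "e > 0"
    have "(\<lambda>n. C * \<tau> ^ n) \<longlonglongrightarrow> C * 0" using \<tau> by (intro tendsto_mult_left LIMSEQ_power_zero) auto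
    then have "eventually (\<lambda>n. C * \<tau> ^ n < e) sequentially" using e by (intro order_tendstoD) auto
    then obtain n where "C * \<tau> ^ n < e" by (auto simp: eventually_sequentially)
    then have "\<forall>r\<le>k. \<forall>u\<in>{0..1}. wnorm (wlist (L - r)) (\<lambda>z. \<Pi>t r u z - Mt n r u z) \<le> ennreal e"
      using lim by (meson ennreal_leI less_imp_le order_trans)
    then show "\<exists>T'. tower k L sum_list T' \<and> (\<forall>r\<le>k. \<forall>u\<in>{0..1}. wnorm (wlist (L - r)) (\<lambda>z. \<Pi>t r u z - T' r u z) \<le> ennreal e)"
      using Mt_tower by blast
  qed
qed

end

section \<open>Stationary paths\<close>

lemma pmf_map_kernel_app: "pmf (map_pmf h P) z = kernel_app (pmf P) (\<lambda>y z. if z = h y then 1 else 0) z"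
  unfolding map_pmf_def pmf_bind_kernel_app by (intro kernel_app_cong) (auto simp: pmf_return)

lemma wnorm_mono_weight:
  assumes "m \<le> n" shows "wnorm (wt sz m) f \<le> wnorm (wt sz n) f"
  using assms by (intro wnorm_mono mult_left_mono wt_mono) auto

lemma abs_kernel_app_pmf_le:
  assumes "integrable (count_space UNIV) \<nu>" "\<And>x. 1 \<le> w x"
  shows "ennreal \<bar>kernel_app \<nu> (\<lambda>x. pmf (K x)) z\<bar> \<le> wnorm w \<nu>"
proof -
  have "ennreal \<bar>kernel_app \<nu> (\<lambda>x. pmf (K x)) z\<bar> \<le> (\<integral>\<^sup>+x. ennreal \<bar>\<nu> x * pmf (K x) z\<bar> \<partial>count_space UNIV)"
    unfolding kernel_app_def using integral_norm_bound_ennreal[OF integrable_mult_pmf[OF assms(1)]] by simp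
  also have "\<dots> \<le> wnorm w \<nu>"
    unfolding wnorm_def
  proof (intro nn_integral_mono ennreal_leI)
    fix x
    have "\<bar>\<nu> x * pmf (K x) z\<bar> \<le> \<bar>\<nu> x\<bar> * 1"
      unfolding abs_mult by (intro mult_left_mono) (auto simp: pmf_le_1)
    also have "\<dots> \<le> \<bar>\<nu> x\<bar> * w x" using assms(2) by (intro mult_left_mono) auto
    finally show "\<bar>\<nu> x * pmf (K x) z\<bar> \<le> \<bar>\<nu> x\<bar> * w x" .
  qed
  finally show ?thesis .
qed

lemma abs_integral_le_wnorm:
  assumes "integrable (count_space UNIV) \<nu>" "\<And>x. 1 \<le> w x"
  shows "ennreal \<bar>\<integral>x. \<nu> x \<partial>count_space UNIV\<bar> \<le> wnorm w \<nu>"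
proof -
  have "kernel_app \<nu> (\<lambda>x. pmf (return_pmf ())) () = (\<integral>x. \<nu> x \<partial>count_space UNIV)" by (simp add: kernel_app_def)
  then show ?thesis using abs_kernel_app_pmf_le[OF assms, of "\<lambda>x. return_pmf ()" "()"] by simp
qed

lemma LIMSEQ_of_wnorm_bound:
  assumes "\<And>n. ennreal \<bar>f n - l\<bar> \<le> ennreal (C * \<tau> ^ n)" "0 \<le> C" "0 \<le> \<tau>" "\<tau> < 1"
  shows "f \<longlonglongrightarrow> l"
proof (rule LIM_zero_cancel, rule Lim_null_comparison)
  show "\<forall>\<^sub>F n in sequentially. norm (f n - l) \<le> C * \<tau> ^ n"
    using assms by (intro always_eventually) (auto simp: ennreal_le_iff)
  have "(\<lambda>n. C * \<tau> ^ n) \<longlonglongrightarrow> C * 0" using assms by (intro tendsto_mult_left LIMSEQ_power_zero) auto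
  then show "(\<lambda>n. C * \<tau> ^ n) \<longlonglongrightarrow> 0" by simp
qed

lemma bind_iter: "bind_pmf (iter Q us x) (Q u) = iter Q (us @ [u]) x"
  by (induction us arbitrary: x) (auto simp: bind_assoc_pmf bind_return_pmf bind_return_pmf' iter_Nil)

definition sz2 :: "nat list list \<Rightarrow> nat" where
  "sz2 z = sum_list (map sum_list z)"

lemma sz2_simps [simp]: "sz2 [] = 0" "sz2 (x # z) = sum_list x + sz2 z"
  by (simp_all add: sz2_def)

context ginar begin

lemma \<mu>it_iter: "\<mu>it n u = iter (Qk \<xi>) (replicate n u) zero"
proof (induction n)
  case (Suc n)
  have "bind_pmf (iter (Qk \<xi>) (replicate n u) zero) (Qk \<xi> u) = iter (Qk \<xi>) (replicate n u @ [u]) zero"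
    by (rule bind_iter)
  then show ?case by (simp only: \<mu>it.simps Suc replicate_append_same replicate_Suc)
qed simp

lemma \<Pi>t_supp: "length z \<noteq> p \<Longrightarrow> \<Pi>t r u z = 0"
  unfolding \<Pi>t_def by (simp add: Mt_supp lim_const)

text \<open>Each property holds for the iterates or relates two consecutive ones, and passes to the
  limit: masses and the action of a probability kernel are continuous for the weighted norm,
  positivity for convergence of the coordinates.\<close>

lemma
  assumes u: "u \<in> {0..1}"
  shows \<Pi>t_nonneg: "0 \<le> \<Pi>t 0 u z" and \<Pi>t_integral: "(\<integral>z. \<Pi>t 0 u z \<partial>count_space UNIV) = 1"
    and \<Pi>t_integrable: "integrable (count_space UNIV) (\<Pi>t 0 u)"
    and \<Pi>t_invariant: "kernel_app (\<Pi>t 0 u) (Qp u) z = \<Pi>t 0 u z"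
proof -
  obtain C \<tau> where C: "0 \<le> C" and \<tau>: "0 \<le> \<tau>" "\<tau> < 1" and lim:
    "\<And>n r u. r \<le> k \<Longrightarrow> u \<in> {0..1} \<Longrightarrow> wnorm (wlist (L - r)) (\<lambda>z. \<Pi>t r u z - Mt n r u z) \<le> ennreal (C * \<tau> ^ n)"
    "\<And>r u z. r \<le> k \<Longrightarrow> u \<in> {0..1} \<Longrightarrow> (\<lambda>n. Mt n r u z) \<longlonglongrightarrow> \<Pi>t r u z"
    by (rule \<Pi>t_limit) blast
  show "0 \<le> \<Pi>t 0 u z"
    by (rule LIMSEQ_le_const[OF lim(2)[of 0 u z]]) (use u in \<open>auto simp: Mt_0\<close>)
  obtain B where "\<And>r u. r \<le> k \<Longrightarrow> u \<in> {0..1} \<Longrightarrow> wnorm (wlist (L - r)) (\<Pi>t r u) \<le> ennreal B"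
    by (rule tower_bounded[OF \<Pi>t_tower]) blast
  from this[of 0 u] have "wnorm (wlist L) (\<Pi>t 0 u) < \<infinity>" using u by (auto intro: le_less_trans)
  then show int: "integrable (count_space UNIV) (\<Pi>t 0 u)" by (rule integrable_wnorm) auto
  have intM: "integrable (count_space UNIV) (Mt n 0 u)" for n by (simp add: Mt_0 integrable_pmf)
  have l: "wnorm (wlist L) (\<lambda>z. Mt n 0 u z - \<Pi>t 0 u z) \<le> ennreal (C * \<tau> ^ n)" for n
    using lim(1)[of 0 u n] u by (subst wnorm_diff_commute) auto
  have intD: "integrable (count_space UNIV) (\<lambda>z. Mt n 0 u z - \<Pi>t 0 u z)" for n
    by (intro Bochner_Integration.integrable_diff intM int)
  have "(\<lambda>n. (\<integral>z. Mt n 0 u z \<partial>count_space UNIV)) \<longlonglongrightarrow> (\<integral>z. \<Pi>t 0 u z \<partial>count_space UNIV)"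
  proof (rule LIMSEQ_of_wnorm_bound[OF _ C \<tau>])
    fix n
    have "ennreal \<bar>\<integral>z. Mt n 0 u z - \<Pi>t 0 u z \<partial>count_space UNIV\<bar> \<le> wnorm (wlist L) (\<lambda>z. Mt n 0 u z - \<Pi>t 0 u z)"
      by (rule abs_integral_le_wnorm[OF intD]) auto
    then show "ennreal \<bar>(\<integral>z. Mt n 0 u z \<partial>count_space UNIV) - (\<integral>z. \<Pi>t 0 u z \<partial>count_space UNIV)\<bar> \<le> ennreal (C * \<tau> ^ n)"
      using l[of n] by (subst (asm) Bochner_Integration.integral_diff[OF intM int]) (rule order_trans)
  qed
  moreover have "(\<integral>z. Mt n 0 u z \<partial>count_space UNIV) = 1" for n by (simp add: Mt_0 integral_pmf)
  ultimately show "(\<integral>z. \<Pi>t 0 u z \<partial>count_space UNIV) = 1"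
    by (simp add: LIMSEQ_const_iff)
  have "(\<lambda>n. kernel_app (Mt n 0 u) (Qp u) z) \<longlonglongrightarrow> kernel_app (\<Pi>t 0 u) (Qp u) z"
  proof (rule LIMSEQ_of_wnorm_bound[OF _ C \<tau>])
    fix n
    have "kernel_app (\<lambda>z. Mt n 0 u z - \<Pi>t 0 u z) (Qp u) z = kernel_app (Mt n 0 u) (Qp u) z - kernel_app (\<Pi>t 0 u) (Qp u) z"
      by (intro kernel_app_diff integrable_mult_pmf int intM)
    then show "ennreal \<bar>kernel_app (Mt n 0 u) (Qp u) z - kernel_app (\<Pi>t 0 u) (Qp u) z\<bar> \<le> ennreal (C * \<tau> ^ n)"
      using abs_kernel_app_pmf_le[OF intD, of "wlist L" n "Qk \<xi> u" z] l[of n] by simp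
  qed
  moreover have "kernel_app (Mt n 0 u) (Qp u) z = Mt (Suc n) 0 u z" for n
    by (simp only: Mt_0 \<mu>it.simps pmf_bind_kernel_app)
  moreover have "(\<lambda>n. Mt (Suc n) 0 u z) \<longlonglongrightarrow> \<Pi>t 0 u z"
    using lim(2)[of 0 u z] u by (intro LIMSEQ_Suc) auto
  ultimately show "kernel_app (\<Pi>t 0 u) (Qp u) z = \<Pi>t 0 u z"
    by (simp only:) (rule LIMSEQ_unique)
qed

definition \<pi>p :: "real \<Rightarrow> nat list pmf" where
  "\<pi>p u = embed_pmf (\<Pi>t 0 u)"

lemma pmf_\<pi>p:
  assumes u: "u \<in> {0..1}" shows "pmf (\<pi>p u) = \<Pi>t 0 u"
proof
  fix z
  have "(\<integral>\<^sup>+z. ennreal (\<Pi>t 0 u z) \<partial>count_space UNIV) = 1"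
    using \<Pi>t_nonneg[OF u] \<Pi>t_integral[OF u] \<Pi>t_integrable[OF u] by (subst nn_integral_eq_integral) auto
  then show "pmf (\<pi>p u) z = \<Pi>t 0 u z"
    unfolding \<pi>p_def using \<Pi>t_nonneg[OF u] by (intro pmf_embed_pmf) auto
qed

lemma \<pi>p_invariant:
  assumes u: "u \<in> {0..1}" shows "invariant_pmf p (Qk \<xi> u) (\<pi>p u)"
  unfolding invariant_pmf_def
proof
  show "set_pmf (\<pi>p u) \<subseteq> {x. length x = p}"
    using \<Pi>t_supp by (auto simp: set_pmf_iff pmf_\<pi>p[OF u]) blast
  show "bind_pmf (\<pi>p u) (Qk \<xi> u) = \<pi>p u"
    by (rule pmf_eqI) (simp add: pmf_bind_kernel_app pmf_\<pi>p[OF u] \<Pi>t_invariant[OF u])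
qed

text \<open>The competitor \<open>\<mu>\<close> may have no moments, so the norm contraction cannot
  be applied to its difference from \<open>\<pi>p u\<close>. Instead the chain converges from each
  single starting point, and dominated convergence averages this over \<open>\<mu>\<close>.\<close>

lemma invariant_unique:
  assumes u: "u \<in> {0..1}" and inv: "invariant_pmf p (Qk \<xi> u) \<mu>"
  shows "\<mu> = \<pi>p u"
proof (rule pmf_eqI)
  fix z
  have L: "1 \<le> L" using kL by simp
  have sup: "set_pmf \<mu> \<subseteq> {x. length x = p}" and eq: "bind_pmf \<mu> (Qk \<xi> u) = \<mu>"
    using inv by (auto simp: invariant_pmf_def)
  have iter: "bind_pmf \<mu> (iter (Qk \<xi>) (replicate n u)) = \<mu>" for n
  proof (induction n)
    case 0
    then show ?case by (simp add: iter_Nil bind_return_pmf')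
  next
    case (Suc n)
    have "bind_pmf \<mu> (iter (Qk \<xi>) (replicate (Suc n) u)) = bind_pmf (bind_pmf \<mu> (Qk \<xi> u)) (iter (Qk \<xi>) (replicate n u))"
    proof -
      have "iter (Qk \<xi>) (u # replicate n u) = (\<lambda>x. bind_pmf (Qk \<xi> u x) (iter (Qk \<xi>) (replicate n u)))"
        by (simp add: fun_eq_iff)
      then show ?thesis by (simp only: replicate_Suc bind_assoc_pmf)
    qed
    then show ?case by (simp only: eq Suc)
  qed
  obtain lim: "\<And>r u z. r \<le> k \<Longrightarrow> u \<in> {0..1} \<Longrightarrow> (\<lambda>n. Mt n r u z) \<longlonglongrightarrow> \<Pi>t r u z"
    by (rule \<Pi>t_limit) blast
  obtain C \<rho> where C: "0 \<le> C" and \<rho>: "0 \<le> \<rho>" "\<rho> < 1" and pt: "\<And>us x. set us \<subseteq> {0..1} \<Longrightarrow> length x = p \<Longrightarrow>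
     wnorm (wlist L) (\<lambda>v. pmf (iter (Qk \<xi>) us x) v - pmf (iter (Qk \<xi>) us zero) v) \<le> ennreal (C * \<rho> ^ length us * wlist L x)"
    using point_contraction[OF L order_refl] by blast
  have conv: "(\<lambda>n. pmf (iter (Qk \<xi>) (replicate n u) x) z) \<longlonglongrightarrow> \<Pi>t 0 u z" if x: "length x = p" for x
  proof -
    have "(\<lambda>n. pmf (iter (Qk \<xi>) (replicate n u) x) z - pmf (iter (Qk \<xi>) (replicate n u) zero) z) \<longlonglongrightarrow> 0"
    proof (rule LIMSEQ_of_wnorm_bound[where C = "C * wlist L x"])
      fix n
      have "ennreal \<bar>pmf (iter (Qk \<xi>) (replicate n u) x) z - pmf (iter (Qk \<xi>) (replicate n u) zero) z\<bar> \<le>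
          wnorm (wlist L) (\<lambda>z. pmf (iter (Qk \<xi>) (replicate n u) x) z - pmf (iter (Qk \<xi>) (replicate n u) zero) z)"
        by (rule wnorm_point) auto
      also have "\<dots> \<le> ennreal (C * \<rho> ^ length (replicate n u) * wlist L x)"
        using u by (intro pt x) auto
      also have "\<dots> = ennreal (C * wlist L x * \<rho> ^ n)" by (simp add: mult_ac)
      finally show "ennreal \<bar>pmf (iter (Qk \<xi>) (replicate n u) x) z - pmf (iter (Qk \<xi>) (replicate n u) zero) z - 0\<bar> \<le> ennreal (C * wlist L x * \<rho> ^ n)"
        by simp
    qed (use C \<rho> in auto)
    moreover have "(\<lambda>n. pmf (iter (Qk \<xi>) (replicate n u) zero) z) \<longlonglongrightarrow> \<Pi>t 0 u z"
      using lim[of 0 u z] u by (simp add: Mt_0 \<mu>it_iter)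
    ultimately have "(\<lambda>n. (pmf (iter (Qk \<xi>) (replicate n u) x) z - pmf (iter (Qk \<xi>) (replicate n u) zero) z) + pmf (iter (Qk \<xi>) (replicate n u) zero) z) \<longlonglongrightarrow> 0 + \<Pi>t 0 u z"
      by (rule tendsto_add)
    then show ?thesis by simp
  qed
  have "(\<lambda>n. \<integral>x. pmf (iter (Qk \<xi>) (replicate n u) x) z \<partial>measure_pmf \<mu>) \<longlonglongrightarrow> (\<integral>x. \<Pi>t 0 u z \<partial>measure_pmf \<mu>)"
  proof (rule integral_dominated_convergence[where w = "\<lambda>_. 1"])
    show "AE x in measure_pmf \<mu>. (\<lambda>n. pmf (iter (Qk \<xi>) (replicate n u) x) z) \<longlonglongrightarrow> \<Pi>t 0 u z"
      using conv sup by (auto simp: AE_measure_pmf_iff)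
  qed (auto simp: pmf_le_1)
  moreover have "(\<integral>x. pmf (iter (Qk \<xi>) (replicate n u) x) z \<partial>measure_pmf \<mu>) = pmf \<mu> z" for n
    by (subst pmf_bind[symmetric]) (simp only: iter)
  ultimately have "(\<lambda>n. pmf \<mu> z) \<longlonglongrightarrow> \<Pi>t 0 u z" by simp
  then show "pmf \<mu> z = pmf (\<pi>p u) z" by (simp add: LIMSEQ_const_iff pmf_\<pi>p[OF u])
qed

lemma the_invariant: "u \<in> {0..1} \<Longrightarrow> the_invariant_pmf p (Qk \<xi> u) = \<pi>p u"
  unfolding the_invariant_pmf_def using \<pi>p_invariant invariant_unique by (intro the_equality) auto

section \<open>Path laws as smooth families\<close>

primrec Pt :: "nat \<Rightarrow> nat list \<Rightarrow> nat \<Rightarrow> real \<Rightarrow> nat list list \<Rightarrow> real" where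
  "Pt 0 x = (if length x = p then tower_return [x] else (\<lambda>_ _ _. 0))"
| "Pt (Suc j) x = (if length x = p then tower_map ((#) x) (tower_bind (Qt x) (Pt j)) else (\<lambda>_ _ _. 0))"

text \<open>Smoothness and the bound are proved together, since \<open>tower_kernel\<close> needs
  the bound for the shorter path. The exponent \<open>m + r\<close> does not grow with the length of
  the path, because prepending a state uses \<open>wnorm_tower_map_bound\<close>.\<close>

lemma Pt_tower_bound:
  "(\<forall>x. tower k L sz2 (Pt j x)) \<and>
   (\<exists>C\<ge>0. \<forall>x r m u. r \<le> k \<longrightarrow> m + r \<le> L \<longrightarrow> u \<in> {0..1} \<longrightarrow> wnorm (wt sz2 m) (Pt j x r u) \<le> ennreal (C * wlist (m + r) x))"
proof (induction j)
  case 0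
  have "wnorm (wt sz2 m) (Pt 0 x r u) \<le> ennreal (1 * wlist (m + r) x)" for x r m u
  proof (cases "length x = p \<and> r = 0")
    case True
    then have "Pt 0 x r u = (\<lambda>z. if z = [x] then 1 else 0)" by (auto simp: tower_return_def)
    then show ?thesis using True by (simp add: wnorm_delta) (simp add: wt_def)
  next
    case False
    then have "Pt 0 x r u = (\<lambda>z. 0)" by (auto simp: tower_return_def)
    then show ?thesis by simp
  qed
  moreover have "tower k L sz2 (Pt 0 x)" for x by (simp add: tower_tower_return)
  ultimately show ?case by (intro conjI allI impI exI[of _ 1] zero_le_one)
next
  case (Suc j)
  then obtain C where C: "0 \<le> C" "\<And>x r m u. r \<le> k \<Longrightarrow> m + r \<le> L \<Longrightarrow> u \<in> {0..1} \<Longrightarrow> wnorm (wt sz2 m) (Pt j x r u) \<le> ennreal (C * wlist (m + r) x)"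
    and tow: "\<And>x. tower k L sz2 (Pt j x)" by auto
  obtain CQ where CQ: "0 \<le> CQ" "\<And>x r m u. r \<le> k \<Longrightarrow> m + r \<le> L \<Longrightarrow> u \<in> {0..1} \<Longrightarrow>
     wnorm (wlist m) (Qt x r u) \<le> ennreal (CQ * wlist (m + r) x)" using Qt_bound by blast
  have t: "tower k L sz2 (tower_bind (Qt x) (Pt j))" for x
    by (rule tower_kernel[OF less_imp_le[OF kL] Qt_tower tow C])
  have "tower k L sz2 (Pt (Suc j) x)" for x
  proof (cases "length x = p")
    case True
    have "tower k L sz2 (tower_map ((#) x) (tower_bind (Qt x) (Pt j)))"
      by (rule tower_tower_map[OF less_imp_le[OF kL] t, where c = "sum_list x"]) simp
    then show ?thesis using True by simp
  qed simp
  moreover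
  define C' where "C' = 2 ^ L * 2 * (real (Suc k) * C * CQ)"
  have ker: "wnorm (wt sz2 m) (tower_bind (Qt x) (Pt j) r u) \<le> ennreal (real (Suc k) * C * CQ * (1 + real (sum_list x)) ^ (m + r))"
    if *: "r \<le> k" "m + r \<le> L" "u \<in> {0..1}" for x r m u
  proof -
    have "wnorm (wt sz2 m) (tower_bind (Qt x) (Pt j) r u) \<le> ennreal (real (Suc r) * C * (CQ * wlist (m + r) x))"
    proof (rule wnorm_tower_bind_le[OF C(1), where sz = sum_list])
      show "wnorm (wlist (m + r - i)) (Qt x i u) \<le> ennreal (CQ * wlist (m + r) x)" if "i \<le> r" for i
        using CQ(2)[of i "m + r - i" u x] that * by auto
      show "wnorm (wt sz2 m) (Pt j y (r - i) u) \<le> ennreal (C * wlist (m + r - i) y)" if "i \<le> r" for i y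
        using C(2)[of "r - i" m u y] that * by auto
    qed (use CQ in auto)
    also have "\<dots> \<le> ennreal (real (Suc k) * C * (CQ * wlist (m + r) x))"
      using * C CQ by (intro ennreal_leI mult_right_mono) auto
    finally show ?thesis by (simp only: wt_def mult.assoc)
  qed
  have "wnorm (wt sz2 m) (Pt (Suc j) x r u) \<le> ennreal (C' * wlist (m + r) x)"
    if *: "r \<le> k" "m + r \<le> L" "u \<in> {0..1}" for x r m u
  proof (cases "length x = p")
    case True
    have "wnorm (wt sz2 m) (tower_map ((#) x) (tower_bind (Qt x) (Pt j)) r u) \<le>
        ennreal (2 ^ m * 2 * (real (Suc k) * C * CQ) * (1 + real (sum_list x)) ^ (m + r))"
      using ker[OF *, of x] ker[OF *(1) _ *(3), of 0 x] * C CQ by (intro wnorm_tower_map_bound[where sz = sz2]) auto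
    also have "\<dots> \<le> ennreal (C' * wlist (m + r) x)"
      unfolding wt_def C'_def using * C CQ by (intro ennreal_leI mult_right_mono power_increasing) auto
    finally show ?thesis using True by simp
  qed simp
  moreover have "0 \<le> C'" using C CQ by (simp add: C'_def)
  ultimately show ?case by (intro conjI allI impI exI[of _ C'])
qed

lemma Pt_0: "length x = p \<Longrightarrow> Pt j x 0 u = pmf (path_pmf (Qk \<xi> u) j x)"
proof (induction j arbitrary: x)
  case 0
  then show ?case by (auto simp: tower_return_def pmf_return fun_eq_iff)
next
  case (Suc j)
  have "tower_bind (Qt x) (Pt j) 0 u z = pmf (bind_pmf (Qk \<xi> u x) (path_pmf (Qk \<xi> u) j)) z" for z
  proof -
    have "tower_bind (Qt x) (Pt j) 0 u z = kernel_app (Qp u x) (\<lambda>y. Pt j y 0 u) z"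
      by (simp add: tower_bind_def Qt_0[OF Suc.prems])
    also have "\<dots> = kernel_app (Qp u x) (\<lambda>y. pmf (path_pmf (Qk \<xi> u) j y)) z"
    proof (intro kernel_app_cong refl)
      fix y assume "Qp u x y \<noteq> 0"
      then have "length y = p" using set_Qk[OF Suc.prems, of \<xi> u] by (auto simp: set_pmf_iff)
      then show "Pt j y 0 u z = pmf (path_pmf (Qk \<xi> u) j y) z" by (simp add: Suc.IH)
    qed
    finally show ?thesis by (simp add: pmf_bind_kernel_app)
  qed
  then have "tower_bind (Qt x) (Pt j) 0 u = pmf (bind_pmf (Qk \<xi> u x) (path_pmf (Qk \<xi> u) j))" by (rule ext)
  moreover have "Pt (Suc j) x 0 u = tower_map ((#) x) (tower_bind (Qt x) (Pt j)) 0 u" by (simp add: Suc.prems)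
  ultimately show ?case by (intro ext) (simp only: tower_map_def pmf_map_kernel_app path_pmf.simps)
qed

lemma stationary_tower: "tower k L sz2 (tower_bind \<Pi>t (Pt j))"
proof -
  obtain C where C: "0 \<le> C" "\<And>x r m u. r \<le> k \<Longrightarrow> m + r \<le> L \<Longrightarrow> u \<in> {0..1} \<Longrightarrow> wnorm (wt sz2 m) (Pt j x r u) \<le> ennreal (C * wlist (m + r) x)"
    using Pt_tower_bound[of j] by blast
  show ?thesis
    using Pt_tower_bound[of j] by (intro tower_kernel[OF less_imp_le[OF kL] \<Pi>t_tower _ C]) blast
qed

lemma stationary_tower_0:
  assumes "u \<in> {0..1}"
  shows "tower_bind \<Pi>t (Pt j) 0 u = pmf (stationary_path_pmf p (Qk \<xi> u) (Suc j))"
proof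
  fix z
  have "tower_bind \<Pi>t (Pt j) 0 u z = kernel_app (\<Pi>t 0 u) (\<lambda>y. Pt j y 0 u) z"
    by (simp add: tower_bind_def)
  also have "\<dots> = kernel_app (\<Pi>t 0 u) (\<lambda>y. pmf (path_pmf (Qk \<xi> u) j y)) z"
  proof (intro kernel_app_cong refl)
    fix y assume "\<Pi>t 0 u y \<noteq> 0"
    then have "length y = p" using \<Pi>t_supp by blast
    then show "Pt j y 0 u z = pmf (path_pmf (Qk \<xi> u) j y) z" by (simp add: Pt_0)
  qed
  finally show "tower_bind \<Pi>t (Pt j) 0 u z = pmf (stationary_path_pmf p (Qk \<xi> u) (Suc j)) z"
    using assms by (simp add: stationary_path_pmf_def the_invariant pmf_bind_kernel_app pmf_\<pi>p)
qed

end

section \<open>From weighted norms to the space of signed measures\<close>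

lemma V_norm_nonneg:
  assumes "\<And>z. z \<in> blocks p j \<Longrightarrow> 0 \<le> (\<Sum>x\<leftarrow>z. V x)"
  shows "0 \<le> V_norm p j V f"
  unfolding V_norm_def
  by (rule SUP_upper2[where i = "\<lambda>_. 0"]) (use assms in \<open>auto simp: infsum_0 zero_ereal_def\<close>)

text \<open>The easy half of the duality between test functions bounded by \<open>V\<close> and
  weighted sums. Upper bounds suffice for both conclusions, as one is an inequality and the other
  asks for finiteness and convergence to 0.\<close>

lemma V_norm_le:
  assumes V: "\<And>z. z \<in> blocks p j \<Longrightarrow> (\<Sum>x\<leftarrow>z. V x) \<le> B * wt sz2 m z" and B: "0 \<le> B"
    and f: "wnorm (wt sz2 m) f \<le> ennreal c" and c: "0 \<le> c"
  shows "V_norm p j V f \<le> ereal (B * c)"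
  unfolding V_norm_def
proof (rule SUP_least)
  fix g assume "g \<in> {g. (\<forall>z\<in>blocks p j. \<bar>g z\<bar> \<le> (\<Sum>x\<leftarrow>z. V x)) \<and> (\<lambda>z. g z * f z) summable_on blocks p j}"
  then have g: "\<And>z. z \<in> blocks p j \<Longrightarrow> \<bar>g z\<bar> \<le> (\<Sum>x\<leftarrow>z. V x)" and sm: "(\<lambda>z. g z * f z) summable_on blocks p j" by auto
  have "infsum (\<lambda>z. g z * f z) (blocks p j) \<le> B * c"
  proof (rule infsum_le_finite_sums[OF sm])
    fix F assume F: "finite F" "F \<subseteq> blocks p j"
    have "(\<Sum>z\<in>F. g z * f z) \<le> (\<Sum>z\<in>F. B * (\<bar>f z\<bar> * wt sz2 m z))"
    proof (rule sum_mono)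
      fix z assume "z \<in> F"
      then have "\<bar>g z\<bar> \<le> B * wt sz2 m z" using F g V by (meson order_trans subsetD)
      then have "\<bar>g z\<bar> * \<bar>f z\<bar> \<le> B * wt sz2 m z * \<bar>f z\<bar>" by (rule mult_right_mono) auto
      then show "g z * f z \<le> B * (\<bar>f z\<bar> * wt sz2 m z)"
        using abs_ge_self[of "g z * f z"] by (simp add: abs_mult mult_ac)
    qed
    also have "\<dots> = B * (\<Sum>z\<in>F. \<bar>f z\<bar> * wt sz2 m z)" by (rule sum_distrib_left[symmetric])
    also have "\<dots> \<le> B * c"
    proof (rule mult_left_mono[OF _ B])
      have "ennreal (\<Sum>z\<in>F. \<bar>f z\<bar> * wt sz2 m z) \<le> ennreal c"
        using sum_le_wnorm[OF F(1), of "wt sz2 m" f] f by (auto intro: order_trans)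
      then show "(\<Sum>z\<in>F. \<bar>f z\<bar> * wt sz2 m z) \<le> c" using c by (simp add: ennreal_le_iff)
    qed
    finally show "(\<Sum>z\<in>F. g z * f z) \<le> B * c" .
  qed
  then show "ereal (infsum (\<lambda>z. g z * f z) (blocks p j)) \<le> ereal (B * c)" by simp
qed

lemma V_space_memI:
  assumes V: "\<And>z. z \<in> blocks p j \<Longrightarrow> (\<Sum>x\<leftarrow>z. V x) \<le> B * wt sz2 m z" and B: "0 \<le> B"
    and f: "wnorm (wt sz2 m) f \<le> ennreal c" and c: "0 \<le> c"
  shows "f \<in> V_space p j V"
proof -
  have "(\<lambda>z. norm (f z)) summable_on blocks p j"
    unfolding Infinite_Sum.abs_summable_iff_bdd_above
  proof (rule bdd_aboveI)
    fix s assume "s \<in> sum (\<lambda>x. norm (f x)) ` {F. F \<subseteq> blocks p j \<and> finite F}"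
    then obtain F where F: "finite F" "s = (\<Sum>z\<in>F. \<bar>f z\<bar>)" by auto
    have "s \<le> (\<Sum>z\<in>F. \<bar>f z\<bar> * wt sz2 m z)"
      unfolding F(2)
    proof (rule sum_mono)
      fix z show "\<bar>f z\<bar> \<le> \<bar>f z\<bar> * wt sz2 m z"
        using mult_left_mono[OF wt_ge_1, of "\<bar>f z\<bar>" sz2 m z] by simp
    qed
    moreover have "ennreal (\<Sum>z\<in>F. \<bar>f z\<bar> * wt sz2 m z) \<le> ennreal c"
      using sum_le_wnorm[OF F(1), of "wt sz2 m" f] f by (auto intro: order_trans)
    ultimately show "s \<le> c" using c by (simp add: ennreal_le_iff)
  qed
  then have "f summable_on blocks p j" by (rule abs_summable_summable)
  moreover have "V_norm p j V f < \<infinity>"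
    using V_norm_le[OF V B f c] by (rule le_less_trans) auto
  ultimately show ?thesis by (simp add: V_space_def)
qed

lemma tendsto_0_ereal:
  fixes f :: "'a \<Rightarrow> ereal"
  assumes "\<And>x. 0 \<le> f x" "\<And>e. e > 0 \<Longrightarrow> eventually (\<lambda>x. f x \<le> ereal e) F"
  shows "(f \<longlongrightarrow> 0) F"
proof (rule order_tendstoI)
  fix a :: ereal assume "a < 0"
  then show "eventually (\<lambda>x. a < f x) F" using assms(1) by (intro always_eventually) (auto intro: less_le_trans)
next
  fix a :: ereal assume "0 < a"
  then obtain e where e: "0 < ereal e" "ereal e < a" using ereal_dense2 by blast
  then have "eventually (\<lambda>x. f x \<le> ereal e) F" by (intro assms(2)) auto
  then show "eventually (\<lambda>x. f x < a) F"
    by (rule eventually_mono) (use e in \<open>auto intro: le_less_trans\<close>)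
qed

text \<open>Level \<open>s\<close> lives in weight \<open>d + k - s\<close>, which is at least
  \<open>d\<close> for all \<open>s <= k\<close>; so all derivatives can be read in the one space
  with weight \<open>d\<close>, which dominates \<open>V\<close> on blocks up to
  \<open>B\<close>.\<close>

lemma tower_Ck_into_V_space:
  assumes T: "tower k (d + k) sz2 T" and F: "\<And>u. u \<in> {0..1} \<Longrightarrow> F u = T 0 u"
    and V: "\<And>z. z \<in> blocks p j \<Longrightarrow> (\<Sum>x\<leftarrow>z. V x) \<le> B * wt sz2 d z" and B: "0 < B"
    and V0: "\<And>z. z \<in> blocks p j \<Longrightarrow> 0 \<le> (\<Sum>x\<leftarrow>z. V x)"
  shows "Ck_into_V_space k p j V F"
proof -
  \<comment> \<open>The factorial undoes the normalisation of the levels.\<close>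
  define D where "D s u z = fact s * T s u z" for s u z
  have low: "wnorm (wt sz2 d) f \<le> wnorm (wt sz2 (d + k - s)) f" if "s \<le> k" for s f
    using that by (intro wnorm_mono_weight) auto
  have Bb: "V_norm p j V f \<le> ereal e" if "wnorm (wt sz2 d) f \<le> ennreal (e / B)" "0 < e" for f e
    using V_norm_le[OF V _ that(1)] B that(2) by simp
  show ?thesis
    unfolding Ck_into_V_space_def
  proof (intro exI[of _ D] conjI allI impI ballI)
    fix u :: real assume "u \<in> {0..1}"
    then show "D 0 u = F u" by (simp add: D_def F fun_eq_iff)
  next
    fix s u assume s: "s \<le> k" and u: "u \<in> {0..1::real}"
    obtain C where C: "0 \<le> C" "\<And>r u. r \<le> k \<Longrightarrow> u \<in> {0..1} \<Longrightarrow> wnorm (wt sz2 (d + k - r)) (T r u) \<le> ennreal C"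
      using tower_bounded[OF T] by blast
    have "wnorm (wt sz2 d) (D s u) = ennreal (fact s) * wnorm (wt sz2 d) (T s u)"
      unfolding D_def[abs_def] wnorm_cmult by simp
    also have "\<dots> \<le> ennreal (fact s) * ennreal C"
      using C(2)[OF s u] low[OF s] by (intro mult_left_mono) (auto intro: order_trans)
    also have "\<dots> = ennreal (fact s * C)" using C by (simp add: ennreal_mult)
    finally show "D s u \<in> V_space p j V"
      using B C by (intro V_space_memI[where B = B and m = d and c = "fact s * C", OF V]) auto
  next
    fix s u assume s: "s < k" and u: "u \<in> {0..1::real}"
    show "((\<lambda>v. V_norm p j V (\<lambda>z. (D s v z - D s u z) / (v - u) - D (Suc s) u z)) \<longlongrightarrow> 0) (at u within {0..1})"
    proof (rule tendsto_0_ereal[OF V_norm_nonneg[OF V0]])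
      fix e :: real assume e: "e > 0"
      have e': "e / B / fact s > 0" using e B by simp
      obtain dl where dl: "dl > 0" "\<And>v. v \<in> {0..1} \<Longrightarrow> v \<noteq> u \<Longrightarrow> \<bar>v - u\<bar> < dl \<Longrightarrow>
        wnorm (wt sz2 (d + k - Suc s)) (\<lambda>z. (T s v z - T s u z) / (v - u) - real (Suc s) * T (Suc s) u z) \<le> ennreal (e / B / fact s)"
        using tower_wnorm_deriv[OF T s u e'] by blast
      show "\<forall>\<^sub>F v in at u within {0..1}. V_norm p j V (\<lambda>z. (D s v z - D s u z) / (v - u) - D (Suc s) u z) \<le> ereal e"
        unfolding eventually_at
      proof (intro exI[of _ dl] conjI ballI impI dl(1))
        fix v assume v: "v \<in> {0..1}" "v \<noteq> u \<and> dist v u < dl"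
        let ?g = "\<lambda>z. (T s v z - T s u z) / (v - u) - real (Suc s) * T (Suc s) u z"
        have "(\<lambda>z. (D s v z - D s u z) / (v - u) - D (Suc s) u z) = (\<lambda>z. fact s * ?g z)"
          by (simp add: D_def fun_eq_iff right_diff_distrib mult_ac)
        then have "wnorm (wt sz2 d) (\<lambda>z. (D s v z - D s u z) / (v - u) - D (Suc s) u z) = ennreal (fact s) * wnorm (wt sz2 d) ?g"
          by (simp only: wnorm_cmult) simp
        also have "\<dots> \<le> ennreal (fact s) * ennreal (e / B / fact s)"
          using dl(2)[of v] v s low[of "Suc s" ?g] by (intro mult_left_mono) (auto simp: dist_real_def intro: order_trans)
        also have "\<dots> = ennreal (e / B)" using e B by (simp add: ennreal_mult[symmetric])
        finally show "V_norm p j V (\<lambda>z. (D s v z - D s u z) / (v - u) - D (Suc s) u z) \<le> ereal e"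
          using e by (intro Bb)
      qed
    qed
  next
    fix u assume u: "u \<in> {0..1::real}"
    show "((\<lambda>v. V_norm p j V (\<lambda>z. D k v z - D k u z)) \<longlongrightarrow> 0) (at u within {0..1})"
    proof (rule tendsto_0_ereal[OF V_norm_nonneg[OF V0]])
      fix e :: real assume e: "e > 0"
      have e': "e / B / fact k > 0" using e B by simp
      obtain dl where dl: "dl > 0" "\<And>v. v \<in> {0..1} \<Longrightarrow> \<bar>v - u\<bar> < dl \<Longrightarrow>
        wnorm (wt sz2 (d + k - k)) (\<lambda>z. T k v z - T k u z) \<le> ennreal (e / B / fact k)"
        using weighted_cont_wnorm_continuous[OF tower_weighted_cont[OF T order_refl] _ u e'] by (metis wt_nonneg)
      show "\<forall>\<^sub>F v in at u within {0..1}. V_norm p j V (\<lambda>z. D k v z - D k u z) \<le> ereal e"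
        unfolding eventually_at
      proof (intro exI[of _ dl] conjI ballI impI dl(1))
        fix v assume v: "v \<in> {0..1}" "v \<noteq> u \<and> dist v u < dl"
        let ?g = "\<lambda>z. T k v z - T k u z"
        have "(\<lambda>z. D k v z - D k u z) = (\<lambda>z. fact k * ?g z)"
          by (simp add: D_def fun_eq_iff right_diff_distrib)
        then have "wnorm (wt sz2 d) (\<lambda>z. D k v z - D k u z) = ennreal (fact k) * wnorm (wt sz2 d) ?g"
          by (simp only: wnorm_cmult) simp
        also have "\<dots> \<le> ennreal (fact k) * ennreal (e / B / fact k)"
          using dl(2)[of v] v by (intro mult_left_mono) (auto simp: dist_real_def)
        also have "\<dots> = ennreal (e / B)" using e B by (simp add: ennreal_mult[symmetric])
        finally show "V_norm p j V (\<lambda>z. D k v z - D k u z) \<le> ereal e"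
          using e by (intro Bb)
      qed
    qed
  qed
qed

section \<open>Local stationarity\<close>

definition is_law :: "'a measure \<Rightarrow> ('a \<Rightarrow> 'b) \<Rightarrow> 'b pmf \<Rightarrow> bool" where
  "is_law M X P \<longleftrightarrow> X \<in> M \<rightarrow>\<^sub>M count_space UNIV \<and> measure_pmf P = distr M (count_space UNIV) X"

lemma is_law_pmf:
  assumes "is_law M X P" shows "pmf P z = measure M {\<omega> \<in> space M. X \<omega> = z}"
proof -
  have "pmf P z = measure (distr M (count_space UNIV) X) {z}"
    using assms by (simp add: is_law_def pmf.rep_eq)
  also have "\<dots> = measure M (X -` {z} \<inter> space M)"
    using assms by (intro measure_distr) (auto simp: is_law_def)
  also have "X -` {z} \<inter> space M = {\<omega> \<in> space M. X \<omega> = z}" by auto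
  finally show ?thesis .
qed

lemma is_law_exists:
  fixes X :: "'a \<Rightarrow> 'b::countable"
  assumes "prob_space M" and X: "X \<in> M \<rightarrow>\<^sub>M count_space UNIV"
  obtains P where "is_law M X P"
proof -
  interpret prob_space M by fact
  let ?N = "distr M (count_space UNIV) X"
  interpret N: prob_space ?N by (rule prob_space_distr) (rule X)
  have "(\<integral>\<^sup>+z. ennreal (measure ?N {z}) \<partial>count_space UNIV) = (\<integral>\<^sup>+z. emeasure ?N {z} \<partial>count_space UNIV)"
    by (simp add: N.emeasure_eq_measure)
  also have "\<dots> = emeasure ?N UNIV"
    by (rule emeasure_countable_singleton[symmetric]) auto
  also have "\<dots> = 1" using N.emeasure_space_1 by simp
  finally have "pmf (embed_pmf (\<lambda>z. measure ?N {z})) z = measure ?N {z}" for z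
    by (intro pmf_embed_pmf) auto
  then have "measure_pmf (embed_pmf (\<lambda>z. measure ?N {z})) = ?N"
    by (intro measure_eqI_countable[of _ UNIV]) (auto simp: emeasure_pmf_single N.emeasure_eq_measure)
  then show ?thesis using X by (intro that) (simp add: is_law_def)
qed

lemma is_law_unique: "is_law M X P \<Longrightarrow> is_law M X P' \<Longrightarrow> P = P'"
  by (simp add: is_law_def measure_pmf_inject[symmetric])

lemma is_lawI:
  fixes X :: "'a \<Rightarrow> 'b::countable"
  assumes "prob_space M" "X \<in> M \<rightarrow>\<^sub>M count_space UNIV"
    and "\<And>z. pmf P z = measure M {\<omega> \<in> space M. X \<omega> = z}"
  shows "is_law M X P"
proof -
  obtain P' where P': "is_law M X P'" using is_law_exists[OF assms(1,2)] .
  have "P = P'" by (rule pmf_eqI) (simp add: assms(3) is_law_pmf[OF P'])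
  then show ?thesis using P' by simp
qed

lemma is_law_comp:
  assumes "is_law M X P" shows "is_law M (\<lambda>\<omega>. f (X \<omega>)) (map_pmf f P)"
proof -
  have X: "X \<in> M \<rightarrow>\<^sub>M count_space UNIV" and P: "measure_pmf P = distr M (count_space UNIV) X"
    using assms by (auto simp: is_law_def)
  have "(\<lambda>\<omega>. f (X \<omega>)) \<in> M \<rightarrow>\<^sub>M count_space UNIV"
    by (rule measurable_compose[OF X]) simp
  moreover have "distr (distr M (count_space UNIV) X) (count_space UNIV) f = distr M (count_space UNIV) (\<lambda>\<omega>. f (X \<omega>))"
    using X by (subst distr_distr) (auto simp: o_def)
  ultimately show ?thesis unfolding is_law_def map_pmf_rep_eq P by simp
qed

lemma measurable_map_count_space:
  fixes Y :: "'c \<Rightarrow> 'a \<Rightarrow> 'b::countable"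
  assumes "\<And>s. s \<in> set ss \<Longrightarrow> Y s \<in> M \<rightarrow>\<^sub>M count_space UNIV"
  shows "(\<lambda>\<omega>. map (\<lambda>s. Y s \<omega>) ss) \<in> M \<rightarrow>\<^sub>M count_space UNIV"
  using assms
proof (induction ss)
  case (Cons s ss)
  have "(\<lambda>\<omega>. (Y s \<omega>, map (\<lambda>s. Y s \<omega>) ss)) \<in> M \<rightarrow>\<^sub>M count_space UNIV \<Otimes>\<^sub>M count_space UNIV"
    using Cons by (intro measurable_Pair) auto
  also have "count_space (UNIV :: 'b set) \<Otimes>\<^sub>M count_space (UNIV :: 'b list set) = count_space UNIV"
    by (subst pair_measure_countable) auto
  finally have m: "(\<lambda>\<omega>. (Y s \<omega>, map (\<lambda>s. Y s \<omega>) ss)) \<in> M \<rightarrow>\<^sub>M count_space UNIV" .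
  have "(\<lambda>(y, ys). y # ys) \<in> count_space UNIV \<rightarrow>\<^sub>M count_space UNIV" by simp
  from measurable_compose[OF m this] show ?case by simp
qed simp

lemma past_algebra_subset:
  assumes "\<And>s. s < t \<Longrightarrow> Y s \<in> M \<rightarrow>\<^sub>M count_space UNIV"
  shows "subalgebra M (past_algebra M Y t)"
proof -
  have "sigma_sets (space M) {Y s -` A \<inter> space M |s A. s < t} \<subseteq> sets M"
    using assms by (intro sets.sigma_sets_subset) (auto intro: measurable_sets)
  moreover have "{Y s -` A \<inter> space M |s A. s < t} \<subseteq> Pow (space M)" by auto
  ultimately show ?thesis
    unfolding subalgebra_def past_algebra_def by (simp add: sets_measure_of space_measure_of)
qed

lemma measurable_past_algebra:
  assumes "s < t" shows "Y s \<in> past_algebra M Y t \<rightarrow>\<^sub>M count_space UNIV"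
proof (rule measurableI)
  fix A :: "nat set"
  have "{Y s -` A \<inter> space M |s A. s < t} \<subseteq> Pow (space M)" by auto
  then show "Y s -` A \<inter> space (past_algebra M Y t) \<in> sets (past_algebra M Y t)"
    unfolding past_algebra_def using assms
    by (auto simp: sets_measure_of space_measure_of intro!: sigma_sets.Basic)
qed auto

text \<open>On a past event that fixes the lag vector the transition probability is constant, so
  integrating the conditional expectation over the event gives an elementary product
  formula.\<close>

lemma transition_step:
  assumes M: "prob_space M" and Y: "\<And>s. s \<le> t \<Longrightarrow> Y s \<in> M \<rightarrow>\<^sub>M count_space UNIV"
    and tr: "has_transition_at M p Y t R" and E: "E \<in> sets (past_algebra M Y t)"
    and x: "\<And>\<omega>. \<omega> \<in> E \<Longrightarrow> lag_vec p Y (t - 1) \<omega> = x"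
  shows "measure M {\<omega> \<in> E. Y t \<omega> = y} = measure M E * pmf (R x) y"
proof -
  interpret prob_space M by fact
  let ?F = "past_algebra M Y t"
  have sub: "subalgebra M ?F" using Y by (intro past_algebra_subset) auto
  interpret F: finite_measure_subalgebra M ?F by unfold_locales (rule sub)
  have EM: "E \<in> sets M" using E sub by (auto simp: subalgebra_def)
  let ?f = "\<lambda>\<omega>. indicator {y} (Y t \<omega>) :: real"
  have Yt: "Y t \<in> M \<rightarrow>\<^sub>M count_space UNIV" by (rule Y) simp
  have f: "?f \<in> borel_measurable M" by (rule measurable_compose[OF Yt]) simp
  have int: "integrable M ?f"
    by (rule integrable_const_bound[where B = 1]) (use f in \<open>auto simp: indicator_def\<close>)
  have "{\<omega> \<in> E. Y t \<omega> = y} = E \<inter> (Y t -` {y} \<inter> space M)"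
    using sets.sets_into_space[OF EM] by auto
  then have Ey: "{\<omega> \<in> E. Y t \<omega> = y} \<in> sets M"
    using EM measurable_sets[OF Yt, of "{y}"] by auto
  have "measure M {\<omega> \<in> E. Y t \<omega> = y} = (\<integral>\<omega>. indicator {\<omega> \<in> E. Y t \<omega> = y} \<omega> \<partial>M)"
    using Ey by simp
  also have "\<dots> = (LINT \<omega>:E|M. ?f \<omega>)"
    unfolding set_lebesgue_integral_def by (intro Bochner_Integration.integral_cong) (auto simp: indicator_def)
  also have "\<dots> = (LINT \<omega>:E|M. real_cond_exp M ?F ?f \<omega>)"
    by (rule F.real_cond_exp_intA[OF int E])
  also have "\<dots> = (LINT \<omega>:E|M. pmf (R x) y)"
    unfolding set_lebesgue_integral_def
  proof (rule integral_cong_AE)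
    have "AE \<omega> in M. real_cond_exp M ?F ?f \<omega> = measure_pmf.prob (R (lag_vec p Y (t - 1) \<omega>)) {y}"
      using tr unfolding has_transition_at_def by blast
    then show "AE \<omega> in M. indicator E \<omega> *\<^sub>R real_cond_exp M ?F ?f \<omega> = indicator E \<omega> *\<^sub>R pmf (R x) y"
      by (rule AE_mp) (auto simp: indicator_def x measure_pmf_single intro!: AE_I2)
  qed (use EM borel_measurable_cond_exp2 in auto)
  also have "\<dots> = measure M E * pmf (R x) y"
    using EM by (simp add: set_lebesgue_integral_def)
  finally show ?thesis .
qed

lemma lag_vec_Suc:
  assumes "1 \<le> p" shows "lag_vec p Y t \<omega> = tl (lag_vec p Y (t - 1) \<omega>) @ [Y t \<omega>]"
proof -
  have "[t - 1 - int p + 1..t - 1] = (t - int p) # [t - int p + 1..t - 1]"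
    using assms by (subst upto_rec1) (auto simp: algebra_simps)
  moreover have "[t - int p + 1..t] = [t - int p + 1..t - 1] @ [t]"
    using assms by (intro upto_rec2) auto
  ultimately show ?thesis by (simp add: lag_vec_def)
qed

lemma length_lag_vec: "length (lag_vec p Y t \<omega>) = p"
  by (simp add: lag_vec_def)

lemma measurable_lag_vec:
  assumes "\<And>s. s \<le> t \<Longrightarrow> Y s \<in> M \<rightarrow>\<^sub>M count_space UNIV"
  shows "lag_vec p Y t \<in> M \<rightarrow>\<^sub>M count_space UNIV"
  using assms unfolding lag_vec_def[abs_def] by (intro measurable_map_count_space) auto

fun pathL :: "('u \<Rightarrow> 's \<Rightarrow> 's pmf) \<Rightarrow> 'u list \<Rightarrow> 's \<Rightarrow> 's list pmf" where
  "pathL Q [] x = return_pmf [x]"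
| "pathL Q (u # us) x = map_pmf ((#) x) (bind_pmf (Q u x) (pathL Q us))"

lemma path_pmf_pathL: "path_pmf (Q u) j = pathL Q (replicate j u)"
proof (induction j)
  case (Suc j)
  then show ?case by (intro ext) simp
qed (simp add: fun_eq_iff)

lemma pathL_nonempty: "[] \<notin> set_pmf (pathL Q us x)"
  by (cases us) auto

text \<open>Paths are defined by their first step, while the law of the process is built forward in
  time; this exchanges the two decompositions.\<close>

lemma pathL_snoc:
  "pathL Q (us @ [u]) x = bind_pmf (pathL Q us x) (\<lambda>zz. map_pmf (\<lambda>z. zz @ [z]) (Q u (last zz)))"
proof (induction us arbitrary: x)
  case Nil
  show ?case by (simp add: bind_return_pmf map_pmf_def bind_assoc_pmf)
next
  case (Cons v us)
  have "pathL Q ((v # us) @ [u]) x =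
      bind_pmf (Q v x) (\<lambda>y. bind_pmf (pathL Q us y) (\<lambda>zz. map_pmf (\<lambda>z. (x # zz) @ [z]) (Q u (last zz))))"
    by (simp add: Cons map_bind_pmf pmf.map_comp o_def)
  also have "\<dots> = bind_pmf (Q v x) (\<lambda>y. bind_pmf (pathL Q us y) (\<lambda>zz. map_pmf (\<lambda>z. (x # zz) @ [z]) (Q u (last (x # zz)))))"
    using pathL_nonempty[of Q us] by (intro bind_pmf_cong refl) (metis last_ConsR)
  also have "\<dots> = bind_pmf (pathL Q (v # us) x) (\<lambda>zz. map_pmf (\<lambda>z. zz @ [z]) (Q u (last zz)))"
    by (simp add: bind_map_pmf bind_assoc_pmf)
  finally show ?case .
qed

context ginar begin

text \<open>Induction by appending a state. The event that the path so far equals \<open>zz\<close>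
  belongs to the past and fixes the lag vector, so \<open>transition_step\<close> applies. A path of
  \<open>i + 1\<close> states has \<open>i\<close> transitions, whose parameters belong to the times
  \<open>t0 + 1\<close> to \<open>t0 + i\<close>.\<close>

lemma path_law:
  assumes M: "prob_space M" and Y: "\<And>s. s \<le> t1 \<Longrightarrow> Y s \<in> M \<rightarrow>\<^sub>M count_space UNIV"
    and tr: "\<And>t. t0 < t \<Longrightarrow> t \<le> t1 \<Longrightarrow> has_transition_at M p Y t (branching_kernel p \<zeta> \<xi> (v t))"
    and P: "is_law M (lag_vec p Y t0) P" and i: "t0 + int i \<le> t1"
  shows "is_law M (\<lambda>\<omega>. map (\<lambda>s. lag_vec p Y s \<omega>) [t0..t0 + int i])
     (bind_pmf P (pathL (Qk \<xi>) (map (\<lambda>l. v (t0 + int l)) [1..<Suc i])))"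
  using i
proof (induction i)
  case 0
  have "pathL (Qk \<xi>) [] = (\<lambda>x. return_pmf [x])" by (simp add: fun_eq_iff)
  then have "bind_pmf P (pathL (Qk \<xi>) []) = map_pmf (\<lambda>x. [x]) P" by (simp add: map_pmf_def)
  moreover have "map (\<lambda>l. v (t0 + int l)) [1..<Suc 0] = []" "[t0..t0 + int 0] = [t0]" by simp_all
  ultimately show ?case using is_law_comp[OF P, of "\<lambda>x. [x]"] by (simp only: list.map)
next
  case (Suc i)
  let ?t = "t0 + int (Suc i)"
  let ?us = "map (\<lambda>l. v (t0 + int l)) [1..<Suc i]"
  let ?path = "\<lambda>i \<omega>. map (\<lambda>s. lag_vec p Y s \<omega>) [t0..t0 + int i]"
  define PP where "PP = bind_pmf P (pathL (Qk \<xi>) ?us)"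
  have IH: "is_law M (?path i) PP" using Suc by (simp add: PP_def)
  have us: "map (\<lambda>l. v (t0 + int l)) [1..<Suc (Suc i)] = ?us @ [v ?t]" by simp
  have path: "?path (Suc i) \<omega> = ?path i \<omega> @ [lag_vec p Y ?t \<omega>]" for \<omega>
  proof -
    have "[t0..?t] = [t0..?t - 1] @ [?t]" by (rule upto_rec2) simp
    then show ?thesis by simp
  qed
  have last: "last (?path i \<omega>) = lag_vec p Y (?t - 1) \<omega>" "?path i \<omega> \<noteq> []" for \<omega>
  proof -
    have "[t0..t0 + int i] = [t0..t0 + int i - 1] @ [t0 + int i]" by (rule upto_rec2) simp
    then show "last (?path i \<omega>) = lag_vec p Y (?t - 1) \<omega>" "?path i \<omega> \<noteq> []" by simp_all
  qed
  have lag: "lag_vec p Y ?t \<omega> = tl (last (?path i \<omega>)) @ [Y ?t \<omega>]" for \<omega>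
    unfolding last(1) by (rule lag_vec_Suc[OF p])
  show ?case
  proof (rule is_lawI[OF M])
    show "?path (Suc i) \<in> M \<rightarrow>\<^sub>M count_space UNIV"
      using Suc.prems by (intro measurable_map_count_space measurable_lag_vec Y) auto
    fix w
    have "bind_pmf P (pathL (Qk \<xi>) (map (\<lambda>l. v (t0 + int l)) [1..<Suc (Suc i)])) =
        bind_pmf PP (\<lambda>zz. map_pmf (\<lambda>z. zz @ [z]) (Qk \<xi> (v ?t) (last zz)))"
      unfolding us PP_def bind_assoc_pmf by (intro bind_pmf_cong refl) (rule pathL_snoc)
    moreover have "pmf (bind_pmf PP (\<lambda>zz. map_pmf (\<lambda>z. zz @ [z]) (Qk \<xi> (v ?t) (last zz)))) w =
        measure M {\<omega> \<in> space M. ?path (Suc i) \<omega> = w}"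
    proof (cases w rule: rev_cases)
      case Nil
      have "[] \<notin> set_pmf (bind_pmf PP (\<lambda>zz. map_pmf (\<lambda>z. zz @ [z]) (Qk \<xi> (v ?t) (last zz))))" by auto
      then have "pmf (bind_pmf PP (\<lambda>zz. map_pmf (\<lambda>z. zz @ [z]) (Qk \<xi> (v ?t) (last zz)))) [] = 0"
        by (simp only: set_pmf_iff not_not)
      moreover have "{\<omega> \<in> space M. ?path (Suc i) \<omega> = []} = {}" unfolding path by auto
      ultimately show ?thesis unfolding Nil by (simp only: measure_empty)
    next
      case (snoc zz z)
      define x where "x = last zz"
      let ?E = "{\<omega> \<in> space M. ?path i \<omega> = zz}"
      let ?R = "branching_kernel p \<zeta> \<xi> (v ?t)"
      have mapsnoc: "pmf (map_pmf (\<lambda>z. zz' @ [z]) A) (zz @ [z]) = (if zz' = zz then pmf A z else 0)" for zz' and A :: "nat list pmf"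
      proof (cases "zz' = zz")
        case True
        then show ?thesis by (simp add: pmf_map_inj'[of "\<lambda>z. zz @ [z]"] inj_def)
      next
        case False
        then have "zz @ [z] \<notin> (\<lambda>z. zz' @ [z]) ` set_pmf A" by auto
        then show ?thesis using False by (simp add: pmf_map_outside)
      qed
      have "pmf (bind_pmf PP (\<lambda>zz. map_pmf (\<lambda>z. zz @ [z]) (Qk \<xi> (v ?t) (last zz)))) w = pmf PP zz * pmf (Qk \<xi> (v ?t) x) z"
        unfolding pmf_bind_kernel_app snoc
        by (subst kernel_app_finite[where S = "{zz}"]) (auto simp: mapsnoc x_def)
      also have "pmf PP zz = measure M ?E" by (rule is_law_pmf[OF IH])
      also have "measure M ?E * pmf (Qk \<xi> (v ?t) x) z = measure M {\<omega> \<in> space M. ?path (Suc i) \<omega> = w}"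
      \<comment> \<open>The new state must be the shifted last state with one fresh coordinate;
        otherwise both sides vanish.\<close>
      proof (cases "z \<in> range (\<lambda>y. tl x @ [y])")
        case True
        then obtain y where y: "z = tl x @ [y]" by auto
        have "pmf (Qk \<xi> (v ?t) x) z = pmf (?R x) y"
          unfolding companion_kernel_def y by (rule pmf_map_inj') (simp add: inj_def)
        moreover have "{\<omega> \<in> space M. ?path (Suc i) \<omega> = w} = {\<omega> \<in> ?E. Y ?t \<omega> = y}"
          unfolding path snoc y lag x_def append1_eq_conv by blast
        moreover have "measure M {\<omega> \<in> ?E. Y ?t \<omega> = y} = measure M ?E * pmf (?R x) y"
        proof (rule transition_step[OF M])
          show "has_transition_at M p Y ?t ?R" using Suc.prems by (intro tr) auto
          show "lag_vec p Y (?t - 1) \<omega> = x" if "\<omega> \<in> ?E" for \<omega>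
            using that last[of \<omega>] by (simp add: x_def)
          have "?path i \<in> past_algebra M Y ?t \<rightarrow>\<^sub>M count_space UNIV"
            unfolding lag_vec_def[abs_def]
            by (intro measurable_map_count_space measurable_past_algebra) auto
          then have "?path i -` {zz} \<inter> space (past_algebra M Y ?t) \<in> sets (past_algebra M Y ?t)"
            by (rule measurable_sets) auto
          moreover have "space (past_algebra M Y ?t) = space M"
            unfolding past_algebra_def by (rule space_measure_of) auto
          moreover have "?path i -` {zz} \<inter> space M = ?E" by auto
          ultimately show "?E \<in> sets (past_algebra M Y ?t)" by simp
        qed (use Y Suc.prems in auto)
        ultimately show ?thesis by simp
      next
        case False
        then have "z \<notin> (\<lambda>y. tl x @ [y]) ` set_pmf (?R x)" by auto
        then have "pmf (Qk \<xi> (v ?t) x) z = 0"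
          unfolding companion_kernel_def by (rule pmf_map_outside)
        moreover have "{\<omega> \<in> space M. ?path (Suc i) \<omega> = w} = {}"
          unfolding path snoc lag append1_eq_conv using False unfolding x_def by blast
        ultimately show ?thesis by (simp only: mult_zero_right measure_empty)
      qed
      finally show ?thesis .
    qed
    ultimately show "pmf (bind_pmf P (pathL (Qk \<xi>) (map (\<lambda>l. v (t0 + int l)) [1..<Suc (Suc i)]))) w =
        measure M {\<omega> \<in> space M. ?path (Suc i) \<omega> = w}" by (simp only:)
  qed
qed

lemma law_step:
  assumes M: "prob_space M" and Y: "\<And>s. s \<le> t + 1 \<Longrightarrow> Y s \<in> M \<rightarrow>\<^sub>M count_space UNIV"
    and tr: "has_transition_at M p Y (t + 1) (branching_kernel p \<zeta> \<xi> u)"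
    and P: "is_law M (lag_vec p Y t) P"
  shows "is_law M (lag_vec p Y (t + 1)) (bind_pmf P (Qk \<xi> u))"
proof -
  have "is_law M (\<lambda>\<omega>. map (\<lambda>s. lag_vec p Y s \<omega>) [t..t + int 1])
     (bind_pmf P (pathL (Qk \<xi>) (map (\<lambda>l. u) [1..<Suc 1])))"
    using tr by (intro path_law[OF M Y _ P, where v = "\<lambda>_. u"]) (auto dest!: antisym[of _ "t + 1"])
  from is_law_comp[OF this, of last]
  have 1: "is_law M (\<lambda>\<omega>. last (map (\<lambda>s. lag_vec p Y s \<omega>) [t..t + 1])) (map_pmf last (bind_pmf P (pathL (Qk \<xi>) [u])))"
    by simp
  have "[t..t + 1] = [t..t + 1 - 1] @ [t + 1]" by (rule upto_rec2) simp
  then have 2: "last (map (\<lambda>s. lag_vec p Y s \<omega>) [t..t + 1]) = lag_vec p Y (t + 1) \<omega>" for \<omega> by simp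
  have "map_pmf last (pathL (Qk \<xi>) [u] x) = Qk \<xi> u x" for x
    by (simp add: map_pmf_def bind_assoc_pmf bind_return_pmf bind_return_pmf')
  then have 3: "map_pmf last (bind_pmf P (pathL (Qk \<xi>) [u])) = bind_pmf P (Qk \<xi> u)"
    unfolding map_bind_pmf by (intro bind_pmf_cong refl) 
  show ?thesis using 1 unfolding 2 3 .
qed

lemma law_supp:
  assumes "is_law M (lag_vec p Y t) P" shows "set_pmf P \<subseteq> {x. length x = p}"
proof
  fix z assume "z \<in> set_pmf P"
  then have "measure M {\<omega> \<in> space M. lag_vec p Y t \<omega> = z} \<noteq> 0"
    using is_law_pmf[OF assms, of z] by (auto simp: set_pmf_iff)
  then have "{\<omega> \<in> space M. lag_vec p Y t \<omega> = z} \<noteq> {}" by (metis measure_empty)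
  then show "z \<in> {x. length x = p}" using length_lag_vec by auto
qed

text \<open>The transition from time -1 to time 0 together with stationarity makes the law at time 0
  invariant for the kernel at \<open>u = 0\<close>, and the invariant law is unique.\<close>

lemma initial_law:
  assumes M: "prob_space M" and Y: "\<And>s. s \<le> 0 \<Longrightarrow> Y s \<in> M \<rightarrow>\<^sub>M count_space UNIV"
    and tr: "has_transition_at M p Y 0 (branching_kernel p \<zeta> \<xi> 0)"
    and stat: "distr M (count_space UNIV) (lag_vec p Y (-1)) = distr M (count_space UNIV) (lag_vec p Y 0)"
  shows "is_law M (lag_vec p Y 0) (\<pi>p 0)"
proof -
  obtain P where P: "is_law M (lag_vec p Y 0) P"
    using is_law_exists[OF M measurable_lag_vec] Y by blast
  then have "is_law M (lag_vec p Y (-1)) P"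
    using stat Y unfolding is_law_def by (auto intro: measurable_lag_vec)
  from law_step[OF M _ _ this, of 0] have "is_law M (lag_vec p Y 0) (bind_pmf P (Qk \<xi> 0))"
    using Y tr by simp
  then have "bind_pmf P (Qk \<xi> 0) = P" using P by (rule is_law_unique)
  then have "invariant_pmf p (Qk \<xi> 0) P" using law_supp[OF P] by (simp add: invariant_pmf_def)
  then have "P = \<pi>p 0" by (intro invariant_unique) auto
  then show ?thesis using P by simp
qed

primrec law_at :: "nat \<Rightarrow> nat \<Rightarrow> nat list pmf" where
  "law_at n 0 = \<pi>p 0"
| "law_at n (Suc t) = bind_pmf (law_at n t) (Qk \<xi> (real (Suc t) / real n))"

lemma law_law_at:
  assumes M: "prob_space M" and Y: "\<And>s. s \<le> int n \<Longrightarrow> Y s \<in> M \<rightarrow>\<^sub>M count_space UNIV"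
    and tr: "\<And>t. 1 \<le> t \<Longrightarrow> t \<le> int n \<Longrightarrow> has_transition_at M p Y t (branching_kernel p \<zeta> \<xi> (real_of_int t / real n))"
    and init: "is_law M (lag_vec p Y 0) (\<pi>p 0)" and t: "t \<le> n"
  shows "is_law M (lag_vec p Y (int t)) (law_at n t)"
  using t
proof (induction t)
  case (Suc t)
  have "is_law M (lag_vec p Y (int t + 1)) (bind_pmf (law_at n t) (Qk \<xi> (real (Suc t) / real n)))"
    using Suc tr[of "int t + 1"] Y by (intro law_step[OF M]) (auto simp: add.commute)
  then show ?case by (simp add: add.commute)
qed (use init in simp)

text \<open>The first derivative is bounded in weight \<open>L - 1\<close>, so the Lipschitz bound
  holds up to that weight only.\<close>

lemma \<Pi>t_lipschitz:
  assumes k: "1 \<le> k" and d: "d + 1 \<le> L"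
  obtains B where "0 \<le> B" "\<And>u v. u \<in> {0..1} \<Longrightarrow> v \<in> {0..1} \<Longrightarrow>
     wnorm (wlist d) (\<lambda>z. \<Pi>t 0 v z - \<Pi>t 0 u z) \<le> ennreal (B * \<bar>v - u\<bar>)"
proof -
  obtain B where B: "0 \<le> B" "\<And>r u. r \<le> k \<Longrightarrow> u \<in> {0..1} \<Longrightarrow> wnorm (wlist (L - r)) (\<Pi>t r u) \<le> ennreal B"
    by (rule tower_bounded[OF \<Pi>t_tower]) blast
  show ?thesis
  proof (rule that[OF B(1)])
    fix u v :: real assume uv: "u \<in> {0..1}" "v \<in> {0..1}"
    show "wnorm (wlist d) (\<lambda>z. \<Pi>t 0 v z - \<Pi>t 0 u z) \<le> ennreal (B * \<bar>v - u\<bar>)"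
    proof (rule wnorm_diff_le_deriv[where F' = "\<lambda>u z. \<Pi>t 1 u z"])
      fix s z assume "s \<in> {0..1::real}"
      then show "((\<lambda>v. \<Pi>t 0 v z) has_real_derivative \<Pi>t 1 s z) (at s within {0..1})"
        using tower_deriv[OF \<Pi>t_tower, of 0 s z] k by simp
    next
      fix s assume "s \<in> closed_segment u v"
      then have "s \<in> {0..1}" using uv by (auto simp: closed_segment_eq_real_ivl split: if_splits)
      then have "wnorm (wlist (L - 1)) (\<Pi>t 1 s) \<le> ennreal B" using B(2)[of 1 s] k by simp
      moreover have "wnorm (wlist d) (\<Pi>t 1 s) \<le> wnorm (wlist (L - 1)) (\<Pi>t 1 s)" using d by (intro wnorm_mono_weight) auto
      ultimately show "wnorm (wlist d) (\<Pi>t 1 s) \<le> ennreal B" by (rule order_trans[rotated])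
    qed (use uv B in auto)
  qed
qed

lemma centred_\<Pi>t_diff:
  assumes uv: "u \<in> {0..1}" "v \<in> {0..1}" and m: "m \<le> L"
  shows "centred m (\<lambda>z. \<Pi>t 0 v z - \<Pi>t 0 u z)"
  unfolding centred_def
proof (intro conjI allI impI)
  obtain B where B: "0 \<le> B" "\<And>r u. r \<le> k \<Longrightarrow> u \<in> {0..1} \<Longrightarrow> wnorm (wlist (L - r)) (\<Pi>t r u) \<le> ennreal B"
    by (rule tower_bounded[OF \<Pi>t_tower]) blast
  have fin: "wnorm (wlist m) (\<Pi>t 0 u) < \<infinity>" if "u \<in> {0..1}" for u
  proof -
    have "wnorm (wlist m) (\<Pi>t 0 u) \<le> wnorm (wlist L) (\<Pi>t 0 u)" by (rule wnorm_mono_weight) fact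
    also have "\<dots> \<le> ennreal B" using B(2)[of 0 u] that by simp
    also have "\<dots> < \<infinity>" by simp
    finally show ?thesis .
  qed
  have "wnorm (wlist m) (\<lambda>z. \<Pi>t 0 v z + - \<Pi>t 0 u z) \<le> wnorm (wlist m) (\<Pi>t 0 v) + wnorm (wlist m) (\<lambda>z. - \<Pi>t 0 u z)"
    by (rule wnorm_add) auto
  also have "\<dots> < \<infinity>" unfolding wnorm_uminus using fin uv by simp
  finally show "wnorm (wlist m) (\<lambda>z. \<Pi>t 0 v z - \<Pi>t 0 u z) < \<infinity>" by simp
  show "(\<integral>z. \<Pi>t 0 v z - \<Pi>t 0 u z \<partial>count_space UNIV) = 0"
    using \<Pi>t_integral[OF uv(1)] \<Pi>t_integral[OF uv(2)] \<Pi>t_integrable[OF uv(1)] \<Pi>t_integrable[OF uv(2)] by simp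
qed (simp add: \<Pi>t_supp)

text \<open>The error at the next time is the old error plus the drift of the invariant law, both
  moved by the same kernel, since the next invariant law is fixed by it. In the adapted norm this is
  a contraction with drift of order \<open>1 / n\<close>, and the error at time 0 is 0.\<close>

lemma law_close:
  assumes k: "1 \<le> k" and d: "1 \<le> d" "d + 1 \<le> L"
  shows "\<exists>K\<ge>0. \<forall>n\<ge>1. \<forall>t\<le>n. wnorm (wlist d) (\<lambda>z. pmf (law_at n t) z - \<Pi>t 0 (real t / real n) z) \<le> ennreal (K / real n)"
proof -
  have d': "1 \<le> d" "d \<le> L" using d by auto
  obtain B where B: "0 \<le> B" "\<And>u v. u \<in> {0..1} \<Longrightarrow> v \<in> {0..1} \<Longrightarrow>
     wnorm (wlist d) (\<lambda>z. \<Pi>t 0 v z - \<Pi>t 0 u z) \<le> ennreal (B * \<bar>v - u\<bar>)"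
    using \<Pi>t_lipschitz[OF k d(2)] by blast
  obtain N C \<rho> where C: "0 \<le> C" and \<rho>: "0 < \<rho>" "\<rho> < 1"
    and N: "\<And>\<nu>. centred d \<nu> \<Longrightarrow> wnorm (wlist d) \<nu> \<le> N \<nu>"
    "\<And>\<nu>. centred d \<nu> \<Longrightarrow> N \<nu> \<le> ennreal C * wnorm (wlist d) \<nu>"
    "\<And>u \<nu>. u \<in> {0..1} \<Longrightarrow> centred d \<nu> \<Longrightarrow> N (kernel_app \<nu> (Qp u)) \<le> ennreal \<rho> * N \<nu>"
    "\<And>\<mu> \<nu>. centred d \<mu> \<Longrightarrow> centred d \<nu> \<Longrightarrow> N (\<lambda>x. \<mu> x + \<nu> x) \<le> N \<mu> + N \<nu>"
    by (rule contracting_norm[OF d']) blast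
  \<comment> \<open>Solves \<open>(1 - \<rho>) * K = C * B\<close>, where \<open>C * B / n\<close>
    bounds the drift of one step in the adapted norm; hence \<open>K / n\<close> is preserved by the
    recursion.\<close>
  define K where "K = C * B / (1 - \<rho>)"
  have K: "0 \<le> K" "\<rho> * (K + C * B) \<le> K"
  proof -
    show "0 \<le> K" using C B \<rho> by (simp add: K_def)
    have "\<rho> * (C * B) \<le> 1 * (C * B)" using \<rho> C B by (intro mult_right_mono) auto
    moreover have "(1 - \<rho>) * K = C * B" using \<rho> by (simp add: K_def)
    ultimately show "\<rho> * (K + C * B) \<le> K" by (simp add: algebra_simps)
  qed
  have "centred d (\<lambda>z. pmf (law_at n t) z - \<Pi>t 0 (real t / real n) z) \<and>
      N (\<lambda>z. pmf (law_at n t) z - \<Pi>t 0 (real t / real n) z) \<le> ennreal (K / real n)" if n: "1 \<le> n" and t: "t \<le> n" for n t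
    using t
  proof (induction t)
    case 0
    have "centred d (\<lambda>z. \<Pi>t 0 0 z - \<Pi>t 0 0 z)" using d' by (intro centred_\<Pi>t_diff) auto
    then have centred: "centred d (\<lambda>z. 0)" by simp
    have "N (\<lambda>z. 0) \<le> 0" using N(2)[OF centred] by simp
    then show ?case using centred by (simp add: pmf_\<pi>p)
  next
    case (Suc t)
    let ?u = "real t / real n" and ?v = "real (Suc t) / real n"
    let ?E = "\<lambda>z. pmf (law_at n t) z - \<Pi>t 0 ?u z" and ?D = "\<lambda>z. \<Pi>t 0 ?u z - \<Pi>t 0 ?v z"
    have uv: "?u \<in> {0..1}" "?v \<in> {0..1}" using Suc.prems n by auto
    have okE: "centred d ?E" and NE: "N ?E \<le> ennreal (K / real n)" using Suc by auto
    have okD: "centred d ?D" using uv d' by (intro centred_\<Pi>t_diff) auto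
    have okED: "centred d (\<lambda>z. ?E z + ?D z)" using okE okD by (rule centred_add)
    have eq: "(\<lambda>z. pmf (law_at n (Suc t)) z - \<Pi>t 0 ?v z) = kernel_app (\<lambda>z. ?E z + ?D z) (Qp ?v)"
    proof
      fix z
      have "kernel_app (\<lambda>z. ?E z + ?D z) (Qp ?v) z = kernel_app (\<lambda>z. pmf (law_at n t) z - \<Pi>t 0 ?v z) (Qp ?v) z"
        by (intro kernel_app_cong) auto
      also have "\<dots> = kernel_app (pmf (law_at n t)) (Qp ?v) z - kernel_app (\<Pi>t 0 ?v) (Qp ?v) z"
        by (intro kernel_app_diff integrable_mult_pmf \<Pi>t_integrable uv integrable_pmf)
      finally show "pmf (law_at n (Suc t)) z - \<Pi>t 0 ?v z = kernel_app (\<lambda>z. ?E z + ?D z) (Qp ?v) z"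
        by (simp only: law_at.simps pmf_bind_kernel_app \<Pi>t_invariant[OF uv(2)])
    qed
    have "N (kernel_app (\<lambda>z. ?E z + ?D z) (Qp ?v)) \<le> ennreal \<rho> * N (\<lambda>z. ?E z + ?D z)"
      by (rule N(3)[OF uv(2) okED])
    also have "\<dots> \<le> ennreal \<rho> * (ennreal (K / real n) + ennreal C * ennreal (B * (1 / real n)))"
    proof (rule mult_left_mono)
      have "\<bar>?u - ?v\<bar> = 1 / real n" using n by (simp add: field_simps)
      then have "wnorm (wlist d) ?D \<le> ennreal (B * (1 / real n))" using B(2)[OF uv(2,1)] by simp
      then have "N ?D \<le> ennreal C * ennreal (B * (1 / real n))"
        using N(2)[OF okD] by (meson mult_left_mono order_trans zero_le)
      then show "N (\<lambda>z. ?E z + ?D z) \<le> ennreal (K / real n) + ennreal C * ennreal (B * (1 / real n))"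
        using N(4)[OF okE okD] NE by (meson add_mono order_trans)
    qed auto
    also have "\<dots> = ennreal (\<rho> * (K / real n + C * (B * (1 / real n))))"
      using \<rho> C B(1) K by (simp add: ennreal_mult[symmetric] ennreal_plus[symmetric] del: ennreal_plus)
    also have "\<rho> * (K / real n + C * (B * (1 / real n))) = \<rho> * (K + C * B) / real n"
      by (simp add: add_divide_distrib distrib_left)
    also have "ennreal (\<rho> * (K + C * B) / real n) \<le> ennreal (K / real n)"
      using K by (intro ennreal_leI divide_right_mono) auto
    finally have "N (kernel_app (\<lambda>z. ?E z + ?D z) (Qp ?v)) \<le> ennreal (K / real n)" .
    moreover have "centred d (kernel_app (\<lambda>z. ?E z + ?D z) (Qp ?v))" by (rule centred_kernel_app[OF d' okED uv(2)])
    ultimately show ?case unfolding eq by simp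
  qed
  then have "wnorm (wlist d) (\<lambda>z. pmf (law_at n t) z - \<Pi>t 0 (real t / real n) z) \<le> ennreal (K / real n)" if "1 \<le> n" "t \<le> n" for n t
    using that N(1) by (meson order_trans)
  then show ?thesis using K by blast
qed

lemma Qp_bound:
  obtains C where "0 \<le> C" "\<And>u x m. u \<in> {0..1} \<Longrightarrow> length x = p \<Longrightarrow> m \<le> L \<Longrightarrow>
    wnorm (wlist m) (Qp u x) \<le> ennreal (C * wlist m x)"
proof -
  obtain C where C: "0 \<le> C" "\<And>x r m u. r \<le> k \<Longrightarrow> m + r \<le> L \<Longrightarrow> u \<in> {0..1} \<Longrightarrow>
     wnorm (wlist m) (Qt x r u) \<le> ennreal (C * wlist (m + r) x)" using Qt_bound by blast
  show ?thesis
  proof (rule that[OF C(1)])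
    fix u and x :: "nat list" and m assume *: "u \<in> {0..1::real}" "length x = p" "m \<le> L"
    show "wnorm (wlist m) (Qp u x) \<le> ennreal (C * wlist m x)"
      using C(2)[of 0 m u x] * by (simp add: Qt_0)
  qed
qed

lemma Qp_lipschitz:
  assumes k: "1 \<le> k"
  obtains C where "0 \<le> C" "\<And>u v x m. u \<in> {0..1} \<Longrightarrow> v \<in> {0..1} \<Longrightarrow> length x = p \<Longrightarrow> m + 1 \<le> L \<Longrightarrow>
    wnorm (wlist m) (\<lambda>z. Qp v x z - Qp u x z) \<le> ennreal (C * \<bar>v - u\<bar> * wlist (m + 1) x)"
proof -
  obtain C where C: "0 \<le> C" "\<And>x r m u. r \<le> k \<Longrightarrow> m + r \<le> L \<Longrightarrow> u \<in> {0..1} \<Longrightarrow>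
     wnorm (wlist m) (Qt x r u) \<le> ennreal (C * wlist (m + r) x)" using Qt_bound by blast
  show ?thesis
  proof (rule that[OF C(1)])
    fix u v and x :: "nat list" and m assume uv: "u \<in> {0..1::real}" "v \<in> {0..1::real}" and x: "length x = p" and m: "m + 1 \<le> L"
    have "wnorm (wlist m) (\<lambda>z. Qt x 0 v z - Qt x 0 u z) \<le> ennreal (C * wlist (m + 1) x * \<bar>v - u\<bar>)"
    proof (rule wnorm_diff_le_deriv[where F' = "\<lambda>u z. Qt x 1 u z"])
      fix s z assume "s \<in> {0..1::real}"
      then show "((\<lambda>v. Qt x 0 v z) has_real_derivative Qt x 1 s z) (at s within {0..1})"
        using tower_deriv[OF Qt_tower, of 0 s x z] k by simp
    next
      fix s assume "s \<in> closed_segment u v"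
      then have "s \<in> {0..1}" using uv by (auto simp: closed_segment_eq_real_ivl split: if_splits)
      then show "wnorm (wlist m) (Qt x 1 s) \<le> ennreal (C * wlist (m + 1) x)"
        using k m by (intro C(2)) auto
    qed (use uv C in auto)
    then show "wnorm (wlist m) (\<lambda>z. Qp v x z - Qp u x z) \<le> ennreal (C * \<bar>v - u\<bar> * wlist (m + 1) x)"
      by (simp add: Qt_0[OF x] mult_ac)
  qed
qed

lemma wnorm_kernel_app_Qp_le:
  assumes \<nu>: "\<And>y. length y \<noteq> p \<Longrightarrow> \<nu> y = 0" and C: "0 \<le> C"
    and H: "\<And>y. length y = p \<Longrightarrow> wnorm w (H y) \<le> ennreal (C * wlist m y)" and w: "\<And>z. 0 \<le> w z"
    and b: "wnorm (wlist m) \<nu> \<le> ennreal b"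
  shows "wnorm w (kernel_app \<nu> H) \<le> ennreal (C * b)"
proof -
  have "wnorm w (kernel_app \<nu> H) \<le> ennreal C * wnorm (wlist m) \<nu>"
    using \<nu> by (intro wnorm_kernel_app_le w C H) auto
  also have "\<dots> \<le> ennreal C * ennreal b" by (intro mult_left_mono b) auto
  also have "\<dots> = ennreal (C * b)" using C by (simp add: ennreal_mult')
  finally show ?thesis .
qed

lemma Qp_supp: "length x = p \<Longrightarrow> length y \<noteq> p \<Longrightarrow> Qp u x y = 0"
  using set_Qk[of x \<xi> u] by (auto simp: set_pmf_iff)

lemma pathL_bound:
  "\<exists>C\<ge>0. \<forall>us x m. set us \<subseteq> {0..1} \<longrightarrow> length us = j \<longrightarrow> length x = p \<longrightarrow> m \<le> L \<longrightarrow>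
     wnorm (wt sz2 m) (pmf (pathL (Qk \<xi>) us x)) \<le> ennreal (C * wlist m x)"
proof (induction j)
  case 0
  have "wnorm (wt sz2 m) (pmf (return_pmf [x])) \<le> ennreal (1 * wlist m x)" for x m
    by (simp add: wnorm_pmf) (simp add: wt_def)
  then show ?case by (intro exI[of _ 1] conjI allI impI zero_le_one) (simp only: length_0_conv pathL.simps)
next
  case (Suc j)
  then obtain C where C: "0 \<le> C" "\<And>us x m. set us \<subseteq> {0..1} \<Longrightarrow> length us = j \<Longrightarrow> length x = p \<Longrightarrow> m \<le> L \<Longrightarrow>
     wnorm (wt sz2 m) (pmf (pathL (Qk \<xi>) us x)) \<le> ennreal (C * wlist m x)" by auto
  obtain CQ where CQ: "0 \<le> CQ" "\<And>u x m. u \<in> {0..1} \<Longrightarrow> length x = p \<Longrightarrow> m \<le> L \<Longrightarrow>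
    wnorm (wlist m) (Qp u x) \<le> ennreal (CQ * wlist m x)" using Qp_bound by blast
  have "wnorm (wt sz2 m) (pmf (pathL (Qk \<xi>) vs x)) \<le> ennreal (2 ^ L * 2 * (C * CQ) * wlist m x)"
    if vs: "set vs \<subseteq> {0..1}" "length vs = Suc j" and x: "length x = p" and m: "m \<le> L" for vs x m
  proof -
    obtain u us where us: "vs = u # us" "set us \<subseteq> {0..1}" "length us = j" "u \<in> {0..1}"
      using vs by (cases vs) auto
    let ?P = "bind_pmf (Qk \<xi> u x) (pathL (Qk \<xi>) us)"
    have P: "wnorm (wt sz2 m) (pmf ?P) \<le> ennreal (C * CQ * (1 + real (sum_list x)) ^ (m + 0))" if m: "m \<le> L" for m
    proof -
      have "wnorm (wt sz2 m) (kernel_app (Qp u x) (\<lambda>y. pmf (pathL (Qk \<xi>) us y))) \<le> ennreal (C * (CQ * wlist m x))"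
        using us m x C CQ by (intro wnorm_kernel_app_Qp_le[where m = m] Qp_supp) auto
      moreover have "pmf ?P = kernel_app (Qp u x) (\<lambda>y. pmf (pathL (Qk \<xi>) us y))" by (rule ext) (rule pmf_bind_kernel_app)
      ultimately show ?thesis by (simp add: wt_def mult.assoc)
    qed
    \<comment> \<open>The family does not depend on its level and parameter; level 0 only selects
      the exponent \<open>m + 0\<close> in \<open>wnorm_tower_map_bound\<close>.\<close>
    have eq: "pmf (pathL (Qk \<xi>) vs x) = tower_map ((#) x) (\<lambda>_ _. pmf ?P) 0 0"
      unfolding us(1) pathL.simps tower_map_def by (rule ext) (rule pmf_map_kernel_app)
    have "wnorm (wt sz2 m) (tower_map ((#) x) (\<lambda>_ _. pmf ?P) 0 0) \<le> ennreal (2 ^ m * 2 * (C * CQ) * (1 + real (sum_list x)) ^ (m + 0))"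
      using P[OF m] P[of 0] C CQ by (intro wnorm_tower_map_bound[where sz = sz2]) auto
    also have "ennreal (2 ^ m * 2 * (C * CQ) * (1 + real (sum_list x)) ^ (m + 0)) \<le> ennreal (2 ^ L * 2 * (C * CQ) * wlist m x)"
      unfolding wt_def using m C CQ by (intro ennreal_leI mult_mono power_increasing) auto
    finally show ?thesis unfolding eq .
  qed
  moreover have "0 \<le> 2 ^ L * 2 * (C * CQ)" using C CQ by simp
  ultimately show ?case by (intro exI[of _ "2 ^ L * 2 * (C * CQ)"] conjI allI impI)
qed

text \<open>The first kernel is changed with the later ones kept, then the later ones by induction.
  Each term changes a single kernel, so the loss of one power in \<open>wlist (m + 1)\<close> does
  not accumulate along the path.\<close>

lemma pathL_lipschitz:
  assumes k: "1 \<le> k"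
  shows "\<exists>C\<ge>0. \<forall>us vs x m \<delta>. set us \<subseteq> {0..1} \<longrightarrow> set vs \<subseteq> {0..1} \<longrightarrow> length us = j \<longrightarrow> list_all2 (\<lambda>a b. \<bar>a - b\<bar> \<le> \<delta>) us vs \<longrightarrow>
     0 \<le> \<delta> \<longrightarrow> length x = p \<longrightarrow> m + 1 \<le> L \<longrightarrow>
     wnorm (wt sz2 m) (\<lambda>w. pmf (pathL (Qk \<xi>) us x) w - pmf (pathL (Qk \<xi>) vs x) w) \<le> ennreal (C * \<delta> * wlist (m + 1) x)"
proof (induction j)
  case 0
  show ?case by (intro exI[of _ 0]) auto
next
  case (Suc j)
  then obtain C where C: "0 \<le> C" "\<And>us vs x m \<delta>. set us \<subseteq> {0..1} \<Longrightarrow> set vs \<subseteq> {0..1} \<Longrightarrow> length us = j \<Longrightarrow>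
     list_all2 (\<lambda>a b. \<bar>a - b\<bar> \<le> \<delta>) us vs \<Longrightarrow> 0 \<le> \<delta> \<Longrightarrow> length x = p \<Longrightarrow> m + 1 \<le> L \<Longrightarrow>
     wnorm (wt sz2 m) (\<lambda>w. pmf (pathL (Qk \<xi>) us x) w - pmf (pathL (Qk \<xi>) vs x) w) \<le> ennreal (C * \<delta> * wlist (m + 1) x)" by auto
  obtain CQ where CQ: "0 \<le> CQ" "\<And>u x m. u \<in> {0..1} \<Longrightarrow> length x = p \<Longrightarrow> m \<le> L \<Longrightarrow>
    wnorm (wlist m) (Qp u x) \<le> ennreal (CQ * wlist m x)" using Qp_bound by blast
  obtain CL where CL: "0 \<le> CL" "\<And>u v x m. u \<in> {0..1} \<Longrightarrow> v \<in> {0..1} \<Longrightarrow> length x = p \<Longrightarrow> m + 1 \<le> L \<Longrightarrow>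
    wnorm (wlist m) (\<lambda>z. Qp v x z - Qp u x z) \<le> ennreal (CL * \<bar>v - u\<bar> * wlist (m + 1) x)" using Qp_lipschitz[OF k] by blast
  obtain CB where CB: "0 \<le> CB" "\<And>us x m. set us \<subseteq> {0..1} \<Longrightarrow> length us = j \<Longrightarrow> length x = p \<Longrightarrow> m \<le> L \<Longrightarrow>
     wnorm (wt sz2 m) (pmf (pathL (Qk \<xi>) us x)) \<le> ennreal (CB * wlist m x)" using pathL_bound[of j] by blast
  \<comment> \<open>The first product is for changing the first kernel and running a path of bounded
    norm after it, the second for one bounded step followed by the induction hypothesis.\<close>
  define C1 where "C1 = CB * CL + C * CQ"
  have C1: "0 \<le> C1" using CB CL C CQ by (simp add: C1_def)
  have "wnorm (wt sz2 m) (\<lambda>w. pmf (pathL (Qk \<xi>) us0 x) w - pmf (pathL (Qk \<xi>) vs0 x) w) \<le> ennreal (2 ^ L * 2 * C1 * \<delta> * wlist (m + 1) x)"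
    if s: "set us0 \<subseteq> {0..1}" "set vs0 \<subseteq> {0..1}" "length us0 = Suc j" "list_all2 (\<lambda>a b. \<bar>a - b\<bar> \<le> \<delta>) us0 vs0"
      and \<delta>: "0 \<le> \<delta>" and x: "length x = p" and m: "m + 1 \<le> L" for us0 vs0 \<delta> x m
  proof -
    obtain u us where us: "us0 = u # us" "set us \<subseteq> {0..1}" "length us = j" "u \<in> {0..1}"
      using s by (cases us0) auto
    obtain v vs where vs: "vs0 = v # vs" "set vs \<subseteq> {0..1}" "v \<in> {0..1}"
      using s us by (cases vs0) auto
    have uv: "\<bar>u - v\<bar> \<le> \<delta>" "list_all2 (\<lambda>a b. \<bar>a - b\<bar> \<le> \<delta>) us vs" using s(4) us(1) vs(1) by auto
    let ?P = "bind_pmf (Qk \<xi> u x) (pathL (Qk \<xi>) us)" and ?P' = "bind_pmf (Qk \<xi> v x) (pathL (Qk \<xi>) vs)"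
    define T where "T w = pmf ?P w - pmf ?P' w" for w
    let ?A = "\<lambda>y. pmf (pathL (Qk \<xi>) us y)" and ?A' = "\<lambda>y. pmf (pathL (Qk \<xi>) vs y)"
    have T: "T = (\<lambda>w. kernel_app (\<lambda>z. Qp u x z - Qp v x z) ?A w + kernel_app (Qp v x) (\<lambda>y w. ?A y w - ?A' y w) w)"
    proof
      fix w
      have "kernel_app (\<lambda>z. Qp u x z - Qp v x z) ?A w = kernel_app (Qp u x) ?A w - kernel_app (Qp v x) ?A w"
        by (intro kernel_app_diff integrable_mult_pmf integrable_pmf)
      moreover have "kernel_app (Qp v x) (\<lambda>y w. ?A y w - ?A' y w) w = kernel_app (Qp v x) ?A w - kernel_app (Qp v x) ?A' w"
        unfolding kernel_app_def right_diff_distrib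
        by (intro Bochner_Integration.integral_diff integrable_mult_pmf integrable_pmf)
      ultimately show "T w = kernel_app (\<lambda>z. Qp u x z - Qp v x z) ?A w + kernel_app (Qp v x) (\<lambda>y w. ?A y w - ?A' y w) w"
        by (simp add: T_def pmf_bind_kernel_app)
    qed
    have nT: "wnorm (wt sz2 m) T \<le> ennreal (C1 * \<delta> * (1 + real (sum_list x)) ^ (m + 1))" if m: "m + 1 \<le> L" for m
    proof -
      have "wnorm (wt sz2 m) T \<le> wnorm (wt sz2 m) (kernel_app (\<lambda>z. Qp u x z - Qp v x z) ?A) + wnorm (wt sz2 m) (kernel_app (Qp v x) (\<lambda>y w. ?A y w - ?A' y w))"
        unfolding T by (rule wnorm_add) auto
      also have "\<dots> \<le> ennreal (CB * (CL * \<delta> * wlist (m + 1) x)) + ennreal (C * \<delta> * (CQ * wlist (m + 1) x))"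
      proof (intro add_mono wnorm_kernel_app_Qp_le)
        show "wnorm (wt sz2 m) (?A y) \<le> ennreal (CB * wlist m y)" if "length y = p" for y
          using us that m by (intro CB(2)) auto
        have "CL * \<bar>u - v\<bar> * wlist (m + 1) x \<le> CL * \<delta> * wlist (m + 1) x"
          using uv(1) CL(1) by (intro mult_right_mono mult_left_mono) auto
        then show "wnorm (wlist m) (\<lambda>z. Qp u x z - Qp v x z) \<le> ennreal (CL * \<delta> * wlist (m + 1) x)"
          using CL(2)[OF vs(3) us(4) x m] by (meson ennreal_leI order_trans)
        show "wnorm (wt sz2 m) (\<lambda>w. ?A y w - ?A' y w) \<le> ennreal (C * \<delta> * wlist (m + 1) y)" if "length y = p" for y
          by (rule C(2)[OF us(2) vs(2) us(3) uv(2) \<delta> that m])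
        show "wnorm (wlist (m + 1)) (Qp v x) \<le> ennreal (CQ * wlist (m + 1) x)"
          using vs x m by (intro CQ(2)) auto
      qed (use Qp_supp[OF x] CB(1) C(1) \<delta> in auto)
      also have "\<dots> = ennreal (C1 * \<delta> * (1 + real (sum_list x)) ^ (m + 1))"
        using CB(1) CL(1) C(1) CQ(1) \<delta> by (subst ennreal_plus[symmetric]) (auto simp: C1_def wt_def algebra_simps)
      finally show ?thesis .
    qed
    \<comment> \<open>Again a family without dependence on its indices; level 1 is chosen because
      the bound for \<open>T\<close> has exponent \<open>m + 1\<close>.\<close>
    have eq: "(\<lambda>w. pmf (pathL (Qk \<xi>) us0 x) w - pmf (pathL (Qk \<xi>) vs0 x) w) = tower_map ((#) x) (\<lambda>_ _. T) 1 0"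
    proof
      fix w
      have int: "integrable (count_space UNIV) (\<lambda>y. pmf P y * (if w = x # y then 1 else 0))" for P :: "nat list list pmf"
        by (rule Bochner_Integration.integrable_bound[OF integrable_pmf]) auto
      have "tower_map ((#) x) (\<lambda>_ _. T) 1 0 w = kernel_app (pmf ?P) (\<lambda>y z. if z = x # y then 1 else 0) w - kernel_app (pmf ?P') (\<lambda>y z. if z = x # y then 1 else 0) w"
        unfolding tower_map_def T_def by (intro kernel_app_diff int)
      then show "pmf (pathL (Qk \<xi>) us0 x) w - pmf (pathL (Qk \<xi>) vs0 x) w = tower_map ((#) x) (\<lambda>_ _. T) 1 0 w"
        unfolding us(1) vs(1) pathL.simps pmf_map_kernel_app by simp
    qed
    have "wnorm (wt sz2 m) (tower_map ((#) x) (\<lambda>_ _. T) 1 0) \<le> ennreal (2 ^ m * 2 * (C1 * \<delta>) * (1 + real (sum_list x)) ^ (m + 1))"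
      using nT[OF m] nT[of 0] m C1 \<delta> by (intro wnorm_tower_map_bound[where sz = sz2]) auto
    also have "ennreal (2 ^ m * 2 * (C1 * \<delta>) * (1 + real (sum_list x)) ^ (m + 1)) \<le> ennreal (2 ^ L * 2 * C1 * \<delta> * wlist (m + 1) x)"
    proof -
      have "(2::real) ^ m \<le> 2 ^ L" using m by (intro power_increasing) auto
      then have "2 ^ m * (2 * (C1 * \<delta>) * (1 + real (sum_list x)) ^ (m + 1)) \<le> 2 ^ L * (2 * (C1 * \<delta>) * (1 + real (sum_list x)) ^ (m + 1))"
        using C1 \<delta> by (intro mult_right_mono) auto
      then show ?thesis unfolding wt_def by (intro ennreal_leI) (simp only: mult.assoc)
    qed
    finally show ?thesis unfolding eq .
  qed
  moreover have "0 \<le> 2 ^ L * 2 * C1" using C1 by simp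
  ultimately show ?case by (intro exI[of _ "2 ^ L * 2 * C1"] conjI allI impI)
qed

text \<open>The path law differs from the stationary one by two effects: the starting law at time
  \<open>t\<close> is not the invariant one at \<open>u\<close>, and the parameters along the path
  are not \<open>u\<close>. The first is transported by a bounded path kernel; the second costs one
  power and is integrated against the invariant law.\<close>

lemma local_stationarity:
  assumes k: "1 \<le> k" and d: "1 \<le> d" "d + 1 \<le> L"
    and V: "\<And>j z. z \<in> blocks p j \<Longrightarrow> (\<Sum>x\<leftarrow>z. V x) \<le> BV j * wt sz2 d z" and BV: "\<And>j. 0 \<le> BV j"
    and arr: "markov_array p (branching_kernel p \<zeta> \<xi>) M Y"
  shows "locally_stationary p V M (\<lambda>n. lag_vec p (Y n)) (\<lambda>u. Qk \<xi> u)"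
  unfolding locally_stationary_def
proof (intro allI impI)
  fix j :: nat assume "1 \<le> j"
  then obtain i where j: "j = Suc i" by (cases j) auto
  obtain K where K: "0 \<le> K" "\<And>n t. 1 \<le> n \<Longrightarrow> t \<le> n \<Longrightarrow> wnorm (wlist d) (\<lambda>z. pmf (law_at n t) z - \<Pi>t 0 (real t / real n) z) \<le> ennreal (K / real n)"
    using law_close[OF k d] by blast
  obtain B where B: "0 \<le> B" "\<And>u v. u \<in> {0..1} \<Longrightarrow> v \<in> {0..1} \<Longrightarrow>
     wnorm (wlist d) (\<lambda>z. \<Pi>t 0 v z - \<Pi>t 0 u z) \<le> ennreal (B * \<bar>v - u\<bar>)"
    using \<Pi>t_lipschitz[OF k d(2)] by blast
  obtain CB where CB: "0 \<le> CB" "\<And>us x m. set us \<subseteq> {0..1} \<Longrightarrow> length us = i \<Longrightarrow> length x = p \<Longrightarrow> m \<le> L \<Longrightarrow>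
     wnorm (wt sz2 m) (pmf (pathL (Qk \<xi>) us x)) \<le> ennreal (CB * wlist m x)" using pathL_bound[of i] by blast
  obtain CL where CL: "0 \<le> CL" "\<And>us vs x m \<delta>. set us \<subseteq> {0..1} \<Longrightarrow> set vs \<subseteq> {0..1} \<Longrightarrow> length us = i \<Longrightarrow>
     list_all2 (\<lambda>a b. \<bar>a - b\<bar> \<le> \<delta>) us vs \<Longrightarrow> 0 \<le> \<delta> \<Longrightarrow> length x = p \<Longrightarrow> m + 1 \<le> L \<Longrightarrow>
     wnorm (wt sz2 m) (\<lambda>w. pmf (pathL (Qk \<xi>) us x) w - pmf (pathL (Qk \<xi>) vs x) w) \<le> ennreal (CL * \<delta> * wlist (m + 1) x)"
    using pathL_lipschitz[OF k, of i] by blast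
  obtain BP where BP: "0 \<le> BP" "\<And>r u. r \<le> k \<Longrightarrow> u \<in> {0..1} \<Longrightarrow> wnorm (wlist (L - r)) (\<Pi>t r u) \<le> ennreal BP"
    by (rule tower_bounded[OF \<Pi>t_tower]) blast
  \<comment> \<open>The first term is the error of the starting law, from \<open>law_close\<close>
    and the Lipschitz bound. The second is the change of the kernels, \<open>1 + i\<close> coming
    from the bound for \<open>\<delta>\<close> and \<open>BP\<close> from the moment of order
    \<open>d + 1\<close> of the invariant law.\<close>
  define C0 where "C0 = CB * (K + B) + CL * (1 + real i) * BP"
  have C0: "0 \<le> C0" using CB(1) K(1) B(1) CL(1) BP(1) by (simp add: C0_def)
  have main: "V_norm p j V (\<lambda>z. measure (distr (M n) (count_space UNIV) (\<lambda>\<omega>. map (\<lambda>s. lag_vec p (Y n) s \<omega>) [t..t + int j - 1])) {z}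
               - pmf (stationary_path_pmf p (Qk \<xi> u) j) z)
        \<le> ereal ((BV j * C0 + 1) * (\<bar>u - real_of_int t / real n\<bar> + 1 / real n))"
    if u: "u \<in> {0..1}" and n: "1 \<le> n" and t: "1 \<le> t" "t \<le> int n - int j + 1" for u n t
  proof -
    have P: "prob_space (M n)" and Y: "\<And>t. t \<le> int n \<Longrightarrow> Y n t \<in> M n \<rightarrow>\<^sub>M count_space UNIV"
      and tr: "\<And>t. 1 \<le> t \<Longrightarrow> t \<le> int n \<Longrightarrow> has_transition_at (M n) p (Y n) t (branching_kernel p \<zeta> \<xi> (real_of_int t / real n))"
      and tr0: "\<And>t. t \<le> 0 \<Longrightarrow> has_transition_at (M n) p (Y n) t (branching_kernel p \<zeta> \<xi> 0)"
      and stat: "\<And>m t. t \<le> 0 \<Longrightarrow> distr (M n) (count_space UNIV) (lag_vec m (Y n) t) = distr (M n) (count_space UNIV) (lag_vec m (Y n) 0)"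
      using arr n unfolding markov_array_def by blast+
    have ti: "t + int i \<le> int n" using t j by auto
    define \<tau> where "\<tau> = nat t"
    have \<tau>: "int \<tau> = t" "\<tau> \<le> n" "real \<tau> = real_of_int t" using t ti by (auto simp: \<tau>_def)
    let ?\<tau> = "real_of_int t / real n"
    have \<tau>01: "?\<tau> \<in> {0..1}" using t ti n by (auto simp: field_simps)
    have init: "is_law (M n) (lag_vec p (Y n) 0) (\<pi>p 0)"
    proof (rule initial_law[OF P])
      show "Y n s \<in> M n \<rightarrow>\<^sub>M count_space UNIV" if "s \<le> 0" for s using that by (intro Y) simp
      show "has_transition_at (M n) p (Y n) 0 (branching_kernel p \<zeta> \<xi> 0)" by (rule tr0) simp
      show "distr (M n) (count_space UNIV) (lag_vec p (Y n) (-1)) = distr (M n) (count_space UNIV) (lag_vec p (Y n) 0)"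
        by (rule stat) simp
    qed
    have law: "is_law (M n) (lag_vec p (Y n) t) (law_at n \<tau>)"
      using law_law_at[OF P Y tr init \<tau>(2)] \<tau>(1) by simp
    define us where "us = map (\<lambda>l. real_of_int (t + int l) / real n) [1..<Suc i]"
    have "is_law (M n) (\<lambda>\<omega>. map (\<lambda>s. lag_vec p (Y n) s \<omega>) [t..t + int i]) (bind_pmf (law_at n \<tau>) (pathL (Qk \<xi>) us))"
      unfolding us_def using t by (intro path_law[OF P Y _ law ti] tr) auto
    moreover have "t + int j - 1 = t + int i" using j by simp
    ultimately have dist: "measure (distr (M n) (count_space UNIV) (\<lambda>\<omega>. map (\<lambda>s. lag_vec p (Y n) s \<omega>) [t..t + int j - 1])) {z} =
        pmf (bind_pmf (law_at n \<tau>) (pathL (Qk \<xi>) us)) z" for z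
      by (simp only: is_law_def pmf.rep_eq)
    let ?rep = "replicate i u"
    \<comment> \<open>The parameters of the path are \<open>(t + 1) / n\<close> to
      \<open>(t + i) / n\<close>, within \<open>i / n\<close> of \<open>t / n\<close>.\<close>
    define \<delta> where "\<delta> = \<bar>u - ?\<tau>\<bar> + real i / real n"
    have \<delta>: "0 \<le> \<delta>" by (simp add: \<delta>_def)
    have us01: "set us \<subseteq> {0..1}" "length us = i"
      using t ti n by (auto simp: us_def field_simps)
    have rep01: "set ?rep \<subseteq> {0..1}" using u by auto
    have close: "list_all2 (\<lambda>a b. \<bar>a - b\<bar> \<le> \<delta>) us ?rep"
      unfolding list_all2_conv_all_nth
    proof (intro conjI allI impI)
      fix l assume "l < length us"
      then have l: "l < i" using us01 by simp
      have "us ! l = ?\<tau> + real (Suc l) / real n" using l by (simp add: us_def add_divide_distrib del: upt_Suc)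
      moreover have "real (Suc l) / real n \<le> real i / real n" using l by (intro divide_right_mono) auto
      moreover have "0 \<le> real (Suc l) / real n" by simp
      moreover have "?rep ! l = u" using l by simp
      ultimately show "\<bar>us ! l - ?rep ! l\<bar> \<le> \<delta>" unfolding \<delta>_def by linarith
    qed (simp add: us01)
    define \<nu> where "\<nu> z = pmf (law_at n \<tau>) z - \<Pi>t 0 u z" for z
    have \<nu>: "wnorm (wlist d) \<nu> \<le> ennreal (K / real n + B * \<bar>?\<tau> - u\<bar>)"
    proof -
      have "wnorm (wlist d) \<nu> = wnorm (wlist d) (\<lambda>z. (pmf (law_at n \<tau>) z - \<Pi>t 0 ?\<tau> z) + (\<Pi>t 0 ?\<tau> z - \<Pi>t 0 u z))"
        by (simp add: \<nu>_def[abs_def])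
      also have "\<dots> \<le> wnorm (wlist d) (\<lambda>z. pmf (law_at n \<tau>) z - \<Pi>t 0 ?\<tau> z) + wnorm (wlist d) (\<lambda>z. \<Pi>t 0 ?\<tau> z - \<Pi>t 0 u z)"
        by (rule wnorm_add) auto
      also have "\<dots> \<le> ennreal (K / real n) + ennreal (B * \<bar>?\<tau> - u\<bar>)"
        using K(2)[OF n \<tau>(2)] B(2)[OF u \<tau>01] by (intro add_mono) (auto simp: \<tau>)
      finally show ?thesis using K(1) B(1) by simp
    qed
    have \<nu>supp: "length y \<noteq> p \<Longrightarrow> \<nu> y = 0" for y
      using law_supp[OF law] \<Pi>t_supp[of y 0 u] by (auto simp: \<nu>_def set_pmf_iff)
    let ?A = "\<lambda>y. pmf (pathL (Qk \<xi>) us y)" and ?A' = "\<lambda>y. pmf (pathL (Qk \<xi>) ?rep y)"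
    let ?f = "\<lambda>z. measure (distr (M n) (count_space UNIV) (\<lambda>\<omega>. map (\<lambda>s. lag_vec p (Y n) s \<omega>) [t..t + int j - 1])) {z}
               - pmf (stationary_path_pmf p (Qk \<xi> u) j) z"
    have "stationary_path_pmf p (Qk \<xi> u) j = bind_pmf (\<pi>p u) (pathL (Qk \<xi>) ?rep)"
      using j by (simp add: stationary_path_pmf_def the_invariant[OF u] path_pmf_pathL[of "Qk \<xi>"])
    then have f: "?f = (\<lambda>z. kernel_app \<nu> ?A z + kernel_app (\<Pi>t 0 u) (\<lambda>y w. ?A y w - ?A' y w) z)"
    proof (intro ext)
      fix z
      have "kernel_app \<nu> ?A z = kernel_app (pmf (law_at n \<tau>)) ?A z - kernel_app (\<Pi>t 0 u) ?A z"
        unfolding \<nu>_def by (intro kernel_app_diff integrable_mult_pmf integrable_pmf \<Pi>t_integrable u)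
      moreover have "kernel_app (\<Pi>t 0 u) (\<lambda>y w. ?A y w - ?A' y w) z = kernel_app (\<Pi>t 0 u) ?A z - kernel_app (\<Pi>t 0 u) ?A' z"
        unfolding kernel_app_def right_diff_distrib
        by (intro Bochner_Integration.integral_diff integrable_mult_pmf \<Pi>t_integrable u)
      moreover assume "stationary_path_pmf p (Qk \<xi> u) j = bind_pmf (\<pi>p u) (pathL (Qk \<xi>) ?rep)"
      ultimately show "?f z = kernel_app \<nu> ?A z + kernel_app (\<Pi>t 0 u) (\<lambda>y w. ?A y w - ?A' y w) z"
        unfolding dist by (simp add: pmf_bind_kernel_app pmf_\<pi>p[OF u])
    qed
    have "wnorm (wt sz2 d) ?f \<le> wnorm (wt sz2 d) (kernel_app \<nu> ?A) + wnorm (wt sz2 d) (kernel_app (\<Pi>t 0 u) (\<lambda>y w. ?A y w - ?A' y w))"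
      unfolding f by (rule wnorm_add) auto
    also have "\<dots> \<le> ennreal (CB * (K / real n + B * \<bar>?\<tau> - u\<bar>)) + ennreal (CL * \<delta> * BP)"
    proof (intro add_mono wnorm_kernel_app_Qp_le[OF \<nu>supp _ _ _ \<nu>] wnorm_kernel_app_Qp_le)
      show "wnorm (wt sz2 d) (?A y) \<le> ennreal (CB * wlist d y)" if "length y = p" for y
        using us01 that d by (intro CB(2)) auto
      show "wnorm (wt sz2 d) (\<lambda>w. ?A y w - ?A' y w) \<le> ennreal (CL * \<delta> * wlist (d + 1) y)" if "length y = p" for y
        by (rule CL(2)[OF us01(1) rep01 us01(2) close \<delta> that d(2)])
      have "wnorm (wlist (d + 1)) (\<Pi>t 0 u) \<le> wnorm (wlist (L - 0)) (\<Pi>t 0 u)" using d by (intro wnorm_mono_weight) auto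
      also have "\<dots> \<le> ennreal BP" using u by (intro BP) auto
      finally show "wnorm (wlist (d + 1)) (\<Pi>t 0 u) \<le> ennreal BP" .
    qed (use CB(1) CL(1) \<delta> \<Pi>t_supp in auto)
    also have "\<dots> = ennreal (CB * (K / real n + B * \<bar>?\<tau> - u\<bar>) + CL * \<delta> * BP)"
      using CB(1) CL(1) K(1) B(1) BP(1) \<delta> by (intro ennreal_plus[symmetric]) auto
    also have "\<dots> \<le> ennreal (C0 * (\<bar>u - ?\<tau>\<bar> + 1 / real n))"
    proof (rule ennreal_leI)
      define a where "a = \<bar>u - ?\<tau>\<bar>"
      define b where "b = 1 / real n"
      have ab: "0 \<le> a" "0 \<le> b" by (auto simp: a_def b_def)
      have e: "\<bar>?\<tau> - u\<bar> = a" "K / real n = K * b" "\<delta> = a + real i * b" by (auto simp: a_def b_def \<delta>_def)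
      have "K * b + B * a \<le> (K + B) * (a + b)" using ab K(1) B(1) by (simp add: algebra_simps)
      then have "CB * (K * b + B * a) \<le> CB * ((K + B) * (a + b))" using CB(1) by (rule mult_left_mono)
      moreover have "a + real i * b \<le> (1 + real i) * (a + b)" using ab by (simp add: algebra_simps)
      then have "CL * (a + real i * b) * BP \<le> CL * ((1 + real i) * (a + b)) * BP"
        using CL(1) BP(1) by (intro mult_right_mono mult_left_mono)
      ultimately have "CB * (K * b + B * a) + CL * (a + real i * b) * BP \<le> CB * ((K + B) * (a + b)) + CL * ((1 + real i) * (a + b)) * BP"
        by (rule add_mono)
      also have "\<dots> = C0 * (a + b)" by (simp add: C0_def algebra_simps)
      finally show "CB * (K / real n + B * \<bar>?\<tau> - u\<bar>) + CL * \<delta> * BP \<le> C0 * (\<bar>u - ?\<tau>\<bar> + 1 / real n)"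
        unfolding e by (simp only: a_def b_def)
    qed
    finally have "V_norm p j V ?f \<le> ereal (BV j * (C0 * (\<bar>u - ?\<tau>\<bar> + 1 / real n)))"
      using C0 by (intro V_norm_le[OF V BV]) auto
    also have "\<dots> \<le> ereal ((BV j * C0 + 1) * (\<bar>u - ?\<tau>\<bar> + 1 / real n))"
      by (simp add: distrib_right mult.assoc)
    finally show ?thesis .
  qed
  \<comment> \<open>The summand 1 makes the constant strictly positive, as the definition
    demands.\<close>
  have "0 < BV j * C0 + 1" using BV[of j] C0 by (simp add: add_nonneg_pos)
  then show "\<exists>C>0. \<forall>u\<in>{0..1}. \<forall>n\<ge>1. \<forall>t. 1 \<le> t \<and> t \<le> int n - int j + 1 \<longrightarrow>
        V_norm p j V (\<lambda>z. measure (distr (M n) (count_space UNIV) (\<lambda>\<omega>. map (\<lambda>s. lag_vec p (Y n) s \<omega>) [t..t + int j - 1])) {z}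
               - pmf (stationary_path_pmf p (Qk \<xi> u) j) z)
        \<le> ereal (C * (\<bar>u - real_of_int t / real n\<bar> + 1 / real n))"
    using main by blast
qed

end

section \<open>The theorem\<close>

lemma nth_deriv01_deriv:
  assumes "Ck01 k f" "r < k" "u \<in> {0..1}"
  shows "(nth_deriv01 r f has_real_derivative nth_deriv01 (Suc r) f u) (at u within {0..1})"
proof -
  have "nth_deriv01 r f differentiable (at u within {0..1})"
    using assms by (auto simp: Ck01_def differentiable_on_def)
  then have "(nth_deriv01 r f has_vector_derivative vector_derivative (nth_deriv01 r f) (at u within {0..1})) (at u within {0..1})"
    by (simp add: vector_derivative_works)
  then show ?thesis
    by (simp add: has_real_derivative_iff_has_vector_derivative nth_deriv01_def)
qed

lemma nth_deriv01_continuous: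
  assumes "Ck01 k f" "r \<le> k"
  shows "continuous_on {0..1} (nth_deriv01 r f)"
  using assms by (cases "r = k") (auto simp: Ck01_def intro: differentiable_imp_continuous_on)

definition taylor_jet :: "(real \<Rightarrow> nat pmf) \<Rightarrow> real \<Rightarrow> real fps fps" where
  "taylor_jet P u = Abs_fps (\<lambda>r. Abs_fps (\<lambda>y. nth_deriv01 r (\<lambda>v. pmf (P v) y) u / fact r))"

lemma taylor_jet_0: "fps_nth (taylor_jet P u) 0 = Fp (P u)"
  by (rule fps_ext) (simp add: taylor_jet_def nth_deriv01_def)

lemma jet_tower_taylor_jet: "jet_tower (taylor_jet P) r u y = nth_deriv01 r (\<lambda>v. pmf (P v) y) u / fact r"
  by (simp add: jet_tower_def taylor_jet_def)

lemma taylor_jet_tower: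
  assumes Ck: "\<And>y. Ck01 k (\<lambda>u. pmf (P u) y)"
    and tail: "\<And>s. s \<le> k \<Longrightarrow> ((\<lambda>m::nat. SUP u\<in>{0..1}. \<Sum>\<^sub>\<infinity>x\<in>{m..}.
          ennreal (real x ^ (L - s) * \<bar>nth_deriv01 s (\<lambda>v. pmf (P v) x) u\<bar>)) \<longlongrightarrow> 0) sequentially"
  shows "tower k L (\<lambda>y. y) (jet_tower (taylor_jet P))"
  unfolding tower_def
proof (intro conjI allI impI ballI)
  fix r :: nat and u :: real and y assume r: "r < k" and u: "u \<in> {0..1}"
  have "((\<lambda>v. nth_deriv01 r (\<lambda>v. pmf (P v) y) v / fact r) has_real_derivative
      nth_deriv01 (Suc r) (\<lambda>v. pmf (P v) y) u / fact r) (at u within {0..1})"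
    by (intro DERIV_cdivide nth_deriv01_deriv[OF Ck r u])
  then show "((\<lambda>v. jet_tower (taylor_jet P) r v y) has_real_derivative real (Suc r) * jet_tower (taylor_jet P) (Suc r) u y) (at u within {0..1})"
    by (simp add: jet_tower_taylor_jet)
next
  fix r assume r: "r \<le> k"
  let ?D = "\<lambda>u x. nth_deriv01 r (\<lambda>v. pmf (P v) x) u"
  show "weighted_cont (wt (\<lambda>y. y) (L - r)) (jet_tower (taylor_jet P) r)"
    unfolding weighted_cont_def
  proof (intro conjI allI impI)
    fix y
    show "continuous_on {0..1} (\<lambda>u. jet_tower (taylor_jet P) r u y)"
      unfolding jet_tower_taylor_jet by (intro continuous_intros nth_deriv01_continuous[OF Ck r]) auto
  next
    fix e :: real assume e: "e > 0"
    \<comment> \<open>The hypothesis has powers of \<open>x\<close>, the weight powers of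
      \<open>1 + x\<close>. Taking \<open>m\<close> at least 1 below gives
      \<open>1 + x <= 2 * x\<close> on the tail, and \<open>e'\<close> absorbs the resulting power
      of 2.\<close>
    define e' where "e' = e / 2 ^ (L - r)"
    have e': "e' > 0" using e by (simp add: e'_def)
    let ?S = "\<lambda>m. SUP u\<in>{0..1}. \<Sum>\<^sub>\<infinity>x\<in>{m..}. ennreal (real x ^ (L - r) * \<bar>?D u x\<bar>)"
    have "eventually (\<lambda>m. ?S m < ennreal e') sequentially"
      using order_tendstoD(2)[OF tail[OF r]] e' by simp
    then obtain m0 where m0: "\<And>m. m \<ge> m0 \<Longrightarrow> ?S m < ennreal e'" by (auto simp: eventually_sequentially)
    define m where "m = Suc m0"
    show "\<exists>S. finite S \<and> (\<forall>u\<in>{0..1}. wnorm (wt (\<lambda>y. y) (L - r)) (\<lambda>z. if z \<in> S then 0 else jet_tower (taylor_jet P) r u z) \<le> ennreal e)"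
    proof (intro exI[of _ "{..<m}"] conjI ballI)
      fix u :: real assume u: "u \<in> {0..1}"
      have "wnorm (wt (\<lambda>y. y) (L - r)) (\<lambda>z. if z \<in> {..<m} then 0 else jet_tower (taylor_jet P) r u z) \<le>
          (\<integral>\<^sup>+x. ennreal (2 ^ (L - r)) * (if x \<in> {m..} then ennreal (real x ^ (L - r) * \<bar>?D u x\<bar>) else 0) \<partial>count_space UNIV)"
        unfolding wnorm_def
      proof (rule nn_integral_mono)
        fix x
        show "ennreal (\<bar>if x \<in> {..<m} then 0 else jet_tower (taylor_jet P) r u x\<bar> * wt (\<lambda>y. y) (L - r) x) \<le>
          ennreal (2 ^ (L - r)) * (if x \<in> {m..} then ennreal (real x ^ (L - r) * \<bar>?D u x\<bar>) else 0)"
        proof (cases "x \<in> {m..}")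
          case True
          then have x: "1 \<le> real x" by (auto simp: m_def)
          have "\<bar>jet_tower (taylor_jet P) r u x\<bar> \<le> \<bar>?D u x\<bar>"
            unfolding jet_tower_taylor_jet abs_divide using fact_ge_1[of r, where 'a = real]
            by (auto intro!: divide_le_eq[THEN iffD2] mult_left_le_one_le simp: mult_le_cancel_left1)
          moreover have "wt (\<lambda>y. y) (L - r) x \<le> (2 * real x) ^ (L - r)"
            unfolding wt_def using x by (intro power_mono) auto
          ultimately have "\<bar>jet_tower (taylor_jet P) r u x\<bar> * wt (\<lambda>y. y) (L - r) x \<le> \<bar>?D u x\<bar> * (2 * real x) ^ (L - r)"
            by (intro mult_mono) auto
          also have "\<dots> = 2 ^ (L - r) * (real x ^ (L - r) * \<bar>?D u x\<bar>)" by (simp add: power_mult_distrib)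
          finally have "ennreal (\<bar>jet_tower (taylor_jet P) r u x\<bar> * wt (\<lambda>y. y) (L - r) x) \<le> ennreal (2 ^ (L - r) * (real x ^ (L - r) * \<bar>?D u x\<bar>))"
            by (rule ennreal_leI)
          also have "\<dots> = ennreal (2 ^ (L - r)) * ennreal (real x ^ (L - r) * \<bar>?D u x\<bar>)" by (rule ennreal_mult) auto
          finally show ?thesis using True by simp
        qed simp
      qed
      also have "\<dots> = ennreal (2 ^ (L - r)) * (\<integral>\<^sup>+x. (if x \<in> {m..} then ennreal (real x ^ (L - r) * \<bar>?D u x\<bar>) else 0) \<partial>count_space UNIV)"
        by (rule nn_integral_cmult) auto
      also have "(\<integral>\<^sup>+x. (if x \<in> {m..} then ennreal (real x ^ (L - r) * \<bar>?D u x\<bar>) else 0) \<partial>count_space UNIV) =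
          (\<Sum>\<^sub>\<infinity>x\<in>{m..}. ennreal (real x ^ (L - r) * \<bar>?D u x\<bar>))"
        unfolding nn_integral_count_space_eq_infsum by (rule infsum_cong_neutral) auto
      also have "\<dots> \<le> ?S m" by (rule SUP_upper) (rule u)
      also have "?S m \<le> ennreal e'" using m0[of m] by (simp add: m_def)
      also have "ennreal (2 ^ (L - r)) * ennreal e' = ennreal e" using e by (simp add: e'_def ennreal_mult[symmetric])
      finally show "wnorm (wt (\<lambda>y. y) (L - r)) (\<lambda>z. if z \<in> {..<m} then 0 else jet_tower (taylor_jet P) r u z) \<le> ennreal e"
        by (simp add: mult_left_mono)
    qed simp
  qed
qed

lemma infsum_ennreal_mono:
  fixes f g :: "'a \<Rightarrow> ennreal"
  assumes "\<And>x. f x \<le> g x" shows "infsum f A \<le> infsum g A"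
  by (rule infsum_mono) (auto simp: assms intro: nonneg_summable_on_complete)

lemma sum_V0_le:
  assumes "z \<in> blocks p j"
  shows "(\<Sum>x\<leftarrow>z. \<Sum>i<p. (1 + real (x ! i)) ^ d) \<le> real j * real p * wt sz2 d z"
proof -
  have "(\<Sum>i<p. (1 + real (x ! i)) ^ d) \<le> real p * wt sz2 d z" if x: "x \<in> set z" for x
  proof -
    have "length x = p" using x assms by (auto simp: blocks_def)
    have "sum_list x \<le> sz2 z" unfolding sz2_def using x by (intro member_le_sum_list) auto
    then have "(1 + real (x ! i)) ^ d \<le> wt sz2 d z" if "i < p" for i
      using elem_le_sum_list[of i x] that \<open>length x = p\<close> unfolding wt_def by (intro power_mono) auto
    then have "(\<Sum>i<p. (1 + real (x ! i)) ^ d) \<le> (\<Sum>i<p. wt sz2 d z)" by (intro sum_mono) auto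
    then show ?thesis by simp
  qed
  then have "(\<Sum>x\<leftarrow>z. \<Sum>i<p. (1 + real (x ! i)) ^ d) \<le> (\<Sum>x\<leftarrow>z. real p * wt sz2 d z)"
    by (rule sum_list_mono)
  also have "\<dots> = real j * real p * wt sz2 d z" using assms by (simp add: blocks_def sum_list_triv)
  finally show ?thesis .
qed

theorem proposition5:
  fixes p k d1 :: nat
    and \<zeta> :: "nat \<Rightarrow> real \<Rightarrow> nat pmf"
    and \<xi> :: "real \<Rightarrow> nat pmf"
    and M :: "nat \<Rightarrow> 'a measure"
    and Y :: "nat \<Rightarrow> int \<Rightarrow> 'a \<Rightarrow> nat"
  defines "R \<equiv> branching_kernel p \<zeta> \<xi>"
    and "Q \<equiv> \<lambda>u. companion_kernel (branching_kernel p \<zeta> \<xi> u)"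
    and "V0 \<equiv> \<lambda>x :: nat list. \<Sum>i<p. (1 + real (x ! i)) ^ d1"
  assumes "p \<ge> 1" and "k \<ge> 1"
    and array: "markov_array p R M Y"
    and E31_mean: "(SUP u\<in>{0..1}. \<Sum>i<p. \<Sum>\<^sub>\<infinity>x. ennreal (real x * pmf (\<zeta> i u) x)) < 1"
    and E31_pos: "\<exists>x0. (INF u\<in>{0..1}. pmf (\<xi> u) x0) > 0"
    and E32_smooth_zeta: "\<forall>i<p. \<forall>x. Ck01 k (\<lambda>u. pmf (\<zeta> i u) x)"
    and E32_smooth_xi: "\<forall>x. Ck01 k (\<lambda>u. pmf (\<xi> u) x)"
    and "d1 \<ge> 1"
    and E32_tail: "\<forall>s\<le>k.
      ((\<lambda>m::nat. SUP u\<in>{0..1}. \<Sum>i<p. \<Sum>\<^sub>\<infinity>x\<in>{m..}.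
          ennreal (real x ^ (d1 + k - s) *
            (\<bar>nth_deriv01 s (\<lambda>v. pmf (\<zeta> i v) x) u\<bar> + \<bar>nth_deriv01 s (\<lambda>v. pmf (\<xi> v) x) u\<bar>)))
        \<longlongrightarrow> 0) sequentially"
  shows "locally_stationary p V0 M (\<lambda>n. lag_vec p (Y n)) Q \<and>
    (\<forall>j\<ge>1. Ck_into_V_space k p j V0 (\<lambda>u. pmf (stationary_path_pmf p (Q u) j)))"
proof -
  let ?L = "d1 + k"
  let ?t = "\<lambda>s i m u. \<Sum>\<^sub>\<infinity>x\<in>{m..}. ennreal (real x ^ (?L - s) *
      (\<bar>nth_deriv01 s (\<lambda>v. pmf (\<zeta> i v) x) u\<bar> + \<bar>nth_deriv01 s (\<lambda>v. pmf (\<xi> v) x) u\<bar>))"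
  \<comment> \<open>Extracts from the joint tail condition the one for a single family;
    \<open>g\<close> stands for the derivatives of some \<open>\<zeta> i\<close> or of
    \<open>\<xi>\<close>, the latter being read off from the summand \<open>i = 0\<close>.\<close>
  have part: "((\<lambda>m::nat. SUP u\<in>{0..1}. \<Sum>\<^sub>\<infinity>x\<in>{m..}. ennreal (real x ^ (?L - s) * g s x u)) \<longlongrightarrow> 0) sequentially"
    if s: "s \<le> k" and i: "i < p"
      and g: "\<And>x u. g s x u \<le> \<bar>nth_deriv01 s (\<lambda>v. pmf (\<zeta> i v) x) u\<bar> + \<bar>nth_deriv01 s (\<lambda>v. pmf (\<xi> v) x) u\<bar>"
    for s i and g :: "nat \<Rightarrow> nat \<Rightarrow> real \<Rightarrow> real"
  proof (rule tendsto_sandwich[OF _ _ tendsto_const])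
    show "((\<lambda>m. SUP u\<in>{0..1}. \<Sum>i<p. ?t s i m u) \<longlongrightarrow> 0) sequentially"
      using E32_tail s by blast
    show "\<forall>\<^sub>F m in sequentially. (SUP u\<in>{0..1}. \<Sum>\<^sub>\<infinity>x\<in>{m..}. ennreal (real x ^ (?L - s) * g s x u)) \<le> (SUP u\<in>{0..1}. \<Sum>i<p. ?t s i m u)"
    proof (intro always_eventually allI SUP_mono bexI)
      fix m :: nat and u :: real
      have "(\<Sum>\<^sub>\<infinity>x\<in>{m..}. ennreal (real x ^ (?L - s) * g s x u)) \<le> ?t s i m u"
        by (intro infsum_ennreal_mono ennreal_leI mult_left_mono g) auto
      also have "\<dots> \<le> (\<Sum>i<p. ?t s i m u)" using i by (intro member_le_sum) auto
      finally show "(\<Sum>\<^sub>\<infinity>x\<in>{m..}. ennreal (real x ^ (?L - s) * g s x u)) \<le> (\<Sum>i<p. ?t s i m u)" .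
    qed
  qed auto
  \<comment> \<open>The total and individual means are finite by the subcriticality assumption, so
    passing from extended to real numbers loses nothing.\<close>
  define a where "a = enn2real (SUP u\<in>{0..1}. \<Sum>i<p. \<Sum>\<^sub>\<infinity>x. ennreal (real x * pmf (\<zeta> i u) x))"
  define mean where "mean i u = enn2real (\<Sum>\<^sub>\<infinity>x. ennreal (real x * pmf (\<zeta> i u) x))" for i u
  have fin: "(\<Sum>i<p. \<Sum>\<^sub>\<infinity>x. ennreal (real x * pmf (\<zeta> i u) x)) \<le> ennreal a" "a < 1" if "u \<in> {0..1}" for u
  proof -
    let ?S = "SUP u\<in>{0..1}. \<Sum>i<p. \<Sum>\<^sub>\<infinity>x. ennreal (real x * pmf (\<zeta> i u) x)"
    have S: "?S = ennreal a" using E31_mean unfolding a_def by (intro ennreal_enn2real[symmetric]) (auto intro: less_trans)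
    show "a < 1" using E31_mean unfolding S by (simp add: ennreal_less_one_iff)
    show "(\<Sum>i<p. \<Sum>\<^sub>\<infinity>x. ennreal (real x * pmf (\<zeta> i u) x)) \<le> ennreal a"
      unfolding S[symmetric] by (rule SUP_upper) (rule that)
  qed
  have mean: "(\<Sum>\<^sub>\<infinity>x. ennreal (real x * pmf (\<zeta> i u) x)) = ennreal (mean i u)" if "u \<in> {0..1}" "i < p" for i u
  proof -
    have "(\<Sum>\<^sub>\<infinity>x. ennreal (real x * pmf (\<zeta> i u) x)) \<le> (\<Sum>i<p. \<Sum>\<^sub>\<infinity>x. ennreal (real x * pmf (\<zeta> i u) x))"
      using that by (intro member_le_sum[of i "{..<p}" "\<lambda>i. \<Sum>\<^sub>\<infinity>x. ennreal (real x * pmf (\<zeta> i u) x)"]) auto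
    also have "\<dots> \<le> ennreal a" by (rule fin[OF that(1)])
    also have "\<dots> < top" by simp
    finally show ?thesis unfolding mean_def by simp
  qed
  interpret G: ginar p k ?L \<zeta> \<xi> "\<lambda>i. taylor_jet (\<zeta> i)" "taylor_jet \<xi>" mean a
  proof
    show "1 \<le> p" by fact
    show "k < d1 + k" using \<open>1 \<le> d1\<close> by simp
    show "tower k ?L (\<lambda>y. y) (jet_tower (taylor_jet (\<zeta> i)))" if "i < p" for i
      using E32_smooth_zeta that by (intro taylor_jet_tower part[OF _ that]) auto
    show "tower k ?L (\<lambda>y. y) (jet_tower (taylor_jet \<xi>))"
      using E32_smooth_xi \<open>1 \<le> p\<close> by (intro taylor_jet_tower part[where i = 0]) auto
    show "wnorm (vw 0 1) (pmf (\<zeta> i u)) \<le> ennreal (mean i u)" if "i < p" "u \<in> {0..1}" for i u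
      using mean[OF that(2,1)] unfolding wnorm_def nn_integral_count_space_eq_infsum
      by (simp add: vw_def mult.commute)
    show "(\<Sum>i<p. mean i u) \<le> a" if u: "u \<in> {0..1}" for u
    proof -
      have "ennreal (\<Sum>i<p. mean i u) = (\<Sum>i<p. \<Sum>\<^sub>\<infinity>x. ennreal (real x * pmf (\<zeta> i u) x))"
        using mean[OF u] by (subst sum_ennreal[symmetric]) (auto simp: mean_def)
      also have "\<dots> \<le> ennreal a" by (rule fin[OF u])
      finally show ?thesis by (simp add: a_def ennreal_le_iff)
    qed
    show "a < 1" using fin(2)[of 0] by simp
  qed (auto simp: taylor_jet_0 mean_def a_def)
  have V: "(\<Sum>x\<leftarrow>z. V0 x) \<le> real j * real p * wt sz2 d1 z" if "z \<in> blocks p j" for j z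
    unfolding V0_def by (rule sum_V0_le) (rule that)
  have "locally_stationary p V0 M (\<lambda>n. lag_vec p (Y n)) Q"
    unfolding Q_def using \<open>1 \<le> k\<close> \<open>1 \<le> d1\<close> array
    by (intro G.local_stationarity[where d = d1 and BV = "\<lambda>j. real j * real p"] V) (auto simp: R_def)
  moreover have "Ck_into_V_space k p j V0 (\<lambda>u. pmf (stationary_path_pmf p (Q u) j))" if j1: "1 \<le> j" for j
  proof -
    obtain i where j: "j = Suc i" using j1 by (cases j) auto
    show ?thesis
    proof (rule tower_Ck_into_V_space[OF _ _ V])
      show "tower k ?L sz2 (tower_bind G.\<Pi>t (G.Pt i))" by (rule G.stationary_tower)
      show "pmf (stationary_path_pmf p (Q u) j) = tower_bind G.\<Pi>t (G.Pt i) 0 u" if "u \<in> {0..1}" for u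
        unfolding Q_def j by (rule G.stationary_tower_0[OF that, symmetric])
      show "0 < real j * real p" using j1 \<open>1 \<le> p\<close> by simp
      show "0 \<le> (\<Sum>x\<leftarrow>z. V0 x)" for z by (intro sum_list_nonneg) (auto simp: V0_def intro!: sum_nonneg)
    qed
  qed
  ultimately show ?thesis by blast
qed

end
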